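(* Let $\mathcal C$ be a cyclic operad with unit. Then the chain complexes $$(k\mathsf{ub})_{(-;+)}^\sharp\otimes_{(k\mathsf{ub})_{(-;+)}}\mathcal K_-\otimes_{(k\mathsf{db})_{(-;-)}}\Lambda_\odot^*(\mathcal C)\qquad\text{and}\qquad(k\mathsf{ub})_{(+;-)}^\sharp\otimes_{(k\mathsf{ub})_{(+;-)}}\mathcal K_+\otimes_{k\mathsf{db}}S_\odot^*(\mathcal C)$$ both have zero homology when evaluated on a non-empty finite set.
   Context: $k$ is a field of characteristic zero, $\mathbf n=\{1,\dots,n\}$, $S_n$ the symmetric group, $\mathrm{sgn}_n$ its sign representation, $(-)^\sharp=\mathrm{Hom}_k(-,k)$. For a $k$-linear category $\mathcal A$, an $\mathcal A$-module is a $k$-linear functor from $\mathcal A$ to $k$-vector spaces, a right $\mathcal A$-module is an $\mathcal A^{op}$-module, and $\otimes_{\mathcal A}$ is the usual tensor product of a right with a left $\mathcal A$-module. $\mathsf{FB}$ is the category of finite sets and bijections, $k\mathsf{FB}$ its $k$-linearization. Twisted Brauer categories. For finite sets $X,Y$ with $|Y|-|X|=2t$, $t\in\mathbb N$, let $D(X,Y)$ be the set of bijections $X\amalg\mathbf{2t}\to Y$; the composite of $f\colon X\amalg\mathbf{2s}\to Y$ and $g\colon Y\amalg\mathbf{2t}\to Z$ is $X\amalg\mathbf{2(s+t)}\cong X\amalg\mathbf{2s}\amalg\mathbf{2t}\to Y\amalg\mathbf{2t}\to Z$ (using the order-preserving identification with $\mathbf{2s}$ first). The group $S_2\wr S_t\subset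 S_{2t}$ (permutations preserving the partition of $\mathbf{2t}$ into the pairs $\{2i-1,2i\}$) acts on the right on $D(X,Y)$ by precomposition. Its representations $k_{(\epsilon;\delta)}$ are: $k_{(+;+)}$ trivial; $k_{(-;+)}$ the restriction of $\mathrm{sgn}_{2t}$; $k_{(+;-)}$ the pullback of $\mathrm{sgn}_t$ along $S_2\wr S_t\to S_t$; $k_{(-;-)}=k_{(-;+)}\otimes k_{(+;-)}$. The $k$-linear category $(k\mathsf{ub})_{(\epsilon;\delta)}$ has objects finite sets and morphisms $X\to Y$ given by $kD(X,Y)\otimes_{k[S_2\wr S_t]}k_{(\epsilon;\delta)}$ if $|Y|-|X|=2t\ge 0$ and $0$ otherwise, with composition induced by that of $D$; the part with $t=0$ is $k\mathsf{FB}$. $(k\mathsf{db})_{(\epsilon;\delta)}$ is the opposite category, $k\mathsf{db}=(k\mathsf{db})_{(+;+)}$; its degree $0$ part is identified with $k\mathsf{FB}$ by inverting bijections. For an ordered pair $(u,v)$ of distinct elements of $X$, $g_{u,v}$ denotes the morphism $X\setminus\{u,v\}\to X$ of $(k\mathsf{ub})_{(\epsilon;\delta)}$, equivalently $X\to X\setminus\{u,v\}$ of $(k\mathsf{db})_{(\epsilon;\delta)}$, given by the class of the bijection $(X\setminus\{u,v\})\amalg\mathbf 2\to X$ that is the identity on $X\setminus\{u,v\}$ and sends $1\mapsto u$, $2\mapsto v$. Koszul complexes. $\mathcal K_-=(k\mathsf{ub})_{(-;+)}\otimes_{k\mathsf{FB}}(k\mathsf{db})_{(-;-)}$ (a left $(k\mathsf{ub})_{(-;+)}$-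 and right $(k\mathsf{db})_{(-;-)}$-module) and $\mathcal K_+=(k\mathsf{ub})_{(+;-)}\otimes_{k\mathsf{FB}}k\mathsf{db}$ (a left $(k\mathsf{ub})_{(+;-)}$- and right $k\mathsf{db}$-module), where for instance $\mathcal K_-(U,X)=\bigoplus_s(k\mathsf{ub})_{(-;+)}(\mathbf s,U)\otimes_{kS_s}(k\mathsf{db})_{(-;-)}(X,\mathbf s)$; in both cases the differential is the unique bimodule morphism sending each $\mathrm{id}_{\mathbf s}\otimes\mathrm{id}_{\mathbf s}$ to $\sum_{1\le i<j\le s}g_{i,j}\otimes g_{i,j}$ (identifying $\mathbf s\setminus\{i,j\}$ with $\mathbf{s-2}$ by the order-preserving bijection). For $\mathcal A=(k\mathsf{ub})_{(\epsilon;\delta)}$, $\mathcal A^\sharp$ is the $\mathcal A$-bimodule $\mathcal A(X,Y)^\sharp$ (covariant in $X$, contravariant in $Y$), and $(\mathcal A^\sharp\otimes_{\mathcal A}M)(X)=\mathcal A(X,-)^\sharp\otimes_{\mathcal A}M$. Cyclic operads. A cyclic operad $\mathcal C$ is a $k\mathsf{FB}$-module with composition maps $\iota_{u,v}\colon\mathcal C(U)\otimes\mathcal C(V)\to\mathcal C((U\setminus\{u\})\amalg(V\setminus\{v\}))$ for disjoint finite sets $U\ni u$, $V\ni v$, natural for bijections, symmetric ($\iota_{u,v}(a\otimes b)=\iota_{v,u}(b\otimes a)$) and associative ($\iota_{v',w}(\iota_{u,v}(a\otimes b)\otimes c)=\iota_{u,v}(a\otimes\iota_{v',w}(b\otimes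 c))$ for $u\in U$, $v\ne v'\in V$, $w\in W$). It has a unit if there is an $S_2$-invariant element of $\mathcal C(\mathbf 2)$, giving an element $1_{\{x,y\}}\in\mathcal C(\{x,y\})$ for every two-element set, such that $\iota_{u,x}(c\otimes 1_{\{x,y\}})$ is the image of $c\in\mathcal C(U)$ under the bijection $U\to(U\setminus\{u\})\amalg\{y\}$ sending $u\mapsto y$. Standing assumption: $\mathcal C(\emptyset)=0$. For a $k\mathsf{FB}$-module $F$, $F^{\odot n}(X)=\bigoplus_{X=U_1\amalg\dots\amalg U_n}F(U_1)\otimes\dots\otimes F(U_n)$; $S_\odot^n(F)=F^{\odot n}/S_n$, $\Lambda_\odot^n(F)=(\mathrm{sgn}_n\otimes F^{\odot n})/S_n$; $S_\odot^*$, $\Lambda_\odot^*$ are their direct sums over $n$. $S_\odot^*(\mathcal C)$ is a $k\mathsf{db}$-module: for $c_i\in\mathcal C(U_i)$, $X=\amalg U_i$, $g_{u,v}$ sends $c_1\cdots c_n$ to $0$ if $u,v$ are in the same $U_i$, and if $u\in U_i,v\in U_j$, $i\ne j$, replaces the factors $c_i,c_j$ by $\iota_{u,v}(c_i\otimes c_j)$. $\Lambda_\odot^*(\mathcal C)$ is a $(k\mathsf{db})_{(-;-)}$-module: $g_{u,v}$ sends $c_1\wedge\dots\wedge c_n$ to $0$ if $u,v$ are in the same $U_i$, and to $c_1\wedge\dots\wedge c_{n-2}\wedge\iota_{u,v}(c_{n-1}\otimes c_n)$ if $u\in U_{n-1}$, $v\in U_n$ (other cases by reordering with sign). *)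

theory Defs
  imports
    Complex_Main
    "HOL-Algebra.Module"
    "HOL-Combinatorics.Permutations"
    "HOL-Library.Poly_Mapping"
    "HOL-Library.FuncSet"
begin

text \<open>
  Conventions. The field of scalars is a type of class \<open>field_char_0\<close>. Vector spaces have explicit
  carriers: they are modules, in the sense of \<^theory>\<open>HOL-Algebra.Module\<close>, over the ring structure \<open>scalars\<close>
  (the ring operations \<open>mult\<close> and \<open>one\<close> that the record type of modules also contains are irrelevant
  and left undefined in the constructions below).
  The category of finite sets is represented by the finite subsets of \<open>nat\<close>; it contains all
  \<open>{1..n}\<close> and every finite set is in bijection with one of its objects, also disjointly from
  any given ones.
\<close>


section \<open>Vector spaces by generators and relations\<close>

definition fscale :: "'k::field \<Rightarrow> ('g \<Rightarrow>\<^sub>0 'k) \<Rightarrow> ('g \<Rightarrow>\<^sub>0 'k)" where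
  "fscale c p = Poly_Mapping.map ((*) c) p"

lemma lookup_fscale [simp]: "Poly_Mapping.lookup (fscale c p) g = c * Poly_Mapping.lookup p g"
  by (simp add: fscale_def Poly_Mapping.map.rep_eq when_def)

global_interpretation free_vs: Vector_Spaces.vector_space fscale
  by unfold_locales (auto intro!: poly_mapping_eqI simp: lookup_add algebra_simps)

abbreviation gen :: "'g \<Rightarrow> ('g \<Rightarrow>\<^sub>0 'k::field)" where
  "gen g \<equiv> Poly_Mapping.single g 1"

definition lin_ext :: "('g \<Rightarrow> ('h \<Rightarrow>\<^sub>0 'k)) \<Rightarrow> ('g \<Rightarrow>\<^sub>0 'k) \<Rightarrow> ('h \<Rightarrow>\<^sub>0 'k::field)" where
  "lin_ext h p = (\<Sum>g\<in>Poly_Mapping.keys p. fscale (Poly_Mapping.lookup p g) (h g))"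

definition bilin_ext ::
  "('a \<Rightarrow> 'b \<Rightarrow> ('h \<Rightarrow>\<^sub>0 'k)) \<Rightarrow> ('a \<Rightarrow>\<^sub>0 'k) \<Rightarrow> ('b \<Rightarrow>\<^sub>0 'k) \<Rightarrow> ('h \<Rightarrow>\<^sub>0 'k::field)" where
  "bilin_ext h p q = lin_ext (\<lambda>a. lin_ext (h a) q) p"

definition free_space :: "'g set \<Rightarrow> ('k::field, 'g \<Rightarrow>\<^sub>0 'k) module" where
  "free_space S =
    \<lparr>carrier = {p. Poly_Mapping.keys p \<subseteq> S}, monoid.mult = undefined, one = undefined,
     ring.zero = 0, add = (+), module.smult = fscale\<rparr>"

definition cls :: "('g \<Rightarrow>\<^sub>0 'k) set \<Rightarrow> ('g \<Rightarrow>\<^sub>0 'k) \<Rightarrow> ('g \<Rightarrow>\<^sub>0 'k::field) set" where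
  "cls R p = (\<lambda>r. p + r) ` free_vs.span R"

text \<open>
  The quotient of the free vector space on \<open>S\<close> by the subspace spanned by \<open>R\<close> (always used with
  \<open>R\<close> contained in the free space); its elements are the cosets.
\<close>

definition presented :: "'g set \<Rightarrow> ('g \<Rightarrow>\<^sub>0 'k) set \<Rightarrow> ('k::field, ('g \<Rightarrow>\<^sub>0 'k) set) module" where
  "presented S R =
    \<lparr>carrier = cls R ` {p. Poly_Mapping.keys p \<subseteq> S}, monoid.mult = undefined, one = undefined,
     ring.zero = cls R 0,
     add = (\<lambda>A B. \<Union>a\<in>A. \<Union>b\<in>B. cls R (a + b)),
     module.smult = (\<lambda>c A. \<Union>a\<in>A. cls R (fscale c a))\<rparr>"

text \<open>
  Maps on quotients induced by (bi)linear maps on free spaces. The union over all representatives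
  is a single coset exactly when the induced map is well defined at the given arguments.
\<close>

definition induced ::
  "('h \<Rightarrow>\<^sub>0 'k) set \<Rightarrow> ('g \<Rightarrow> ('h \<Rightarrow>\<^sub>0 'k)) \<Rightarrow> ('g \<Rightarrow>\<^sub>0 'k) set \<Rightarrow> ('h \<Rightarrow>\<^sub>0 'k::field) set" where
  "induced R h A = (\<Union>a\<in>A. cls R (lin_ext h a))"

definition induced2 ::
  "('h \<Rightarrow>\<^sub>0 'k) set \<Rightarrow> ('a \<Rightarrow> 'b \<Rightarrow> ('h \<Rightarrow>\<^sub>0 'k)) \<Rightarrow> ('a \<Rightarrow>\<^sub>0 'k) set \<Rightarrow> ('b \<Rightarrow>\<^sub>0 'k) set
    \<Rightarrow> ('h \<Rightarrow>\<^sub>0 'k::field) set" where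
  "induced2 R h A B = (\<Union>a\<in>A. \<Union>b\<in>B. cls R (bilin_ext h a b))"

definition linear_maps :: "('k::field, 'v) module \<Rightarrow> ('k, 'w) module \<Rightarrow> ('v \<Rightarrow> 'w) set" where
  "linear_maps V W =
    {\<phi> \<in> carrier V \<rightarrow> carrier W.
      (\<forall>x\<in>carrier V. \<forall>y\<in>carrier V. \<phi> (x \<oplus>\<^bsub>V\<^esub> y) = \<phi> x \<oplus>\<^bsub>W\<^esub> \<phi> y) \<and>
      (\<forall>c. \<forall>x\<in>carrier V. \<phi> (c \<odot>\<^bsub>V\<^esub> x) = c \<odot>\<^bsub>W\<^esub> \<phi> x)}"

text \<open>The field, as a ring and as a module over itself.\<close>

definition scalars :: "('k::field, 'k) module" where
  "scalars = \<lparr>carrier = UNIV, monoid.mult = (*), one = 1,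
     ring.zero = 0, add = (+), module.smult = (*)\<rparr>"

definition dual :: "('k::field, 'v) module \<Rightarrow> ('k, 'v \<Rightarrow> 'k) module" where
  "dual V = \<lparr>carrier = linear_maps V scalars \<inter> extensional (carrier V),
     monoid.mult = undefined, one = undefined,
     ring.zero = (\<lambda>x\<in>carrier V. 0),
     add = (\<lambda>\<phi> \<psi>. \<lambda>x\<in>carrier V. \<phi> x + \<psi> x),
     module.smult = (\<lambda>c \<phi>. \<lambda>x\<in>carrier V. c * \<phi> x)\<rparr>"


section \<open>Linear categories, modules and their tensor product\<close>

text \<open>\<open>Cmp A X Y Z g f\<close> is the composite of \<open>f : X \<rightarrow> Y\<close> and \<open>g : Y \<rightarrow> Z\<close>.\<close>

record ('o, 'k, 'm) lincat =
  Ob :: "'o set"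
  Hom :: "'o \<Rightarrow> 'o \<Rightarrow> ('k, 'm) module"
  Cmp :: "'o \<Rightarrow> 'o \<Rightarrow> 'o \<Rightarrow> 'm \<Rightarrow> 'm \<Rightarrow> 'm"
  Idn :: "'o \<Rightarrow> 'm"

definition opposite :: "('o, 'k, 'm) lincat \<Rightarrow> ('o, 'k, 'm) lincat" where
  "opposite A = \<lparr>Ob = Ob A, Hom = (\<lambda>X Y. Hom A Y X),
     Cmp = (\<lambda>X Y Z g f. Cmp A Z Y X f g), Idn = Idn A\<rparr>"

text \<open>
  For a left \<open>A\<close>-module \<open>M\<close> and \<open>a \<in> Hom A X Y\<close>, \<open>Act M X Y a\<close> is the action map
  \<open>At M X \<rightarrow> At M Y\<close>. Right \<open>A\<close>-modules are represented as left modules over the opposite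
  category, so there \<open>Act N Y X a : At N Y \<rightarrow> At N X\<close> for \<open>a \<in> Hom A X Y\<close>.
\<close>

record ('o, 'k, 'm, 'v) catmod =
  At :: "'o \<Rightarrow> ('k, 'v) module"
  Act :: "'o \<Rightarrow> 'o \<Rightarrow> 'm \<Rightarrow> 'v \<Rightarrow> 'v"

definition tensor_gens ::
  "('o, 'k, 'm) lincat \<Rightarrow> ('o, 'k, 'm, 'n) catmod \<Rightarrow> ('o, 'k, 'm, 'v) catmod \<Rightarrow> ('o \<times> 'n \<times> 'v) set"
  where
  "tensor_gens A N M =
    {(Y, n, m). Y \<in> Ob A \<and> n \<in> carrier (At N Y) \<and> m \<in> carrier (At M Y)}"

definition tensor_rels ::
  "('o, 'k::field, 'm) lincat \<Rightarrow> ('o, 'k, 'm, 'n) catmod \<Rightarrow> ('o, 'k, 'm, 'v) catmod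
    \<Rightarrow> ('o \<times> 'n \<times> 'v \<Rightarrow>\<^sub>0 'k) set" where
  "tensor_rels A N M =
     {gen (Y, n \<oplus>\<^bsub>At N Y\<^esub> n', m) - gen (Y, n, m) - gen (Y, n', m) | Y n n' m.
        Y \<in> Ob A \<and> n \<in> carrier (At N Y) \<and> n' \<in> carrier (At N Y) \<and> m \<in> carrier (At M Y)}
   \<union> {gen (Y, n, m \<oplus>\<^bsub>At M Y\<^esub> m') - gen (Y, n, m) - gen (Y, n, m') | Y n m m'.
        Y \<in> Ob A \<and> n \<in> carrier (At N Y) \<and> m \<in> carrier (At M Y) \<and> m' \<in> carrier (At M Y)}
   \<union> {gen (Y, c \<odot>\<^bsub>At N Y\<^esub> n, m) - fscale c (gen (Y, n, m)) | Y c n m.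
        Y \<in> Ob A \<and> n \<in> carrier (At N Y) \<and> m \<in> carrier (At M Y)}
   \<union> {gen (Y, n, c \<odot>\<^bsub>At M Y\<^esub> m) - fscale c (gen (Y, n, m)) | Y c n m.
        Y \<in> Ob A \<and> n \<in> carrier (At N Y) \<and> m \<in> carrier (At M Y)}
   \<union> {gen (Y, Act N Y' Y a n, m) - gen (Y', n, Act M Y Y' a m) | Y Y' a n m.
        Y \<in> Ob A \<and> Y' \<in> Ob A \<and> a \<in> carrier (Hom A Y Y') \<and>
        n \<in> carrier (At N Y') \<and> m \<in> carrier (At M Y)}"

text \<open>\<open>N \<otimes>\<^sub>A M\<close> for a right \<open>A\<close>-module \<open>N\<close> and a left \<open>A\<close>-module \<open>M\<close>.\<close>

definition tensor ::
  "('o, 'k::field, 'm) lincat \<Rightarrow> ('o, 'k, 'm, 'n) catmod \<Rightarrow> ('o, 'k, 'm, 'v) catmod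
    \<Rightarrow> ('k, ('o \<times> 'n \<times> 'v \<Rightarrow>\<^sub>0 'k) set) module" where
  "tensor A N M = presented (tensor_gens A N M) (tensor_rels A N M)"

text \<open>
  The maps \<open>h \<otimes> id\<close> and \<open>id \<otimes> h\<close>; the first argument is the tensor relations of the target.
\<close>

definition tensor_map1 ::
  "('o \<times> 'n \<times> 'v \<Rightarrow>\<^sub>0 'k) set \<Rightarrow> ('o \<Rightarrow> 'l \<Rightarrow> 'n) \<Rightarrow> ('o \<times> 'l \<times> 'v \<Rightarrow>\<^sub>0 'k::field) set
    \<Rightarrow> ('o \<times> 'n \<times> 'v \<Rightarrow>\<^sub>0 'k) set" where
  "tensor_map1 R h = induced R (\<lambda>(Y, n, m). gen (Y, h Y n, m))"

definition tensor_map2 ::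
  "('o \<times> 'n \<times> 'v \<Rightarrow>\<^sub>0 'k) set \<Rightarrow> ('o \<Rightarrow> 'w \<Rightarrow> 'v) \<Rightarrow> ('o \<times> 'n \<times> 'w \<Rightarrow>\<^sub>0 'k::field) set
    \<Rightarrow> ('o \<times> 'n \<times> 'v \<Rightarrow>\<^sub>0 'k) set" where
  "tensor_map2 R h = induced R (\<lambda>(Y, n, m). gen (Y, n, h Y m))"


section \<open>Finite sets and bijections\<close>

definition Bij :: "nat set \<Rightarrow> nat set \<Rightarrow> (nat \<Rightarrow> nat) set" where
  "Bij X Y = {f \<in> extensional X. bij_betw f X Y}"

text \<open>The part of \<open>k FB\<close> on sets with \<open>s\<close> elements.\<close>

definition kFB :: "nat \<Rightarrow> (nat set, 'k::field, (nat \<Rightarrow> nat) \<Rightarrow>\<^sub>0 'k) lincat" where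
  "kFB s = \<lparr>Ob = {S. finite S \<and> card S = s}, Hom = (\<lambda>X Y. free_space (Bij X Y)),
     Cmp = (\<lambda>X Y Z. bilin_ext (\<lambda>g f. gen (compose X g f))), Idn = (\<lambda>X. gen (restrict id X))\<rparr>"


section \<open>Twisted Brauer categories\<close>

datatype polarity = Plus | Minus

type_synonym polarities = "polarity \<times> polarity"

text \<open>The character with value \<open>z\<close> or the trivial one.\<close>

fun twist :: "polarity \<Rightarrow> int \<Rightarrow> int" where
  "twist Plus z = 1"
| "twist Minus z = z"

definition pairs_of :: "nat set \<Rightarrow> nat set \<Rightarrow> nat" where
  "pairs_of X Y = (card Y - card X) div 2"

text \<open>
  When \<open>card Y - card X\<close> is negative or odd there are no bijections below, so that
  \<open>D X Y\<close> is empty and the space of morphisms is zero, as it should be.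
\<close>

definition D :: "nat set \<Rightarrow> nat set \<Rightarrow> (nat + nat \<Rightarrow> nat) set" where
  "D X Y = {f \<in> extensional (X <+> {1..2 * pairs_of X Y}).
              bij_betw f (X <+> {1..2 * pairs_of X Y}) Y}"

definition D_comp ::
  "nat set \<Rightarrow> nat set \<Rightarrow> nat set \<Rightarrow> (nat + nat \<Rightarrow> nat) \<Rightarrow> (nat + nat \<Rightarrow> nat) \<Rightarrow> (nat + nat \<Rightarrow> nat)"
  where
  "D_comp X Y Z g f =
    (let s = pairs_of X Y; t = pairs_of Y Z in
     restrict (\<lambda>z. case z of
         Inl x \<Rightarrow> g (Inl (f (Inl x)))
       | Inr i \<Rightarrow> if i \<le> 2 * s then g (Inl (f (Inr i))) else g (Inr (i - 2 * s)))
      (X <+> {1..2 * (s + t)}))"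

text \<open>The group \<open>S\<^sub>2 \<wr> S\<^sub>t\<close>, its homomorphism to \<open>S\<^sub>t\<close>, and its characters.\<close>

definition wreath :: "nat \<Rightarrow> (nat \<Rightarrow> nat) set" where
  "wreath t = {\<sigma>. \<sigma> permutes {1..2 * t} \<and>
     (\<forall>i\<in>{1..t}. \<exists>j\<in>{1..t}. \<sigma> ` {2 * i - 1, 2 * i} = {2 * j - 1, 2 * j})}"

definition on_pairs :: "(nat \<Rightarrow> nat) \<Rightarrow> nat \<Rightarrow> nat" where
  "on_pairs \<sigma> i = (\<sigma> (2 * i) + 1) div 2"

definition character :: "polarities \<Rightarrow> (nat \<Rightarrow> nat) \<Rightarrow> int" where
  "character p \<sigma> = twist (fst p) (sign \<sigma>) * twist (snd p) (sign (on_pairs \<sigma>))"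

text \<open>
  \<open>k D(X, Y) \<otimes> k\<^sub>p\<close> over the group algebra of the wreath product is the quotient of \<open>k D(X, Y)\<close>
  identifying \<open>f \<sigma>\<close> with the multiple of \<open>f\<close> by the value of the character at \<open>\<sigma>\<close>.
\<close>

definition ub_rels :: "polarities \<Rightarrow> nat set \<Rightarrow> nat set \<Rightarrow> ((nat + nat \<Rightarrow> nat) \<Rightarrow>\<^sub>0 'k::field) set" where
  "ub_rels p X Y = {gen (f \<circ> map_sum id \<sigma>) - fscale (of_int (character p \<sigma>)) (gen f) | f \<sigma>.
     f \<in> D X Y \<and> \<sigma> \<in> wreath (pairs_of X Y)}"

type_synonym 'k ubmor = "((nat + nat \<Rightarrow> nat) \<Rightarrow>\<^sub>0 'k) set"

definition ub_cls :: "polarities \<Rightarrow> nat set \<Rightarrow> nat set \<Rightarrow> (nat + nat \<Rightarrow> nat) \<Rightarrow> 'k::field ubmor" where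
  "ub_cls p X Y f = cls (ub_rels p X Y) (gen f)"

text \<open>A bijection \<open>X \<rightarrow> Y\<close> as an element of \<open>D X Y\<close>.\<close>

definition bij_D :: "nat set \<Rightarrow> (nat \<Rightarrow> nat) \<Rightarrow> (nat + nat \<Rightarrow> nat)" where
  "bij_D X \<sigma> = restrict (\<lambda>z. \<sigma> (projl z)) (X <+> {})"

definition ub :: "polarities \<Rightarrow> (nat set, 'k::field, 'k ubmor) lincat" where
  "ub p = \<lparr>Ob = {X. finite X},
     Hom = (\<lambda>X Y. presented (D X Y) (ub_rels p X Y)),
     Cmp = (\<lambda>X Y Z. induced2 (ub_rels p X Z) (\<lambda>g f. gen (D_comp X Y Z g f))),
     Idn = (\<lambda>X. ub_cls p X X (bij_D X id))\<rparr>"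

definition db :: "polarities \<Rightarrow> (nat set, 'k::field, 'k ubmor) lincat" where
  "db p = opposite (ub p)"

text \<open>
  \<open>g\<^sub>u\<^sub>,\<^sub>v\<close>, as a morphism \<open>X - {u, v} \<rightarrow> X\<close> of \<open>ub p\<close> and \<open>X \<rightarrow> X - {u, v}\<close> of \<open>db p\<close>.
\<close>

definition chord :: "polarities \<Rightarrow> nat set \<Rightarrow> nat \<Rightarrow> nat \<Rightarrow> 'k::field ubmor" where
  "chord p X u v = ub_cls p (X - {u, v}) X
     (restrict (\<lambda>z. case z of Inl x \<Rightarrow> x | Inr i \<Rightarrow> if i = 1 then u else v)
       ((X - {u, v}) <+> {1..2}))"

text \<open>
  The embeddings of \<open>k FB\<close> as the degree zero parts of \<open>ub p\<close> and, inverting bijections, of \<open>db p\<close>.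
\<close>

definition FB_ub :: "polarities \<Rightarrow> nat set \<Rightarrow> nat set \<Rightarrow> ((nat \<Rightarrow> nat) \<Rightarrow>\<^sub>0 'k::field) \<Rightarrow> 'k ubmor" where
  "FB_ub p X Y a = cls (ub_rels p X Y) (lin_ext (\<lambda>\<sigma>. gen (bij_D X \<sigma>)) a)"

definition FB_db :: "polarities \<Rightarrow> nat set \<Rightarrow> nat set \<Rightarrow> ((nat \<Rightarrow> nat) \<Rightarrow>\<^sub>0 'k::field) \<Rightarrow> 'k ubmor" where
  "FB_db p X Y a = cls (ub_rels p Y X) (lin_ext (\<lambda>\<sigma>. gen (bij_D Y (inv_into X \<sigma>))) a)"


section \<open>Koszul complexes\<close>

text \<open>\<open>ub p\<close> as a right \<open>k FB\<close>-module and \<open>db q\<close> as a left \<open>k FB\<close>-module.\<close>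

definition ub_FB ::
  "polarities \<Rightarrow> nat set \<Rightarrow> (nat set, 'k::field, (nat \<Rightarrow> nat) \<Rightarrow>\<^sub>0 'k, 'k ubmor) catmod" where
  "ub_FB p U = \<lparr>At = (\<lambda>S. Hom (ub p) S U),
     Act = (\<lambda>S' S a f. Cmp (ub p) S S' U f (FB_ub p S S' a))\<rparr>"

definition db_FB ::
  "polarities \<Rightarrow> nat set \<Rightarrow> (nat set, 'k::field, (nat \<Rightarrow> nat) \<Rightarrow>\<^sub>0 'k, 'k ubmor) catmod" where
  "db_FB q X = \<lparr>At = (\<lambda>S. Hom (db q) X S),
     Act = (\<lambda>S S' a g. Cmp (db q) X S S' (FB_db q S S' a) g)\<rparr>"

type_synonym 'k koszul = "(nat set \<times> 'k ubmor \<times> 'k ubmor \<Rightarrow>\<^sub>0 'k) set"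

text \<open>
  \<open>ub p \<otimes>\<^bsub>kFB\<^esub> db q\<close> is the direct sum over \<open>s\<close> of the sub-bimodules \<open>koszul p q s\<close>
  supported on sets with \<open>s\<close> elements, and the differential maps \<open>koszul p q s\<close> to
  \<open>koszul p q (s - 2)\<close>.
\<close>

definition koszul_rels ::
  "polarities \<Rightarrow> polarities \<Rightarrow> nat \<Rightarrow> nat set \<Rightarrow> nat set
    \<Rightarrow> (nat set \<times> 'k::field ubmor \<times> 'k ubmor \<Rightarrow>\<^sub>0 'k) set" where
  "koszul_rels p q s U X = tensor_rels (kFB s) (ub_FB p U) (db_FB q X)"

definition koszul ::
  "polarities \<Rightarrow> polarities \<Rightarrow> nat \<Rightarrow> nat set \<Rightarrow> nat set \<Rightarrow> ('k::field, 'k koszul) module" where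
  "koszul p q s U X = tensor (kFB s) (ub_FB p U) (db_FB q X)"

definition koszul_lact ::
  "polarities \<Rightarrow> polarities \<Rightarrow> nat \<Rightarrow> nat set \<Rightarrow> nat set \<Rightarrow> nat set
    \<Rightarrow> 'k::field ubmor \<Rightarrow> 'k koszul \<Rightarrow> 'k koszul" where
  "koszul_lact p q s X U U' b =
     tensor_map1 (koszul_rels p q s U' X) (\<lambda>S f. Cmp (ub p) S U U' b f)"

definition koszul_ract ::
  "polarities \<Rightarrow> polarities \<Rightarrow> nat \<Rightarrow> nat set \<Rightarrow> nat set \<Rightarrow> nat set
    \<Rightarrow> 'k::field ubmor \<Rightarrow> 'k koszul \<Rightarrow> 'k koszul" where
  "koszul_ract p q s U X X' a =
     tensor_map2 (koszul_rels p q s U X') (\<lambda>S g. Cmp (db q) X' X S g a)"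

text \<open>
  The bimodule morphism with value \<open>\<Sum>\<^bsub>i<j\<^esub> g\<^sub>i\<^sub>,\<^sub>j \<otimes> g\<^sub>i\<^sub>,\<^sub>j\<close> at \<open>id\<^sub>S \<otimes> id\<^sub>S\<close>. As
  \<open>f \<otimes> g = f \<cdot> (id\<^sub>S \<otimes> id\<^sub>S) \<cdot> g\<close>, its value at \<open>f \<otimes> g\<close> must be the sum of the
  \<open>f g\<^sub>i\<^sub>,\<^sub>j \<otimes> g\<^sub>i\<^sub>,\<^sub>j g\<close>. Identifying \<open>S - {i, j}\<close> with \<open>{1..s-2}\<close> does not change the class over
  \<open>k FB\<close>. For \<open>s < 2\<close> the sum is empty, so that the truncated index \<open>s - 2\<close> is harmless.
\<close>

definition koszul_d ::
  "polarities \<Rightarrow> polarities \<Rightarrow> nat \<Rightarrow> nat set \<Rightarrow> nat set \<Rightarrow> 'k::field koszul \<Rightarrow> 'k koszul" where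
  "koszul_d p q s U X = induced (koszul_rels p q (s - 2) U X)
     (\<lambda>(S, f, g). \<Sum>(i, j)\<in>{(i, j). i \<in> S \<and> j \<in> S \<and> i < j}.
        gen (S - {i, j},
             Cmp (ub p) (S - {i, j}) S U f (chord p S i j),
             Cmp (db q) X S (S - {i, j}) (chord q S i j) g))"


section \<open>Tensoring with a module and with the dual of the upward Brauer category\<close>

definition koszul_right ::
  "polarities \<Rightarrow> polarities \<Rightarrow> nat \<Rightarrow> nat set
    \<Rightarrow> (nat set, 'k::field, 'k ubmor, 'k koszul) catmod" where
  "koszul_right p q s U = \<lparr>At = koszul p q s U, Act = koszul_ract p q s U\<rparr>"

text \<open>The left \<open>ub p\<close>-module \<open>koszul p q s \<otimes>\<^bsub>db q\<^esub> M\<close> and its differential.\<close>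

definition koszul_tensor ::
  "polarities \<Rightarrow> polarities \<Rightarrow> (nat set, 'k::field, 'k ubmor, 'v) catmod \<Rightarrow> nat
    \<Rightarrow> (nat set, 'k, 'k ubmor, (nat set \<times> 'k koszul \<times> 'v \<Rightarrow>\<^sub>0 'k) set) catmod" where
  "koszul_tensor p q M s =
    \<lparr>At = (\<lambda>U. tensor (db q) (koszul_right p q s U) M),
     Act = (\<lambda>U U' b. tensor_map1 (tensor_rels (db q) (koszul_right p q s U') M)
              (\<lambda>X. koszul_lact p q s X U U' b))\<rparr>"

definition koszul_tensor_d ::
  "polarities \<Rightarrow> polarities \<Rightarrow> (nat set, 'k::field, 'k ubmor, 'v) catmod \<Rightarrow> nat \<Rightarrow> nat set
    \<Rightarrow> (nat set \<times> 'k koszul \<times> 'v \<Rightarrow>\<^sub>0 'k) set \<Rightarrow> (nat set \<times> 'k koszul \<times> 'v \<Rightarrow>\<^sub>0 'k) set" where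
  "koszul_tensor_d p q M s U =
     tensor_map1 (tensor_rels (db q) (koszul_right p q (s - 2) U) M) (\<lambda>X. koszul_d p q s U X)"

text \<open>The right \<open>A\<close>-module \<open>Y \<mapsto> A(X, Y)\<^sup>\<sharp>\<close>.\<close>

definition dual_right ::
  "('o, 'k::field, 'm) lincat \<Rightarrow> 'o \<Rightarrow> ('o, 'k, 'm, 'm \<Rightarrow> 'k) catmod" where
  "dual_right A X = \<lparr>At = (\<lambda>Y. dual (Hom A X Y)),
     Act = (\<lambda>Y' Y a \<phi>. \<lambda>f\<in>carrier (Hom A X Y). \<phi> (Cmp A X Y Y' a f))\<rparr>"

text \<open>The components and the differential of \<open>ub\<^sup>\<sharp> \<otimes>\<^bsub>ub\<^esub> K \<otimes>\<^bsub>db\<^esub> M\<close>, evaluated at \<open>X\<close>.\<close>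

definition brauer_complex ::
  "polarities \<Rightarrow> polarities \<Rightarrow> (nat set, 'k::field, 'k ubmor, 'v) catmod \<Rightarrow> nat set \<Rightarrow> nat
    \<Rightarrow> ('k, (nat set \<times> ('k ubmor \<Rightarrow> 'k) \<times> (nat set \<times> 'k koszul \<times> 'v \<Rightarrow>\<^sub>0 'k) set \<Rightarrow>\<^sub>0 'k) set) module"
  where
  "brauer_complex p q M X s = tensor (ub p) (dual_right (ub p) X) (koszul_tensor p q M s)"

definition brauer_complex_d ::
  "polarities \<Rightarrow> polarities \<Rightarrow> (nat set, 'k::field, 'k ubmor, 'v) catmod \<Rightarrow> nat set \<Rightarrow> nat
    \<Rightarrow> (nat set \<times> ('k ubmor \<Rightarrow> 'k) \<times> (nat set \<times> 'k koszul \<times> 'v \<Rightarrow>\<^sub>0 'k) set \<Rightarrow>\<^sub>0 'k) set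
    \<Rightarrow> (nat set \<times> ('k ubmor \<Rightarrow> 'k) \<times> (nat set \<times> 'k koszul \<times> 'v \<Rightarrow>\<^sub>0 'k) set \<Rightarrow>\<^sub>0 'k) set" where
  "brauer_complex_d p q M X s =
     tensor_map2 (tensor_rels (ub p) (dual_right (ub p) X) (koszul_tensor p q M (s - 2)))
       (\<lambda>Y. koszul_tensor_d p q M s Y)"

text \<open>
  For a complex whose differential maps the component \<open>s\<close> to the component \<open>s - 2\<close> (and is zero on
  the components \<open>0\<close> and \<open>1\<close>): every kernel is equal to the corresponding image.
\<close>

definition zero_homology :: "(nat \<Rightarrow> ('k, 'v) module) \<Rightarrow> (nat \<Rightarrow> 'v \<Rightarrow> 'v) \<Rightarrow> bool" where
  "zero_homology T d \<longleftrightarrow>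
     (\<forall>s. {x \<in> carrier (T s). d s x = \<zero>\<^bsub>T (s - 2)\<^esub>} = d (s + 2) ` carrier (T (s + 2)))"


section \<open>Cyclic operads\<close>

text \<open>
  \<open>Tr C U V \<sigma>\<close> is the action of a bijection \<open>\<sigma> \<in> Bij U V\<close>, and
  \<open>Circ C U V u v\<close> is \<open>\<iota>\<^sub>u\<^sub>,\<^sub>v\<close>, as a bilinear map on \<open>Sp C U\<close> and \<open>Sp C V\<close>.
\<close>

record ('k, 'v) operad_data =
  Sp :: "nat set \<Rightarrow> ('k, 'v) module"
  Tr :: "nat set \<Rightarrow> nat set \<Rightarrow> (nat \<Rightarrow> nat) \<Rightarrow> 'v \<Rightarrow> 'v"
  Circ :: "nat set \<Rightarrow> nat set \<Rightarrow> nat \<Rightarrow> nat \<Rightarrow> 'v \<Rightarrow> 'v \<Rightarrow> 'v"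

locale cyclic_operad =
  fixes C :: "('k::field_char_0, 'v) operad_data"
  assumes space: "finite U \<Longrightarrow> module scalars (Sp C U)"
    and tr_linear: "finite U \<Longrightarrow> \<sigma> \<in> Bij U V \<Longrightarrow> Tr C U V \<sigma> \<in> linear_maps (Sp C U) (Sp C V)"
    and tr_id: "finite U \<Longrightarrow> a \<in> carrier (Sp C U) \<Longrightarrow> Tr C U U (restrict id U) a = a"
    and tr_comp: "finite U \<Longrightarrow> \<sigma> \<in> Bij U V \<Longrightarrow> \<tau> \<in> Bij V W \<Longrightarrow> a \<in> carrier (Sp C U) \<Longrightarrow>
          Tr C U W (compose U \<tau> \<sigma>) a = Tr C V W \<tau> (Tr C U V \<sigma> a)"
    and circ_linear_left: "finite U \<Longrightarrow> finite V \<Longrightarrow> U \<inter> V = {} \<Longrightarrow> u \<in> U \<Longrightarrow> v \<in> V \<Longrightarrow>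
          b \<in> carrier (Sp C V) \<Longrightarrow>
          (\<lambda>a. Circ C U V u v a b) \<in> linear_maps (Sp C U) (Sp C ((U - {u}) \<union> (V - {v})))"
    and circ_linear_right: "finite U \<Longrightarrow> finite V \<Longrightarrow> U \<inter> V = {} \<Longrightarrow> u \<in> U \<Longrightarrow> v \<in> V \<Longrightarrow>
          a \<in> carrier (Sp C U) \<Longrightarrow>
          (\<lambda>b. Circ C U V u v a b) \<in> linear_maps (Sp C V) (Sp C ((U - {u}) \<union> (V - {v})))"
    and circ_natural: "finite U \<Longrightarrow> finite V \<Longrightarrow> U \<inter> V = {} \<Longrightarrow> u \<in> U \<Longrightarrow> v \<in> V \<Longrightarrow>
          \<sigma> \<in> Bij U U' \<Longrightarrow> \<tau> \<in> Bij V V' \<Longrightarrow> U' \<inter> V' = {} \<Longrightarrow>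
          a \<in> carrier (Sp C U) \<Longrightarrow> b \<in> carrier (Sp C V) \<Longrightarrow>
          Circ C U' V' (\<sigma> u) (\<tau> v) (Tr C U U' \<sigma> a) (Tr C V V' \<tau> b) =
          Tr C ((U - {u}) \<union> (V - {v})) ((U' - {\<sigma> u}) \<union> (V' - {\<tau> v}))
            (\<lambda>x\<in>(U - {u}) \<union> (V - {v}). if x \<in> U then \<sigma> x else \<tau> x) (Circ C U V u v a b)"
    and circ_sym: "finite U \<Longrightarrow> finite V \<Longrightarrow> U \<inter> V = {} \<Longrightarrow> u \<in> U \<Longrightarrow> v \<in> V \<Longrightarrow>
          a \<in> carrier (Sp C U) \<Longrightarrow> b \<in> carrier (Sp C V) \<Longrightarrow>
          Circ C U V u v a b = Circ C V U v u b a"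
    and circ_assoc: "finite U \<Longrightarrow> finite V \<Longrightarrow> finite W \<Longrightarrow>
          U \<inter> V = {} \<Longrightarrow> U \<inter> W = {} \<Longrightarrow> V \<inter> W = {} \<Longrightarrow>
          u \<in> U \<Longrightarrow> v \<in> V \<Longrightarrow> v' \<in> V \<Longrightarrow> v \<noteq> v' \<Longrightarrow> w \<in> W \<Longrightarrow>
          a \<in> carrier (Sp C U) \<Longrightarrow> b \<in> carrier (Sp C V) \<Longrightarrow> c \<in> carrier (Sp C W) \<Longrightarrow>
          Circ C ((U - {u}) \<union> (V - {v})) W v' w (Circ C U V u v a b) c =
          Circ C U ((V - {v'}) \<union> (W - {w})) u v a (Circ C V W v' w b c)"

definition has_unit :: "('k, 'v) operad_data \<Rightarrow> bool" where
  "has_unit C \<longleftrightarrow> (\<exists>e\<in>carrier (Sp C {1, 2}).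
     (\<forall>\<sigma>\<in>Bij {1, 2} {1, 2}. Tr C {1, 2} {1, 2} \<sigma> e = e) \<and>
     (\<forall>U u x y c. finite U \<and> u \<in> U \<and> x \<notin> U \<and> y \<notin> U \<and> x \<noteq> y \<and> c \<in> carrier (Sp C U) \<longrightarrow>
        Circ C U {x, y} u x c (Tr C {1, 2} {x, y} (\<lambda>i\<in>{1, 2}. if i = 1 then x else y) e) =
        Tr C U ((U - {u}) \<union> {y}) (\<lambda>z\<in>U. if z = u then y else z) c))"


section \<open>The modules \<open>S\<^sub>\<odot>\<^sup>*(C)\<close> and \<open>\<Lambda>\<^sub>\<odot>\<^sup>*(C)\<close>\<close>

text \<open>
  A list of pairs \<open>(U\<^sub>i, c\<^sub>i)\<close> with \<open>c\<^sub>i \<in> C(U\<^sub>i)\<close> stands for \<open>c\<^sub>1 \<otimes> \<dots> \<otimes> c\<^sub>n\<close> in the summand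
  \<open>C(U\<^sub>1) \<otimes> \<dots> \<otimes> C(U\<^sub>n)\<close> of the \<open>n\<close>-fold product; all \<open>n\<close> are treated at once. The polarity is
  \<open>Plus\<close> for \<open>S\<^sub>\<odot>\<^sup>*\<close> and \<open>Minus\<close> for \<open>\<Lambda>\<^sub>\<odot>\<^sup>*\<close>.
\<close>

definition words :: "('k, 'v) operad_data \<Rightarrow> nat set \<Rightarrow> (nat set \<times> 'v) list set" where
  "words C X = {ws. (\<forall>(U, c)\<in>set ws. c \<in> carrier (Sp C U)) \<and>
     (\<forall>i<length ws. \<forall>j<length ws. i \<noteq> j \<longrightarrow> fst (ws ! i) \<inter> fst (ws ! j) = {}) \<and>
     X = (\<Union>(U, c)\<in>set ws. U)}"

definition odot_rels ::
  "polarity \<Rightarrow> ('k::field, 'v) operad_data \<Rightarrow> nat set \<Rightarrow> ((nat set \<times> 'v) list \<Rightarrow>\<^sub>0 'k) set" where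
  "odot_rels e C X =
     {gen (ws[i := (U, a \<oplus>\<^bsub>Sp C U\<^esub> b)]) - gen (ws[i := (U, a)]) - gen (ws[i := (U, b)]) | ws i U a b.
        ws \<in> words C X \<and> i < length ws \<and> U = fst (ws ! i) \<and>
        a \<in> carrier (Sp C U) \<and> b \<in> carrier (Sp C U)}
   \<union> {gen (ws[i := (U, r \<odot>\<^bsub>Sp C U\<^esub> a)]) - fscale r (gen (ws[i := (U, a)])) | ws i U r a.
        ws \<in> words C X \<and> i < length ws \<and> U = fst (ws ! i) \<and> a \<in> carrier (Sp C U)}
   \<union> {gen (permute_list \<pi> ws) - fscale (of_int (twist e (sign \<pi>))) (gen ws) | ws \<pi>.
        ws \<in> words C X \<and> \<pi> permutes {..<length ws}}"

definition odot :: "polarity \<Rightarrow> ('k::field, 'v) operad_data \<Rightarrow> nat set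
    \<Rightarrow> ('k, ((nat set \<times> 'v) list \<Rightarrow>\<^sub>0 'k) set) module" where
  "odot e C X = presented (words C X) (odot_rels e C X)"

text \<open>
  The action of \<open>g\<^sub>u\<^sub>,\<^sub>v\<close> on \<open>c\<^sub>1 \<cdots> c\<^sub>n\<close> for \<open>u \<in> U\<^sub>i\<close> and \<open>v \<in> U\<^sub>j\<close>: the factors \<open>c\<^sub>i\<close>, \<open>c\<^sub>j\<close> are moved,
  in this order, to the end of the word and then composed. With positions \<open>i, j\<close> counted from
  \<open>0\<close>, moving the factors takes \<open>(n-1-j) + (n-2-i)\<close> transpositions if \<open>i < j\<close> and
  \<open>(n-1-j) + (n-1-i)\<close> if \<open>j < i\<close>.
\<close>

definition position :: "(nat set \<times> 'v) list \<Rightarrow> nat \<Rightarrow> nat" where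
  "position ws u = (THE i. i < length ws \<and> u \<in> fst (ws ! i))"

definition contract ::
  "polarity \<Rightarrow> ('k::field, 'v) operad_data \<Rightarrow> nat \<Rightarrow> nat \<Rightarrow> (nat set \<times> 'v) list
    \<Rightarrow> ((nat set \<times> 'v) list \<Rightarrow>\<^sub>0 'k)" where
  "contract e C u v ws =
    (let i = position ws u; j = position ws v; n = length ws;
         U = fst (ws ! i); V = fst (ws ! j);
         N = (if i < j then (n - 1 - j) + (n - 2 - i) else (n - 1 - j) + (n - 1 - i))
     in if i = j then 0
        else fscale (of_int (twist e ((-1) ^ N)))
          (gen (nths ws (- {i, j}) @
             [((U - {u}) \<union> (V - {v}), Circ C U V u v (snd (ws ! i)) (snd (ws ! j)))])))"

definition relabel ::
  "('k::field, 'v) operad_data \<Rightarrow> (nat \<Rightarrow> nat) \<Rightarrow> (nat set \<times> 'v) list \<Rightarrow> (nat set \<times> 'v) list" where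
  "relabel C \<tau> ws = map (\<lambda>(U, c). (\<tau> ` U, Tr C U (\<tau> ` U) (restrict \<tau> U) c)) ws"

text \<open>
  In \<open>ub\<close>, the element \<open>f \<in> D Y X\<close> is the composite of the bijection of \<open>Y\<close> with \<open>f ` Inl ` Y\<close>
  followed by the \<open>g\<^sub>u\<^sub>,\<^sub>v\<close> with \<open>(u, v) = (f (Inr 1), f (Inr 2))\<close>,
  \<open>(f (Inr 3), f (Inr 4))\<close>, and so on in this order. Viewed as a morphism \<open>X \<rightarrow> Y\<close> of the opposite
  category it therefore acts by contracting the pairs of points, the last pair first,
  and then relabelling along the inverse of the bijection.
\<close>

fun contract_pairs ::
  "polarity \<Rightarrow> ('k::field, 'v) operad_data \<Rightarrow> (nat + nat \<Rightarrow> nat) \<Rightarrow> nat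
    \<Rightarrow> ((nat set \<times> 'v) list \<Rightarrow>\<^sub>0 'k) \<Rightarrow> ((nat set \<times> 'v) list \<Rightarrow>\<^sub>0 'k)" where
  "contract_pairs e C f 0 x = x"
| "contract_pairs e C f (Suc t) x =
     contract_pairs e C f t
       (lin_ext (contract e C (f (Inr (2 * t + 1))) (f (Inr (2 * t + 2)))) x)"

definition D_action ::
  "polarity \<Rightarrow> ('k::field, 'v) operad_data \<Rightarrow> nat set \<Rightarrow> nat set \<Rightarrow> (nat + nat \<Rightarrow> nat)
    \<Rightarrow> (nat set \<times> 'v) list \<Rightarrow> ((nat set \<times> 'v) list \<Rightarrow>\<^sub>0 'k)" where
  "D_action e C X Y f ws =
     lin_ext (\<lambda>ws'. gen (relabel C (inv_into Y (\<lambda>y. f (Inl y))) ws'))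
       (contract_pairs e C f (pairs_of Y X) (gen ws))"

text \<open>
  \<open>S\<^sub>\<odot>\<^sup>*(C)\<close> as a module over \<open>db (Plus, Plus)\<close> (for \<open>e = Plus\<close>) and \<open>\<Lambda>\<^sub>\<odot>\<^sup>*(C)\<close> as a module over
  \<open>db (Minus, Minus)\<close> (for \<open>e = Minus\<close>).
\<close>

definition odot_module ::
  "polarity \<Rightarrow> ('k::field, 'v) operad_data
    \<Rightarrow> (nat set, 'k, 'k ubmor, ((nat set \<times> 'v) list \<Rightarrow>\<^sub>0 'k) set) catmod" where
  "odot_module e C = \<lparr>At = odot e C,
     Act = (\<lambda>X Y. induced2 (odot_rels e C Y) (D_action e C X Y))\<rparr>"

abbreviation "S_odot \<equiv> odot_module Plus"
abbreviation "Lambda_odot \<equiv> odot_module Minus"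

end

theory Submission
  imports Defs
begin

text \<open>
  The component \<open>s\<close> of either complex at \<open>X\<close> is spanned by classes \<open>\<phi> \<otimes> m\<close> with \<open>S\<close> of size \<open>s\<close>,
  \<open>\<phi>\<close> in the dual of \<open>ub(X, S)\<close> and \<open>m\<close> a word of operad elements with leaves \<open>S\<close>, and the differential
  maps \<open>\<phi> \<otimes> m\<close> to the sum of \<open>g\<^sub>i\<^sub>j\<^sup>* \<phi> \<otimes> g\<^sub>i\<^sub>j m\<close> over the chords \<open>(i, j)\<close> in \<open>S\<close>. Fix \<open>x0 \<in> X\<close>, which is
  where non-emptiness enters. For new leaves \<open>a\<close> and \<open>b\<close> a contracting homotopy is
  \<open>\<phi> \<otimes> m \<mapsto> \<phi>\<^sup>+ \<otimes> m 1\<^sub>a\<^sub>b\<close>, where \<open>1\<^sub>a\<^sub>b\<close> is the unit of the operad and \<open>\<phi>\<^sup>+\<close> lives on the diagrams that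
  send \<open>x0\<close> to \<open>a\<close> and pair \<open>b\<close> with some leaf \<open>z\<close>; its value there is that of \<open>\<phi>\<close> on the diagram in
  which the pair is removed and \<open>x0\<close> is sent to \<open>z\<close>. In the differential of \<open>\<phi>\<^sup>+ \<otimes> m 1\<^sub>a\<^sub>b\<close>, the chords
  inside \<open>S\<close> reproduce minus the homotopy applied to the differential of \<open>\<phi> \<otimes> m\<close>, those that contain
  \<open>a\<close> kill \<open>\<phi>\<^sup>+\<close>, and the chord \<open>(y, b)\<close> contracts the unit away and leaves the part of \<open>\<phi>\<close> supported on
  the diagrams with \<open>x0 \<mapsto> y\<close>. Summed over \<open>y \<in> S\<close> these parts give back \<open>\<phi> \<otimes> m\<close>.
\<close>

text \<open>The minus sign in the homotopy is where the polarities enter. Composing with a chord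
  inside S puts the pair of the chord after the new one, and contracting a word puts the joined
  vertex after the unit. Restoring the order costs the sign of \<open>snd p\<close> for diagrams and
  the sign of \<open>e\<close> for words, and in both complexes exactly one of these is -1. The same
  product of signs makes two successive chords anticommute, so that the differential squares to
  zero; equality of the first polarities makes the differential independent of the orientation of a
  chord. The formal obstacle is that every space is a quotient, so each map has to be checked on
  relations, and the homotopy is only given on classes \<phi> \<otimes> m. It extends because it is
  compatible with bijections of S. This compatibility also frees the homotopy from the choice of the
  new leaves, which cannot be the same for S and for S minus a chord when they are chosen as
  functions of the set.\<close>

lemma lin_ext_superset:
  assumes "finite A" "Poly_Mapping.keys p \<subseteq> A"
  shows "lin_ext h p = (\<Sum>g\<in>A. fscale (Poly_Mapping.lookup p g) (h g))"
  unfolding lin_ext_def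
  by (rule sum.mono_neutral_left) (use assms in \<open>auto simp: in_keys_iff\<close>)

text \<open>Linearity between free spaces as two bare equations, so that it can be used by rewriting
  without an instance of the locale of linear maps for each pair of types.\<close>

definition flin :: "(('g \<Rightarrow>\<^sub>0 'k::field) \<Rightarrow> ('h \<Rightarrow>\<^sub>0 'k)) \<Rightarrow> bool" where
  "flin f \<longleftrightarrow> (\<forall>x y. f (x + y) = f x + f y) \<and> (\<forall>c x. f (fscale c x) = fscale c (f x))"

lemma flin_add: "flin f \<Longrightarrow> f (x + y) = f x + f y"
  and flin_scale: "flin f \<Longrightarrow> f (fscale c x) = fscale c (f x)"
  by (auto simp: flin_def)

lemma flin_zero: "flin f \<Longrightarrow> f 0 = 0"
  using flin_scale[of f 0 0] by simp

lemma flin_diff: "flin f \<Longrightarrow> f (x - y) = f x - f y"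
  using flin_add[of f "x - y" y] by simp

lemma flin_sum: "flin f \<Longrightarrow> f (sum g A) = (\<Sum>a\<in>A. f (g a))"
  by (induction A rule: infinite_finite_induct) (auto simp: flin_zero flin_add)

lemma flin_compose: "flin f \<Longrightarrow> flin g \<Longrightarrow> flin (\<lambda>x. f (g x))"
  by (simp add: flin_def)

lemma flin_lin_ext: "flin (lin_ext h)"
  unfolding flin_def
proof (intro conjI allI)
  fix x y :: "'a \<Rightarrow>\<^sub>0 'b"
  let ?A = "Poly_Mapping.keys x \<union> Poly_Mapping.keys y"
  have "Poly_Mapping.keys (x + y) \<subseteq> ?A" by (rule Poly_Mapping.keys_add)
  then show "lin_ext h (x + y) = lin_ext h x + lin_ext h y"
    by (simp add: lin_ext_superset[of ?A] lookup_add free_vs.scale_left_distrib sum.distrib)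
next
  fix c and x :: "'a \<Rightarrow>\<^sub>0 'b"
  have "Poly_Mapping.keys (fscale c x) \<subseteq> Poly_Mapping.keys x"
    by (auto simp: in_keys_iff)
  then show "lin_ext h (fscale c x) = fscale c (lin_ext h x)"
    by (simp add: lin_ext_superset[of "Poly_Mapping.keys x"] free_vs.scale_sum_right)
qed

lemmas lin_ext_add = flin_add[OF flin_lin_ext] and lin_ext_scale = flin_scale[OF flin_lin_ext]
  and lin_ext_zero [simp] = flin_zero[OF flin_lin_ext]
  and lin_ext_diff = flin_diff[OF flin_lin_ext] and lin_ext_sum = flin_sum[OF flin_lin_ext]

lemma lin_ext_gen [simp]: "lin_ext h (gen g) = h g"
  by (subst lin_ext_superset[of "{g}"]) auto

lemma lin_ext_cong:
  "(\<And>g. g \<in> Poly_Mapping.keys p \<Longrightarrow> h g = h' g) \<Longrightarrow> lin_ext h p = lin_ext h' p"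
  by (simp add: lin_ext_def)

lemma flin_lin_ext_comp: "flin f \<Longrightarrow> f (lin_ext h p) = lin_ext (\<lambda>g. f (h g)) p"
  by (simp add: lin_ext_def flin_sum flin_scale)

lemma lin_ext_gen_eq: "lin_ext gen p = (p :: 'g \<Rightarrow>\<^sub>0 'k::field)"
proof (rule poly_mapping_eqI)
  fix g
  have "Poly_Mapping.lookup (lin_ext gen p) g =
    (\<Sum>x\<in>Poly_Mapping.keys p. if x = g then Poly_Mapping.lookup p x else 0)"
    unfolding lin_ext_def Poly_Mapping.lookup_sum by (rule sum.cong) (auto simp: lookup_single when_def)
  also have "\<dots> = (if g \<in> Poly_Mapping.keys p then Poly_Mapping.lookup p g else 0)"
    by (rule sum.delta) (rule finite_keys)
  also have "\<dots> = Poly_Mapping.lookup p g"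
    using in_keys_iff[of g p] by auto
  finally show "Poly_Mapping.lookup (lin_ext gen p) g = Poly_Mapping.lookup p g" .
qed

lemma flin_eq_lin_ext: "flin f \<Longrightarrow> f p = lin_ext (\<lambda>g. f (gen g)) p"
  using flin_lin_ext_comp[of f gen p] by (simp add: lin_ext_gen_eq)

lemma flin_fscale: "flin (fscale c)"
  unfolding flin_def
  by (intro conjI allI free_vs.scale_right_distrib) (simp only: free_vs.scale_scale mult.commute[of c])

lemma lin_ext_zero_fun [simp]: "lin_ext (\<lambda>g. 0) p = 0"
  by (simp add: lin_ext_def)

lemma keys_fscale: "Poly_Mapping.keys (fscale c p) \<subseteq> Poly_Mapping.keys p"
  by (auto simp: in_keys_iff)

lemma keys_sum_subset:
  "(\<And>x. x \<in> A \<Longrightarrow> Poly_Mapping.keys (f x) \<subseteq> S) \<Longrightarrow> Poly_Mapping.keys (sum f A) \<subseteq> S"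
proof (induction A rule: infinite_finite_induct)
  case (insert x F)
  then show ?case using Poly_Mapping.keys_add[of "f x" "sum f F"] by auto
qed auto

lemma keys_scale: "Poly_Mapping.keys p \<subseteq> S \<Longrightarrow> Poly_Mapping.keys (fscale c p) \<subseteq> S"
  using keys_fscale[of c p] by auto

lemma keys_lin_ext:
  "(\<And>g. g \<in> Poly_Mapping.keys p \<Longrightarrow> Poly_Mapping.keys (h g) \<subseteq> S) \<Longrightarrow> Poly_Mapping.keys (lin_ext h p) \<subseteq> S"
  unfolding lin_ext_def by (intro keys_sum_subset keys_scale)

lemma keys_plus: "Poly_Mapping.keys p \<subseteq> S \<Longrightarrow> Poly_Mapping.keys q \<subseteq> S \<Longrightarrow> Poly_Mapping.keys (p + q) \<subseteq> S"
  using Poly_Mapping.keys_add[of p q] by auto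

lemma keys_minus: "Poly_Mapping.keys p \<subseteq> S \<Longrightarrow> Poly_Mapping.keys q \<subseteq> S \<Longrightarrow> Poly_Mapping.keys (p - q) \<subseteq> S"
  unfolding subset_iff in_keys_iff lookup_minus by (metis diff_zero)

lemma keys_span:
  assumes "x \<in> free_vs.span R" "\<And>r. r \<in> R \<Longrightarrow> Poly_Mapping.keys r \<subseteq> S"
  shows "Poly_Mapping.keys x \<subseteq> S"
  using assms(1)
proof (induction rule: free_vs.span_induct_alt)
  case (step c x y)
  then show ?case using assms(2)[of x] by (intro keys_plus keys_scale) simp_all
qed simp

lemma flin_span_zero:
  assumes "flin f" "x \<in> free_vs.span R" "\<And>r. r \<in> R \<Longrightarrow> f r = 0"
  shows "f x = 0"
  using assms(2)
  by (induction rule: free_vs.span_induct_alt)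
    (auto simp: flin_zero[OF assms(1)] flin_add[OF assms(1)] flin_scale[OF assms(1)] assms(3))

subsection \<open>Normal forms modulo a subspace\<close>

text \<open>
  A linear map with kernel exactly the span of \<open>R\<close>: it turns equality of cosets into an equation
  between vectors, which can be rewritten and summed.
\<close>

definition nf :: "('g \<Rightarrow>\<^sub>0 'k::field) set \<Rightarrow> ('g \<Rightarrow>\<^sub>0 'k) \<Rightarrow> ('g \<Rightarrow>\<^sub>0 'k)" where
  "nf R = (SOME f. flin f \<and> (\<forall>x. f x = 0 \<longleftrightarrow> x \<in> free_vs.span R))"

text \<open>The span has a linear projection \<open>g\<close> onto it, here a left inverse of the
  identity on the span. Then x - g x vanishes exactly on the span.\<close>

lemma nf_exists: "\<exists>f :: _ \<Rightarrow> ('g \<Rightarrow>\<^sub>0 'k). flin f \<and> (\<forall>x. f x = 0 \<longleftrightarrow> x \<in> free_vs.span (R :: ('g \<Rightarrow>\<^sub>0 'k::field) set))"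
proof -
  interpret vector_space_pair "fscale :: 'k \<Rightarrow> ('g \<Rightarrow>\<^sub>0 'k) \<Rightarrow> _" fscale ..
  have "Vector_Spaces.linear fscale fscale (id :: ('g \<Rightarrow>\<^sub>0 'k) \<Rightarrow> _)"
    by (rule free_vs.linear_id)
  from linear_exists_left_inverse_on[OF this free_vs.subspace_span[of R]] obtain g where
    g: "g ` UNIV \<subseteq> free_vs.span R" "Vector_Spaces.linear fscale fscale g" "\<forall>v\<in>free_vs.span R. g v = v"
    by auto
  have "flin (\<lambda>x. x - g x)"
    using linear_add[OF g(2)] linear_scale[OF g(2)]
    by (simp add: flin_def free_vs.scale_right_diff_distrib)
  moreover have "x - g x = 0 \<longleftrightarrow> x \<in> free_vs.span R" for x
    using g by (metis eq_iff_diff_eq_0 rangeI subsetD)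
  ultimately show ?thesis by blast
qed

lemma flin_nf: "flin (nf R)" and nf_eq_0_iff: "nf R x = 0 \<longleftrightarrow> x \<in> free_vs.span R"
  using someI_ex[OF nf_exists[of R]] unfolding nf_def[symmetric] by auto

lemmas nf_add = flin_add[OF flin_nf] and nf_scale = flin_scale[OF flin_nf]
  and nf_zero [simp] = flin_zero[OF flin_nf]
  and nf_diff = flin_diff[OF flin_nf] and nf_sum = flin_sum[OF flin_nf]
  and nf_lin_ext = flin_lin_ext_comp[OF flin_nf]

lemma nf_rel: "r \<in> R \<Longrightarrow> nf R r = 0"
  by (simp add: nf_eq_0_iff free_vs.span_base)

lemma nf_rel_eq: "p - q \<in> R \<Longrightarrow> nf R p = nf R q"
  using nf_rel[of "p - q" R] by (simp add: nf_diff)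

lemma cls_eq_iff: "cls R p = cls R q \<longleftrightarrow> nf R p = nf R q"
proof -
  have "cls R p = cls R q \<longleftrightarrow> p - q \<in> free_vs.span R"
  proof
    assume "cls R p = cls R q"
    moreover have "p \<in> cls R p"
      unfolding cls_def using free_vs.span_zero[of R] by force
    ultimately obtain r where "r \<in> free_vs.span R" "p = q + r" by (auto simp: cls_def)
    then show "p - q \<in> free_vs.span R" by simp
  next
    assume a: "p - q \<in> free_vs.span R"
    have sub: "cls R p \<subseteq> cls R q" if "p - q \<in> free_vs.span R" for p q
    proof
      fix x assume "x \<in> cls R p"
      then obtain r where "r \<in> free_vs.span R" "x = p + r" by (auto simp: cls_def)
      then have "x = q + ((p - q) + r)" "(p - q) + r \<in> free_vs.span R"
        using that by (auto intro: free_vs.span_add)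
      then show "x \<in> cls R q" unfolding cls_def by blast
    qed
    have "q - p \<in> free_vs.span R" using free_vs.span_neg[OF a] by simp
    with a show "cls R p = cls R q" using sub by blast
  qed
  also have "\<dots> \<longleftrightarrow> nf R p = nf R q"
    by (simp add: nf_diff flip: nf_eq_0_iff)
  finally show ?thesis .
qed

lemma mem_cls_iff: "x \<in> cls R p \<longleftrightarrow> nf R x = nf R p"
proof -
  have "x \<in> cls R p \<longleftrightarrow> x - p \<in> free_vs.span R"
    unfolding cls_def by (auto simp: image_iff intro!: bexI[of _ "x - p"])
  then show ?thesis by (simp add: nf_diff flip: nf_eq_0_iff)
qed

lemma cls_self: "p \<in> cls R p" by (simp add: mem_cls_iff)

text \<open>Descent of a map to a quotient by evaluation at a chosen representative. By
  \<open>plift_cls\<close> the choice does not matter once the map is linear and kills the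
  relations.\<close>

definition plift :: "(('g \<Rightarrow>\<^sub>0 'k::field) \<Rightarrow> ('h \<Rightarrow>\<^sub>0 'k)) \<Rightarrow> ('g \<Rightarrow>\<^sub>0 'k) set \<Rightarrow> ('h \<Rightarrow>\<^sub>0 'k)" where
  "plift L A = L (SOME p. p \<in> A)"

lemma flin_nf_eq:
  assumes "flin L" "\<And>r. r \<in> R \<Longrightarrow> L r = 0" "nf R p = nf R q"
  shows "L p = L q"
proof -
  have "p - q \<in> free_vs.span R" using assms(3) by (simp add: nf_diff flip: nf_eq_0_iff)
  from flin_span_zero[OF assms(1) this assms(2)] show ?thesis
    by (simp add: flin_diff[OF assms(1)])
qed

lemma plift_cls:
  assumes "flin L" "\<And>r. r \<in> R \<Longrightarrow> L r = 0"
  shows "plift L (cls R p) = L p"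
  unfolding plift_def
proof (rule flin_nf_eq[OF assms])
  have "(SOME q. q \<in> cls R p) \<in> cls R p" by (rule someI[of "\<lambda>q. q \<in> cls R p", OF cls_self])
  then show "nf R (SOME q. q \<in> cls R p) = nf R p" by (simp only: mem_cls_iff)
qed

text \<open>The coset counterpart of \<open>nf\<close>. It is linear (\<open>lin_on_val\<close>) and
  injective (\<open>val_inj\<close>), so an equation in a quotient becomes one between vectors,
  where finite sums and differences exist; the module record only offers sums of two elements and
  multiples.\<close>

definition val :: "('g \<Rightarrow>\<^sub>0 'k::field) set \<Rightarrow> ('g \<Rightarrow>\<^sub>0 'k) set \<Rightarrow> ('g \<Rightarrow>\<^sub>0 'k)" where
  "val R = plift (nf R)"

lemma val_cls [simp]: "val R (cls R p) = nf R p"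
  by (simp add: val_def plift_cls flin_nf nf_rel)

section \<open>Quotient spaces and linear maps out of them\<close>

lemma presented_carrier: "carrier (presented S R) = cls R ` {p. Poly_Mapping.keys p \<subseteq> S}"
  by (simp add: presented_def)

lemma presented_memE:
  assumes "x \<in> carrier (presented S R)"
  obtains p where "Poly_Mapping.keys p \<subseteq> S" "x = cls R p"
  using assms by (auto simp: presented_carrier)

lemma cls_in_presented: "Poly_Mapping.keys p \<subseteq> S \<Longrightarrow> cls R p \<in> carrier (presented S R)"
  by (auto simp: presented_carrier)

lemma cls_gen_in_presented: "g \<in> S \<Longrightarrow> cls R (gen g) \<in> carrier (presented S R)"
  by (auto simp: presented_carrier)

lemma presented_zero: "\<zero>\<^bsub>presented S R\<^esub> = cls R 0" by (simp add: presented_def)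

lemma presented_add: "cls R p \<oplus>\<^bsub>presented S R\<^esub> cls R q = cls R (p + q)"
proof -
  have "cls R (a + b) = cls R (p + q)" if "a \<in> cls R p" "b \<in> cls R q" for a b
    using that by (simp add: mem_cls_iff cls_eq_iff nf_add)
  moreover have "p \<in> cls R p" "q \<in> cls R q" by (rule cls_self)+
  ultimately have "(\<Union>a\<in>cls R p. \<Union>b\<in>cls R q. cls R (a + b)) = cls R (p + q)" by blast
  then show ?thesis by (simp add: presented_def)
qed

lemma presented_smult: "c \<odot>\<^bsub>presented S R\<^esub> cls R p = cls R (fscale c p)"
proof -
  have "cls R (fscale c a) = cls R (fscale c p)" if "a \<in> cls R p" for a
    using that by (simp add: mem_cls_iff cls_eq_iff nf_scale)
  with cls_self[of p R] have "(\<Union>a\<in>cls R p. cls R (fscale c a)) = cls R (fscale c p)" by blast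
  then show ?thesis by (simp add: presented_def)
qed

text \<open>Closure under the two operations is what the arguments use of a carrier. Equations are
  tested after an injective linear map to a free space, where the laws of a vector space are at
  hand.\<close>

definition closed_space :: "('k, 'v) module \<Rightarrow> bool" where
  "closed_space V \<longleftrightarrow> (\<forall>x\<in>carrier V. \<forall>y\<in>carrier V. x \<oplus>\<^bsub>V\<^esub> y \<in> carrier V) \<and>
     (\<forall>c. \<forall>x\<in>carrier V. c \<odot>\<^bsub>V\<^esub> x \<in> carrier V)"

lemma closed_add: "closed_space V \<Longrightarrow> x \<in> carrier V \<Longrightarrow> y \<in> carrier V \<Longrightarrow> x \<oplus>\<^bsub>V\<^esub> y \<in> carrier V"
  and closed_smult: "closed_space V \<Longrightarrow> x \<in> carrier V \<Longrightarrow> c \<odot>\<^bsub>V\<^esub> x \<in> carrier V"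
  by (auto simp: closed_space_def)

lemma closed_presented: "closed_space (presented S R)"
  unfolding closed_space_def
proof (intro conjI ballI allI)
  fix x y assume x: "x \<in> carrier (presented S R)" and y: "y \<in> carrier (presented S R)"
  obtain p where p: "Poly_Mapping.keys p \<subseteq> S" "x = cls R p" using x by (rule presented_memE)
  obtain q where q: "Poly_Mapping.keys q \<subseteq> S" "y = cls R q" using y by (rule presented_memE)
  show "x \<oplus>\<^bsub>presented S R\<^esub> y \<in> carrier (presented S R)"
    unfolding p(2) q(2) presented_add by (intro cls_in_presented keys_plus p q)
next
  fix c x assume x: "x \<in> carrier (presented S R)"
  obtain p where p: "Poly_Mapping.keys p \<subseteq> S" "x = cls R p" using x by (rule presented_memE)
  show "c \<odot>\<^bsub>presented S R\<^esub> x \<in> carrier (presented S R)"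
    unfolding p(2) presented_smult by (intro cls_in_presented keys_scale p)
qed

text \<open>Linearity of a map from a carrier to a free space, next to \<open>linear_maps\<close>,
  whose target is again a carrier. Maps out of quotients are built and added up in this
  form.\<close>

definition lin_on :: "('k::field, 'v) module \<Rightarrow> ('v \<Rightarrow> ('h \<Rightarrow>\<^sub>0 'k)) \<Rightarrow> bool" where
  "lin_on V L \<longleftrightarrow> (\<forall>x\<in>carrier V. \<forall>y\<in>carrier V. L (x \<oplus>\<^bsub>V\<^esub> y) = L x + L y) \<and>
     (\<forall>c. \<forall>x\<in>carrier V. L (c \<odot>\<^bsub>V\<^esub> x) = fscale c (L x))"

lemma lin_onI:
  "(\<And>x y. x \<in> carrier V \<Longrightarrow> y \<in> carrier V \<Longrightarrow> L (x \<oplus>\<^bsub>V\<^esub> y) = L x + L y) \<Longrightarrow>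
   (\<And>c x. x \<in> carrier V \<Longrightarrow> L (c \<odot>\<^bsub>V\<^esub> x) = fscale c (L x)) \<Longrightarrow> lin_on V L"
  by (simp add: lin_on_def)

lemma lin_on_add: "lin_on V L \<Longrightarrow> x \<in> carrier V \<Longrightarrow> y \<in> carrier V \<Longrightarrow> L (x \<oplus>\<^bsub>V\<^esub> y) = L x + L y"
  and lin_on_smult: "lin_on V L \<Longrightarrow> x \<in> carrier V \<Longrightarrow> L (c \<odot>\<^bsub>V\<^esub> x) = fscale c (L x)"
  by (auto simp: lin_on_def)

lemma linear_mapsI:
  "(\<And>x. x \<in> carrier V \<Longrightarrow> f x \<in> carrier W) \<Longrightarrow>
   (\<And>x y. x \<in> carrier V \<Longrightarrow> y \<in> carrier V \<Longrightarrow> f (x \<oplus>\<^bsub>V\<^esub> y) = f x \<oplus>\<^bsub>W\<^esub> f y) \<Longrightarrow>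
   (\<And>c x. x \<in> carrier V \<Longrightarrow> f (c \<odot>\<^bsub>V\<^esub> x) = c \<odot>\<^bsub>W\<^esub> f x) \<Longrightarrow> f \<in> linear_maps V W"
  by (simp add: linear_maps_def)

lemma linear_maps_add: "f \<in> linear_maps V W \<Longrightarrow> x \<in> carrier V \<Longrightarrow> y \<in> carrier V \<Longrightarrow> f (x \<oplus>\<^bsub>V\<^esub> y) = f x \<oplus>\<^bsub>W\<^esub> f y"
  and linear_maps_smult: "f \<in> linear_maps V W \<Longrightarrow> x \<in> carrier V \<Longrightarrow> f (c \<odot>\<^bsub>V\<^esub> x) = c \<odot>\<^bsub>W\<^esub> f x"
  and linear_maps_mem: "f \<in> linear_maps V W \<Longrightarrow> x \<in> carrier V \<Longrightarrow> f x \<in> carrier W"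
  by (auto simp: linear_maps_def)

lemma linear_maps_cong:
  "closed_space V \<Longrightarrow> (\<And>x. x \<in> carrier V \<Longrightarrow> f x = g x) \<Longrightarrow> f \<in> linear_maps V W \<Longrightarrow> g \<in> linear_maps V W"
  by (rule linear_mapsI)
    (metis linear_maps_mem linear_maps_add linear_maps_smult closed_add closed_smult)+

lemma linear_maps_comp: "f \<in> linear_maps V W \<Longrightarrow> g \<in> linear_maps U V \<Longrightarrow> (\<lambda>x. f (g x)) \<in> linear_maps U W"
  by (rule linear_mapsI) (simp_all add: linear_maps_mem linear_maps_add linear_maps_smult)

lemma lin_on_comp: "lin_on V L \<Longrightarrow> f \<in> linear_maps U V \<Longrightarrow> lin_on U (\<lambda>x. L (f x))"
  by (simp add: lin_on_def linear_maps_def Pi_iff)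

lemma lin_on_plus: "lin_on V L \<Longrightarrow> lin_on V L' \<Longrightarrow> lin_on V (\<lambda>x. L x + L' x)"
  by (simp add: lin_on_def free_vs.scale_right_distrib)

lemma lin_on_flin: "flin f \<Longrightarrow> lin_on V L \<Longrightarrow> lin_on V (\<lambda>x. f (L x))"
  by (simp add: lin_on_def flin_def)

lemma lin_on_sum: "(\<And>a. a \<in> A \<Longrightarrow> lin_on V (L a)) \<Longrightarrow> lin_on V (\<lambda>x. \<Sum>a\<in>A. L a x)"
  by (simp add: lin_on_def sum.distrib free_vs.scale_sum_right)

lemma lin_on_scale: "lin_on V L \<Longrightarrow> lin_on V (\<lambda>x. fscale c (L x))"
  by (rule lin_on_flin[OF flin_fscale])

lemma lin_on_presentedI:
  assumes "flin L" "\<And>p. Poly_Mapping.keys p \<subseteq> S \<Longrightarrow> F (cls R p) = L p"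
  shows "lin_on (presented S R) F"
  using assms
  by (auto simp: lin_on_def presented_carrier presented_add presented_smult keys_plus keys_scale
      flin_add flin_scale)

lemma lin_on_plift: "(\<And>r. r \<in> R \<Longrightarrow> L r = 0) \<Longrightarrow> flin L \<Longrightarrow> lin_on (presented S R) (plift L)"
  by (rule lin_on_presentedI[of L]) (auto simp: plift_cls)

lemma lin_on_val: "lin_on (presented S R) (val R)"
  unfolding val_def by (rule lin_on_plift) (auto simp: flin_nf nf_rel)

lemma val_inj: "x \<in> carrier (presented S R) \<Longrightarrow> y \<in> carrier (presented S R) \<Longrightarrow> val R x = val R y \<longleftrightarrow> x = y"
  by (elim presented_memE) (simp add: cls_eq_iff)

lemma lin_on_cls_sum:
  assumes L: "lin_on (presented S R) L" and "finite A" "A \<subseteq> S"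
  shows "L (cls R (\<Sum>g\<in>A. fscale (c g) (gen g))) = (\<Sum>g\<in>A. fscale (c g) (L (cls R (gen g))))"
  using assms(2,3)
proof (induction A)
  case empty
  \<comment> \<open>The value at zero comes from homogeneity: zero is 0 times itself.\<close>
  have "cls R (0 :: 'a \<Rightarrow>\<^sub>0 'b) = 0 \<odot>\<^bsub>presented S R\<^esub> cls R 0" by (simp add: presented_smult)
  then have "L (cls R 0) = fscale 0 (L (cls R 0))"
    using lin_on_smult[OF L, of "cls R 0" 0] by (simp add: cls_in_presented)
  then show ?case by simp
next
  case (insert x F)
  have k: "Poly_Mapping.keys (\<Sum>g\<in>F. fscale (c g) (gen g)) \<subseteq> S"
    using insert by (intro keys_sum_subset keys_scale) auto
  have "cls R (\<Sum>g\<in>insert x F. fscale (c g) (gen g)) =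
    (c x \<odot>\<^bsub>presented S R\<^esub> cls R (gen x)) \<oplus>\<^bsub>presented S R\<^esub> cls R (\<Sum>g\<in>F. fscale (c g) (gen g))"
    using insert by (simp add: presented_smult presented_add)
  then show ?case using insert k
    by (simp add: lin_on_add[OF L] lin_on_smult[OF L] cls_in_presented cls_gen_in_presented
        closed_smult[OF closed_presented])
qed

lemma lin_on_cls:
  assumes "lin_on (presented S R) L" "Poly_Mapping.keys p \<subseteq> S"
  shows "L (cls R p) = lin_ext (\<lambda>g. L (cls R (gen g))) p"
  using lin_on_cls_sum[OF assms(1), of "Poly_Mapping.keys p" "Poly_Mapping.lookup p"] assms(2)
    lin_ext_gen_eq[of p] by (simp add: lin_ext_def)

lemma lin_on_eq:
  assumes "lin_on (presented S R) L" "lin_on (presented S R) L'"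
    "\<And>g. g \<in> S \<Longrightarrow> L (cls R (gen g)) = L' (cls R (gen g))" "x \<in> carrier (presented S R)"
  shows "L x = L' x"
proof -
  obtain p where p: "Poly_Mapping.keys p \<subseteq> S" "x = cls R p" using assms(4) by (rule presented_memE)
  have "lin_ext (\<lambda>g. L (cls R (gen g))) p = lin_ext (\<lambda>g. L' (cls R (gen g))) p"
    by (rule lin_ext_cong) (use p assms(3) in auto)
  then show ?thesis using p by (simp add: lin_on_cls[OF assms(1)] lin_on_cls[OF assms(2)])
qed

lemma linear_maps_eq:
  assumes "f \<in> linear_maps (presented S R) (presented S' R')" "g \<in> linear_maps (presented S R) (presented S' R')"
    "\<And>s. s \<in> S \<Longrightarrow> f (cls R (gen s)) = g (cls R (gen s))" "x \<in> carrier (presented S R)"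
  shows "f x = g x"
proof -
  have "val R' (f x) = val R' (g x)"
    by (rule lin_on_eq[where L="\<lambda>x. val R' (f x)" and L'="\<lambda>x. val R' (g x)", OF _ _ _ assms(4)])
       (auto intro: lin_on_comp[OF lin_on_val] assms simp: assms(3))
  then show ?thesis
    using val_inj linear_maps_mem[OF assms(1,4)] linear_maps_mem[OF assms(2,4)] by blast
qed

lemma linear_maps_presentedI:
  assumes "flin L" "\<And>p. Poly_Mapping.keys p \<subseteq> S \<Longrightarrow> F (cls R p) = cls R' (L p)"
    "\<And>p. Poly_Mapping.keys p \<subseteq> S \<Longrightarrow> Poly_Mapping.keys (L p) \<subseteq> S'"
  shows "F \<in> linear_maps (presented S R) (presented S' R')"
  using assms
  by (auto simp: linear_maps_def presented_carrier presented_add presented_smult keys_plus keys_scale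
      flin_add flin_scale)

lemma flin_bilin1: "flin (\<lambda>p. bilin_ext h p q)"
  unfolding bilin_ext_def by (rule flin_lin_ext)

lemma bilin_ext_swap: "bilin_ext h p q = lin_ext (\<lambda>b. lin_ext (\<lambda>a. h a b) p) q"
proof -
  have "bilin_ext h p q = (\<Sum>a\<in>Poly_Mapping.keys p. \<Sum>b\<in>Poly_Mapping.keys q.
      fscale (Poly_Mapping.lookup p a * Poly_Mapping.lookup q b) (h a b))"
    unfolding bilin_ext_def lin_ext_def by (simp only: free_vs.scale_sum_right free_vs.scale_scale)
  also have "\<dots> = (\<Sum>b\<in>Poly_Mapping.keys q. \<Sum>a\<in>Poly_Mapping.keys p.
      fscale (Poly_Mapping.lookup q b * Poly_Mapping.lookup p a) (h a b))"
    by (subst sum.swap) (simp only: mult.commute)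
  also have "\<dots> = lin_ext (\<lambda>b. lin_ext (\<lambda>a. h a b) p) q"
    unfolding lin_ext_def by (simp only: free_vs.scale_sum_right free_vs.scale_scale)
  finally show ?thesis .
qed

lemma flin_bilin2: "flin (bilin_ext h p)"
  unfolding bilin_ext_swap[abs_def] by (rule flin_lin_ext)

lemma bilin_ext_gen [simp]: "bilin_ext h (gen a) (gen b) = h a b"
  by (simp add: bilin_ext_def)

lemma induced_cls:
  assumes "\<And>r. r \<in> R \<Longrightarrow> nf R' (lin_ext h r) = 0"
  shows "induced R' h (cls R p) = cls R' (lin_ext h p)"
proof -
  have "cls R' (lin_ext h a) = cls R' (lin_ext h p)" if "a \<in> cls R p" for a
  proof -
    have "nf R' (lin_ext h a) = nf R' (lin_ext h p)"
      by (rule flin_nf_eq[of "\<lambda>x. nf R' (lin_ext h x)" R])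
        (use that assms in \<open>auto simp: mem_cls_iff intro: flin_compose flin_nf flin_lin_ext\<close>)
    then show ?thesis by (simp add: cls_eq_iff)
  qed
  with cls_self[of p R] show ?thesis unfolding induced_def by blast
qed

lemma induced_linear:
  assumes "\<And>r. r \<in> R \<Longrightarrow> nf R' (lin_ext h r) = 0" "\<And>g. g \<in> S \<Longrightarrow> Poly_Mapping.keys (h g) \<subseteq> S'"
  shows "induced R' h \<in> linear_maps (presented S R) (presented S' R')"
proof (rule linear_maps_presentedI[OF flin_lin_ext[of h]])
  fix p :: "'a \<Rightarrow>\<^sub>0 'b" assume p: "Poly_Mapping.keys p \<subseteq> S"
  show "induced R' h (cls R p) = cls R' (lin_ext h p)" by (rule induced_cls[OF assms(1)])
  show "Poly_Mapping.keys (lin_ext h p) \<subseteq> S'" using p assms(2) by (intro keys_lin_ext) blast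
qed

text \<open>Well-definedness of \<open>induced2\<close> is checked on a relation in one variable
  against a generator in the other. The conditions on keys are there because the union in
  \<open>induced2\<close> runs over all representatives, and each of them has to stay in the span of
  the generators.\<close>

locale bilinear_induced =
  fixes S1 :: "'a set" and R1 :: "('a \<Rightarrow>\<^sub>0 'k::field) set" and S2 :: "'b set" and R2 :: "('b \<Rightarrow>\<^sub>0 'k) set"
    and S' :: "'c set" and R' :: "('c \<Rightarrow>\<^sub>0 'k) set" and h :: "'a \<Rightarrow> 'b \<Rightarrow> ('c \<Rightarrow>\<^sub>0 'k)"
  assumes R1: "r \<in> R1 \<Longrightarrow> Poly_Mapping.keys r \<subseteq> S1" and R2: "r' \<in> R2 \<Longrightarrow> Poly_Mapping.keys r' \<subseteq> S2"
    and h1: "r \<in> R1 \<Longrightarrow> b \<in> S2 \<Longrightarrow> nf R' (lin_ext (\<lambda>a. h a b) r) = 0"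
    and h2: "r' \<in> R2 \<Longrightarrow> a \<in> S1 \<Longrightarrow> nf R' (lin_ext (h a) r') = 0"
    and hS: "a \<in> S1 \<Longrightarrow> b \<in> S2 \<Longrightarrow> Poly_Mapping.keys (h a b) \<subseteq> S'"
begin

lemma keys_rep:
  assumes "\<And>r. r \<in> R \<Longrightarrow> Poly_Mapping.keys r \<subseteq> S" "Poly_Mapping.keys p \<subseteq> S" "a \<in> cls R p"
  shows "Poly_Mapping.keys a \<subseteq> S"
proof -
  obtain r where r: "r \<in> free_vs.span R" "a = p + r" using assms(3) by (auto simp: cls_def)
  then show ?thesis using keys_span[OF r(1) assms(1)] assms(2) by (simp add: keys_plus)
qed

lemma induced2_cls:
  assumes p: "Poly_Mapping.keys p \<subseteq> S1" and q: "Poly_Mapping.keys q \<subseteq> S2"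
  shows "induced2 R' h (cls R1 p) (cls R2 q) = cls R' (bilin_ext h p q)"
proof -
  have "cls R' (bilin_ext h a b) = cls R' (bilin_ext h p q)" if a: "a \<in> cls R1 p" and b: "b \<in> cls R2 q" for a b
  proof -
    \<comment> \<open>The representatives are exchanged one at a time. While \<open>a\<close> is
      replaced by \<open>p\<close>, the other argument is the arbitrary representative
      \<open>b\<close>, and \<open>h1\<close> only speaks of generators from
      \<open>S2\<close>.\<close>
    have kb: "Poly_Mapping.keys b \<subseteq> S2" by (rule keys_rep[OF R2 q b])
    have "nf R' (bilin_ext h a b) = nf R' (bilin_ext h p b)"
    proof (rule flin_nf_eq[of "\<lambda>x. nf R' (bilin_ext h x b)" R1])
      show "flin (\<lambda>x. nf R' (bilin_ext h x b))" by (intro flin_compose[OF flin_nf] flin_bilin1)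
      fix r assume r: "r \<in> R1"
      have "nf R' (bilin_ext h r b) = lin_ext (\<lambda>g. nf R' (lin_ext (\<lambda>a. h a g) r)) b"
        by (simp add: bilin_ext_swap nf_lin_ext)
      also have "\<dots> = lin_ext (\<lambda>_. 0) b" by (rule lin_ext_cong) (use h1 r kb in auto)
      finally show "nf R' (bilin_ext h r b) = 0" by simp
    qed (use a in \<open>simp add: mem_cls_iff\<close>)
    also have "\<dots> = nf R' (bilin_ext h p q)"
    proof (rule flin_nf_eq[of "\<lambda>x. nf R' (bilin_ext h p x)" R2])
      show "flin (\<lambda>x. nf R' (bilin_ext h p x))" by (intro flin_compose[OF flin_nf] flin_bilin2)
      fix r assume r: "r \<in> R2"
      have "nf R' (bilin_ext h p r) = lin_ext (\<lambda>g. nf R' (lin_ext (h g) r)) p"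
        by (simp add: bilin_ext_def nf_lin_ext)
      also have "\<dots> = lin_ext (\<lambda>_. 0) p" by (rule lin_ext_cong) (use h2 r p in auto)
      finally show "nf R' (bilin_ext h p r) = 0" by simp
    qed (use b in \<open>simp add: mem_cls_iff\<close>)
    finally show ?thesis by (simp add: cls_eq_iff)
  qed
  with cls_self[of p R1] cls_self[of q R2] show ?thesis unfolding induced2_def by blast
qed

lemma keys_bilin: "Poly_Mapping.keys p \<subseteq> S1 \<Longrightarrow> Poly_Mapping.keys q \<subseteq> S2 \<Longrightarrow> Poly_Mapping.keys (bilin_ext h p q) \<subseteq> S'"
  unfolding bilin_ext_def by (intro keys_lin_ext) (use hS in blast)

lemma induced2_linear1:
  assumes "B \<in> carrier (presented S2 R2)"
  shows "(\<lambda>A. induced2 R' h A B) \<in> linear_maps (presented S1 R1) (presented S' R')"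
proof -
  obtain q where q: "Poly_Mapping.keys q \<subseteq> S2" "B = cls R2 q" using assms by (rule presented_memE)
  show ?thesis
    by (rule linear_maps_presentedI[OF flin_bilin1[of h q]]) (simp_all add: q induced2_cls keys_bilin)
qed

lemma induced2_linear2:
  assumes "A \<in> carrier (presented S1 R1)"
  shows "induced2 R' h A \<in> linear_maps (presented S2 R2) (presented S' R')"
proof -
  obtain q where q: "Poly_Mapping.keys q \<subseteq> S1" "A = cls R1 q" using assms by (rule presented_memE)
  show ?thesis
    by (rule linear_maps_presentedI[OF flin_bilin2[of h q]]) (simp_all add: q induced2_cls keys_bilin)
qed

end

section \<open>Relations of tensor products\<close>

lemma tensor_add1:
  "Y \<in> Ob A \<Longrightarrow> n \<in> carrier (At N Y) \<Longrightarrow> n' \<in> carrier (At N Y) \<Longrightarrow> m \<in> carrier (At M Y) \<Longrightarrow>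
   nf (tensor_rels A N M) (gen (Y, n \<oplus>\<^bsub>At N Y\<^esub> n', m)) =
   nf (tensor_rels A N M) (gen (Y, n, m)) + nf (tensor_rels A N M) (gen (Y, n', m))"
proof -
  assume "Y \<in> Ob A" "n \<in> carrier (At N Y)" "n' \<in> carrier (At N Y)" "m \<in> carrier (At M Y)"
  then have "gen (Y, n \<oplus>\<^bsub>At N Y\<^esub> n', m) - gen (Y, n, m) - gen (Y, n', m) \<in> tensor_rels A N M"
    unfolding tensor_rels_def
    by - (rule UnI1, rule UnI1, rule UnI1, rule UnI1, blast)
  from nf_rel[OF this] show ?thesis by (simp only: nf_diff) (simp add: algebra_simps)
qed

lemma tensor_add2:
  "Y \<in> Ob A \<Longrightarrow> n \<in> carrier (At N Y) \<Longrightarrow> m \<in> carrier (At M Y) \<Longrightarrow> m' \<in> carrier (At M Y) \<Longrightarrow>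
   nf (tensor_rels A N M) (gen (Y, n, m \<oplus>\<^bsub>At M Y\<^esub> m')) =
   nf (tensor_rels A N M) (gen (Y, n, m)) + nf (tensor_rels A N M) (gen (Y, n, m'))"
proof -
  assume "Y \<in> Ob A" "n \<in> carrier (At N Y)" "m \<in> carrier (At M Y)" "m' \<in> carrier (At M Y)"
  then have "gen (Y, n, m \<oplus>\<^bsub>At M Y\<^esub> m') - gen (Y, n, m) - gen (Y, n, m') \<in> tensor_rels A N M"
    unfolding tensor_rels_def
    by - (rule UnI1, rule UnI1, rule UnI1, rule UnI2, blast)
  from nf_rel[OF this] show ?thesis by (simp only: nf_diff) (simp add: algebra_simps)
qed

lemma tensor_smult1:
  "Y \<in> Ob A \<Longrightarrow> n \<in> carrier (At N Y) \<Longrightarrow> m \<in> carrier (At M Y) \<Longrightarrow>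
   nf (tensor_rels A N M) (gen (Y, c \<odot>\<^bsub>At N Y\<^esub> n, m)) = fscale c (nf (tensor_rels A N M) (gen (Y, n, m)))"
  unfolding nf_scale[symmetric] by (rule nf_rel_eq) (unfold tensor_rels_def, blast)

lemma tensor_smult2:
  "Y \<in> Ob A \<Longrightarrow> n \<in> carrier (At N Y) \<Longrightarrow> m \<in> carrier (At M Y) \<Longrightarrow>
   nf (tensor_rels A N M) (gen (Y, n, c \<odot>\<^bsub>At M Y\<^esub> m)) = fscale c (nf (tensor_rels A N M) (gen (Y, n, m)))"
  unfolding nf_scale[symmetric] by (rule nf_rel_eq) (unfold tensor_rels_def, blast)

lemma tensor_balanced:
  "Y \<in> Ob A \<Longrightarrow> Y' \<in> Ob A \<Longrightarrow> a \<in> carrier (Hom A Y Y') \<Longrightarrow> n \<in> carrier (At N Y') \<Longrightarrow> m \<in> carrier (At M Y) \<Longrightarrow>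
   nf (tensor_rels A N M) (gen (Y, Act N Y' Y a n, m)) = nf (tensor_rels A N M) (gen (Y', n, Act M Y Y' a m))"
  by (rule nf_rel_eq) (unfold tensor_rels_def, blast)

text \<open>The universal property of the tensor product, in the form needed for
  \<open>plift\<close>: the five families of relations correspond to additivity and homogeneity in
  either factor and to balancing.\<close>

lemma tensor_lift:
  assumes lin1: "\<And>Y m. Y \<in> Ob A \<Longrightarrow> m \<in> carrier (At M Y) \<Longrightarrow> lin_on (At N Y) (\<lambda>n. \<beta> (Y, n, m))"
    and lin2: "\<And>Y n. Y \<in> Ob A \<Longrightarrow> n \<in> carrier (At N Y) \<Longrightarrow> lin_on (At M Y) (\<lambda>m. \<beta> (Y, n, m))"
    and bal: "\<And>Y Y' a n m. Y \<in> Ob A \<Longrightarrow> Y' \<in> Ob A \<Longrightarrow> a \<in> carrier (Hom A Y Y') \<Longrightarrow>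
      n \<in> carrier (At N Y') \<Longrightarrow> m \<in> carrier (At M Y) \<Longrightarrow>
      \<beta> (Y, Act N Y' Y a n, m) = \<beta> (Y', n, Act M Y Y' a m)"
    and r: "r \<in> tensor_rels A N M"
  shows "lin_ext \<beta> r = 0"
  using r unfolding tensor_rels_def
  by (auto simp: lin_ext_diff lin_ext_add lin_ext_scale lin_on_add[OF lin1] lin_on_add[OF lin2]
      lin_on_smult[OF lin1] lin_on_smult[OF lin2] bal)

lemma lin_on_tensor1:
  "Y \<in> Ob A \<Longrightarrow> m \<in> carrier (At M Y) \<Longrightarrow> lin_on (At N Y) (\<lambda>n. nf (tensor_rels A N M) (gen (Y, n, m)))"
  by (rule lin_onI) (auto simp: tensor_add1 tensor_smult1)

lemma lin_on_tensor2:
  "Y \<in> Ob A \<Longrightarrow> n \<in> carrier (At N Y) \<Longrightarrow> lin_on (At M Y) (\<lambda>m. nf (tensor_rels A N M) (gen (Y, n, m)))"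
  by (rule lin_onI) (auto simp: tensor_add2 tensor_smult2)

lemma tensor_map1_rels:
  assumes "\<And>Y. Y \<in> Ob A \<Longrightarrow> h Y \<in> linear_maps (At L Y) (At N Y)"
    and "\<And>Y Y' a l. Y \<in> Ob A \<Longrightarrow> Y' \<in> Ob A \<Longrightarrow> a \<in> carrier (Hom A Y Y') \<Longrightarrow> l \<in> carrier (At L Y') \<Longrightarrow>
      h Y (Act L Y' Y a l) = Act N Y' Y a (h Y' l)"
    and M: "\<And>Y Y' a m. Y \<in> Ob A \<Longrightarrow> Y' \<in> Ob A \<Longrightarrow> a \<in> carrier (Hom A Y Y') \<Longrightarrow> m \<in> carrier (At M Y) \<Longrightarrow> Act M Y Y' a m \<in> carrier (At M Y')"
    and "r \<in> tensor_rels A L M"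
  shows "nf (tensor_rels A N M) (lin_ext (\<lambda>(Y, n, m). gen (Y, h Y n, m)) r) = 0"
  unfolding nf_lin_ext
  by (rule tensor_lift[OF _ _ _ assms(4)])
     (auto simp: assms(2) tensor_balanced M linear_maps_mem[OF assms(1)]
       intro: lin_on_comp[OF lin_on_tensor1 assms(1)] lin_on_tensor2)

lemma tensor_map2_rels:
  assumes "\<And>Y. Y \<in> Ob A \<Longrightarrow> h Y \<in> linear_maps (At L Y) (At M Y)"
    and "\<And>Y Y' a l. Y \<in> Ob A \<Longrightarrow> Y' \<in> Ob A \<Longrightarrow> a \<in> carrier (Hom A Y Y') \<Longrightarrow> l \<in> carrier (At L Y) \<Longrightarrow>
      h Y' (Act L Y Y' a l) = Act M Y Y' a (h Y l)"
    and N: "\<And>Y Y' a m. Y \<in> Ob A \<Longrightarrow> Y' \<in> Ob A \<Longrightarrow> a \<in> carrier (Hom A Y Y') \<Longrightarrow> m \<in> carrier (At N Y') \<Longrightarrow> Act N Y' Y a m \<in> carrier (At N Y)"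
    and "r \<in> tensor_rels A N L"
  shows "nf (tensor_rels A N M) (lin_ext (\<lambda>(Y, n, m). gen (Y, n, h Y m)) r) = 0"
  unfolding nf_lin_ext
  by (rule tensor_lift[OF _ _ _ assms(4)])
     (auto simp: assms(2) tensor_balanced N linear_maps_mem[OF assms(1)]
       intro: lin_on_comp[OF lin_on_tensor2 assms(1)] lin_on_tensor1)

subsection \<open>Wreath products\<close>

abbreviation pinv :: "(nat \<Rightarrow> nat) \<Rightarrow> nat \<Rightarrow> nat" where "pinv \<equiv> inv_into UNIV"

text \<open>The pair \<open>{2i - 1, 2i}\<close> containing \<open>x\<close>; the junk point \<open>0\<close> forms a pair \<open>0\<close> of its own.\<close>

definition pr :: "nat \<Rightarrow> nat" where "pr x = (x + 1) div 2"

definition flip :: "nat \<Rightarrow> nat \<Rightarrow> nat" where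
  "flip k = Transposition.transpose (2 * k - 1) (2 * k)"

definition pswap :: "nat \<Rightarrow> nat \<Rightarrow> nat" where
  "pswap k = Transposition.transpose (2 * k - 1) (2 * k + 1) \<circ> Transposition.transpose (2 * k) (2 * k + 2)"

lemma pr_eq_iff: "i \<ge> 1 \<Longrightarrow> pr x = i \<longleftrightarrow> x = 2 * i - 1 \<or> x = 2 * i"
  by (auto simp: pr_def)

lemma pr_double [simp]: "pr (2 * i) = i"
  by (simp add: pr_def)

lemma pr_same: "pr x = pr y \<Longrightarrow> pr z = pr x \<Longrightarrow> x \<noteq> y \<Longrightarrow> z = x \<or> z = y"
  by (auto simp: pr_def)

lemma pr_partner: assumes "1 \<le> x" obtains z where "pr z = pr x" "z \<noteq> x"
proof (cases "even x")
  case True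
  then have "pr (x - 1) = pr x" "x - 1 \<noteq> x" using assms by (auto simp: pr_def elim!: evenE)
  then show ?thesis by (rule that)
next
  case False
  then have "pr (x + 1) = pr x" "x + 1 \<noteq> x" using assms by (auto simp: pr_def elim!: oddE)
  then show ?thesis by (rule that)
qed

lemma pr_range: "x \<in> {1..2 * t} \<longleftrightarrow> pr x \<in> {1..t}"
  by (auto simp: pr_def)

lemma wreath_permutes: "\<sigma> \<in> wreath t \<Longrightarrow> \<sigma> permutes {1..2 * t}"
  by (simp add: wreath_def)

text \<open>A fibre of \<open>pr\<close> lies inside {1..2t} or outside of it, and outside the
  permutation is the identity. Hence preservation of pairs can be required for all numbers, without
  any range condition.\<close>

lemma wreath_iff:
  "\<sigma> \<in> wreath t \<longleftrightarrow> \<sigma> permutes {1..2 * t} \<and> (\<forall>x y. pr x = pr y \<longrightarrow> pr (\<sigma> x) = pr (\<sigma> y))"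
proof (intro iffI conjI allI impI)
  assume w: "\<sigma> \<in> wreath t"
  then show p: "\<sigma> permutes {1..2 * t}" by (rule wreath_permutes)
  fix x y assume xy: "pr x = pr y"
  show "pr (\<sigma> x) = pr (\<sigma> y)"
  proof (cases "x \<in> {1..2 * t}")
    case True
    define i where "i = pr x"
    have i: "i \<in> {1..t}" using True by (simp only: pr_range i_def)
    then obtain j where j: "j \<in> {1..t}" "\<sigma> ` {2 * i - 1, 2 * i} = {2 * j - 1, 2 * j}"
      using w unfolding wreath_def by blast
    have "x \<in> {2 * i - 1, 2 * i}" "y \<in> {2 * i - 1, 2 * i}"
      using i xy pr_eq_iff[of i x] pr_eq_iff[of i y] by (auto simp: i_def)
    then have "\<sigma> x \<in> {2 * j - 1, 2 * j}" "\<sigma> y \<in> {2 * j - 1, 2 * j}" using j(2) by blast+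
    then have "pr (\<sigma> x) = j" "pr (\<sigma> y) = j" using j(1) pr_eq_iff[of j] by auto
    then show ?thesis by simp
  next
    case False
    moreover from this have "y \<notin> {1..2 * t}" using xy unfolding pr_range by metis
    ultimately have "\<sigma> x = x" "\<sigma> y = y" using permutes_not_in[OF p] by blast+
    then show ?thesis using xy by simp
  qed
next
  assume a: "\<sigma> permutes {1..2 * t} \<and> (\<forall>x y. pr x = pr y \<longrightarrow> pr (\<sigma> x) = pr (\<sigma> y))"
  show "\<sigma> \<in> wreath t" unfolding wreath_def
  proof (intro CollectI conjI ballI)
    show p: "\<sigma> permutes {1..2 * t}" using a by blast
    fix i assume i: "i \<in> {1..t}"
    define j where "j = pr (\<sigma> (2 * i))"
    have "2 * i \<in> {1..2 * t}" using i by auto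
    then have "\<sigma> (2 * i) \<in> {1..2 * t}" unfolding permutes_in_image[OF p] .
    then have j: "j \<in> {1..t}" by (simp only: pr_range j_def)
    have "pr (2 * i - 1) = pr (2 * i)" using i by (auto simp: pr_def)
    then have "pr (\<sigma> (2 * i - 1)) = j" using a by (auto simp: j_def)
    moreover have "2 * i - 1 \<noteq> 2 * i" using i by (cases i) auto
    then have "\<sigma> (2 * i - 1) \<noteq> \<sigma> (2 * i)" by (simp only: inj_eq[OF permutes_inj[OF p]] not_False_eq_True)
    ultimately have "\<sigma> ` {2 * i - 1, 2 * i} = {2 * j - 1, 2 * j}"
      using j pr_eq_iff[of j "\<sigma> (2 * i - 1)"] pr_eq_iff[of j "\<sigma> (2 * i)"] by (auto simp: j_def)
    then show "\<exists>j\<in>{1..t}. \<sigma> ` {2 * i - 1, 2 * i} = {2 * j - 1, 2 * j}" using j by blast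
  qed
qed

lemma wreath_pr: "\<sigma> \<in> wreath t \<Longrightarrow> pr x = pr y \<Longrightarrow> pr (\<sigma> x) = pr (\<sigma> y)"
  unfolding wreath_iff by blast

lemma wreathI: "\<sigma> permutes {1..2 * t} \<Longrightarrow> (\<And>x y. pr x = pr y \<Longrightarrow> pr (\<sigma> x) = pr (\<sigma> y)) \<Longrightarrow> \<sigma> \<in> wreath t"
  unfolding wreath_iff by blast

lemma wreath_id: "id \<in> wreath t" by (rule wreathI) (simp_all add: permutes_id)

lemma wreath_comp: "\<sigma> \<in> wreath t \<Longrightarrow> \<tau> \<in> wreath t \<Longrightarrow> \<sigma> \<circ> \<tau> \<in> wreath t"
  by (rule wreathI) (blast intro: permutes_compose wreath_permutes, simp only: comp_apply, blast intro: wreath_pr)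

text \<open>Two-element pairs make one direction enough: the partner of
  \<open>pinv \<sigma> x\<close> is sent into the pair of x, to a point other than x, and this can
  only be y.\<close>

lemma wreath_inv: assumes "\<sigma> \<in> wreath t" shows "pinv \<sigma> \<in> wreath t"
  unfolding wreath_iff
proof (intro conjI allI impI)
  have p: "\<sigma> permutes {1..2 * t}" using assms by (rule wreath_permutes)
  then show pi: "pinv \<sigma> permutes {1..2 * t}" by (rule permutes_inv)
  fix x y assume xy: "pr x = pr y"
  show "pr (pinv \<sigma> x) = pr (pinv \<sigma> y)"
  proof (cases "x = y \<or> x = 0")
    case True
    then have "x = y" using xy by (auto simp: pr_def)
    then show ?thesis by simp
  next
    case False
    have "pinv \<sigma> x \<noteq> pinv \<sigma> 0" using False pi by (metis permutes_inj inj_eq)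
    moreover have "pinv \<sigma> 0 = 0" using pi by (simp add: permutes_not_in)
    ultimately have "1 \<le> pinv \<sigma> x" by simp
    then obtain z where z: "pr z = pr (pinv \<sigma> x)" "z \<noteq> pinv \<sigma> x" by (rule pr_partner)
    have s: "\<sigma> (pinv \<sigma> w) = w" for w using p by (rule permutes_inverses)
    have "pr (\<sigma> z) = pr x" using wreath_pr[OF assms z(1)] by (simp add: s)
    moreover have "\<sigma> z \<noteq> x" using z(2) p by (metis permutes_inverses(2))
    ultimately have "\<sigma> z = y" using pr_same[OF xy] False by blast
    then have "pinv \<sigma> y = z" using p by (metis permutes_inverses(2))
    then show ?thesis using z by simp
  qed
qed

lemma pr_flip: "1 \<le> k \<Longrightarrow> pr (flip k x) = pr x"
  by (auto simp: flip_def Transposition.transpose_def pr_def)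

lemma pr_pswap: "1 \<le> k \<Longrightarrow> pr (pswap k x) = Transposition.transpose k (Suc k) (pr x)"
  by (auto simp: pswap_def Transposition.transpose_def pr_def)

lemma flip_wreath: "1 \<le> k \<Longrightarrow> k \<le> t \<Longrightarrow> flip k \<in> wreath t"
  by (rule wreathI) (auto simp: pr_flip, auto simp: flip_def intro!: permutes_swap_id)

lemma pswap_wreath: "1 \<le> k \<Longrightarrow> k < t \<Longrightarrow> pswap k \<in> wreath t"
  by (rule wreathI) (auto simp: pr_pswap, auto simp: pswap_def intro!: permutes_swap_id permutes_compose)

lemma flip_flip: "flip k \<circ> flip k = id" by (simp add: flip_def)

lemma pswap_apply: "1 \<le> k \<Longrightarrow> pswap k x =
  (if pr x = k then x + 2 else if pr x = Suc k then x - 2 else x)"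
  by (auto simp: pswap_def Transposition.transpose_def pr_def)

lemma flip_apply: "1 \<le> k \<Longrightarrow> flip k x = (if x = 2 * k - 1 then 2 * k else if x = 2 * k then 2 * k - 1 else x)"
  by (auto simp: flip_def Transposition.transpose_def)

lemma pswap_pswap: "1 \<le> k \<Longrightarrow> pswap k \<circ> pswap k = id"
  by (auto simp: fun_eq_iff pswap_apply pr_def)

text \<open>
  The wreath product is generated by the flips of a pair and the exchanges of neighbouring pairs, so
  that compatibility with a character only has to be checked on these.
\<close>

inductive_set wgen :: "nat \<Rightarrow> (nat \<Rightarrow> nat) set" for t where
  wgen_id: "id \<in> wgen t"
| wgen_flip: "\<sigma> \<in> wgen t \<Longrightarrow> 1 \<le> k \<Longrightarrow> k \<le> t \<Longrightarrow> \<sigma> \<circ> flip k \<in> wgen t"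
| wgen_pswap: "\<sigma> \<in> wgen t \<Longrightarrow> 1 \<le> k \<Longrightarrow> k < t \<Longrightarrow> \<sigma> \<circ> pswap k \<in> wgen t"

lemma wgen_comp: "\<tau> \<in> wgen t \<Longrightarrow> \<sigma> \<in> wgen t \<Longrightarrow> \<sigma> \<circ> \<tau> \<in> wgen t"
  by (induction rule: wgen.induct) (simp_all add: o_assoc wgen.intros)

lemma wgen_wreath: "\<sigma> \<in> wgen t \<Longrightarrow> \<sigma> \<in> wreath t"
  by (induction rule: wgen.induct) (blast intro: wreath_comp wreath_id flip_wreath pswap_wreath)+

lemma wgen_mono: "\<sigma> \<in> wgen t \<Longrightarrow> \<sigma> \<in> wgen (Suc t)"
proof (induction rule: wgen.induct)
  case (wgen_flip \<sigma> k)
  show ?case by (rule wgen.wgen_flip) (use wgen_flip in simp_all)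
next
  case (wgen_pswap \<sigma> k)
  show ?case by (rule wgen.wgen_pswap) (use wgen_pswap in simp_all)
qed (rule wgen_id)

lemma wgen_left_inverse: "\<sigma> \<in> wgen t \<Longrightarrow> \<exists>\<tau>\<in>wgen t. \<sigma> \<circ> \<tau> = id"
proof (induction rule: wgen.induct)
  case wgen_id
  show ?case by (rule bexI[of _ id]) (simp_all add: wgen.wgen_id del: id_apply)
next
  case (wgen_flip \<sigma> k)
  then obtain \<tau> where t: "\<tau> \<in> wgen t" "\<sigma> \<circ> \<tau> = id" by blast
  have "flip k \<circ> \<tau> \<in> wgen t"
    using wgen_comp[OF t(1) wgen.wgen_flip[OF wgen.wgen_id]] wgen_flip by simp
  moreover have "(\<sigma> \<circ> flip k) \<circ> (flip k \<circ> \<tau>) = id"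
    using t(2) flip_flip[of k] by (metis comp_assoc comp_id)
  ultimately show ?case by blast
next
  case (wgen_pswap \<sigma> k)
  then obtain \<tau> where t: "\<tau> \<in> wgen t" "\<sigma> \<circ> \<tau> = id" by blast
  have "pswap k \<circ> \<tau> \<in> wgen t"
    using wgen_comp[OF t(1) wgen.wgen_pswap[OF wgen.wgen_id]] wgen_pswap by simp
  moreover have "(\<sigma> \<circ> pswap k) \<circ> (pswap k \<circ> \<tau>) = id"
    using t(2) pswap_pswap[OF wgen_pswap(2)] by (metis comp_assoc comp_id)
  ultimately show ?case by blast
qed

text \<open>The exchange \<open>pswap k\<close> with k = pr x moves x + 2 to x. So x is reached from
  a point of the last pair by repeated exchanges, and within the last pair a flip suffices.\<close>

lemma wgen_transitive: "1 \<le> x \<Longrightarrow> x \<le> 2 * t \<Longrightarrow> \<exists>c\<in>wgen t. c (2 * t) = x"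
proof (induction "2 * t - x" arbitrary: x rule: less_induct)
  case less
  show ?case
  proof (cases "pr x = t")
    case True
    have t: "1 \<le> t" using less.prems by simp
    have "x = 2 * t \<or> x = 2 * t - 1" using True pr_eq_iff[OF t] by blast
    then show ?thesis
    proof
      assume "x = 2 * t" then show ?thesis by (intro bexI[OF _ wgen_id]) simp
    next
      assume x: "x = 2 * t - 1"
      have "id \<circ> flip t \<in> wgen t" by (rule wgen_flip[OF wgen_id t]) simp
      moreover have "(id \<circ> flip t) (2 * t) = x" using x t by (simp add: flip_apply)
      ultimately show ?thesis by blast
    qed
  next
    case False
    define k where "k = pr x"
    have k: "1 \<le> k" "k < t" using less.prems False by (auto simp: k_def pr_def)
    have x2: "x + 2 \<le> 2 * t" using k by (auto simp: k_def pr_def)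
    have lt: "2 * t - (x + 2) < 2 * t - x" using x2 by simp
    obtain c where c: "c \<in> wgen t" "c (2 * t) = x + 2" using less.hyps[OF lt _ x2] by auto
    have "(id \<circ> pswap k) \<circ> c \<in> wgen t" by (intro wgen_comp c wgen_pswap wgen_id k)
    moreover have "((id \<circ> pswap k) \<circ> c) (2 * t) = x"
      using c k by (simp add: pswap_apply) (simp add: k_def pr_def)
    ultimately show ?thesis by blast
  qed
qed

text \<open>A fixed point forces its partner to be fixed, so the whole last pair stays in
  place.\<close>

lemma wreath_fix_last:
  assumes "\<sigma> \<in> wreath (Suc t)" "\<sigma> (2 * Suc t) = 2 * Suc t"
  shows "\<sigma> \<in> wreath t"
proof -
  have p: "\<sigma> permutes {1..2 * Suc t}" by (rule wreath_permutes[OF assms(1)])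
  have "pr (\<sigma> (2 * t + 1)) = pr (\<sigma> (2 * Suc t))"
    by (rule wreath_pr[OF assms(1)]) (simp add: pr_def)
  then have "\<sigma> (2 * t + 1) = 2 * t + 1 \<or> \<sigma> (2 * t + 1) = \<sigma> (2 * Suc t)"
    using assms(2) by (auto simp: pr_def)
  then have f: "\<sigma> (2 * t + 1) = 2 * t + 1" using permutes_inj[OF p] by (auto simp: inj_eq)
  have "\<sigma> permutes {1..2 * t}"
  proof (rule permutes_superset[OF p])
    fix x assume "x \<in> {1..2 * Suc t} - {1..2 * t}"
    then have "x = 2 * t + 1 \<or> x = 2 * Suc t" by auto
    then show "\<sigma> x = x" using f assms(2) by auto
  qed
  then show ?thesis by (rule wreathI) (rule wreath_pr[OF assms(1)])
qed

text \<open>The usual stabiliser argument: by \<open>wgen_transitive\<close> a product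
  \<open>c\<close> of generators can be chosen such that \<sigma> composed with \<open>c\<close>
  fixes the last point, and then \<sigma> composed with \<open>c\<close> belongs to the group on one
  pair less.\<close>

lemma wreath_wgen: "\<sigma> \<in> wreath t \<Longrightarrow> \<sigma> \<in> wgen t"
proof (induction t arbitrary: \<sigma>)
  case 0
  then have "\<sigma> permutes {}" using wreath_permutes[of \<sigma> 0] by simp
  then have "\<sigma> = id" by (simp only: permutes_empty)
  then show ?case using wgen_id[of 0] by (simp only:)
next
  case (Suc t)
  have p: "\<sigma> permutes {1..2 * Suc t}" by (rule wreath_permutes[OF Suc.prems])
  define x where "x = pinv \<sigma> (2 * Suc t)"
  have "x \<in> {1..2 * Suc t}" unfolding x_def permutes_in_image[OF permutes_inv[OF p]] by simp
  then obtain c where c: "c \<in> wgen (Suc t)" "c (2 * Suc t) = x"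
    using wgen_transitive[of x "Suc t"] by auto
  have "\<sigma> \<circ> c \<in> wreath (Suc t)" by (intro wreath_comp Suc.prems wgen_wreath c)
  moreover have "(\<sigma> \<circ> c) (2 * Suc t) = 2 * Suc t"
    using c(2) permutes_inverses(1)[OF p] by (simp add: x_def)
  ultimately have "\<sigma> \<circ> c \<in> wreath t" by (rule wreath_fix_last)
  then have 1: "\<sigma> \<circ> c \<in> wgen (Suc t)" by (rule wgen_mono[OF Suc.IH])
  obtain d where d: "d \<in> wgen (Suc t)" "c \<circ> d = id" using wgen_left_inverse[OF c(1)] by blast
  have "\<sigma> = (\<sigma> \<circ> c) \<circ> d" unfolding comp_assoc d(2) by simp
  then show ?case using wgen_comp[OF d(1) 1] by (simp only:)
qed

lemma wreath_induct [consumes 1, case_names id flip pswap]: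
  assumes "\<sigma> \<in> wreath t" "P id"
    "\<And>\<sigma> k. \<sigma> \<in> wreath t \<Longrightarrow> P \<sigma> \<Longrightarrow> 1 \<le> k \<Longrightarrow> k \<le> t \<Longrightarrow> P (\<sigma> \<circ> flip k)"
    "\<And>\<sigma> k. \<sigma> \<in> wreath t \<Longrightarrow> P \<sigma> \<Longrightarrow> 1 \<le> k \<Longrightarrow> k < t \<Longrightarrow> P (\<sigma> \<circ> pswap k)"
  shows "P \<sigma>"
  using wreath_wgen[OF assms(1)]
  by (induction rule: wgen.induct) (blast intro: assms(2-) wgen_wreath)+

lemma twist_mult: "twist e (a * b) = twist e a * twist e b" by (cases e) auto

lemma twist_one [simp]: "twist e 1 = 1" by (cases e) auto

lemma on_pairs_pr: "on_pairs \<sigma> i = pr (\<sigma> (2 * i))" by (simp add: on_pairs_def pr_def)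

lemma on_pairs_id: "on_pairs id = id" by (simp add: on_pairs_pr fun_eq_iff)

lemma on_pairs_comp: "\<sigma> \<in> wreath t \<Longrightarrow> on_pairs (\<sigma> \<circ> \<tau>) = on_pairs \<sigma> \<circ> on_pairs \<tau>"
  unfolding fun_eq_iff on_pairs_pr comp_apply by (metis wreath_pr pr_double)

lemma on_pairs_flip: "1 \<le> k \<Longrightarrow> on_pairs (flip k) = id"
  by (simp add: fun_eq_iff on_pairs_pr pr_flip)

lemma on_pairs_pswap: "1 \<le> k \<Longrightarrow> on_pairs (pswap k) = Transposition.transpose k (Suc k)"
  by (simp add: fun_eq_iff on_pairs_pr pr_pswap)

text \<open>Multiplicativity of \<open>sign\<close> is available for finitely supported
  permutations, so this prepares \<open>character_comp\<close>.\<close>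

lemma permutation_on_pairs: "\<sigma> \<in> wreath t \<Longrightarrow> permutation (on_pairs \<sigma>)"
proof (induction rule: wreath_induct)
  case id
  show ?case unfolding on_pairs_id by (rule permutation_id)
next
  case (flip \<sigma> k)
  show ?case unfolding on_pairs_comp[OF flip(1)] on_pairs_flip[OF flip(2)] comp_id by (rule flip(4))
next
  case (pswap \<sigma> k)
  show ?case unfolding on_pairs_comp[OF pswap(1)] on_pairs_pswap[OF pswap(2)]
    by (intro permutation_compose pswap(4) permutation_swap_id)
qed

lemma wreath_permutation: "\<sigma> \<in> wreath t \<Longrightarrow> permutation \<sigma>"
  using wreath_permutes permutation_permutes by blast

lemma character_comp: "\<sigma> \<in> wreath t \<Longrightarrow> \<tau> \<in> wreath t \<Longrightarrow>
  character p (\<sigma> \<circ> \<tau>) = character p \<sigma> * character p \<tau>"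
  unfolding character_def on_pairs_comp
  by (simp only: sign_compose wreath_permutation permutation_on_pairs twist_mult mult.assoc mult.left_commute)

lemma character_id [simp]: "character p id = 1"
  by (simp add: character_def on_pairs_id)

lemma character_flip: "1 \<le> k \<Longrightarrow> character p (flip k) = twist (fst p) (-1)"
proof -
  assume k: "1 \<le> k"
  then have "2 * k - 1 \<noteq> 2 * k" by (cases k) auto
  then show ?thesis using k unfolding character_def on_pairs_flip[OF k] unfolding flip_def sign_swap_id by simp
qed

text \<open>An exchange of two pairs is a product of two transpositions, hence even, and only the
  second polarity sees it. A flip, in turn, is odd and trivial on pairs, so only the first polarity
  sees it.\<close>

lemma character_pswap: "1 \<le> k \<Longrightarrow> character p (pswap k) = twist (snd p) (-1)"
proof -
  assume k: "1 \<le> k"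
  then have "2 * k - 1 \<noteq> 2 * k + 1" by (cases k) auto
  then have "sign (pswap k) = 1"
    unfolding pswap_def by (simp add: sign_compose permutation_swap_id sign_swap_id)
  then show ?thesis unfolding character_def on_pairs_pswap[OF k] sign_swap_id by simp
qed

lemma character_square: "character p \<sigma> * character p \<sigma> = 1"
  by (cases "fst p"; cases "snd p") (auto simp: character_def algebra_simps)

lemma character_inv: "\<sigma> \<in> wreath t \<Longrightarrow> character p (pinv \<sigma>) = character p \<sigma>"
proof -
  assume s: "\<sigma> \<in> wreath t"
  have "character p \<sigma> * character p (pinv \<sigma>) = character p (\<sigma> \<circ> pinv \<sigma>)"
    by (simp add: character_comp[OF s wreath_inv[OF s]])
  also have "\<sigma> \<circ> pinv \<sigma> = id" using wreath_permutes[OF s] by (rule permutes_inv_o)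
  finally have "character p \<sigma> * (character p \<sigma> * character p (pinv \<sigma>)) = character p \<sigma>"
    by (simp only: character_id mult_1_right)
  then show ?thesis by (simp only: mult.assoc[symmetric] character_square mult_1_left)
qed

text \<open>\<open>act\<close> is a right action and \<open>F\<close> stands for multiplication by a
  sign in the target of \<open>h\<close>. With the group generated by flips and exchanges,
  equivariance under these spreads to the whole group.\<close>

lemma wreath_character_induct:
  fixes h :: "'a \<Rightarrow> 'b" and F :: "int \<Rightarrow> 'b \<Rightarrow> 'b"
  assumes "\<sigma> \<in> wreath t" "f \<in> S"
    and S: "\<And>f \<sigma>. f \<in> S \<Longrightarrow> \<sigma> \<in> wreath t \<Longrightarrow> act f \<sigma> \<in> S"
    and act: "act f id = f" "\<And>\<sigma> \<tau>. act f (\<sigma> \<circ> \<tau>) = act (act f \<sigma>) \<tau>"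
    and F: "\<And>x. F 1 x = x" "\<And>a b x. F a (F b x) = F (a * b) x"
    and flip: "\<And>f k. f \<in> S \<Longrightarrow> 1 \<le> k \<Longrightarrow> k \<le> t \<Longrightarrow> h (act f (flip k)) = F (twist (fst p) (-1)) (h f)"
    and pswap: "\<And>f k. f \<in> S \<Longrightarrow> 1 \<le> k \<Longrightarrow> k < t \<Longrightarrow> h (act f (pswap k)) = F (twist (snd p) (-1)) (h f)"
  shows "h (act f \<sigma>) = F (character p \<sigma>) (h f)"
  using assms(1)
proof (induction rule: wreath_induct)
  case id
  show ?case by (simp only: act character_id F)
next
  case (flip \<sigma> k)
  show ?case
    unfolding act(2) assms(8)[OF S[OF \<open>f \<in> S\<close> flip(1)] flip(2,3)] flip(4) F
      character_comp[OF flip(1) flip_wreath[OF flip(2,3)]] character_flip[OF flip(2)]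
    by (simp only: mult.commute)
next
  case (pswap \<sigma> k)
  show ?case
    unfolding act(2) assms(9)[OF S[OF \<open>f \<in> S\<close> pswap(1)] pswap(2,3)] pswap(4) F
      character_comp[OF pswap(1) pswap_wreath[OF pswap(2,3)]] character_pswap[OF pswap(2)]
    by (simp only: mult.commute)
qed

subsection \<open>Brauer diagrams\<close>

lemma wreath_mono: "\<sigma> \<in> wreath s \<Longrightarrow> s \<le> t \<Longrightarrow> \<sigma> \<in> wreath t"
  by (rule wreathI, rule permutes_subset[OF wreath_permutes]) (auto, metis wreath_pr)

lemma Inl_Plus_iff [simp]: "Inl x \<in> A <+> B \<longleftrightarrow> x \<in> A"
  and Inr_Plus_iff [simp]: "Inr y \<in> A <+> B \<longleftrightarrow> y \<in> B"
  by (auto simp: Plus_def)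

lemma D_Inl: "f \<in> D X Y \<Longrightarrow> x \<in> X \<Longrightarrow> f (Inl x) \<in> Y"
  unfolding D_def by (auto dest: bij_betwE)

lemma D_Inr: "f \<in> D X Y \<Longrightarrow> 1 \<le> i \<Longrightarrow> i \<le> 2 * pairs_of X Y \<Longrightarrow> f (Inr i) \<in> Y"
  unfolding D_def by (auto dest: bij_betwE)

lemma D_inj: "f \<in> D X Y \<Longrightarrow> inj_on f (X <+> {1..2 * pairs_of X Y})"
  unfolding D_def by (auto simp: bij_betw_def)

lemma D_image: "f \<in> D X Y \<Longrightarrow> f ` (X <+> {1..2 * pairs_of X Y}) = Y"
  unfolding D_def by (auto simp: bij_betw_def)

lemma D_ext: "f \<in> D X Y \<Longrightarrow> f \<in> extensional (X <+> {1..2 * pairs_of X Y})"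
  unfolding D_def by auto

lemma D_Inl_inj: "f \<in> D X Y \<Longrightarrow> x \<in> X \<Longrightarrow> y \<in> X \<Longrightarrow> f (Inl x) = f (Inl y) \<longleftrightarrow> x = y"
  using D_inj[of f X Y] by (auto simp: inj_on_def)

lemma D_Inr_inj: "f \<in> D X Y \<Longrightarrow> 1 \<le> i \<Longrightarrow> i \<le> 2 * pairs_of X Y \<Longrightarrow> 1 \<le> j \<Longrightarrow> j \<le> 2 * pairs_of X Y \<Longrightarrow>
  f (Inr i) = f (Inr j) \<longleftrightarrow> i = j"
  using inj_onD[OF D_inj[of f X Y], of "Inr i" "Inr j"] by auto

lemma D_Inl_Inr: "f \<in> D X Y \<Longrightarrow> x \<in> X \<Longrightarrow> 1 \<le> j \<Longrightarrow> j \<le> 2 * pairs_of X Y \<Longrightarrow> f (Inl x) \<noteq> f (Inr j)"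
  using inj_onD[OF D_inj[of f X Y], of "Inl x" "Inr j"] by auto

lemma D_surjE:
  assumes "f \<in> D X Y" "y \<in> Y"
  obtains (Inl) x where "x \<in> X" "y = f (Inl x)"
  | (Inr) i where "1 \<le> i" "i \<le> 2 * pairs_of X Y" "y = f (Inr i)"
proof -
  obtain z where z: "z \<in> X <+> {1..2 * pairs_of X Y}" "y = f z"
    using D_image[OF assms(1)] assms(2) by blast
  then show ?thesis using that by (cases z) auto
qed

lemma D_card:
  assumes "f \<in> D X Y" "finite X"
  shows "card Y = card X + 2 * pairs_of X Y"
proof -
  have "card (X <+> {1..2 * pairs_of X Y}) = card Y"
    using assms(1) unfolding D_def by (auto intro: bij_betw_same_card)
  then show ?thesis using assms(2) by (simp add: card_Plus)
qed

lemma D_finite: "f \<in> D X Y \<Longrightarrow> finite X \<Longrightarrow> finite Y"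
  using D_image[of f X Y] by (metis finite_Plus finite_atLeastAtMost finite_imageI)

lemma pairs_of_eq: "card Y = card X + 2 * t \<Longrightarrow> pairs_of X Y = t"
  by (simp add: pairs_of_def)

text \<open>Surjectivity follows from injectivity by counting, so that it need not be proved for
  each new diagram.\<close>

lemma DI:
  assumes "finite X" "card Y = card X + 2 * t" "f \<in> extensional (X <+> {1..2 * t})"
    "inj_on f (X <+> {1..2 * t})" "f ` (X <+> {1..2 * t}) \<subseteq> Y" "finite Y"
  shows "f \<in> D X Y"
proof -
  have "card (f ` (X <+> {1..2 * t})) = card Y"
    using assms by (simp add: card_image card_Plus)
  then have "f ` (X <+> {1..2 * t}) = Y" using assms by (intro card_subset_eq) auto
  then show ?thesis using assms pairs_of_eq[OF assms(2)] by (simp add: D_def bij_betw_def)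
qed

lemma D_eqI:
  assumes "f \<in> D X Y" "g \<in> D X Y" "\<And>x. x \<in> X \<Longrightarrow> f (Inl x) = g (Inl x)"
    "\<And>i. 1 \<le> i \<Longrightarrow> i \<le> 2 * pairs_of X Y \<Longrightarrow> f (Inr i) = g (Inr i)"
  shows "f = g"
  by (rule extensionalityI[OF D_ext[OF assms(1)] D_ext[OF assms(2)]]) (auto simp: Plus_def assms)

lemma pairs_of_add:
  assumes "f \<in> D X Y" "g \<in> D Y Z" "finite X"
  shows "pairs_of X Z = pairs_of X Y + pairs_of Y Z"
  using D_card[OF assms(1,3)] D_card[OF assms(2) D_finite[OF assms(1,3)]]
  by (intro pairs_of_eq) simp

lemma D_comp_Inl: "x \<in> X \<Longrightarrow> D_comp X Y Z g f (Inl x) = g (Inl (f (Inl x)))"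
  by (simp add: D_comp_def Let_def)

lemma D_comp_Inr1: "1 \<le> i \<Longrightarrow> i \<le> 2 * pairs_of X Y \<Longrightarrow> D_comp X Y Z g f (Inr i) = g (Inl (f (Inr i)))"
  by (simp add: D_comp_def Let_def)

lemma D_comp_Inr2: "2 * pairs_of X Y < i \<Longrightarrow> i \<le> 2 * (pairs_of X Y + pairs_of Y Z) \<Longrightarrow>
  D_comp X Y Z g f (Inr i) = g (Inr (i - 2 * pairs_of X Y))"
  by (simp add: D_comp_def Let_def)

lemma D_comp_in_D:
  assumes f: "f \<in> D X Y" and g: "g \<in> D Y Z" and X: "finite X"
  shows "D_comp X Y Z g f \<in> D X Z"
proof (rule DI[OF X])
  let ?s = "pairs_of X Y" and ?t = "pairs_of Y Z"
  have Y: "finite Y" by (rule D_finite[OF f X])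
  show "card Z = card X + 2 * (?s + ?t)" using D_card[OF f X] D_card[OF g Y] by simp
  show "D_comp X Y Z g f \<in> extensional (X <+> {1..2 * (?s + ?t)})"
    by (simp add: D_comp_def Let_def)
  show "finite Z" by (rule D_finite[OF g Y])
  \<comment> \<open>The composite is \<open>g\<close> after this reindexing, which feeds the values
    of \<open>f\<close> to the left summand and shifts the remaining labels down to those of
    \<open>g\<close>. Injectivity then splits into that of \<open>?k\<close> and of
    \<open>g\<close>.\<close>
  let ?k = "\<lambda>z. case z of Inl x \<Rightarrow> Inl (f (Inl x)) | Inr i \<Rightarrow> if i \<le> 2 * ?s then Inl (f (Inr i)) else Inr (i - 2 * ?s)"
  have eq: "D_comp X Y Z g f z = g (?k z)" if "z \<in> X <+> {1..2 * (?s + ?t)}" for z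
    using that by (auto simp: D_comp_def Let_def)
  have k: "?k z \<in> Y <+> {1..2 * ?t}" if "z \<in> X <+> {1..2 * (?s + ?t)}" for z
    using that by (auto intro!: D_Inl[OF f] D_Inr[OF f])
  have ki: "inj_on ?k (X <+> {1..2 * (?s + ?t)})"
  proof (rule inj_onI)
    fix a b assume ab: "a \<in> X <+> {1..2 * (?s + ?t)}" "b \<in> X <+> {1..2 * (?s + ?t)}" "?k a = ?k b"
    show "a = b"
      by (cases a; cases b)
        (use ab in \<open>auto simp: D_Inl_inj[OF f] D_Inr_inj[OF f] D_Inl_Inr[OF f] D_Inl_Inr[OF f, symmetric] split: if_splits\<close>)
  qed
  have "inj_on (\<lambda>z. g (?k z)) (X <+> {1..2 * (?s + ?t)})"
    using comp_inj_on[OF ki, of g] inj_on_subset[OF D_inj[OF g]] k by (auto simp: o_def image_subset_iff)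
  then show "inj_on (D_comp X Y Z g f) (X <+> {1..2 * (?s + ?t)})"
    using inj_on_cong[of _ "D_comp X Y Z g f" "\<lambda>z. g (?k z)"] eq by blast
  show "D_comp X Y Z g f ` (X <+> {1..2 * (?s + ?t)}) \<subseteq> Z"
  proof (rule image_subsetI)
    fix z assume z: "z \<in> X <+> {1..2 * (?s + ?t)}"
    show "D_comp X Y Z g f z \<in> Z"
      unfolding eq[OF z] using imageI[OF k[OF z], of g] unfolding D_image[OF g] .
  qed
qed

lemma D_comp_assoc:
  assumes f: "f \<in> D X Y" and g: "g \<in> D Y Z" and h: "h \<in> D Z W" and X: "finite X"
  shows "D_comp X Z W h (D_comp X Y Z g f) = D_comp X Y W (D_comp Y Z W h g) f"
proof -
  have Y: "finite Y" by (rule D_finite[OF f X])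
  have gf: "D_comp X Y Z g f \<in> D X Z" by (rule D_comp_in_D[OF f g X])
  have hg: "D_comp Y Z W h g \<in> D Y W" by (rule D_comp_in_D[OF g h Y])
  note p = pairs_of_add[OF f g X] pairs_of_add[OF g h Y] pairs_of_add[OF gf h X]
  show ?thesis
  proof (rule D_eqI[OF D_comp_in_D[OF gf h X] D_comp_in_D[OF f hg X]])
    fix x assume "x \<in> X"
    then show "D_comp X Z W h (D_comp X Y Z g f) (Inl x) = D_comp X Y W (D_comp Y Z W h g) f (Inl x)"
      using D_Inl[OF f] by (simp add: D_comp_Inl)
  next
    fix i assume i: "1 \<le> i" "i \<le> 2 * pairs_of X W"
    consider "i \<le> 2 * pairs_of X Y" | "2 * pairs_of X Y < i" "i \<le> 2 * pairs_of X Z" | "2 * pairs_of X Z < i"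
      by linarith
    then show "D_comp X Z W h (D_comp X Y Z g f) (Inr i) = D_comp X Y W (D_comp Y Z W h g) f (Inr i)"
    proof cases
      case 1
      then show ?thesis using i p D_Inr[OF f] by (simp add: D_comp_Inl D_comp_Inr1)
    next
      case 2
      then show ?thesis using i p by (simp add: D_comp_Inr1 D_comp_Inr2)
    next
      case 3
      then show ?thesis using i p by (simp add: D_comp_Inr2)
    qed
  qed
qed

lemma D_act:
  assumes f: "f \<in> D X Y" and s: "\<sigma> permutes {1..2 * pairs_of X Y}"
  shows "f \<circ> map_sum id \<sigma> \<in> D X Y"
proof -
  let ?A = "X <+> {1..2 * pairs_of X Y}"
  have "bij_betw (map_sum id \<sigma>) ?A ?A"
  proof (rule bij_betwI[where g="map_sum id (pinv \<sigma>)"])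
    show "map_sum id \<sigma> \<in> ?A \<rightarrow> ?A" "map_sum id (pinv \<sigma>) \<in> ?A \<rightarrow> ?A"
      using permutes_in_image[OF s] permutes_in_image[OF permutes_inv[OF s]]
      by (auto simp: Plus_def simp del: atLeastAtMost_iff)
  qed (auto simp: permutes_inverses[OF s])
  then have "bij_betw (f \<circ> map_sum id \<sigma>) ?A Y"
    using f unfolding D_def by (auto intro: bij_betw_trans)
  moreover have "f \<circ> map_sum id \<sigma> \<in> extensional ?A"
    unfolding extensional_def
  proof (intro CollectI allI impI)
    fix z assume z: "z \<notin> ?A"
    then have "map_sum id \<sigma> z = z"
      using permutes_not_in[OF s] by (cases z) (auto simp del: atLeastAtMost_iff)
    then show "(f \<circ> map_sum id \<sigma>) z = undefined"
      using z D_ext[OF f] by (simp add: extensional_def)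
  qed
  ultimately show ?thesis by (simp add: D_def)
qed

lemma D_act_wreath: "f \<in> D X Y \<Longrightarrow> \<sigma> \<in> wreath (pairs_of X Y) \<Longrightarrow> f \<circ> map_sum id \<sigma> \<in> D X Y"
  by (blast intro: D_act wreath_permutes)

lemma map_sum_id_comp: "f \<circ> map_sum id (\<sigma> \<circ> \<tau>) = (f \<circ> map_sum id \<sigma>) \<circ> map_sum id \<tau>"
  by (rule ext) (simp add: sum.map_comp comp_assoc split: sum.split)

lemma map_sum_id_id: "f \<circ> map_sum id id = f"
  by (simp add: sum.map_id0)

lemma wreath_generators_extend:
  fixes h :: "(nat + nat \<Rightarrow> nat) \<Rightarrow> 'b" and F :: "int \<Rightarrow> 'b \<Rightarrow> 'b"
  assumes "\<sigma> \<in> wreath (pairs_of X Y)" "f \<in> D X Y"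
    and "\<And>x. F 1 x = x" "\<And>a b x. F a (F b x) = F (a * b) x"
    and "\<And>f k. f \<in> D X Y \<Longrightarrow> 1 \<le> k \<Longrightarrow> k \<le> pairs_of X Y \<Longrightarrow> h (f \<circ> map_sum id (flip k)) = F (twist (fst p) (-1)) (h f)"
    and "\<And>f k. f \<in> D X Y \<Longrightarrow> 1 \<le> k \<Longrightarrow> k < pairs_of X Y \<Longrightarrow> h (f \<circ> map_sum id (pswap k)) = F (twist (snd p) (-1)) (h f)"
  shows "h (f \<circ> map_sum id \<sigma>) = F (character p \<sigma>) (h f)"
  by (rule wreath_character_induct[where act="\<lambda>f \<sigma>. f \<circ> map_sum id \<sigma>" and S="D X Y" and h=h and F=F, OF assms(1,2)])
    (simp_all only: D_act_wreath map_sum_id_id map_sum_id_comp assms)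

text \<open>The relations of \<open>ub p\<close> range over the whole wreath product. For a map out
  of its morphism spaces, this reduces them to flips and exchanges of neighbouring pairs.\<close>

lemma ub_lift:
  fixes h :: "(nat + nat \<Rightarrow> nat) \<Rightarrow> ('h \<Rightarrow>\<^sub>0 'k::field)"
  assumes "\<And>f k. f \<in> D X Y \<Longrightarrow> 1 \<le> k \<Longrightarrow> k \<le> pairs_of X Y \<Longrightarrow>
      h (f \<circ> map_sum id (flip k)) = fscale (of_int (twist (fst p) (-1))) (h f)"
    and "\<And>f k. f \<in> D X Y \<Longrightarrow> 1 \<le> k \<Longrightarrow> k < pairs_of X Y \<Longrightarrow>
      h (f \<circ> map_sum id (pswap k)) = fscale (of_int (twist (snd p) (-1))) (h f)"
    and r: "r \<in> ub_rels p X Y"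
  shows "lin_ext h r = 0"
proof -
  obtain f \<sigma> where f: "r = gen (f \<circ> map_sum id \<sigma>) - fscale (of_int (character p \<sigma>)) (gen f)"
    "f \<in> D X Y" "\<sigma> \<in> wreath (pairs_of X Y)"
    using r unfolding ub_rels_def by blast
  have "h (f \<circ> map_sum id \<sigma>) = fscale (of_int (character p \<sigma>)) (h f)"
    by (rule wreath_generators_extend[OF f(3,2), where F="\<lambda>c. fscale (of_int c)" and h=h, OF _ _ assms(1,2)]) simp_all
  then show ?thesis unfolding f(1) by (simp only: lin_ext_diff lin_ext_scale lin_ext_gen) simp
qed

lemma ub_rel: "f \<in> D X Y \<Longrightarrow> \<sigma> \<in> wreath (pairs_of X Y) \<Longrightarrow>
  nf (ub_rels p X Y) (gen (f \<circ> map_sum id \<sigma>)) = fscale (of_int (character p \<sigma>)) (nf (ub_rels p X Y) (gen f))"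
  unfolding nf_scale[symmetric] by (rule nf_rel_eq) (unfold ub_rels_def, blast)

lemma ub_cls_act: "f \<in> D X Y \<Longrightarrow> \<sigma> \<in> wreath (pairs_of X Y) \<Longrightarrow>
  ub_cls p X Y (f \<circ> map_sum id \<sigma>) = of_int (character p \<sigma>) \<odot>\<^bsub>Hom (ub p) X Y\<^esub> ub_cls p X Y f"
  by (simp only: ub_cls_def ub_def lincat.simps presented_smult cls_eq_iff ub_rel nf_scale)

lemma keys_ub_rels: "r \<in> ub_rels p X Y \<Longrightarrow> Poly_Mapping.keys r \<subseteq> D X Y"
proof -
  assume "r \<in> ub_rels p X Y"
  then obtain f \<sigma> where f: "r = gen (f \<circ> map_sum id \<sigma>) - fscale (of_int (character p \<sigma>)) (gen f)"
    "f \<in> D X Y" "\<sigma> \<in> wreath (pairs_of X Y)"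
    unfolding ub_rels_def by blast
  show ?thesis unfolding f(1)
    by (intro keys_minus keys_scale) (simp_all add: f D_act_wreath[OF f(2,3)])
qed

subsection \<open>The twisted Brauer category\<close>

lemma ub_Hom: "Hom (ub p) X Y = presented (D X Y) (ub_rels p X Y)" by (simp add: ub_def)

lemma ub_Ob [simp]: "X \<in> Ob (ub p) \<longleftrightarrow> finite X" by (simp add: ub_def)

lemma ub_cls_in: "f \<in> D X Y \<Longrightarrow> ub_cls p X Y f \<in> carrier (Hom (ub p) X Y)"
  unfolding ub_Hom ub_cls_def by (rule cls_gen_in_presented)

lemma ub_closed: "closed_space (Hom (ub p) X Y)" unfolding ub_Hom by (rule closed_presented)

text \<open>In a composite the pairs of the inner diagram \<open>f\<close> come first, so the pair
  \<open>k\<close> of \<open>g\<close> reappears with its number shifted by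
  \<open>pairs_of X Y\<close>.\<close>

lemma D_comp_flip:
  assumes f: "f \<in> D X Y" and g: "g \<in> D Y Z" and X: "finite X" and k: "1 \<le> k" "k \<le> pairs_of Y Z"
  shows "D_comp X Y Z (g \<circ> map_sum id (flip k)) f = D_comp X Y Z g f \<circ> map_sum id (flip (k + pairs_of X Y))"
proof -
  note p = pairs_of_add[OF f g X]
  have w: "flip (k + pairs_of X Y) \<in> wreath (pairs_of X Z)" using k p by (intro flip_wreath) auto
  have w': "flip k \<in> wreath (pairs_of Y Z)" using k by (intro flip_wreath) auto
  show ?thesis
  proof (rule D_eqI[OF D_comp_in_D[OF f D_act_wreath[OF g w'] X] D_act_wreath[OF D_comp_in_D[OF f g X] w]])
    fix x assume "x \<in> X"
    then show "D_comp X Y Z (g \<circ> map_sum id (flip k)) f (Inl x) =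
      (D_comp X Y Z g f \<circ> map_sum id (flip (k + pairs_of X Y))) (Inl x)"
      by (simp add: D_comp_Inl)
  next
    fix i assume i: "1 \<le> i" "i \<le> 2 * pairs_of X Z"
    show "D_comp X Y Z (g \<circ> map_sum id (flip k)) f (Inr i) =
      (D_comp X Y Z g f \<circ> map_sum id (flip (k + pairs_of X Y))) (Inr i)"
    proof (cases "i \<le> 2 * pairs_of X Y")
      case True
      then have "flip (k + pairs_of X Y) i = i" using k by (auto simp: flip_apply)
      then show ?thesis using True i by (simp add: D_comp_Inr1)
    next
      case False
      then have "flip (k + pairs_of X Y) i = flip k (i - 2 * pairs_of X Y) + 2 * pairs_of X Y"
        using k by (auto simp: flip_apply)
      moreover have "1 \<le> flip k (i - 2 * pairs_of X Y)" "flip k (i - 2 * pairs_of X Y) \<le> 2 * pairs_of Y Z"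
        using k i False p by (auto simp: flip_apply)
      ultimately show ?thesis using False i p by (simp add: D_comp_Inr2)
    qed
  qed
qed

lemma D_comp_pswap:
  assumes f: "f \<in> D X Y" and g: "g \<in> D Y Z" and X: "finite X" and k: "1 \<le> k" "k < pairs_of Y Z"
  shows "D_comp X Y Z (g \<circ> map_sum id (pswap k)) f = D_comp X Y Z g f \<circ> map_sum id (pswap (k + pairs_of X Y))"
proof -
  note p = pairs_of_add[OF f g X]
  have w: "pswap (k + pairs_of X Y) \<in> wreath (pairs_of X Z)" using k p by (intro pswap_wreath) auto
  have w': "pswap k \<in> wreath (pairs_of Y Z)" using k by (intro pswap_wreath) auto
  show ?thesis
  proof (rule D_eqI[OF D_comp_in_D[OF f D_act_wreath[OF g w'] X] D_act_wreath[OF D_comp_in_D[OF f g X] w]])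
    fix x assume "x \<in> X"
    then show "D_comp X Y Z (g \<circ> map_sum id (pswap k)) f (Inl x) =
      (D_comp X Y Z g f \<circ> map_sum id (pswap (k + pairs_of X Y))) (Inl x)"
      by (simp add: D_comp_Inl)
  next
    fix i assume i: "1 \<le> i" "i \<le> 2 * pairs_of X Z"
    show "D_comp X Y Z (g \<circ> map_sum id (pswap k)) f (Inr i) =
      (D_comp X Y Z g f \<circ> map_sum id (pswap (k + pairs_of X Y))) (Inr i)"
    proof (cases "i \<le> 2 * pairs_of X Y")
      case True
      then have "pr i \<le> pairs_of X Y" by (simp add: pr_def)
      then have "pswap (k + pairs_of X Y) i = i" using k by (simp add: pswap_apply)
      then show ?thesis using True i by (simp add: D_comp_Inr1)
    next
      case False
      then have "pr i = pr (i - 2 * pairs_of X Y) + pairs_of X Y" "pr (i - 2 * pairs_of X Y) \<ge> 1"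
        by (auto simp: pr_def)
      then have a: "pswap (k + pairs_of X Y) i = pswap k (i - 2 * pairs_of X Y) + 2 * pairs_of X Y"
        using k False by (auto simp: pswap_apply pr_def)
      have "pswap k permutes {1..2 * pairs_of Y Z}" using w' by (rule wreath_permutes)
      moreover have "i - 2 * pairs_of X Y \<in> {1..2 * pairs_of Y Z}" using False i p by auto
      ultimately have "pswap k (i - 2 * pairs_of X Y) \<in> {1..2 * pairs_of Y Z}"
        by (simp only: permutes_in_image)
      then show ?thesis using False i p a by (simp add: D_comp_Inr2)
    qed
  qed
qed

text \<open>The pairs of \<open>f\<close> keep their numbers in the composite. Any element of their
  wreath product therefore acts unshifted and can be treated at once, whereas the shift on the side
  of \<open>g\<close> is followed only for generators.\<close>

lemma D_comp_act_right:
  assumes f: "f \<in> D X Y" and g: "g \<in> D Y Z" and X: "finite X" and s: "\<sigma> \<in> wreath (pairs_of X Y)"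
  shows "D_comp X Y Z g (f \<circ> map_sum id \<sigma>) = D_comp X Y Z g f \<circ> map_sum id \<sigma>"
proof -
  note p = pairs_of_add[OF f g X]
  have s1: "\<sigma> permutes {1..2 * pairs_of X Y}" by (rule wreath_permutes[OF s])
  have s2: "\<sigma> permutes {1..2 * pairs_of X Z}" by (rule permutes_subset[OF s1]) (use p in auto)
  show ?thesis
  proof (rule D_eqI[OF D_comp_in_D[OF D_act[OF f s1] g X] D_act[OF D_comp_in_D[OF f g X] s2]])
    fix x assume "x \<in> X"
    then show "D_comp X Y Z g (f \<circ> map_sum id \<sigma>) (Inl x) = (D_comp X Y Z g f \<circ> map_sum id \<sigma>) (Inl x)"
      by (simp add: D_comp_Inl)
  next
    fix i assume i: "1 \<le> i" "i \<le> 2 * pairs_of X Z"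
    show "D_comp X Y Z g (f \<circ> map_sum id \<sigma>) (Inr i) = (D_comp X Y Z g f \<circ> map_sum id \<sigma>) (Inr i)"
    proof (cases "i \<le> 2 * pairs_of X Y")
      case True
      then have "i \<in> {1..2 * pairs_of X Y}" using i by simp
      then have "\<sigma> i \<in> {1..2 * pairs_of X Y}" by (simp only: permutes_in_image[OF s1])
      then show ?thesis using True i by (simp add: D_comp_Inr1)
    next
      case False
      then have "\<sigma> i = i" using permutes_not_in[OF s1, of i] by simp
      then show ?thesis using False i p by (simp add: D_comp_Inr2)
    qed
  qed
qed

lemma ub_comp_bilinear:
  assumes X: "finite X"
  shows "bilinear_induced (D Y Z) (ub_rels p Y Z) (D X Y) (ub_rels p X Y) (D X Z) (ub_rels p X Z)
    (\<lambda>g f. gen (D_comp X Y Z g f))"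
proof
  fix r b assume r: "r \<in> ub_rels p Y Z" and b: "b \<in> D X Y"
  show "nf (ub_rels p X Z) (lin_ext (\<lambda>a. gen (D_comp X Y Z a b)) r) = 0"
    unfolding nf_lin_ext
  proof (rule ub_lift[OF _ _ r])
    fix f k assume f: "f \<in> D Y Z" and k: "1 \<le> k" "k \<le> pairs_of Y Z"
    have "flip (k + pairs_of X Y) \<in> wreath (pairs_of X Z)"
      using k pairs_of_add[OF b f X] by (intro flip_wreath) auto
    then show "nf (ub_rels p X Z) (gen (D_comp X Y Z (f \<circ> map_sum id (flip k)) b)) =
      fscale (of_int (twist (fst p) (-1))) (nf (ub_rels p X Z) (gen (D_comp X Y Z f b)))"
      using k by (simp only: D_comp_flip[OF b f X k] ub_rel[OF D_comp_in_D[OF b f X]]) (simp add: character_flip)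
  next
    fix f k assume f: "f \<in> D Y Z" and k: "1 \<le> k" "k < pairs_of Y Z"
    have "pswap (k + pairs_of X Y) \<in> wreath (pairs_of X Z)"
      using k pairs_of_add[OF b f X] by (intro pswap_wreath) auto
    then show "nf (ub_rels p X Z) (gen (D_comp X Y Z (f \<circ> map_sum id (pswap k)) b)) =
      fscale (of_int (twist (snd p) (-1))) (nf (ub_rels p X Z) (gen (D_comp X Y Z f b)))"
      using k by (simp only: D_comp_pswap[OF b f X k] ub_rel[OF D_comp_in_D[OF b f X]]) (simp add: character_pswap)
  qed
next
  fix r a assume r: "r \<in> ub_rels p X Y" and a: "a \<in> D Y Z"
  then obtain f \<sigma> where f: "r = gen (f \<circ> map_sum id \<sigma>) - fscale (of_int (character p \<sigma>)) (gen f)"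
    "f \<in> D X Y" "\<sigma> \<in> wreath (pairs_of X Y)"
    unfolding ub_rels_def by blast
  have "\<sigma> \<in> wreath (pairs_of X Z)"
    by (rule wreath_mono[OF f(3)]) (simp add: pairs_of_add[OF f(2) a X])
  then show "nf (ub_rels p X Z) (lin_ext (\<lambda>b. gen (D_comp X Y Z a b)) r) = 0"
    unfolding f(1) lin_ext_diff lin_ext_scale lin_ext_gen nf_diff nf_scale D_comp_act_right[OF f(2) a X f(3)]
    by (simp only: ub_rel[OF D_comp_in_D[OF f(2) a X]] diff_self)
qed (auto dest: keys_ub_rels simp: D_comp_in_D X)

lemma ub_Cmp: "Cmp (ub p) X Y Z = induced2 (ub_rels p X Z) (\<lambda>g f. gen (D_comp X Y Z g f))"
  by (simp add: ub_def)

lemma ub_Cmp_linear1: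
  "finite X \<Longrightarrow> f \<in> carrier (Hom (ub p) X Y) \<Longrightarrow>
   (\<lambda>g. Cmp (ub p) X Y Z g f) \<in> linear_maps (Hom (ub p) Y Z) (Hom (ub p) X Z)"
  unfolding ub_Hom ub_Cmp by (rule bilinear_induced.induced2_linear1[OF ub_comp_bilinear])

lemma ub_Cmp_linear2:
  "finite X \<Longrightarrow> g \<in> carrier (Hom (ub p) Y Z) \<Longrightarrow>
   (\<lambda>f. Cmp (ub p) X Y Z g f) \<in> linear_maps (Hom (ub p) X Y) (Hom (ub p) X Z)"
  unfolding ub_Hom ub_Cmp by (rule bilinear_induced.induced2_linear2[OF ub_comp_bilinear])

lemma ub_Cmp_in:
  "finite X \<Longrightarrow> f \<in> carrier (Hom (ub p) X Y) \<Longrightarrow> g \<in> carrier (Hom (ub p) Y Z) \<Longrightarrow>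
   Cmp (ub p) X Y Z g f \<in> carrier (Hom (ub p) X Z)"
  by (rule linear_maps_mem[OF ub_Cmp_linear1])

lemma ub_Cmp_cls:
  "finite X \<Longrightarrow> f \<in> D X Y \<Longrightarrow> g \<in> D Y Z \<Longrightarrow>
   Cmp (ub p) X Y Z (ub_cls p Y Z g) (ub_cls p X Y f) = ub_cls p X Z (D_comp X Y Z g f)"
  unfolding ub_Cmp ub_cls_def
  by (subst bilinear_induced.induced2_cls[OF ub_comp_bilinear]) auto

lemma ub_maps_eq:
  assumes "F \<in> linear_maps (Hom (ub p) X Y) (Hom (ub p) X' Y')" "G \<in> linear_maps (Hom (ub p) X Y) (Hom (ub p) X' Y')"
    "\<And>f. f \<in> D X Y \<Longrightarrow> F (ub_cls p X Y f) = G (ub_cls p X Y f)" "a \<in> carrier (Hom (ub p) X Y)"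
  shows "F a = G a"
  using linear_maps_eq[OF assms(1,2)[unfolded ub_Hom] _ assms(4)[unfolded ub_Hom]] assms(3)
  unfolding ub_cls_def by blast

lemma ub_lin_on_eq:
  assumes "lin_on (Hom (ub p) X Y) F" "lin_on (Hom (ub p) X Y) G"
    "\<And>f. f \<in> D X Y \<Longrightarrow> F (ub_cls p X Y f) = G (ub_cls p X Y f)" "a \<in> carrier (Hom (ub p) X Y)"
  shows "F a = G a"
  using lin_on_eq[OF assms(1,2)[unfolded ub_Hom] _ assms(4)[unfolded ub_Hom]] assms(3)
  unfolding ub_cls_def by blast

text \<open>Both sides are trilinear; the arguments are replaced by diagrams one after the other,
  until \<open>D_comp_assoc\<close> applies.\<close>

lemma ub_Cmp_assoc:
  assumes X: "finite X" and Y: "finite Y"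
    and a: "a \<in> carrier (Hom (ub p) X Y)" and b: "b \<in> carrier (Hom (ub p) Y Z)" and c: "c \<in> carrier (Hom (ub p) Z W)"
  shows "Cmp (ub p) X Z W c (Cmp (ub p) X Y Z b a) = Cmp (ub p) X Y W (Cmp (ub p) Y Z W c b) a"
proof (rule ub_maps_eq[where a=c, OF _ _ _ c])
  show "(\<lambda>c. Cmp (ub p) X Z W c (Cmp (ub p) X Y Z b a)) \<in> linear_maps (Hom (ub p) Z W) (Hom (ub p) X W)"
    by (intro ub_Cmp_linear1 ub_Cmp_in X a b)
  show "(\<lambda>c. Cmp (ub p) X Y W (Cmp (ub p) Y Z W c b) a) \<in> linear_maps (Hom (ub p) Z W) (Hom (ub p) X W)"
    by (rule linear_maps_comp[OF ub_Cmp_linear1[OF X a] ub_Cmp_linear1[OF Y b]])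
  fix h assume h: "h \<in> D Z W"
  note h' = ub_cls_in[OF h, of p]
  show "Cmp (ub p) X Z W (ub_cls p Z W h) (Cmp (ub p) X Y Z b a) = Cmp (ub p) X Y W (Cmp (ub p) Y Z W (ub_cls p Z W h) b) a"
  proof (rule ub_maps_eq[where a=b, OF _ _ _ b])
    show "(\<lambda>b. Cmp (ub p) X Z W (ub_cls p Z W h) (Cmp (ub p) X Y Z b a)) \<in> linear_maps (Hom (ub p) Y Z) (Hom (ub p) X W)"
      by (rule linear_maps_comp[OF ub_Cmp_linear2[OF X h'] ub_Cmp_linear1[OF X a]])
    show "(\<lambda>b. Cmp (ub p) X Y W (Cmp (ub p) Y Z W (ub_cls p Z W h) b) a) \<in> linear_maps (Hom (ub p) Y Z) (Hom (ub p) X W)"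
      by (rule linear_maps_comp[OF ub_Cmp_linear1[OF X a] ub_Cmp_linear2[OF Y h']])
    fix g assume g: "g \<in> D Y Z"
    note g' = ub_cls_in[OF g, of p]
    show "Cmp (ub p) X Z W (ub_cls p Z W h) (Cmp (ub p) X Y Z (ub_cls p Y Z g) a) =
      Cmp (ub p) X Y W (Cmp (ub p) Y Z W (ub_cls p Z W h) (ub_cls p Y Z g)) a"
    proof (rule ub_maps_eq[where a=a, OF _ _ _ a])
      show "(\<lambda>a. Cmp (ub p) X Z W (ub_cls p Z W h) (Cmp (ub p) X Y Z (ub_cls p Y Z g) a)) \<in> linear_maps (Hom (ub p) X Y) (Hom (ub p) X W)"
        by (rule linear_maps_comp[OF ub_Cmp_linear2[OF X h'] ub_Cmp_linear2[OF X g']])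
      show "(\<lambda>a. Cmp (ub p) X Y W (Cmp (ub p) Y Z W (ub_cls p Z W h) (ub_cls p Y Z g)) a) \<in> linear_maps (Hom (ub p) X Y) (Hom (ub p) X W)"
        by (intro ub_Cmp_linear2 ub_Cmp_in X Y g' h')
      fix f assume f: "f \<in> D X Y"
      show "Cmp (ub p) X Z W (ub_cls p Z W h) (Cmp (ub p) X Y Z (ub_cls p Y Z g) (ub_cls p X Y f)) =
        Cmp (ub p) X Y W (Cmp (ub p) Y Z W (ub_cls p Z W h) (ub_cls p Y Z g)) (ub_cls p X Y f)"
        by (simp only: ub_Cmp_cls X Y f g h D_comp_in_D[OF f g X] D_comp_in_D[OF g h Y] D_comp_assoc)
    qed
  qed
qed

subsection \<open>Bijections and chords\<close>

lemma BijD: "\<sigma> \<in> Bij X Y \<Longrightarrow> bij_betw \<sigma> X Y" "\<sigma> \<in> Bij X Y \<Longrightarrow> \<sigma> \<in> extensional X"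
  by (auto simp: Bij_def)

lemma pairs_of_same: "card X = card Y \<Longrightarrow> pairs_of X Y = 0"
  by (simp add: pairs_of_def)

lemma bij_D_in_D:
  assumes "bij_betw \<sigma> X Y" "finite X" shows "bij_D X \<sigma> \<in> D X Y"
proof (rule DI[where t=0])
  show "card Y = card X + 2 * 0" using bij_betw_same_card[OF assms(1)] by simp
  show "finite Y" using assms bij_betw_finite by blast
  show "bij_D X \<sigma> \<in> extensional (X <+> {1..2 * 0})" by (simp add: bij_D_def)
  have e: "X <+> {1..2 * 0 :: nat} = Inl ` X" by auto
  have v: "bij_D X \<sigma> (Inl x) = \<sigma> x" if "x \<in> X" for x using that by (simp add: bij_D_def)
  show "inj_on (bij_D X \<sigma>) (X <+> {1..2 * 0})"
    unfolding e using inj_onD[OF bij_betw_imp_inj_on[OF assms(1)]] by (intro inj_onI) (auto simp: v)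
  show "bij_D X \<sigma> ` (X <+> {1..2 * 0}) \<subseteq> Y"
    unfolding e using bij_betwE[OF assms(1)] by (auto simp: v)
qed (rule assms)

lemma bij_D_Inl: "x \<in> X \<Longrightarrow> bij_D X \<sigma> (Inl x) = \<sigma> x" by (simp add: bij_D_def)

lemma bij_D_cong: "(\<And>x. x \<in> X \<Longrightarrow> \<sigma> x = \<tau> x) \<Longrightarrow> bij_D X \<sigma> = bij_D X \<tau>"
  by (auto simp: bij_D_def restrict_def fun_eq_iff)

lemma bij_D_pairs: "bij_betw \<sigma> X Y \<Longrightarrow> pairs_of X Y = 0"
  by (rule pairs_of_same) (rule bij_betw_same_card)

lemma D_comp_bij:
  assumes "bij_betw \<sigma> X Y" "bij_betw \<tau> Y Z" "finite X"
  shows "D_comp X Y Z (bij_D Y \<tau>) (bij_D X \<sigma>) = bij_D X (\<tau> \<circ> \<sigma>)"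
proof (rule D_eqI)
  have Y: "finite Y" using assms bij_betw_finite by blast
  have c: "bij_betw (\<tau> \<circ> \<sigma>) X Z" by (rule bij_betw_trans[OF assms(1,2)])
  show "bij_D X (\<tau> \<circ> \<sigma>) \<in> D X Z" by (rule bij_D_in_D[OF c assms(3)])
  show "D_comp X Y Z (bij_D Y \<tau>) (bij_D X \<sigma>) \<in> D X Z"
    by (intro D_comp_in_D bij_D_in_D assms Y)
  fix x assume "x \<in> X"
  then show "D_comp X Y Z (bij_D Y \<tau>) (bij_D X \<sigma>) (Inl x) = bij_D X (\<tau> \<circ> \<sigma>) (Inl x)"
    using bij_betwE[OF assms(1)] by (simp add: D_comp_Inl bij_D_Inl)
next
  fix i :: nat assume "1 \<le> i" "i \<le> 2 * pairs_of X Z"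
  then show "D_comp X Y Z (bij_D Y \<tau>) (bij_D X \<sigma>) (Inr i) = bij_D X (\<tau> \<circ> \<sigma>) (Inr i)"
    using bij_D_pairs[OF bij_betw_trans[OF assms(1,2)]] by simp
qed

lemma D_comp_id_left:
  assumes f: "f \<in> D X Y" and X: "finite X"
  shows "D_comp X Y Y (bij_D Y id) f = f"
proof (rule D_eqI[OF D_comp_in_D[OF f bij_D_in_D[OF bij_betw_id] X] f])
  show "finite Y" by (rule D_finite[OF f X])
next
  fix x assume "x \<in> X"
  then show "D_comp X Y Y (bij_D Y id) f (Inl x) = f (Inl x)"
    unfolding D_comp_Inl[OF \<open>x \<in> X\<close>] by (simp add: bij_D_Inl[OF D_Inl[OF f]])
next
  fix i assume i: "1 \<le> i" "i \<le> 2 * pairs_of X Y"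
  show "D_comp X Y Y (bij_D Y id) f (Inr i) = f (Inr i)"
    unfolding D_comp_Inr1[OF i] by (simp add: bij_D_Inl[OF D_Inr[OF f i]])
qed

lemma D_comp_id_right:
  assumes f: "f \<in> D X Y" and X: "finite X"
  shows "D_comp X X Y f (bij_D X id) = f"
proof (rule D_eqI[OF D_comp_in_D[OF bij_D_in_D[OF bij_betw_id X] f X] f])
  fix x assume x: "x \<in> X"
  show "D_comp X X Y f (bij_D X id) (Inl x) = f (Inl x)"
    unfolding D_comp_Inl[OF x] bij_D_Inl[OF x] by simp
next
  fix i assume i: "1 \<le> i" "i \<le> 2 * pairs_of X Y"
  have "pairs_of X X = 0" by (rule pairs_of_same) simp
  then show "D_comp X X Y f (bij_D X id) (Inr i) = f (Inr i)"
    using D_comp_Inr2[of X X i Y f "bij_D X id"] i by simp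
qed

abbreviation idm :: "polarities \<Rightarrow> nat set \<Rightarrow> 'k::field ubmor" where
  "idm p X \<equiv> ub_cls p X X (bij_D X id)"

lemma idm_in: "finite X \<Longrightarrow> idm p X \<in> carrier (Hom (ub p) X X)"
  by (intro ub_cls_in bij_D_in_D bij_betw_id)

lemma linear_maps_ident: "closed_space V \<Longrightarrow> (\<lambda>x. x) \<in> linear_maps V V"
  by (rule linear_mapsI) auto

lemma ub_Cmp_id_left:
  assumes "finite X" "finite Y" "a \<in> carrier (Hom (ub p) X Y)"
  shows "Cmp (ub p) X Y Y (idm p Y) a = a"
  by (rule ub_maps_eq[where F="\<lambda>a. Cmp (ub p) X Y Y (idm p Y) a" and G="\<lambda>a. a", OF ub_Cmp_linear2 linear_maps_ident _ assms(3)])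
    (simp_all add: assms idm_in ub_closed ub_Cmp_cls bij_D_in_D bij_betw_id D_comp_id_left)

lemma ub_Cmp_id_right:
  assumes "finite X" "a \<in> carrier (Hom (ub p) X Y)"
  shows "Cmp (ub p) X X Y a (idm p X) = a"
  by (rule ub_maps_eq[where F="\<lambda>a. Cmp (ub p) X X Y a (idm p X)" and G="\<lambda>a. a", OF ub_Cmp_linear1 linear_maps_ident _ assms(2)])
    (simp_all add: assms idm_in ub_closed ub_Cmp_cls bij_D_in_D bij_betw_id D_comp_id_right)

definition chordD :: "nat set \<Rightarrow> nat \<Rightarrow> nat \<Rightarrow> (nat + nat \<Rightarrow> nat)" where
  "chordD X u v = restrict (\<lambda>z. case z of Inl x \<Rightarrow> x | Inr i \<Rightarrow> if i = 1 then u else v)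
       ((X - {u, v}) <+> {1..2})"

lemma chord_eq: "chord p X u v = ub_cls p (X - {u, v}) X (chordD X u v)"
  by (simp add: chord_def chordD_def)

lemma card_pair: "finite X \<Longrightarrow> u \<in> X \<Longrightarrow> v \<in> X \<Longrightarrow> u \<noteq> v \<Longrightarrow> card X = card (X - {u, v}) + 2 * 1"
proof -
  assume a: "finite X" "u \<in> X" "v \<in> X" "u \<noteq> v"
  then have "card (X - {u, v}) = card X - card {u, v}" by (intro card_Diff_subset) auto
  moreover have "card {u, v} \<le> card X" using a by (intro card_mono) auto
  ultimately show ?thesis using a by simp
qed

lemma pairs_of_pair: "finite X \<Longrightarrow> u \<in> X \<Longrightarrow> v \<in> X \<Longrightarrow> u \<noteq> v \<Longrightarrow> pairs_of (X - {u, v}) X = 1"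
  by (rule pairs_of_eq) (rule card_pair)

lemma chordD_in_D:
  assumes "finite X" "u \<in> X" "v \<in> X" "u \<noteq> v"
  shows "chordD X u v \<in> D (X - {u, v}) X"
proof (rule DI[where t=1])
  show "inj_on (chordD X u v) ((X - {u, v}) <+> {1..2 * 1})"
    using assms by (auto simp: chordD_def inj_on_def split: if_splits)
  show "chordD X u v ` ((X - {u, v}) <+> {1..2 * 1}) \<subseteq> X"
    using assms by (auto simp: chordD_def)
  show "card X = card (X - {u, v}) + 2 * 1" by (rule card_pair[OF assms])
  show "chordD X u v \<in> extensional ((X - {u, v}) <+> {1..2 * 1})" by (simp add: chordD_def)
qed (use assms in simp_all)

lemma chordD_Inl: "x \<in> X \<Longrightarrow> x \<noteq> u \<Longrightarrow> x \<noteq> v \<Longrightarrow> chordD X u v (Inl x) = x"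
  by (simp add: chordD_def)

lemma chordD_Inr: "chordD X u v (Inr 1) = u" "chordD X u v (Inr (Suc 0)) = u" "chordD X u v (Inr 2) = v"
  by (simp_all add: chordD_def)

lemma chord_in: "finite X \<Longrightarrow> u \<in> X \<Longrightarrow> v \<in> X \<Longrightarrow> u \<noteq> v \<Longrightarrow>
  chord p X u v \<in> carrier (Hom (ub p) (X - {u, v}) X)"
  unfolding chord_eq by (intro ub_cls_in chordD_in_D)

text \<open>Reversing the orientation of a chord is the flip of its only pair, which is why the sign
  belongs to the first polarity.\<close>

lemma chord_swap:
  assumes "finite X" "u \<in> X" "v \<in> X" "u \<noteq> v"
  shows "chord p X v u = of_int (twist (fst p) (-1)) \<odot>\<^bsub>Hom (ub p) (X - {u, v}) X\<^esub> chord p X u v"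
proof -
  note pp = pairs_of_pair[OF assms]
  have w: "flip 1 \<in> wreath (pairs_of (X - {u, v}) X)" unfolding pp by (rule flip_wreath) auto
  have s: "X - {v, u} = X - {u, v}" by auto
  have "chordD X v u \<in> D (X - {u, v}) X" using chordD_in_D[of X v u] assms s by metis
  then have "chordD X v u = chordD X u v \<circ> map_sum id (flip 1)"
  proof (rule D_eqI[OF _ D_act_wreath[OF chordD_in_D[OF assms] w]])
    fix i assume "1 \<le> i" "i \<le> 2 * pairs_of (X - {u, v}) X"
    then have "i = 1 \<or> i = 2" unfolding pp by auto
    then show "chordD X v u (Inr i) = (chordD X u v \<circ> map_sum id (flip 1)) (Inr i)"
      by (auto simp: flip_apply chordD_Inr)
  qed (auto simp: chordD_Inl)
  then have "chord p X v u = ub_cls p (X - {u, v}) X (chordD X u v \<circ> map_sum id (flip 1))"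
    unfolding chord_eq s by simp
  also have "\<dots> = of_int (twist (fst p) (-1)) \<odot>\<^bsub>Hom (ub p) (X - {u, v}) X\<^esub> chord p X u v"
    unfolding chord_eq ub_cls_act[OF chordD_in_D[OF assms] w] character_flip[OF order_refl] ..
  finally show ?thesis .
qed

lemma bij_betw_remove_pair:
  assumes s: "bij_betw \<sigma> Y Y'" and uv: "u \<in> Y" "v \<in> Y"
  shows "bij_betw \<sigma> (Y - {u, v}) (Y' - {\<sigma> u, \<sigma> v})"
proof (rule bij_betw_subset[OF s])
  have "\<sigma> ` (Y - {u, v}) = \<sigma> ` Y - \<sigma> ` {u, v}"
    by (rule inj_on_image_set_diff[of _ Y]) (use s uv in \<open>auto simp: bij_betw_def\<close>)
  then show "\<sigma> ` (Y - {u, v}) = Y' - {\<sigma> u, \<sigma> v}"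
    using s by (simp add: bij_betw_def)
qed auto

lemma D_comp_chord_natural:
  assumes s: "bij_betw \<sigma> Y Y'" and Y: "finite Y" and uv: "u \<in> Y" "v \<in> Y" "u \<noteq> v"
  shows "D_comp (Y - {u, v}) Y Y' (bij_D Y \<sigma>) (chordD Y u v) =
    D_comp (Y - {u, v}) (Y' - {\<sigma> u, \<sigma> v}) Y' (chordD Y' (\<sigma> u) (\<sigma> v)) (bij_D (Y - {u, v}) \<sigma>)"
proof -
  have Y': "finite Y'" using s Y bij_betw_finite by blast
  have suv: "\<sigma> u \<in> Y'" "\<sigma> v \<in> Y'" "\<sigma> u \<noteq> \<sigma> v"
    using bij_betwE[OF s] uv inj_onD[OF bij_betw_imp_inj_on[OF s]] by blast+
  have s': "bij_betw \<sigma> (Y - {u, v}) (Y' - {\<sigma> u, \<sigma> v})"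
    by (rule bij_betw_remove_pair[OF s uv(1,2)])
  have f: "finite (Y - {u, v})" using Y by simp
  note c = chordD_in_D[OF Y uv] and c' = chordD_in_D[OF Y' suv] and b = bij_D_in_D[OF s Y] and b' = bij_D_in_D[OF s' f]
  have pp: "pairs_of (Y - {u, v}) Y' = 1" "pairs_of (Y - {u, v}) Y = 1" "pairs_of (Y' - {\<sigma> u, \<sigma> v}) Y' = 1"
    "pairs_of (Y - {u, v}) (Y' - {\<sigma> u, \<sigma> v}) = 0"
    using pairs_of_add[OF c b f] pairs_of_pair[OF Y uv] pairs_of_pair[OF Y' suv] bij_D_pairs[OF s] bij_D_pairs[OF s']
    by simp_all
  show ?thesis
  proof (rule D_eqI[OF D_comp_in_D[OF c b f] D_comp_in_D[OF b' c' f]])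
    fix x assume x: "x \<in> Y - {u, v}"
    then have "\<sigma> x \<in> Y' - {\<sigma> u, \<sigma> v}" using bij_betwE[OF s'] by blast
    then show "D_comp (Y - {u, v}) Y Y' (bij_D Y \<sigma>) (chordD Y u v) (Inl x) =
      D_comp (Y - {u, v}) (Y' - {\<sigma> u, \<sigma> v}) Y' (chordD Y' (\<sigma> u) (\<sigma> v)) (bij_D (Y - {u, v}) \<sigma>) (Inl x)"
      using x by (simp add: D_comp_Inl chordD_Inl bij_D_Inl)
  next
    fix i assume "1 \<le> i" "i \<le> 2 * pairs_of (Y - {u, v}) Y'"
    then have "i = 1 \<or> i = 2" by (auto simp: pp)
    then show "D_comp (Y - {u, v}) Y Y' (bij_D Y \<sigma>) (chordD Y u v) (Inr i) =
      D_comp (Y - {u, v}) (Y' - {\<sigma> u, \<sigma> v}) Y' (chordD Y' (\<sigma> u) (\<sigma> v)) (bij_D (Y - {u, v}) \<sigma>) (Inr i)"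
      using uv by (auto simp: D_comp_Inr1 D_comp_Inr2 pp chordD_Inr bij_D_Inl)
  qed
qed

lemma chord_natural:
  assumes s: "bij_betw \<sigma> Y Y'" and Y: "finite Y" and uv: "u \<in> Y" "v \<in> Y" "u \<noteq> v"
  shows "Cmp (ub p) (Y - {u, v}) Y Y' (ub_cls p Y Y' (bij_D Y \<sigma>)) (chord p Y u v) =
    Cmp (ub p) (Y - {u, v}) (Y' - {\<sigma> u, \<sigma> v}) Y' (chord p Y' (\<sigma> u) (\<sigma> v))
      (ub_cls p (Y - {u, v}) (Y' - {\<sigma> u, \<sigma> v}) (bij_D (Y - {u, v}) \<sigma>))"
proof -
  have Y': "finite Y'" using s Y bij_betw_finite by blast
  have suv: "\<sigma> u \<in> Y'" "\<sigma> v \<in> Y'" "\<sigma> u \<noteq> \<sigma> v"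
    using bij_betwE[OF s] uv inj_onD[OF bij_betw_imp_inj_on[OF s]] by blast+
  have s': "bij_betw \<sigma> (Y - {u, v}) (Y' - {\<sigma> u, \<sigma> v})"
    by (rule bij_betw_remove_pair[OF s uv(1,2)])
  have f: "finite (Y - {u, v})" using Y by simp
  note c = chordD_in_D[OF Y uv] and c' = chordD_in_D[OF Y' suv] and b = bij_D_in_D[OF s Y] and b' = bij_D_in_D[OF s' f]
  show ?thesis unfolding chord_eq ub_Cmp_cls[OF f c b] ub_Cmp_cls[OF f b' c']
    by (simp only: D_comp_chord_natural[OF assms])
qed

text \<open>The two orders of composition list the same two pairs in opposite order. They differ by
  one exchange of pairs, so the sign belongs to the second polarity.\<close>

lemma chord_commute:
  assumes X: "finite X" and i: "u \<in> X" "v \<in> X" "w \<in> X" "z \<in> X" and d: "distinct [u, v, w, z]"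
    and Z: "Z = X - {u, v, w, z}"
  shows "Cmp (ub p) Z (X - {u, v}) X (chord p X u v) (chord p (X - {u, v}) w z) =
    of_int (twist (snd p) (-1)) \<odot>\<^bsub>Hom (ub p) Z X\<^esub>
    Cmp (ub p) Z (X - {w, z}) X (chord p X w z) (chord p (X - {w, z}) u v)"
proof -
  have f: "finite Z" "finite (X - {u, v})" "finite (X - {w, z})" using X Z by auto
  have Z1: "X - {u, v} - {w, z} = Z" and Z2: "X - {w, z} - {u, v} = Z" using Z by auto
  have uv: "u \<noteq> v" and wz: "w \<noteq> z" using d by auto
  have wz': "w \<in> X - {u, v}" "z \<in> X - {u, v}" and uv': "u \<in> X - {w, z}" "v \<in> X - {w, z}" using d i by auto
  note c1 = chordD_in_D[OF X i(1,2) uv] and c2 = chordD_in_D[OF f(2) wz' wz, unfolded Z1]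
   and c3 = chordD_in_D[OF X i(3,4) wz] and c4 = chordD_in_D[OF f(3) uv' uv, unfolded Z2]
  note D1 = D_comp_in_D[OF c2 c1 f(1)] and D2 = D_comp_in_D[OF c4 c3 f(1)]
  have pp: "pairs_of (X - {u, v}) X = 1" "pairs_of Z (X - {u, v}) = 1" "pairs_of (X - {w, z}) X = 1" "pairs_of Z (X - {w, z}) = 1"
    "pairs_of Z X = 2"
    using pairs_of_pair[OF X i(1,2) uv] pairs_of_pair[OF f(2) wz' wz] pairs_of_pair[OF X i(3,4) wz]
      pairs_of_pair[OF f(3) uv' uv] pairs_of_add[OF c2 c1 f(1)] by (simp_all add: Z1 Z2)
  have w: "pswap 1 \<in> wreath (pairs_of Z X)" unfolding pp by (rule pswap_wreath) auto
  have ps: "pswap 1 1 = 3" "pswap 1 2 = 4" "pswap 1 3 = 1" "pswap 1 4 = 2"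
    by (simp_all add: pswap_apply pr_def)
  have "D_comp Z (X - {u, v}) X (chordD X u v) (chordD (X - {u, v}) w z) =
    D_comp Z (X - {w, z}) X (chordD X w z) (chordD (X - {w, z}) u v) \<circ> map_sum id (pswap 1)"
  proof (rule D_eqI[OF D1 D_act_wreath[OF D2 w]])
    fix x assume "x \<in> Z"
    then show "D_comp Z (X - {u, v}) X (chordD X u v) (chordD (X - {u, v}) w z) (Inl x) =
      (D_comp Z (X - {w, z}) X (chordD X w z) (chordD (X - {w, z}) u v) \<circ> map_sum id (pswap 1)) (Inl x)"
      unfolding Z by (simp add: D_comp_Inl chordD_Inl)
  next
    fix k assume "1 \<le> k" "k \<le> 2 * pairs_of Z X"
    then have "k = 1 \<or> k = 2 \<or> k = 3 \<or> k = 4" unfolding pp by auto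
    then show "D_comp Z (X - {u, v}) X (chordD X u v) (chordD (X - {u, v}) w z) (Inr k) =
      (D_comp Z (X - {w, z}) X (chordD X w z) (chordD (X - {w, z}) u v) \<circ> map_sum id (pswap 1)) (Inr k)"
      using i d by (elim disjE) (simp_all only: comp_apply map_sum.simps ps,
         simp_all add: D_comp_Inr1 D_comp_Inr2 pp chordD_Inr chordD_Inl)
  qed
  then show ?thesis
    unfolding chord_eq Z1 Z2 ub_Cmp_cls[OF f(1) c2 c1] ub_Cmp_cls[OF f(1) c4 c3]
    by (simp only: ub_cls_act[OF D2 w] character_pswap[OF order_refl])
qed

lemma FB_ub_gen: "FB_ub p X Y (gen \<sigma>) = ub_cls p X Y (bij_D X \<sigma>)"
  by (simp add: FB_ub_def ub_cls_def)

lemma FB_db_gen: "FB_db p X Y (gen \<sigma>) = ub_cls p Y X (bij_D Y (inv_into X \<sigma>))"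
  by (simp add: FB_db_def ub_cls_def)

lemma free_space_simps: "carrier (free_space S) = {p. Poly_Mapping.keys p \<subseteq> S}"
  "x \<oplus>\<^bsub>free_space S\<^esub> y = x + y" "c \<odot>\<^bsub>free_space S\<^esub> x = fscale c x"
  by (simp_all add: free_space_def)

lemma kFB_simps [simp]: "S \<in> Ob (kFB s) \<longleftrightarrow> finite S \<and> card S = s"
  "Hom (kFB s) X Y = free_space (Bij X Y)"
  by (simp_all add: kFB_def)

lemma Bij_inv: "\<sigma> \<in> Bij X Y \<Longrightarrow> bij_betw (inv_into X \<sigma>) Y X"
  by (auto simp: Bij_def bij_betw_inv_into)

lemma FB_ub_linear:
  assumes "finite X"
  shows "FB_ub p X Y \<in> linear_maps (free_space (Bij X Y)) (Hom (ub p) X Y)"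
  unfolding ub_Hom
proof (rule linear_mapsI)
  fix x :: "(nat \<Rightarrow> nat) \<Rightarrow>\<^sub>0 'a" assume x: "x \<in> carrier (free_space (Bij X Y))"
  show "FB_ub p X Y x \<in> carrier (presented (D X Y) (ub_rels p X Y))"
    unfolding FB_ub_def
    by (rule cls_in_presented, rule keys_lin_ext)
      (use x assms in \<open>auto simp: free_space_simps intro!: bij_D_in_D BijD\<close>)
qed (simp_all add: FB_ub_def presented_add presented_smult free_space_simps lin_ext_add lin_ext_scale)

lemma FB_db_linear:
  assumes "finite Y"
  shows "FB_db p X Y \<in> linear_maps (free_space (Bij X Y)) (Hom (ub p) Y X)"
  unfolding ub_Hom
proof (rule linear_mapsI)
  fix x :: "(nat \<Rightarrow> nat) \<Rightarrow>\<^sub>0 'a" assume x: "x \<in> carrier (free_space (Bij X Y))"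
  show "FB_db p X Y x \<in> carrier (presented (D Y X) (ub_rels p Y X))"
    unfolding FB_db_def
    by (rule cls_in_presented, rule keys_lin_ext)
      (use x assms in \<open>auto simp: free_space_simps intro!: bij_D_in_D Bij_inv\<close>)
qed (simp_all add: FB_db_def presented_add presented_smult free_space_simps lin_ext_add lin_ext_scale)

lemma free_lin_on: assumes "lin_on (free_space S) L" "Poly_Mapping.keys p \<subseteq> S"
  shows "L p = lin_ext (\<lambda>g. L (gen g)) p"
proof -
  have "L (\<Sum>g\<in>A. fscale (c g) (gen g)) = (\<Sum>g\<in>A. fscale (c g) (L (gen g)))" if "finite A" "A \<subseteq> S" for A c
    using that
  proof (induction A)
    case empty
    show ?case using lin_on_smult[OF assms(1), of 0 0] by (simp add: free_space_simps)
  next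
    case (insert x F)
    have "Poly_Mapping.keys (\<Sum>g\<in>F. fscale (c g) (gen g)) \<subseteq> S" "Poly_Mapping.keys (fscale (c x) (gen x)) \<subseteq> S"
      using insert by (auto intro!: keys_sum_subset keys_scale)
    then show ?case using insert lin_on_add[OF assms(1), unfolded free_space_simps] lin_on_smult[OF assms(1), unfolded free_space_simps]
      by simp
  qed
  from this[of "Poly_Mapping.keys p" "Poly_Mapping.lookup p"] show ?thesis
    using assms(2) lin_ext_gen_eq[of p] by (simp add: lin_ext_def)
qed

lemma free_lin_on_eq:
  assumes "lin_on (free_space S) L" "lin_on (free_space S) L'" "\<And>g. g \<in> S \<Longrightarrow> L (gen g) = L' (gen g)"
    "x \<in> carrier (free_space S)"
  shows "L x = L' x"
proof -
  have k: "Poly_Mapping.keys x \<subseteq> S" using assms(4) by (simp add: free_space_simps)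
  show ?thesis unfolding free_lin_on[OF assms(1) k] free_lin_on[OF assms(2) k]
    by (rule lin_ext_cong) (use k assms(3) in auto)
qed

lemma db_simps [simp]: "Hom (db q) X Y = Hom (ub q) Y X" "Cmp (db q) X Y Z g f = Cmp (ub q) Z Y X f g"
  "X \<in> Ob (db q) \<longleftrightarrow> finite X" "Idn (db q) = Idn (ub q)"
  by (simp_all add: db_def opposite_def)

subsection \<open>Duals\<close>

lemma scalars_simps [simp]: "carrier scalars = UNIV" "x \<oplus>\<^bsub>scalars\<^esub> y = x + y" "c \<odot>\<^bsub>scalars\<^esub> x = c * x"
  by (simp_all add: scalars_def)

lemma dual_carrier: "\<phi> \<in> carrier (dual V) \<longleftrightarrow> \<phi> \<in> linear_maps V scalars \<and> \<phi> \<in> extensional (carrier V)"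
  by (simp add: dual_def)

lemma dual_add: "\<phi> \<oplus>\<^bsub>dual V\<^esub> \<psi> = (\<lambda>x\<in>carrier V. \<phi> x + \<psi> x)"
  and dual_smult: "c \<odot>\<^bsub>dual V\<^esub> \<phi> = (\<lambda>x\<in>carrier V. c * \<phi> x)"
  by (simp_all add: dual_def)

lemma dual_restrict: "closed_space V \<Longrightarrow> f \<in> linear_maps V scalars \<Longrightarrow> (\<lambda>x\<in>carrier V. f x) \<in> carrier (dual V)"
  by (auto simp: dual_carrier intro: linear_maps_cong[of V f])

lemma closed_dual: "closed_space V \<Longrightarrow> closed_space (dual V)"
  unfolding closed_space_def[of "dual V"]
  by (auto simp: dual_add dual_smult linear_maps_def dual_carrier algebra_simps closed_add closed_smult
      intro!: dual_restrict)

lemma dual_right_simps: "At (dual_right A X) Y = dual (Hom A X Y)"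
  "Act (dual_right A X) Y' Y a \<phi> = (\<lambda>f\<in>carrier (Hom A X Y). \<phi> (Cmp A X Y Y' a f))"
  by (simp_all add: dual_right_def)

text \<open>Elements of a dual are extensional, so linearity of a map into it can be tested
  pointwise on \<open>carrier W\<close>.\<close>

lemma dual_mapsI:
  assumes "\<And>\<phi>. \<phi> \<in> carrier V \<Longrightarrow> F \<phi> \<in> carrier (dual W)"
    "\<And>x \<phi> \<psi>. x \<in> carrier W \<Longrightarrow> \<phi> \<in> carrier V \<Longrightarrow> \<psi> \<in> carrier V \<Longrightarrow> F (\<phi> \<oplus>\<^bsub>V\<^esub> \<psi>) x = F \<phi> x + F \<psi> x"
    "\<And>x c \<phi>. x \<in> carrier W \<Longrightarrow> \<phi> \<in> carrier V \<Longrightarrow> F (c \<odot>\<^bsub>V\<^esub> \<phi>) x = c * F \<phi> x" and V: "closed_space V"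
  shows "F \<in> linear_maps V (dual W)"
proof (rule linear_mapsI)
  fix x y assume xy: "x \<in> carrier V" "y \<in> carrier V"
  show "F (x \<oplus>\<^bsub>V\<^esub> y) = F x \<oplus>\<^bsub>dual W\<^esub> F y" unfolding dual_add
    by (rule extensionalityI[of _ "carrier W"])
      (use assms(1)[OF closed_add[OF V xy]] assms(2) xy in \<open>auto simp: dual_carrier\<close>)
next
  fix c x assume x: "x \<in> carrier V"
  show "F (c \<odot>\<^bsub>V\<^esub> x) = c \<odot>\<^bsub>dual W\<^esub> F x" unfolding dual_smult
    by (rule extensionalityI[of _ "carrier W"])
      (use assms(1)[OF closed_smult[OF V x]] assms(3) x in \<open>auto simp: dual_carrier\<close>)
qed (rule assms(1))

lemma dual_act_in:
  assumes X: "finite X" and a: "a \<in> carrier (Hom (ub p) Y Y')" and \<phi>: "\<phi> \<in> carrier (dual (Hom (ub p) X Y'))"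
  shows "Act (dual_right (ub p) X) Y' Y a \<phi> \<in> carrier (dual (Hom (ub p) X Y))"
  unfolding dual_right_simps
  by (rule dual_restrict[OF ub_closed], rule linear_maps_comp[OF _ ub_Cmp_linear2[OF X a]]) (use \<phi> in \<open>simp add: dual_carrier\<close>)

lemma dual_act_linear1:
  assumes X: "finite X" and a: "a \<in> carrier (Hom (ub p) Y Y')"
  shows "Act (dual_right (ub p) X) Y' Y a \<in> linear_maps (dual (Hom (ub p) X Y')) (dual (Hom (ub p) X Y))"
  by (rule dual_mapsI)
    (simp_all add: dual_act_in[OF assms] closed_dual ub_closed, simp_all add: dual_right_simps dual_add dual_smult ub_Cmp_in[OF X _ a])

lemma dual_act_linear2:
  fixes \<phi> :: "'k::field ubmor \<Rightarrow> 'k"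
  assumes X: "finite X" and \<phi>: "\<phi> \<in> carrier (dual (Hom (ub p) X Y'))"
  shows "(\<lambda>a. Act (dual_right (ub p) X) Y' Y a \<phi>) \<in> linear_maps (Hom (ub p) Y Y') (dual (Hom (ub p) X Y))"
proof (rule dual_mapsI)
  have p: "\<phi> \<in> linear_maps (Hom (ub p) X Y') scalars" using \<phi> by (simp add: dual_carrier)
  fix f :: "'k ubmor" assume f: "f \<in> carrier (Hom (ub p) X Y)"
  note l = linear_maps_comp[OF p ub_Cmp_linear1[OF X f]]
  show "Act (dual_right (ub p) X) Y' Y (a \<oplus>\<^bsub>Hom (ub p) Y Y'\<^esub> b) \<phi> f =
    Act (dual_right (ub p) X) Y' Y a \<phi> f + Act (dual_right (ub p) X) Y' Y b \<phi> f"
    if "a \<in> carrier (Hom (ub p) Y Y')" "b \<in> carrier (Hom (ub p) Y Y')" for a b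
    using linear_maps_add[OF l that] f by (simp add: dual_right_simps)
  show "Act (dual_right (ub p) X) Y' Y (c \<odot>\<^bsub>Hom (ub p) Y Y'\<^esub> a) \<phi> f = c * Act (dual_right (ub p) X) Y' Y a \<phi> f"
    if "a \<in> carrier (Hom (ub p) Y Y')" for a c
    using linear_maps_smult[OF l that] f by (simp add: dual_right_simps)
qed (simp_all add: dual_act_in[OF X _ \<phi>] ub_closed)

lemma dual_act_comp:
  assumes X: "finite X" and Y: "finite Y" and a: "a \<in> carrier (Hom (ub p) Y Y')" and b: "b \<in> carrier (Hom (ub p) Y' Y'')"
  shows "Act (dual_right (ub p) X) Y' Y a (Act (dual_right (ub p) X) Y'' Y' b \<phi>) =
    Act (dual_right (ub p) X) Y'' Y (Cmp (ub p) Y Y' Y'' b a) \<phi>"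
  unfolding dual_right_simps
  by (rule restrict_ext) (simp add: ub_Cmp_in[OF X _ a] ub_Cmp_assoc[OF X Y _ a b])

lemma dual_act_id:
  assumes X: "finite X" and Y: "finite Y" and \<phi>: "\<phi> \<in> carrier (dual (Hom (ub p) X Y))"
  shows "Act (dual_right (ub p) X) Y Y (idm p Y) \<phi> = \<phi>"
  unfolding dual_right_simps
  by (rule extensionalityI[of _ "carrier (Hom (ub p) X Y)"])
    (use \<phi> in \<open>auto simp: dual_carrier ub_Cmp_id_left[OF X Y]\<close>)

lemma dual_eqI:
  fixes \<phi> \<psi> :: "'k::field ubmor \<Rightarrow> 'k"
  assumes "\<phi> \<in> carrier (dual (Hom (ub p) X Y))" "\<psi> \<in> carrier (dual (Hom (ub p) X Y))"
    "\<And>f. f \<in> D X Y \<Longrightarrow> \<phi> (ub_cls p X Y f) = \<psi> (ub_cls p X Y f)"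
  shows "\<phi> = \<psi>"
proof (rule extensionalityI[of _ "carrier (Hom (ub p) X Y)"])
  fix x :: "'k ubmor" assume x: "x \<in> carrier (Hom (ub p) X Y)"
  \<comment> \<open>A scalar is regarded as a vector of the free space on the single generator
    \<open>()\<close>, which brings functionals under the lemmas on \<open>lin_on\<close>.\<close>
  have l: "lin_on (Hom (ub p) X Y) (\<lambda>x. Poly_Mapping.single () (\<chi> x))" if "\<chi> \<in> carrier (dual (Hom (ub p) X Y))" for \<chi> :: "'k ubmor \<Rightarrow> 'k"
    using that by (intro lin_onI) (auto simp: dual_carrier linear_maps_def single_add intro!: poly_mapping_eqI simp: lookup_single when_def)
  have "Poly_Mapping.single () (\<phi> x) = Poly_Mapping.single () (\<psi> x)"
    by (rule ub_lin_on_eq[OF l[OF assms(1)] l[OF assms(2)] _ x]) (simp add: assms(3))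
  then show "\<phi> x = \<psi> x" by (metis lookup_single_eq)
qed (use assms in \<open>auto simp: dual_carrier\<close>)

text \<open>The functional with prescribed values \<open>h\<close> on diagrams, provided that
  \<open>h\<close> transforms by the character. The one-generator free space again plays the role of
  the field, to make \<open>plift\<close> applicable.\<close>

definition dual_fun :: "polarities \<Rightarrow> nat set \<Rightarrow> nat set \<Rightarrow> ((nat + nat \<Rightarrow> nat) \<Rightarrow> 'k::field) \<Rightarrow> 'k ubmor \<Rightarrow> 'k" where
  "dual_fun p X Y h = (\<lambda>x\<in>carrier (Hom (ub p) X Y). Poly_Mapping.lookup (plift (lin_ext (\<lambda>f. Poly_Mapping.single () (h f))) x) ())"

context
  fixes h :: "(nat + nat \<Rightarrow> nat) \<Rightarrow> 'k::field" and p X Y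
  assumes equivariant: "\<And>f \<sigma>. f \<in> D X Y \<Longrightarrow> \<sigma> \<in> wreath (pairs_of X Y) \<Longrightarrow>
    h (f \<circ> map_sum id \<sigma>) = of_int (character p \<sigma>) * h f"
begin

lemma dual_fun_rels: "r \<in> ub_rels p X Y \<Longrightarrow> lin_ext (\<lambda>f. Poly_Mapping.single () (h f)) r = 0"
  unfolding ub_rels_def
  by (auto simp: lin_ext_diff lin_ext_scale equivariant intro!: poly_mapping_eqI simp: lookup_minus lookup_single when_def
      simp del: id_apply)

lemma dual_fun_in: "dual_fun p X Y h \<in> carrier (dual (Hom (ub p) X Y))"
proof -
  have l: "lin_on (Hom (ub p) X Y) (plift (lin_ext (\<lambda>f. Poly_Mapping.single () (h f))))"
    unfolding ub_Hom by (rule lin_on_plift[OF dual_fun_rels flin_lin_ext])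
  show ?thesis unfolding dual_fun_def
    by (rule dual_restrict[OF ub_closed])
       (auto simp: linear_maps_def lin_on_add[OF l] lin_on_smult[OF l] lookup_add)
qed

lemma dual_fun_cls: "f \<in> D X Y \<Longrightarrow> dual_fun p X Y h (ub_cls p X Y f) = h f"
proof -
  assume f: "f \<in> D X Y"
  have "(ub_cls p X Y f :: 'k ubmor) \<in> carrier (Hom (ub p) X Y)" by (rule ub_cls_in[OF f])
  then have "dual_fun p X Y h (ub_cls p X Y f) =
    Poly_Mapping.lookup (plift (lin_ext (\<lambda>f. Poly_Mapping.single () (h f))) (ub_cls p X Y f)) ()"
    unfolding dual_fun_def by (rule restrict_apply')
  also have "plift (lin_ext (\<lambda>f. Poly_Mapping.single () (h f))) (ub_cls p X Y f) =
      lin_ext (\<lambda>f. Poly_Mapping.single () (h f)) (gen f)"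
    unfolding ub_cls_def by (rule plift_cls[OF flin_lin_ext]) (rule dual_fun_rels)
  finally show ?thesis by simp
qed

end

lemma dual_equivariant:
  fixes \<phi> :: "'k::field ubmor \<Rightarrow> 'k"
  assumes "\<phi> \<in> carrier (dual (Hom (ub p) X Y))" "f \<in> D X Y" "\<sigma> \<in> wreath (pairs_of X Y)"
  shows "\<phi> (ub_cls p X Y (f \<circ> map_sum id \<sigma>)) = of_int (character p \<sigma>) * \<phi> (ub_cls p X Y f)"
proof -
  have "\<phi> \<in> linear_maps (Hom (ub p) X Y) scalars" using assms(1) by (simp add: dual_carrier)
  from linear_maps_smult[OF this ub_cls_in[OF assms(2)], of "of_int (character p \<sigma>)"]
  show ?thesis unfolding ub_cls_act[OF assms(2,3)] by simp
qed

section \<open>Pure tensors and functoriality of tensor products\<close>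

lemma tensor_genI: "Y \<in> Ob A \<Longrightarrow> n \<in> carrier (At N Y) \<Longrightarrow> m \<in> carrier (At M Y) \<Longrightarrow> (Y, n, m) \<in> tensor_gens A N M"
  by (simp add: tensor_gens_def)

lemma tensor_cls_in: "Y \<in> Ob A \<Longrightarrow> n \<in> carrier (At N Y) \<Longrightarrow> m \<in> carrier (At M Y) \<Longrightarrow>
  cls (tensor_rels A N M) (gen (Y, n, m)) \<in> carrier (tensor A N M)"
  unfolding tensor_def by (intro cls_gen_in_presented tensor_genI)

lemma tensor_lin_on_eq:
  assumes "lin_on (tensor A N M) L" "lin_on (tensor A N M) L'"
    "\<And>Y n m. Y \<in> Ob A \<Longrightarrow> n \<in> carrier (At N Y) \<Longrightarrow> m \<in> carrier (At M Y) \<Longrightarrow>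
      L (cls (tensor_rels A N M) (gen (Y, n, m))) = L' (cls (tensor_rels A N M) (gen (Y, n, m)))"
    "x \<in> carrier (tensor A N M)"
  shows "L x = L' x"
  by (rule lin_on_eq[OF assms(1,2)[unfolded tensor_def] _ assms(4)[unfolded tensor_def]])
    (auto simp: tensor_gens_def intro: assms(3))

lemma tensor_maps_eq:
  assumes "f \<in> linear_maps (tensor A N M) (presented S R)" "g \<in> linear_maps (tensor A N M) (presented S R)"
    "\<And>Y n m. Y \<in> Ob A \<Longrightarrow> n \<in> carrier (At N Y) \<Longrightarrow> m \<in> carrier (At M Y) \<Longrightarrow>
      f (cls (tensor_rels A N M) (gen (Y, n, m))) = g (cls (tensor_rels A N M) (gen (Y, n, m)))"
    "x \<in> carrier (tensor A N M)"
  shows "f x = g x"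
  by (rule linear_maps_eq[OF assms(1,2)[unfolded tensor_def] _ assms(4)[unfolded tensor_def]])
    (clarsimp simp: tensor_gens_def assms(3))

lemma tensor_left_linear:
  assumes "Y \<in> Ob A" "m \<in> carrier (At M Y)"
  shows "(\<lambda>n. cls (tensor_rels A N M) (gen (Y, n, m))) \<in> linear_maps (At N Y) (tensor A N M)"
proof (rule linear_mapsI)
  fix x y assume "x \<in> carrier (At N Y)" "y \<in> carrier (At N Y)"
  then show "cls (tensor_rels A N M) (gen (Y, x \<oplus>\<^bsub>At N Y\<^esub> y, m)) =
    cls (tensor_rels A N M) (gen (Y, x, m)) \<oplus>\<^bsub>tensor A N M\<^esub> cls (tensor_rels A N M) (gen (Y, y, m))"
    unfolding tensor_def presented_add cls_eq_iff nf_add by (intro tensor_add1 assms)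
next
  fix c x assume "x \<in> carrier (At N Y)"
  then show "cls (tensor_rels A N M) (gen (Y, c \<odot>\<^bsub>At N Y\<^esub> x, m)) =
    c \<odot>\<^bsub>tensor A N M\<^esub> cls (tensor_rels A N M) (gen (Y, x, m))"
    unfolding tensor_def presented_smult cls_eq_iff nf_scale by (intro tensor_smult1 assms)
qed (rule tensor_cls_in[OF assms(1) _ assms(2)])

lemma tensor_right_linear:
  assumes "Y \<in> Ob A" "n \<in> carrier (At N Y)"
  shows "(\<lambda>m. cls (tensor_rels A N M) (gen (Y, n, m))) \<in> linear_maps (At M Y) (tensor A N M)"
proof (rule linear_mapsI)
  fix x y assume "x \<in> carrier (At M Y)" "y \<in> carrier (At M Y)"
  then show "cls (tensor_rels A N M) (gen (Y, n, x \<oplus>\<^bsub>At M Y\<^esub> y)) =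
    cls (tensor_rels A N M) (gen (Y, n, x)) \<oplus>\<^bsub>tensor A N M\<^esub> cls (tensor_rels A N M) (gen (Y, n, y))"
    unfolding tensor_def presented_add cls_eq_iff nf_add by (intro tensor_add2 assms)
next
  fix c x assume "x \<in> carrier (At M Y)"
  then show "cls (tensor_rels A N M) (gen (Y, n, c \<odot>\<^bsub>At M Y\<^esub> x)) =
    c \<odot>\<^bsub>tensor A N M\<^esub> cls (tensor_rels A N M) (gen (Y, n, x))"
    unfolding tensor_def presented_smult cls_eq_iff nf_scale by (intro tensor_smult2 assms)
qed (rule tensor_cls_in[OF assms(1,2)])

locale tensor_functor1 =
  fixes A :: "('o, 'k::field, 'm) lincat" and L :: "('o, 'k, 'm, 'l) catmod" and N :: "('o, 'k, 'm, 'n) catmod"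
    and M :: "('o, 'k, 'm, 'v) catmod" and h :: "'o \<Rightarrow> 'l \<Rightarrow> 'n"
  assumes lin: "Y \<in> Ob A \<Longrightarrow> h Y \<in> linear_maps (At L Y) (At N Y)"
    and equiv: "Y \<in> Ob A \<Longrightarrow> Y' \<in> Ob A \<Longrightarrow> a \<in> carrier (Hom A Y Y') \<Longrightarrow> l \<in> carrier (At L Y') \<Longrightarrow>
      h Y (Act L Y' Y a l) = Act N Y' Y a (h Y' l)"
    and act: "Y \<in> Ob A \<Longrightarrow> Y' \<in> Ob A \<Longrightarrow> a \<in> carrier (Hom A Y Y') \<Longrightarrow> m \<in> carrier (At M Y) \<Longrightarrow> Act M Y Y' a m \<in> carrier (At M Y')"
begin

lemma rels: "r \<in> tensor_rels A L M \<Longrightarrow> nf (tensor_rels A N M) (lin_ext (\<lambda>(Y, n, m). gen (Y, h Y n, m)) r) = 0"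
  by (rule tensor_map1_rels[OF lin equiv act])

lemma map_linear: "tensor_map1 (tensor_rels A N M) h \<in> linear_maps (tensor A L M) (tensor A N M)"
  unfolding tensor_map1_def tensor_def
  by (rule induced_linear[OF rels]) (auto simp: tensor_gens_def linear_maps_mem[OF lin])

lemma map_cls: "tensor_map1 (tensor_rels A N M) h (cls (tensor_rels A L M) (gen (Y, n, m))) =
  cls (tensor_rels A N M) (gen (Y, h Y n, m))"
  unfolding tensor_map1_def by (subst induced_cls[OF rels]) simp_all

end

locale tensor_functor2 =
  fixes A :: "('o, 'k::field, 'm) lincat" and N :: "('o, 'k, 'm, 'n) catmod" and L :: "('o, 'k, 'm, 'l) catmod"
    and M :: "('o, 'k, 'm, 'v) catmod" and h :: "'o \<Rightarrow> 'l \<Rightarrow> 'v"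
  assumes lin: "Y \<in> Ob A \<Longrightarrow> h Y \<in> linear_maps (At L Y) (At M Y)"
    and equiv: "Y \<in> Ob A \<Longrightarrow> Y' \<in> Ob A \<Longrightarrow> a \<in> carrier (Hom A Y Y') \<Longrightarrow> l \<in> carrier (At L Y) \<Longrightarrow>
      h Y' (Act L Y Y' a l) = Act M Y Y' a (h Y l)"
    and act: "Y \<in> Ob A \<Longrightarrow> Y' \<in> Ob A \<Longrightarrow> a \<in> carrier (Hom A Y Y') \<Longrightarrow> m \<in> carrier (At N Y') \<Longrightarrow> Act N Y' Y a m \<in> carrier (At N Y)"
begin

lemma rels: "r \<in> tensor_rels A N L \<Longrightarrow> nf (tensor_rels A N M) (lin_ext (\<lambda>(Y, n, m). gen (Y, n, h Y m)) r) = 0"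
  by (rule tensor_map2_rels[OF lin equiv act])

lemma map_linear: "tensor_map2 (tensor_rels A N M) h \<in> linear_maps (tensor A N L) (tensor A N M)"
  unfolding tensor_map2_def tensor_def
  by (rule induced_linear[OF rels]) (auto simp: tensor_gens_def linear_maps_mem[OF lin])

lemma map_cls: "tensor_map2 (tensor_rels A N M) h (cls (tensor_rels A N L) (gen (Y, n, m))) =
  cls (tensor_rels A N M) (gen (Y, n, h Y m))"
  unfolding tensor_map2_def by (subst induced_cls[OF rels]) simp_all

end

subsection \<open>The Koszul bimodules\<close>

lemma FB_simps: "At (ub_FB p U) S = Hom (ub p) S U"
  "Act (ub_FB p U) S' S a f = Cmp (ub p) S S' U f (FB_ub p S S' a)"
  "At (db_FB q X) S = Hom (ub q) S X"
  "Act (db_FB q X) S S' a g = Cmp (ub q) S' S X g (FB_db q S S' a)"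
  by (simp_all add: ub_FB_def db_FB_def)

lemma FB_ub_in: "finite S \<Longrightarrow> a \<in> carrier (free_space (Bij S S')) \<Longrightarrow> FB_ub p S S' a \<in> carrier (Hom (ub p) S S')"
  by (rule linear_maps_mem[OF FB_ub_linear])

lemma FB_db_in: "finite S' \<Longrightarrow> a \<in> carrier (free_space (Bij S S')) \<Longrightarrow> FB_db p S S' a \<in> carrier (Hom (ub p) S' S)"
  by (rule linear_maps_mem[OF FB_db_linear])

lemma koszul_ract_functor:
  assumes "a \<in> carrier (Hom (ub q) X X')"
  shows "tensor_functor2 (kFB s) (ub_FB p U) (db_FB q X) (db_FB q X') (\<lambda>S g. Cmp (db q) X' X S g a)"
  by unfold_locales
    (use assms in \<open>auto simp: FB_simps ub_Cmp_assoc FB_db_in FB_ub_in intro!: ub_Cmp_linear2 ub_Cmp_in\<close>)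

lemma koszul_lact_functor:
  assumes "b \<in> carrier (Hom (ub p) U U')"
  shows "tensor_functor1 (kFB s) (ub_FB p U) (ub_FB p U') (db_FB q X) (\<lambda>S f. Cmp (ub p) S U U' b f)"
  by unfold_locales
    (use assms in \<open>auto simp: FB_simps ub_Cmp_assoc FB_db_in FB_ub_in intro!: ub_Cmp_linear2 ub_Cmp_in\<close>)

lemma koszul_ract_linear: "a \<in> carrier (Hom (ub q) X X') \<Longrightarrow>
  koszul_ract p q s U X X' a \<in> linear_maps (koszul p q s U X) (koszul p q s U X')"
  unfolding koszul_ract_def koszul_rels_def koszul_def by (rule tensor_functor2.map_linear[OF koszul_ract_functor])

lemma koszul_ract_cls: "a \<in> carrier (Hom (ub q) X X') \<Longrightarrow>
  koszul_ract p q s U X X' a (cls (koszul_rels p q s U X) (gen (S, f, g))) =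
  cls (koszul_rels p q s U X') (gen (S, f, Cmp (ub q) S X X' a g))"
proof -
  assume a: "a \<in> carrier (Hom (ub q) X X')"
  show ?thesis unfolding koszul_ract_def koszul_rels_def tensor_functor2.map_cls[OF koszul_ract_functor[OF a]] by simp
qed

lemma koszul_lact_linear: "b \<in> carrier (Hom (ub p) U U') \<Longrightarrow>
  koszul_lact p q s X U U' b \<in> linear_maps (koszul p q s U X) (koszul p q s U' X)"
  unfolding koszul_lact_def koszul_rels_def koszul_def by (rule tensor_functor1.map_linear[OF koszul_lact_functor])

lemma koszul_lact_cls: "b \<in> carrier (Hom (ub p) U U') \<Longrightarrow>
  koszul_lact p q s X U U' b (cls (koszul_rels p q s U X) (gen (S, f, g))) =
  cls (koszul_rels p q s U' X) (gen (S, Cmp (ub p) S U U' b f, g))"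
  unfolding koszul_lact_def koszul_rels_def by (rule tensor_functor1.map_cls[OF koszul_lact_functor])

lemma koszul_maps_eq:
  assumes "f \<in> linear_maps (koszul p q s U X) (koszul p q s' U' X')" "g \<in> linear_maps (koszul p q s U X) (koszul p q s' U' X')"
    "\<And>S F G. finite S \<Longrightarrow> card S = s \<Longrightarrow> F \<in> carrier (Hom (ub p) S U) \<Longrightarrow> G \<in> carrier (Hom (ub q) S X) \<Longrightarrow>
      f (cls (koszul_rels p q s U X) (gen (S, F, G))) = g (cls (koszul_rels p q s U X) (gen (S, F, G)))"
    "x \<in> carrier (koszul p q s U X)"
  shows "f x = g x"
  using tensor_maps_eq[OF assms(1,2)[unfolded koszul_def tensor_def[of _ _ "db_FB q X'"]] _ assms(4)[unfolded koszul_def]]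
    assms(3) unfolding koszul_rels_def by (simp add: FB_simps)

definition ordered_pairs :: "nat set \<Rightarrow> (nat \<times> nat) set" where
  "ordered_pairs S = {(i, j). i \<in> S \<and> j \<in> S \<and> i < j}"

lemma finite_ordered_pairs [simp]: "finite S \<Longrightarrow> finite (ordered_pairs S)"
  by (rule finite_subset[of _ "S \<times> S"]) (auto simp: ordered_pairs_def)

text \<open>A bijection of subsets of \<open>nat\<close> need not be monotone. Symmetry of
  \<open>F\<close> makes the sum one over unordered pairs, and the two witnesses restore the order
  of each pair.\<close>

lemma sum_ordered_pairs_bij:
  assumes s: "bij_betw \<sigma> S S'"
    and F: "\<And>i j. i \<in> S' \<Longrightarrow> j \<in> S' \<Longrightarrow> i \<noteq> j \<Longrightarrow> F i j = F j i"
  shows "(\<Sum>(i, j)\<in>ordered_pairs S. F (\<sigma> i) (\<sigma> j)) = (\<Sum>(i, j)\<in>ordered_pairs S'. F i j)"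
proof -
  let ?\<tau> = "inv_into S \<sigma>"
  have t: "\<And>y. y \<in> S' \<Longrightarrow> \<sigma> (?\<tau> y) = y" "\<And>x. x \<in> S \<Longrightarrow> ?\<tau> (\<sigma> x) = x"
    "\<And>y. y \<in> S' \<Longrightarrow> ?\<tau> y \<in> S" "\<And>x. x \<in> S \<Longrightarrow> \<sigma> x \<in> S'"
    using s bij_betw_inv_into_right[OF s] bij_betw_inv_into_left[OF s] bij_betwE[OF s] bij_betwE[OF bij_betw_inv_into[OF s]]
    by blast+
  have si: "\<sigma> x = \<sigma> y \<longleftrightarrow> x = y" if "x \<in> S" "y \<in> S" for x y using t(2) that by metis
  have ti: "?\<tau> x = ?\<tau> y \<longleftrightarrow> x = y" if "x \<in> S'" "y \<in> S'" for x y using t(1) that by metis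
  show ?thesis
    by (rule sum.reindex_bij_witness[where j="\<lambda>(i, j). if \<sigma> i < \<sigma> j then (\<sigma> i, \<sigma> j) else (\<sigma> j, \<sigma> i)"
          and i="\<lambda>(i, j). if ?\<tau> i < ?\<tau> j then (?\<tau> i, ?\<tau> j) else (?\<tau> j, ?\<tau> i)"])
      (auto simp: ordered_pairs_def t si ti not_less_iff_gr_or_eq split: if_splits intro!: F)
qed

definition kap :: "polarities \<Rightarrow> polarities \<Rightarrow> nat \<Rightarrow> nat set \<Rightarrow> nat set \<Rightarrow> nat set \<Rightarrow> 'k::field ubmor \<Rightarrow> 'k ubmor
    \<Rightarrow> (nat set \<times> 'k ubmor \<times> 'k ubmor \<Rightarrow>\<^sub>0 'k)" where
  "kap p q s U X S f g = nf (koszul_rels p q s U X) (gen (S, f, g))"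

lemma kap_lin1: "finite S \<Longrightarrow> card S = s \<Longrightarrow> g \<in> carrier (Hom (ub q) S X) \<Longrightarrow>
  lin_on (Hom (ub p) S U) (\<lambda>f. kap p q s U X S f g)"
  using lin_on_tensor1[of S "kFB s" g "db_FB q X" "ub_FB p U"] by (simp add: kap_def koszul_rels_def FB_simps)

lemma kap_lin2: "finite S \<Longrightarrow> card S = s \<Longrightarrow> f \<in> carrier (Hom (ub p) S U) \<Longrightarrow>
  lin_on (Hom (ub q) S X) (\<lambda>g. kap p q s U X S f g)"
  using lin_on_tensor2[of S "kFB s" f "ub_FB p U" "db_FB q X"] by (simp add: kap_def koszul_rels_def FB_simps)

lemma kap_balanced:
  fixes f g :: "'k::field ubmor"
  assumes b: "bij_betw \<sigma> S S'" and S: "finite S" "card S = s"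
    and f: "f \<in> carrier (Hom (ub p) S' U)" and g: "g \<in> carrier (Hom (ub q) S X)"
  shows "kap p q s U X S (Cmp (ub p) S S' U f (ub_cls p S S' (bij_D S \<sigma>))) g =
    kap p q s U X S' f (Cmp (ub q) S' S X g (ub_cls q S' S (bij_D S' (inv_into S \<sigma>))))"
proof -
  \<comment> \<open>Morphisms of \<open>kFB\<close> are extensional, so \<sigma> is restricted
    first; neither its diagram nor \<open>inv_into S \<sigma>\<close> changes.\<close>
  let ?\<sigma> = "restrict \<sigma> S"
  have B: "?\<sigma> \<in> Bij S S'" using b by (simp add: Bij_def)
  have S': "finite S'" "card S' = s" using bij_betw_finite[OF b] bij_betw_same_card[OF b] S by simp_all
  have 1: "bij_D S ?\<sigma> = bij_D S \<sigma>" by (rule bij_D_cong) simp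
  have 2: "inv_into S ?\<sigma> y = inv_into S \<sigma> y" for y
    unfolding inv_into_def by (rule arg_cong[where f=Eps]) (auto simp: fun_eq_iff)
  have 3: "bij_D S' (inv_into S ?\<sigma>) = bij_D S' (inv_into S \<sigma>)" by (rule bij_D_cong) (rule 2)
  show ?thesis
    using tensor_balanced[of S "kFB s" S' "gen ?\<sigma>" f "ub_FB p U" g "db_FB q X"] S S' f g B
    by (simp add: kap_def koszul_rels_def FB_simps free_space_simps FB_ub_gen FB_db_gen 1 3)
qed

text \<open>Turning the chord around changes both tensor factors by the sign of the first polarity.
  These polarities agree, so the signs cancel and the differential may be summed over unordered
  pairs.\<close>

lemma kap_pair_sym:
  fixes f g :: "'k::field_char_0 ubmor"
  assumes pq: "fst p = fst q" and S: "finite S" "card S = s" and ij: "i \<in> S" "j \<in> S" "i \<noteq> j"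
    and f: "f \<in> carrier (Hom (ub p) S U)" and g: "g \<in> carrier (Hom (ub q) S X)"
  shows "kap p q (s - 2) U X (S - {i, j}) (Cmp (ub p) (S - {i, j}) S U f (chord p S i j)) (Cmp (ub q) (S - {i, j}) S X g (chord q S i j)) =
    kap p q (s - 2) U X (S - {j, i}) (Cmp (ub p) (S - {j, i}) S U f (chord p S j i)) (Cmp (ub q) (S - {j, i}) S X g (chord q S j i))"
proof -
  have e: "S - {j, i} = S - {i, j}" by auto
  have F: "finite (S - {i, j})" "card (S - {i, j}) = s - 2" using S card_pair[OF S(1) ij] by auto
  let ?c = "of_int (twist (fst p) (-1)) :: 'k"
  have c: "?c * ?c = 1" by (cases "fst p") auto
  have p: "chord p S i j \<in> carrier (Hom (ub p) (S - {i, j}) S)" and q: "chord q S i j \<in> carrier (Hom (ub q) (S - {i, j}) S)"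
    by (rule chord_in[OF S(1) ij])+
  note fp = ub_Cmp_in[OF F(1) p f] and gq = ub_Cmp_in[OF F(1) q g]
  show ?thesis
    unfolding e chord_swap[OF S(1) ij] linear_maps_smult[OF ub_Cmp_linear2[OF F(1) f] p]
      linear_maps_smult[OF ub_Cmp_linear2[OF F(1) g] q]
    unfolding lin_on_smult[OF kap_lin1[OF F closed_smult[OF ub_closed gq]] fp]
      lin_on_smult[OF kap_lin2[OF F fp] gq] free_vs.scale_scale pq[symmetric] c by simp
qed

definition koszul_sum :: "polarities \<Rightarrow> polarities \<Rightarrow> nat \<Rightarrow> nat set \<Rightarrow> nat set \<Rightarrow> nat set \<Rightarrow> 'k::field ubmor \<Rightarrow> 'k ubmor
    \<Rightarrow> (nat set \<times> 'k ubmor \<times> 'k ubmor \<Rightarrow>\<^sub>0 'k)" where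
  "koszul_sum p q s U X S f g = (\<Sum>(i, j)\<in>ordered_pairs S. kap p q (s - 2) U X (S - {i, j})
     (Cmp (ub p) (S - {i, j}) S U f (chord p S i j)) (Cmp (ub q) (S - {i, j}) S X g (chord q S i j)))"

lemma ordered_pairsD: "(i, j) \<in> ordered_pairs S \<Longrightarrow> i \<in> S \<and> j \<in> S \<and> i \<noteq> j"
  by (auto simp: ordered_pairs_def)

lemma koszul_sum_lin1:
  assumes S: "finite S" "card S = s" and g: "g \<in> carrier (Hom (ub q) S X)"
  shows "lin_on (Hom (ub p) S U) (\<lambda>f. koszul_sum p q s U X S f g)"
  unfolding koszul_sum_def
proof (rule lin_on_sum, clarify)
  fix i j assume "(i, j) \<in> ordered_pairs S"
  then have ij: "i \<in> S" "j \<in> S" "i \<noteq> j" by (auto dest: ordered_pairsD)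
  have F: "finite (S - {i, j})" "card (S - {i, j}) = s - 2" using S card_pair[OF S(1) ij] by auto
  show "lin_on (Hom (ub p) S U) (\<lambda>f. kap p q (s - 2) U X (S - {i, j}) (Cmp (ub p) (S - {i, j}) S U f (chord p S i j))
      (Cmp (ub q) (S - {i, j}) S X g (chord q S i j)))"
    by (rule lin_on_comp[OF kap_lin1[OF F] ub_Cmp_linear1[OF F(1)]])
      (intro ub_Cmp_in F chord_in S ij g)+
qed

lemma koszul_sum_lin2:
  assumes S: "finite S" "card S = s" and f: "f \<in> carrier (Hom (ub p) S U)"
  shows "lin_on (Hom (ub q) S X) (\<lambda>g. koszul_sum p q s U X S f g)"
  unfolding koszul_sum_def
proof (rule lin_on_sum, clarify)
  fix i j assume "(i, j) \<in> ordered_pairs S"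
  then have ij: "i \<in> S" "j \<in> S" "i \<noteq> j" by (auto dest: ordered_pairsD)
  have F: "finite (S - {i, j})" "card (S - {i, j}) = s - 2" using S card_pair[OF S(1) ij] by auto
  show "lin_on (Hom (ub q) S X) (\<lambda>g. kap p q (s - 2) U X (S - {i, j}) (Cmp (ub p) (S - {i, j}) S U f (chord p S i j))
      (Cmp (ub q) (S - {i, j}) S X g (chord q S i j)))"
    by (rule lin_on_comp[OF kap_lin2[OF F] ub_Cmp_linear1[OF F(1)]])
      (intro ub_Cmp_in F chord_in S ij f)+
qed

text \<open>By \<open>chord_natural\<close> a bijection passes through a chord and turns the chord
  (i, j) into its image. What remains is a reindexing of the sum along the bijection, where symmetry
  of the terms is required.\<close>

lemma koszul_sum_balanced:
  fixes f g :: "'k::field_char_0 ubmor"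
  assumes pq: "fst p = fst q" and b: "bij_betw \<sigma> S S'" and S: "finite S" "card S = s"
    and f: "f \<in> carrier (Hom (ub p) S' U)" and g: "g \<in> carrier (Hom (ub q) S X)"
  shows "koszul_sum p q s U X S (Cmp (ub p) S S' U f (ub_cls p S S' (bij_D S \<sigma>))) g =
    koszul_sum p q s U X S' f (Cmp (ub q) S' S X g (ub_cls q S' S (bij_D S' (inv_into S \<sigma>))))"
proof -
  let ?\<tau> = "inv_into S \<sigma>"
  have S': "finite S'" "card S' = s" using bij_betw_finite[OF b] bij_betw_same_card[OF b] S by simp_all
  have b': "bij_betw ?\<tau> S' S" using b by (rule bij_betw_inv_into)
  let ?p = "ub_cls p S S' (bij_D S \<sigma>)" and ?q = "ub_cls q S' S (bij_D S' ?\<tau>)"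
  have p: "?p \<in> carrier (Hom (ub p) S S')" and q: "?q \<in> carrier (Hom (ub q) S' S)"
    by (intro ub_cls_in bij_D_in_D b b' S S')+
  note gq = ub_Cmp_in[OF S'(1) q g]
  let ?F = "\<lambda>i j. kap p q (s - 2) U X (S' - {i, j}) (Cmp (ub p) (S' - {i, j}) S' U f (chord p S' i j))
     (Cmp (ub q) (S' - {i, j}) S' X (Cmp (ub q) S' S X g ?q) (chord q S' i j))"
  have "koszul_sum p q s U X S' f (Cmp (ub q) S' S X g ?q) = (\<Sum>(i, j)\<in>ordered_pairs S'. ?F i j)"
    by (simp add: koszul_sum_def)
  also have "\<dots> = (\<Sum>(i, j)\<in>ordered_pairs S. ?F (\<sigma> i) (\<sigma> j))"
    by (rule sum_ordered_pairs_bij[OF b, symmetric]) (rule kap_pair_sym[OF pq S' _ _ _ f gq])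
  also have "\<dots> = koszul_sum p q s U X S (Cmp (ub p) S S' U f ?p) g"
    unfolding koszul_sum_def
  proof (rule sum.cong[OF refl], clarify)
    fix i j assume "(i, j) \<in> ordered_pairs S"
    then have ij: "i \<in> S" "j \<in> S" "i \<noteq> j" by (auto dest: ordered_pairsD)
    let ?A = "S - {i, j}" and ?A' = "S' - {\<sigma> i, \<sigma> j}"
    have F: "finite ?A" "card ?A = s - 2" using S card_pair[OF S(1) ij] by auto
    have bA: "bij_betw \<sigma> ?A ?A'" by (rule bij_betw_remove_pair[OF b ij(1,2)])
    have sij: "\<sigma> i \<in> S'" "\<sigma> j \<in> S'" "\<sigma> i \<noteq> \<sigma> j"
      using bij_betwE[OF b] ij inj_onD[OF bij_betw_imp_inj_on[OF b]] by blast+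
    have t: "?\<tau> (\<sigma> i) = i" "?\<tau> (\<sigma> j) = j" using ij b by (simp_all add: bij_betw_inv_into_left)
    have F': "finite ?A'" using S' by simp
    have tA: "bij_betw ?\<tau> ?A' ?A" using bij_betw_remove_pair[OF b' sij(1,2)] by (simp add: t)
    have inv: "inv_into ?A \<sigma> y = ?\<tau> y" if y: "y \<in> ?A'" for y
    proof (rule inv_into_f_eq[OF bij_betw_imp_inj_on[OF bA]])
      show "?\<tau> y \<in> ?A" using bij_betwE[OF tA] y by blast
      show "\<sigma> (?\<tau> y) = y" using y by (intro bij_betw_inv_into_right[OF b]) simp
    qed
    have pA: "ub_cls p ?A ?A' (bij_D ?A \<sigma>) \<in> carrier (Hom (ub p) ?A ?A')"
      and qA: "ub_cls q ?A' ?A (bij_D ?A' ?\<tau>) \<in> carrier (Hom (ub q) ?A' ?A)"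
      by (intro ub_cls_in bij_D_in_D bA tA F F')+
    note cp = chord_in[OF S(1) ij, of p] and cq = chord_in[OF S(1) ij, of q]
      and cp' = chord_in[OF S'(1) sij, of p] and cq' = chord_in[OF S'(1) sij, of q]
    have 1: "Cmp (ub p) ?A S U (Cmp (ub p) S S' U f ?p) (chord p S i j) =
      Cmp (ub p) ?A ?A' U (Cmp (ub p) ?A' S' U f (chord p S' (\<sigma> i) (\<sigma> j))) (ub_cls p ?A ?A' (bij_D ?A \<sigma>))"
      by (simp only: ub_Cmp_assoc[OF F(1) S(1) cp p f, symmetric] ub_Cmp_assoc[OF F(1) F' pA cp' f, symmetric]
          chord_natural[OF b S(1) ij])
    have 2: "Cmp (ub q) ?A' S' X (Cmp (ub q) S' S X g ?q) (chord q S' (\<sigma> i) (\<sigma> j)) =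
      Cmp (ub q) ?A' ?A X (Cmp (ub q) ?A S X g (chord q S i j)) (ub_cls q ?A' ?A (bij_D ?A' ?\<tau>))"
      by (simp only: ub_Cmp_assoc[OF F' S'(1) cq' q g, symmetric] ub_Cmp_assoc[OF F' F(1) qA cq g, symmetric]
          chord_natural[OF b' S'(1) sij] t)
    have 3: "bij_D ?A' (inv_into ?A \<sigma>) = bij_D ?A' ?\<tau>" by (rule bij_D_cong) (rule inv)
    show "?F (\<sigma> i) (\<sigma> j) = kap p q (s - 2) U X ?A (Cmp (ub p) ?A S U (Cmp (ub p) S S' U f ?p) (chord p S i j))
       (Cmp (ub q) ?A S X g (chord q S i j))"
      unfolding 1 2
      using kap_balanced[OF bA F ub_Cmp_in[OF F' cp' f] ub_Cmp_in[OF F(1) cq g]]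
      unfolding 3 by simp
  qed
  finally show ?thesis ..
qed

lemma koszul_d_rels:
  fixes r :: "_ \<Rightarrow>\<^sub>0 'k::field_char_0"
  assumes pq: "fst p = fst q" and r: "r \<in> koszul_rels p q s U X"
  shows "lin_ext (\<lambda>(S, f, g). koszul_sum p q s U X S f g) r = 0"
proof (rule tensor_lift[OF _ _ _ r[unfolded koszul_rels_def]], goal_cases)
  case (1 Y m)
  then show ?case by (simp add: FB_simps koszul_sum_lin1)
next
  case (2 Y n)
  then show ?case by (simp add: FB_simps koszul_sum_lin2)
next
  case (3 Y Y' a n m)
  then have Y: "finite Y" "card Y = s" "finite Y'" "card Y' = s" and a: "a \<in> carrier (free_space (Bij Y Y'))"
    and n: "n \<in> carrier (Hom (ub p) Y' U)" and m: "m \<in> carrier (Hom (ub q) Y X)" by (simp_all add: FB_simps)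
  have "koszul_sum p q s U X Y (Cmp (ub p) Y Y' U n (FB_ub p Y Y' a)) m =
    koszul_sum p q s U X Y' n (Cmp (ub q) Y' Y X m (FB_db q Y Y' a))"
  proof (rule free_lin_on_eq[OF _ _ _ a])
    show "lin_on (free_space (Bij Y Y')) (\<lambda>a. koszul_sum p q s U X Y (Cmp (ub p) Y Y' U n (FB_ub p Y Y' a)) m)"
      by (rule lin_on_comp[OF lin_on_comp[OF koszul_sum_lin1[OF Y(1,2) m] ub_Cmp_linear2[OF Y(1) n]] FB_ub_linear[OF Y(1)]])
    show "lin_on (free_space (Bij Y Y')) (\<lambda>a. koszul_sum p q s U X Y' n (Cmp (ub q) Y' Y X m (FB_db q Y Y' a)))"
      by (rule lin_on_comp[OF lin_on_comp[OF koszul_sum_lin2[OF Y(3,4) n] ub_Cmp_linear2[OF Y(3) m]] FB_db_linear[OF Y(3)]])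
    fix \<sigma> assume "\<sigma> \<in> Bij Y Y'"
    then show "koszul_sum p q s U X Y (Cmp (ub p) Y Y' U n (FB_ub p Y Y' (gen \<sigma>))) m =
      koszul_sum p q s U X Y' n (Cmp (ub q) Y' Y X m (FB_db q Y Y' (gen \<sigma>)))"
      unfolding FB_ub_gen FB_db_gen by (intro koszul_sum_balanced pq Y n m BijD)
  qed
  then show ?case by (simp add: FB_simps)
qed

definition koszul_raw :: "polarities \<Rightarrow> polarities \<Rightarrow> nat set \<Rightarrow> nat set \<Rightarrow> nat set \<times> 'k::field ubmor \<times> 'k ubmor
    \<Rightarrow> (nat set \<times> 'k ubmor \<times> 'k ubmor \<Rightarrow>\<^sub>0 'k)" where
  "koszul_raw p q U X = (\<lambda>(S, f, g). \<Sum>(i, j)\<in>ordered_pairs S.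
        gen (S - {i, j}, Cmp (ub p) (S - {i, j}) S U f (chord p S i j), Cmp (ub q) (S - {i, j}) S X g (chord q S i j)))"

lemma koszul_raw_nf: "nf (koszul_rels p q (s - 2) U X) (koszul_raw p q U X (S, f, g)) = koszul_sum p q s U X S f g"
  by (simp add: koszul_raw_def koszul_sum_def kap_def nf_sum case_prod_unfold)

lemma koszul_d_raw: "koszul_d p q s U X = induced (koszul_rels p q (s - 2) U X) (koszul_raw p q U X)"
  by (simp add: koszul_d_def koszul_raw_def ordered_pairs_def)

lemma koszul_d_rels':
  fixes r :: "_ \<Rightarrow>\<^sub>0 'k::field_char_0"
  assumes pq: "fst p = fst q" and r: "r \<in> koszul_rels p q s U X"
  shows "nf (koszul_rels p q (s - 2) U X) (lin_ext (koszul_raw p q U X) r) = 0"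
proof -
  have "nf (koszul_rels p q (s - 2) U X) (lin_ext (koszul_raw p q U X) r) =
    lin_ext (\<lambda>(S, f, g). koszul_sum p q s U X S f g) r"
    unfolding nf_lin_ext by (rule lin_ext_cong) (auto simp: koszul_raw_nf)
  then show ?thesis by (simp add: koszul_d_rels[OF assms])
qed

lemma keys_koszul_raw:
  assumes "(S, f, g) \<in> tensor_gens (kFB s) (ub_FB p U) (db_FB q X)"
  shows "Poly_Mapping.keys (koszul_raw p q U X (S, f, g)) \<subseteq> tensor_gens (kFB (s - 2)) (ub_FB p U) (db_FB q X)"
  unfolding koszul_raw_def prod.case
proof (rule keys_sum_subset, goal_cases)
  case (1 x)
  obtain i j where xij: "x = (i, j)" by (cases x)
  have S: "finite S" "card S = s" and f: "f \<in> carrier (Hom (ub p) S U)" and g: "g \<in> carrier (Hom (ub q) S X)"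
    using assms by (auto simp: tensor_gens_def FB_simps)
  have ij: "i \<in> S" "j \<in> S" "i \<noteq> j" using 1 unfolding xij by (auto dest: ordered_pairsD)
  have F: "finite (S - {i, j})" "card (S - {i, j}) = s - 2" using S card_pair[OF S(1) ij] by auto
  show ?case
    using F ub_Cmp_in[OF F(1) chord_in[OF S(1) ij] f] ub_Cmp_in[OF F(1) chord_in[OF S(1) ij] g]
    unfolding xij by (simp add: tensor_gens_def FB_simps)
qed

lemma koszul_d_linear:
  fixes p q :: polarities
  assumes pq: "fst p = fst q"
  shows "(koszul_d p q s U X :: 'k::field_char_0 koszul \<Rightarrow> _) \<in> linear_maps (koszul p q s U X) (koszul p q (s - 2) U X)"
  unfolding koszul_d_raw koszul_def tensor_def koszul_rels_def[symmetric]
proof (rule induced_linear[OF koszul_d_rels'[OF pq]])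
  fix y assume "y \<in> tensor_gens (kFB s) (ub_FB p U) (db_FB q X :: (nat set, 'k, _, 'k ubmor) catmod)"
  then show "Poly_Mapping.keys (koszul_raw p q U X y) \<subseteq> tensor_gens (kFB (s - 2)) (ub_FB p U) (db_FB q X)"
    using keys_koszul_raw by (cases y) blast
qed

lemma koszul_d_cls:
  fixes f :: "'k::field_char_0 ubmor"
  assumes "fst p = fst q"
  shows "koszul_d p q s U X (cls (koszul_rels p q s U X) (gen (S, f, g))) =
    cls (koszul_rels p q (s - 2) U X) (koszul_raw p q U X (S, f, g))"
  unfolding koszul_d_raw by (subst induced_cls[OF koszul_d_rels'[OF assms]]) simp_all

text \<open>Serves to apply a map given on pure tensors to the sums produced by
  \<open>koszul_raw\<close>. The argument passes through \<open>val\<close>, as a carrier has no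
  finite sums of its own.\<close>

lemma val_koszul_map_sum:
  assumes "F \<in> linear_maps (koszul p q s U X) (koszul p q s U' X')"
    "\<And>S f g. finite S \<Longrightarrow> card S = s \<Longrightarrow> f \<in> carrier (Hom (ub p) S U) \<Longrightarrow> g \<in> carrier (Hom (ub q) S X) \<Longrightarrow>
      F (cls (koszul_rels p q s U X) (gen (S, f, g))) = cls (koszul_rels p q s U' X') (gen (S, a S f, b S g))"
    and "finite A"
    and "\<And>x. x \<in> A \<Longrightarrow> finite (S x) \<and> card (S x) = s \<and> f x \<in> carrier (Hom (ub p) (S x) U) \<and> g x \<in> carrier (Hom (ub q) (S x) X)"
  shows "F (cls (koszul_rels p q s U X) (\<Sum>x\<in>A. gen (S x, f x, g x))) =
    cls (koszul_rels p q s U' X') (\<Sum>x\<in>A. gen (S x, a (S x) (f x), b (S x) (g x)))"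
proof -
  let ?R = "koszul_rels p q s U X" and ?R' = "koszul_rels p q s U' X'"
  let ?G = "tensor_gens (kFB s) (ub_FB p U) (db_FB q X)"
  have k: "Poly_Mapping.keys (\<Sum>x\<in>A. gen (S x, f x, g x)) \<subseteq> ?G"
    by (rule keys_sum_subset) (use assms(4) in \<open>auto simp: tensor_gens_def FB_simps\<close>)
  have F: "F \<in> linear_maps (presented ?G ?R) (presented (tensor_gens (kFB s) (ub_FB p U') (db_FB q X')) ?R')"
    using assms(1) by (simp add: koszul_def tensor_def koszul_rels_def)
  have L: "lin_on (presented ?G ?R) (\<lambda>x. val ?R' (F x))" by (rule lin_on_comp[OF lin_on_val F])
  have "val ?R' (F (cls ?R (\<Sum>x\<in>A. gen (S x, f x, g x)))) = (\<Sum>x\<in>A. val ?R' (F (cls ?R (gen (S x, f x, g x)))))"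
    unfolding lin_on_cls[OF L k] by (simp add: lin_ext_sum)
  also have "\<dots> = (\<Sum>x\<in>A. nf ?R' (gen (S x, a (S x) (f x), b (S x) (g x))))"
    by (rule sum.cong[OF refl]) (use assms(2,4) in simp)
  finally have v: "val ?R' (F (cls ?R (\<Sum>x\<in>A. gen (S x, f x, g x)))) =
    nf ?R' (\<Sum>x\<in>A. gen (S x, a (S x) (f x), b (S x) (g x)))" by (simp add: nf_sum)
  have "F (cls ?R (\<Sum>x\<in>A. gen (S x, f x, g x))) \<in> carrier (presented (tensor_gens (kFB s) (ub_FB p U') (db_FB q X')) ?R')"
    by (rule linear_maps_mem[OF F cls_in_presented[OF k]])
  then obtain w where w: "F (cls ?R (\<Sum>x\<in>A. gen (S x, f x, g x))) = cls ?R' w" by (rule presented_memE)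
  show ?thesis using v unfolding w by (simp add: cls_eq_iff)
qed

text \<open>The differential inserts chords between the two tensor factors, while the actions
  compose at their outer ends. Associativity separates the two, here and in
  \<open>koszul_d_lact\<close>.\<close>

lemma koszul_d_ract:
  fixes x :: "'k::field_char_0 koszul"
  assumes pq: "fst p = fst q" and a: "a \<in> carrier (Hom (ub q) X X')" and x: "x \<in> carrier (koszul p q s U X)"
  shows "koszul_d p q s U X' (koszul_ract p q s U X X' a x) = koszul_ract p q (s - 2) U X X' a (koszul_d p q s U X x)"
proof (rule koszul_maps_eq[OF _ _ _ x])
  show "(\<lambda>x. koszul_d p q s U X' (koszul_ract p q s U X X' a x)) \<in> linear_maps (koszul p q s U X) (koszul p q (s - 2) U X')"
    by (rule linear_maps_comp[OF koszul_d_linear[OF pq] koszul_ract_linear[OF a]])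
  show "(\<lambda>x. koszul_ract p q (s - 2) U X X' a (koszul_d p q s U X x)) \<in> linear_maps (koszul p q s U X) (koszul p q (s - 2) U X')"
    by (rule linear_maps_comp[OF koszul_ract_linear[OF a] koszul_d_linear[OF pq]])
  fix S and F G :: "'k ubmor"
  assume S: "finite S" "card S = s" and F: "F \<in> carrier (Hom (ub p) S U)" and G: "G \<in> carrier (Hom (ub q) S X)"
  have ij: "finite (S - {i, j}) \<and> card (S - {i, j}) = s - 2 \<and>
     Cmp (ub p) (S - {i, j}) S U F (chord p S i j) \<in> carrier (Hom (ub p) (S - {i, j}) U) \<and>
     Cmp (ub q) (S - {i, j}) S X G (chord q S i j) \<in> carrier (Hom (ub q) (S - {i, j}) X) \<and>
     Cmp (ub q) (S - {i, j}) S X' (Cmp (ub q) S X X' a G) (chord q S i j) =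
     Cmp (ub q) (S - {i, j}) X X' a (Cmp (ub q) (S - {i, j}) S X G (chord q S i j))"
    if "(i, j) \<in> ordered_pairs S" for i j
  proof -
    have ij: "i \<in> S" "j \<in> S" "i \<noteq> j" using that by (auto dest: ordered_pairsD)
    have f: "finite (S - {i, j})" "card (S - {i, j}) = s - 2" using S card_pair[OF S(1) ij] by auto
    show ?thesis using f ub_Cmp_in[OF f(1) chord_in[OF S(1) ij] F] ub_Cmp_in[OF f(1) chord_in[OF S(1) ij] G]
      by (simp add: ub_Cmp_assoc[OF f(1) S(1) chord_in[OF S(1) ij] G a])
  qed
  show "koszul_d p q s U X' (koszul_ract p q s U X X' a (cls (koszul_rels p q s U X) (gen (S, F, G)))) =
    koszul_ract p q (s - 2) U X X' a (koszul_d p q s U X (cls (koszul_rels p q s U X) (gen (S, F, G))))"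
    unfolding koszul_ract_cls[OF a] koszul_d_cls[OF pq] koszul_raw_def prod.case case_prod_unfold
    by (subst val_koszul_map_sum[OF koszul_ract_linear[OF a] koszul_ract_cls[OF a]])
      (use S ij in auto)
qed

lemma koszul_d_lact:
  fixes x :: "'k::field_char_0 koszul"
  assumes pq: "fst p = fst q" and b: "b \<in> carrier (Hom (ub p) U U')" and x: "x \<in> carrier (koszul p q s U X)"
  shows "koszul_d p q s U' X (koszul_lact p q s X U U' b x) = koszul_lact p q (s - 2) X U U' b (koszul_d p q s U X x)"
proof (rule koszul_maps_eq[OF _ _ _ x])
  show "(\<lambda>x. koszul_d p q s U' X (koszul_lact p q s X U U' b x)) \<in> linear_maps (koszul p q s U X) (koszul p q (s - 2) U' X)"
    by (rule linear_maps_comp[OF koszul_d_linear[OF pq] koszul_lact_linear[OF b]])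
  show "(\<lambda>x. koszul_lact p q (s - 2) X U U' b (koszul_d p q s U X x)) \<in> linear_maps (koszul p q s U X) (koszul p q (s - 2) U' X)"
    by (rule linear_maps_comp[OF koszul_lact_linear[OF b] koszul_d_linear[OF pq]])
  fix S and F G :: "'k ubmor"
  assume S: "finite S" "card S = s" and F: "F \<in> carrier (Hom (ub p) S U)" and G: "G \<in> carrier (Hom (ub q) S X)"
  have ij: "finite (S - {i, j}) \<and> card (S - {i, j}) = s - 2 \<and>
     Cmp (ub p) (S - {i, j}) S U F (chord p S i j) \<in> carrier (Hom (ub p) (S - {i, j}) U) \<and>
     Cmp (ub q) (S - {i, j}) S X G (chord q S i j) \<in> carrier (Hom (ub q) (S - {i, j}) X) \<and>
     Cmp (ub p) (S - {i, j}) S U' (Cmp (ub p) S U U' b F) (chord p S i j) =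
     Cmp (ub p) (S - {i, j}) U U' b (Cmp (ub p) (S - {i, j}) S U F (chord p S i j))"
    if "(i, j) \<in> ordered_pairs S" for i j
  proof -
    have ij: "i \<in> S" "j \<in> S" "i \<noteq> j" using that by (auto dest: ordered_pairsD)
    have f: "finite (S - {i, j})" "card (S - {i, j}) = s - 2" using S card_pair[OF S(1) ij] by auto
    show ?thesis using f ub_Cmp_in[OF f(1) chord_in[OF S(1) ij] F] ub_Cmp_in[OF f(1) chord_in[OF S(1) ij] G]
      by (simp add: ub_Cmp_assoc[OF f(1) S(1) chord_in[OF S(1) ij] F b])
  qed
  show "koszul_d p q s U' X (koszul_lact p q s X U U' b (cls (koszul_rels p q s U X) (gen (S, F, G)))) =
    koszul_lact p q (s - 2) X U U' b (koszul_d p q s U X (cls (koszul_rels p q s U X) (gen (S, F, G))))"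
    unfolding koszul_lact_cls[OF b] koszul_d_cls[OF pq] koszul_raw_def prod.case case_prod_unfold
    by (subst val_koszul_map_sum[OF koszul_lact_linear[OF b] koszul_lact_cls[OF b]])
      (use S ij in auto)
qed

subsection \<open>Modules over the downward Brauer category\<close>

lemma koszul_lin_on_eq:
  assumes "lin_on (koszul p q s U X) L" "lin_on (koszul p q s U X) L'"
    "\<And>S F G. finite S \<Longrightarrow> card S = s \<Longrightarrow> F \<in> carrier (Hom (ub p) S U) \<Longrightarrow> G \<in> carrier (Hom (ub q) S X) \<Longrightarrow>
      L (cls (koszul_rels p q s U X) (gen (S, F, G))) = L' (cls (koszul_rels p q s U X) (gen (S, F, G)))"
    "x \<in> carrier (koszul p q s U X)"
  shows "L x = L' x"
  using tensor_lin_on_eq[OF assms(1,2)[unfolded koszul_def] _ assms(4)[unfolded koszul_def]]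
    assms(3) unfolding koszul_rels_def by (simp add: FB_simps)

lemma koszul_lact_ract:
  fixes x :: "'k::field koszul"
  assumes a: "a \<in> carrier (Hom (ub q) X X')" and b: "b \<in> carrier (Hom (ub p) U U')" and x: "x \<in> carrier (koszul p q s U X)"
  shows "koszul_lact p q s X' U U' b (koszul_ract p q s U X X' a x) = koszul_ract p q s U' X X' a (koszul_lact p q s X U U' b x)"
proof (rule koszul_maps_eq[OF _ _ _ x])
  show "(\<lambda>x. koszul_lact p q s X' U U' b (koszul_ract p q s U X X' a x)) \<in> linear_maps (koszul p q s U X) (koszul p q s U' X')"
    by (rule linear_maps_comp[OF koszul_lact_linear[OF b] koszul_ract_linear[OF a]])
  show "(\<lambda>x. koszul_ract p q s U' X X' a (koszul_lact p q s X U U' b x)) \<in> linear_maps (koszul p q s U X) (koszul p q s U' X')"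
    by (rule linear_maps_comp[OF koszul_ract_linear[OF a] koszul_lact_linear[OF b]])
qed (simp only: koszul_lact_cls[OF b] koszul_ract_cls[OF a])

lemma koszul_cls_in:
  "finite S \<Longrightarrow> card S = s \<Longrightarrow> F \<in> carrier (Hom (ub p) S U) \<Longrightarrow> G \<in> carrier (Hom (ub q) S X) \<Longrightarrow>
   cls (koszul_rels p q s U X) (gen (S, F, G)) \<in> carrier (koszul p q s U X)"
  unfolding koszul_rels_def koszul_def by (rule tensor_cls_in) (simp_all add: FB_simps)

lemma koszul_right_simps [simp]: "At (koszul_right p q s U) = koszul p q s U"
  "Act (koszul_right p q s U) = koszul_ract p q s U"
  by (simp_all add: koszul_right_def)

text \<open>What the complex uses of a left module over \<open>db q\<close>, expressed in
  \<open>ub q\<close>: a morphism from Y to Z of the former is one from Z to Y of the latter, which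
  accounts for the order of the factors in \<open>act_comp\<close>.\<close>

locale db_module =
  fixes q :: polarities and M :: "(nat set, 'k::field_char_0, 'k ubmor, 'v) catmod"
  assumes M_closed: "finite Y \<Longrightarrow> closed_space (At M Y)"
    and act_linear1: "finite Y \<Longrightarrow> finite Z \<Longrightarrow> a \<in> carrier (Hom (ub q) Z Y) \<Longrightarrow> Act M Y Z a \<in> linear_maps (At M Y) (At M Z)"
    and act_linear2: "finite Y \<Longrightarrow> finite Z \<Longrightarrow> m \<in> carrier (At M Y) \<Longrightarrow>
      (\<lambda>a. Act M Y Z a m) \<in> linear_maps (Hom (ub q) Z Y) (At M Z)"
    and act_id: "finite Y \<Longrightarrow> m \<in> carrier (At M Y) \<Longrightarrow> Act M Y Y (idm q Y) m = m"
    and act_comp: "finite Y \<Longrightarrow> finite Z \<Longrightarrow> finite W \<Longrightarrow> a \<in> carrier (Hom (ub q) Z Y) \<Longrightarrow> b \<in> carrier (Hom (ub q) W Z) \<Longrightarrow>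
      m \<in> carrier (At M Y) \<Longrightarrow> Act M Z W b (Act M Y Z a m) = Act M Y W (Cmp (ub q) W Z Y a b) m"
begin

lemma act_in: "finite Y \<Longrightarrow> finite Z \<Longrightarrow> a \<in> carrier (Hom (ub q) Z Y) \<Longrightarrow> m \<in> carrier (At M Y) \<Longrightarrow> Act M Y Z a m \<in> carrier (At M Z)"
  by (rule linear_maps_mem[OF act_linear1])

end

text \<open>The two sign conditions have different tasks. Equal first polarities make the Koszul
  differential well defined; opposite signs of the second ones make chords anticommute on the tensor
  product, which gives d d = 0.\<close>

locale brauer = db_module q M for q and M :: "(nat set, 'k::field_char_0, 'k ubmor, 'v) catmod" +
  fixes p :: polarities and X :: "nat set"
  assumes X: "finite X" and pq: "fst p = fst q" and opposite_signs: "twist (snd p) (-1) * twist (snd q) (-1) = -1"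
begin

abbreviation "N \<equiv> dual_right (ub p) X :: (nat set, 'k, 'k ubmor, 'k ubmor \<Rightarrow> 'k) catmod"
abbreviation "Rk s U Y \<equiv> koszul_rels p q s U Y :: (nat set \<times> 'k ubmor \<times> 'k ubmor \<Rightarrow>\<^sub>0 'k) set"
abbreviation "R2 s U \<equiv> tensor_rels (db q) (koszul_right p q s U) M"
abbreviation "KT s \<equiv> koszul_tensor p q M s"
abbreviation "R3 s \<equiv> tensor_rels (ub p) N (KT s)"
abbreviation "T s \<equiv> brauer_complex p q M X s"
abbreviation "Dual S \<equiv> dual (Hom (ub p) X S) :: ('k, 'k ubmor \<Rightarrow> 'k) module"

lemma N_simps: "At N Y = Dual Y" by (rule dual_right_simps)

lemma N_in: "a \<in> carrier (Hom (ub p) Y Y') \<Longrightarrow> \<phi> \<in> carrier (Dual Y') \<Longrightarrow> Act N Y' Y a \<phi> \<in> carrier (Dual Y)"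
  by (rule dual_act_in[OF X])

section \<open>The triple tensor product, its spanning classes and its differential\<close>

lemma KT_At: "At (KT s) U = tensor (db q) (koszul_right p q s U) M"
  by (simp add: koszul_tensor_def)

lemma KT_Act: "Act (KT s) U U' b = tensor_map1 (R2 s U') (\<lambda>Y. koszul_lact p q s Y U U' b)"
  by (simp add: koszul_tensor_def)

lemma lact_functor:
  assumes b: "b \<in> carrier (Hom (ub p) U U')"
  shows "tensor_functor1 (db q) (koszul_right p q s U) (koszul_right p q s U') M (\<lambda>Y. koszul_lact p q s Y U U' b)"
  by unfold_locales (simp_all add: koszul_lact_linear[OF b] koszul_lact_ract[OF _ b] act_in)

lemma d_functor: "tensor_functor1 (db q) (koszul_right p q s U) (koszul_right p q (s - 2) U) M (\<lambda>Y. koszul_d p q s U Y)"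
  by unfold_locales (simp_all add: koszul_d_linear[OF pq] koszul_d_ract[OF pq] act_in)

lemmas KT_linear = tensor_functor1.map_linear[OF lact_functor, folded KT_Act KT_At]
lemmas KT_cls = tensor_functor1.map_cls[OF lact_functor, folded KT_Act]
lemmas KTd_linear = tensor_functor1.map_linear[OF d_functor, folded koszul_tensor_d_def KT_At]
lemmas KTd_cls = tensor_functor1.map_cls[OF d_functor, folded koszul_tensor_d_def]

lemma R2_cls_in: "finite Y \<Longrightarrow> w \<in> carrier (koszul p q s U Y) \<Longrightarrow> m \<in> carrier (At M Y) \<Longrightarrow>
  cls (R2 s U) (gen (Y, w, m)) \<in> carrier (At (KT s) U)"
  unfolding KT_At by (rule tensor_cls_in) simp_all

lemma R2_linear: "finite Y \<Longrightarrow> m \<in> carrier (At M Y) \<Longrightarrow>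
  (\<lambda>w. cls (R2 s U) (gen (Y, w, m))) \<in> linear_maps (koszul p q s U Y) (At (KT s) U)"
  unfolding KT_At using tensor_left_linear[of Y "db q" m M "koszul_right p q s U"] by simp

lemma KTd_equiv:
  assumes b: "b \<in> carrier (Hom (ub p) U U')" and z: "z \<in> carrier (At (KT s) U)"
  shows "koszul_tensor_d p q M s U' (Act (KT s) U U' b z) = Act (KT (s - 2)) U U' b (koszul_tensor_d p q M s U z)"
  unfolding KT_At
proof (rule tensor_maps_eq[OF _ _ _ z[unfolded KT_At]])
  show "(\<lambda>z. koszul_tensor_d p q M s U' (Act (KT s) U U' b z)) \<in> linear_maps (tensor (db q) (koszul_right p q s U) M)
      (presented (tensor_gens (db q) (koszul_right p q (s - 2) U') M) (R2 (s - 2) U'))"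
    using linear_maps_comp[OF KTd_linear KT_linear[OF b]] by (simp add: KT_At tensor_def)
  show "(\<lambda>z. Act (KT (s - 2)) U U' b (koszul_tensor_d p q M s U z)) \<in> linear_maps (tensor (db q) (koszul_right p q s U) M)
      (presented (tensor_gens (db q) (koszul_right p q (s - 2) U') M) (R2 (s - 2) U'))"
    using linear_maps_comp[OF KT_linear[OF b] KTd_linear] by (simp add: KT_At tensor_def)
qed (simp add: KT_cls[OF b] KTd_cls koszul_d_lact[OF pq b])

lemma complex_d_functor: "tensor_functor2 (ub p) N (KT s) (KT (s - 2)) (\<lambda>Y. koszul_tensor_d p q M s Y)"
  by unfold_locales (simp_all add: KTd_linear KTd_equiv N_simps N_in)

lemmas d_linear = tensor_functor2.map_linear[OF complex_d_functor, folded brauer_complex_d_def brauer_complex_def]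
lemmas d_cls = tensor_functor2.map_cls[OF complex_d_functor, folded brauer_complex_d_def]

abbreviation "d s \<equiv> brauer_complex_d p q M X s"

text \<open>
  \<open>ecl s S \<phi> m\<close> is the class of \<open>\<phi> \<otimes> (id \<otimes> id) \<otimes> m\<close>; by \<open>elc_eq\<close> these classes span.
\<close>

definition elc where
  "elc s U \<phi> Y S F G m = cls (R3 s) (gen (U, \<phi>, cls (R2 s U) (gen (Y, cls (Rk s U Y) (gen (S, F, G)), m))))"

definition ecl where "ecl s S \<phi> m = elc s S \<phi> S S (idm p S) (idm q S) m"

text \<open>The class \<open>ecl\<close> as a vector, so that signed sums of such classes can be
  written down.\<close>

definition E where "E s S \<phi> m = val (R3 s) (ecl s S \<phi> m)"

lemma T_presented: "T s = presented (tensor_gens (ub p) N (KT s)) (R3 s)"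
  by (simp add: brauer_complex_def tensor_def)

lemma T_val_lin: "lin_on (T s) (val (R3 s))" unfolding T_presented by (rule lin_on_val)

lemma T_val_inj: "x \<in> carrier (T s) \<Longrightarrow> y \<in> carrier (T s) \<Longrightarrow> val (R3 s) x = val (R3 s) y \<longleftrightarrow> x = y"
  unfolding T_presented by (rule val_inj)

lemma R3_linear: "finite U \<Longrightarrow> \<phi> \<in> carrier (Dual U) \<Longrightarrow>
  (\<lambda>z. cls (R3 s) (gen (U, \<phi>, z))) \<in> linear_maps (At (KT s) U) (T s)"
  unfolding brauer_complex_def by (rule tensor_right_linear) (simp_all add: N_simps)

text \<open>The tensor F \<otimes> G is F (id \<otimes> id) G. Balancing over \<open>ub p\<close>
  hands F to \<phi>, and balancing over \<open>db q\<close> hands G to m.\<close>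

lemma elc_eq:
  assumes U: "finite U" and \<phi>: "\<phi> \<in> carrier (Dual U)" and Y: "finite Y" and m: "m \<in> carrier (At M Y)"
    and S: "finite S" "card S = s" and F: "F \<in> carrier (Hom (ub p) S U)" and G: "G \<in> carrier (Hom (ub q) S Y)"
  shows "elc s U \<phi> Y S F G m = ecl s S (Act N U S F \<phi>) (Act M Y S G m)"
proof -
  note ip = idm_in[OF S(1), of p] and iq = idm_in[OF S(1), of q]
  have Gm: "Act M Y S G m \<in> carrier (At M S)" by (rule act_in[OF Y S(1) G m])
  let ?w = "cls (Rk s S S) (gen (S, idm p S, idm q S))"
  have w: "?w \<in> carrier (koszul p q s S S)" by (rule koszul_cls_in[OF S ip iq])
  let ?w' = "cls (Rk s U S) (gen (S, F, idm q S))"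
  have w': "?w' \<in> carrier (koszul p q s U S)" by (rule koszul_cls_in[OF S F iq])
  have "ecl s S (Act N U S F \<phi>) (Act M Y S G m) =
    cls (R3 s) (gen (U, \<phi>, Act (KT s) S U F (cls (R2 s S) (gen (S, ?w, Act M Y S G m)))))"
    unfolding ecl_def elc_def cls_eq_iff
    by (rule tensor_balanced) (simp_all add: S U F \<phi> N_simps R2_cls_in[OF S(1) w Gm])
  also have "Act (KT s) S U F (cls (R2 s S) (gen (S, ?w, Act M Y S G m))) = cls (R2 s U) (gen (S, ?w', Act M Y S G m))"
    unfolding KT_cls[OF F] koszul_lact_cls[OF F] ub_Cmp_id_right[OF S(1) F] ..
  also have "\<dots> = cls (R2 s U) (gen (Y, koszul_ract p q s U S Y G ?w', m))"
    unfolding cls_eq_iff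
    using tensor_balanced[of Y "db q" S G ?w' "koszul_right p q s U" m M] Y S G w' m by simp
  also have "koszul_ract p q s U S Y G ?w' = cls (Rk s U Y) (gen (S, F, G))"
    unfolding koszul_ract_cls[OF G] ub_Cmp_id_right[OF S(1) G] ..
  finally show ?thesis unfolding elc_def ..
qed

lemma T_lin_on_eq:
  assumes L: "lin_on (T s) L" and L': "lin_on (T s) L'"
    and eq: "\<And>S \<phi> m. finite S \<Longrightarrow> card S = s \<Longrightarrow> \<phi> \<in> carrier (Dual S) \<Longrightarrow> m \<in> carrier (At M S) \<Longrightarrow>
      L (ecl s S \<phi> m) = L' (ecl s S \<phi> m)"
    and x: "x \<in> carrier (T s)"
  shows "L x = L' x"
proof (rule tensor_lin_on_eq[OF L[unfolded brauer_complex_def] L'[unfolded brauer_complex_def] _ x[unfolded brauer_complex_def]])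
  fix U \<phi> z assume "U \<in> Ob (ub p)" "\<phi> \<in> carrier (At N U)" and z: "z \<in> carrier (At (KT s) U)"
  then have U: "finite U" and \<phi>: "\<phi> \<in> carrier (Dual U)" by (simp_all add: N_simps)
  note r = R3_linear[OF U \<phi>, of s]
  show "L (cls (R3 s) (gen (U, \<phi>, z))) = L' (cls (R3 s) (gen (U, \<phi>, z)))"
  proof (rule tensor_lin_on_eq[OF lin_on_comp[OF L r, unfolded KT_At] lin_on_comp[OF L' r, unfolded KT_At] _ z[unfolded KT_At]])
    fix Y and w :: "'k koszul" and m assume "Y \<in> Ob (db q)" "w \<in> carrier (At (koszul_right p q s U) Y)" and m: "m \<in> carrier (At M Y)"
    then have Y: "finite Y" and w: "w \<in> carrier (koszul p q s U Y)" by simp_all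
    note r2 = R2_linear[OF Y m, of s U]
    show "L (cls (R3 s) (gen (U, \<phi>, cls (R2 s U) (gen (Y, w, m))))) = L' (cls (R3 s) (gen (U, \<phi>, cls (R2 s U) (gen (Y, w, m)))))"
    proof (rule koszul_lin_on_eq[OF lin_on_comp[OF lin_on_comp[OF L r] r2] lin_on_comp[OF lin_on_comp[OF L' r] r2] _ w])
      fix S and F G :: "'k ubmor"
      assume S: "finite S" "card S = s" and F: "F \<in> carrier (Hom (ub p) S U)" and G: "G \<in> carrier (Hom (ub q) S Y)"
      show "L (cls (R3 s) (gen (U, \<phi>, cls (R2 s U) (gen (Y, cls (Rk s U Y) (gen (S, F, G)), m))))) =
        L' (cls (R3 s) (gen (U, \<phi>, cls (R2 s U) (gen (Y, cls (Rk s U Y) (gen (S, F, G)), m)))))"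
        unfolding elc_def[symmetric] elc_eq[OF U \<phi> Y m S F G]
        by (intro eq S N_in F \<phi> act_in Y G m)
    qed
  qed
qed

lemma ecl_in: "finite S \<Longrightarrow> card S = s \<Longrightarrow> \<phi> \<in> carrier (Dual S) \<Longrightarrow> m \<in> carrier (At M S) \<Longrightarrow> ecl s S \<phi> m \<in> carrier (T s)"
  unfolding ecl_def elc_def
  by (rule linear_maps_mem[OF R3_linear]) (auto intro: R2_cls_in koszul_cls_in idm_in)

lemma E_lin1: "finite S \<Longrightarrow> card S = s \<Longrightarrow> m \<in> carrier (At M S) \<Longrightarrow> lin_on (Dual S) (\<lambda>\<phi>. E s S \<phi> m)"
  unfolding E_def ecl_def elc_def val_cls
  using lin_on_tensor1[of S "ub p" "cls (R2 s S) (gen (S, cls (Rk s S S) (gen (S, idm p S, idm q S)), m))" "KT s" N]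
  by (simp add: R2_cls_in koszul_cls_in idm_in N_simps)

lemma E_lin2: "finite S \<Longrightarrow> card S = s \<Longrightarrow> \<phi> \<in> carrier (Dual S) \<Longrightarrow> lin_on (At M S) (\<lambda>m. E s S \<phi> m)"
proof -
  assume S: "finite S" "card S = s" and \<phi>: "\<phi> \<in> carrier (Dual S)"
  have 1: "lin_on (At (KT s) S) (\<lambda>z. nf (R3 s) (gen (S, \<phi>, z)))"
    by (rule lin_on_tensor2) (simp_all add: S \<phi> N_simps)
  have 2: "(\<lambda>m. cls (R2 s S) (gen (S, cls (Rk s S S) (gen (S, idm p S, idm q S)), m))) \<in> linear_maps (At M S) (At (KT s) S)"
    unfolding KT_At by (rule tensor_right_linear) (simp_all add: S koszul_cls_in idm_in)
  show ?thesis unfolding E_def ecl_def elc_def val_cls by (rule lin_on_comp[OF 1 2])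
qed

abbreviation "bij_ub r S S' \<sigma> \<equiv> ub_cls r S S' (bij_D S \<sigma>)"

text \<open>Both sides are one and the same tensor over \<open>kFB\<close>, with the bijection in
  the left or in the right factor of id \<otimes> id. It arrives inverted on the right because
  degree zero of \<open>db q\<close> is identified with \<open>kFB\<close> by inversion.\<close>

lemma E_balanced:
  assumes b: "bij_betw \<sigma> S S'" and S: "finite S" "card S = s" and \<phi>: "\<phi> \<in> carrier (Dual S')" and m: "m \<in> carrier (At M S)"
  shows "E s S (Act N S' S (bij_ub p S S' \<sigma>) \<phi>) m = E s S' \<phi> (Act M S S' (bij_ub q S' S (inv_into S \<sigma>)) m)"
proof -
  have S': "finite S'" "card S' = s" using bij_betw_finite[OF b] bij_betw_same_card[OF b] S by simp_all
  have p: "bij_ub p S S' \<sigma> \<in> carrier (Hom (ub p) S S')" and q: "bij_ub q S' S (inv_into S \<sigma>) \<in> carrier (Hom (ub q) S' S)"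
    by (intro ub_cls_in bij_D_in_D b bij_betw_inv_into S S')+
  note ip = idm_in[OF S'(1), of p] and iq = idm_in[OF S(1), of q]
  have "cls (Rk s S' S) (gen (S, bij_ub p S S' \<sigma>, idm q S)) = cls (Rk s S' S) (gen (S', idm p S', bij_ub q S' S (inv_into S \<sigma>)))"
    using kap_balanced[OF b S ip iq]
    unfolding cls_eq_iff kap_def ub_Cmp_id_left[OF S(1) S'(1) p] ub_Cmp_id_left[OF S'(1) S(1) q] .
  then have "elc s S' \<phi> S S (bij_ub p S S' \<sigma>) (idm q S) m = elc s S' \<phi> S S' (idm p S') (bij_ub q S' S (inv_into S \<sigma>)) m"
    unfolding elc_def by simp
  then show ?thesis
    unfolding elc_eq[OF S'(1) \<phi> S(1) m S p iq] elc_eq[OF S'(1) \<phi> S(1) m S' ip q]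
      act_id[OF S(1) m] dual_act_id[OF X S'(1) \<phi>] E_def by simp
qed

text \<open>The Koszul differential puts a chord on each side of the tensor sign;
  \<open>elc_eq\<close> then lets \<phi> absorb the left one and m the right one.\<close>

lemma d_ecl:
  assumes S: "finite S" "card S = s" and \<phi>: "\<phi> \<in> carrier (Dual S)" and m: "m \<in> carrier (At M S)"
  shows "val (R3 (s - 2)) (d s (ecl s S \<phi> m)) = (\<Sum>(i, j)\<in>ordered_pairs S.
    E (s - 2) (S - {i, j}) (Act N S (S - {i, j}) (chord p S i j) \<phi>) (Act M S (S - {i, j}) (chord q S i j) m))"
proof -
  note ip = idm_in[OF S(1), of p] and iq = idm_in[OF S(1), of q]
  let ?L = "\<lambda>w. val (R3 (s - 2)) (cls (R3 (s - 2)) (gen (S, \<phi>, cls (R2 (s - 2) S) (gen (S, w, m)))))"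
  have L: "lin_on (koszul p q (s - 2) S S) ?L"
    by (rule lin_on_comp[OF lin_on_comp[OF T_val_lin R3_linear[OF S(1) \<phi>]] R2_linear[OF S(1) m]])
  let ?raw = "koszul_raw p q S S (S, idm p S, idm q S) :: nat set \<times> 'k ubmor \<times> 'k ubmor \<Rightarrow>\<^sub>0 'k"
  have k: "Poly_Mapping.keys ?raw \<subseteq> tensor_gens (kFB (s - 2)) (ub_FB p S) (db_FB q S)"
    by (rule keys_koszul_raw) (simp add: tensor_gens_def FB_simps S ip iq)
  have "val (R3 (s - 2)) (d s (ecl s S \<phi> m)) = ?L (cls (Rk (s - 2) S S) ?raw)"
    unfolding ecl_def elc_def d_cls KTd_cls koszul_d_cls[OF pq] ..
  also have "\<dots> = lin_ext (\<lambda>g. ?L (cls (Rk (s - 2) S S) (gen g))) ?raw"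
    by (rule lin_on_cls[OF L[unfolded koszul_def tensor_def koszul_rels_def[symmetric]] k])
  also have "\<dots> = (\<Sum>(i, j)\<in>ordered_pairs S.
    val (R3 (s - 2)) (elc (s - 2) S \<phi> S (S - {i, j}) (Cmp (ub p) (S - {i, j}) S S (idm p S) (chord p S i j))
        (Cmp (ub q) (S - {i, j}) S S (idm q S) (chord q S i j)) m))"
    by (simp only: koszul_raw_def lin_ext_sum elc_def case_prod_unfold lin_ext_gen fst_conv snd_conv)
  also have "\<dots> = (\<Sum>(i, j)\<in>ordered_pairs S.
    E (s - 2) (S - {i, j}) (Act N S (S - {i, j}) (chord p S i j) \<phi>) (Act M S (S - {i, j}) (chord q S i j) m))"
  proof (rule sum.cong[OF refl], clarify)
    fix i j assume "(i, j) \<in> ordered_pairs S"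
    then have ij: "i \<in> S" "j \<in> S" "i \<noteq> j" by (auto dest: ordered_pairsD)
    have F: "finite (S - {i, j})" "card (S - {i, j}) = s - 2" using S card_pair[OF S(1) ij] by auto
    note cp = chord_in[OF S(1) ij, of p] and cq = chord_in[OF S(1) ij, of q]
    show "val (R3 (s - 2)) (elc (s - 2) S \<phi> S (S - {i, j}) (Cmp (ub p) (S - {i, j}) S S (idm p S) (chord p S i j))
        (Cmp (ub q) (S - {i, j}) S S (idm q S) (chord q S i j)) m) =
      E (s - 2) (S - {i, j}) (Act N S (S - {i, j}) (chord p S i j) \<phi>) (Act M S (S - {i, j}) (chord q S i j) m)"
      unfolding ub_Cmp_id_left[OF F(1) S(1) cp] ub_Cmp_id_left[OF F(1) S(1) cq] E_def
        elc_eq[OF S(1) \<phi> S(1) m F cp cq] ..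
  qed
  finally show ?thesis .
qed

text \<open>The terms of two disjoint chords in either order are opposite, as
  \<open>chord_commute\<close> gives the sign of \<open>snd p\<close> on the functional and that of
  \<open>snd q\<close> on the module. Exchanging the chords thus shows that the sum is its own
  negative.\<close>

lemma E_d_d:
  assumes S: "finite S" "card S = s" and \<phi>: "\<phi> \<in> carrier (Dual S)" and m: "m \<in> carrier (At M S)"
  shows "(\<Sum>(i, j)\<in>ordered_pairs S. \<Sum>(k, l)\<in>ordered_pairs (S - {i, j}).
    E (s - 2 - 2) (S - {i, j} - {k, l})
      (Act N (S - {i, j}) (S - {i, j} - {k, l}) (chord p (S - {i, j}) k l) (Act N S (S - {i, j}) (chord p S i j) \<phi>))
      (Act M (S - {i, j}) (S - {i, j} - {k, l}) (chord q (S - {i, j}) k l) (Act M S (S - {i, j}) (chord q S i j) m))) = 0"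
    (is "(\<Sum>(i, j)\<in>_. \<Sum>(k, l)\<in>_. ?Q i j k l) = 0")
proof -
  have anti: "?Q i j k l = - ?Q k l i j" if 1: "(i, j) \<in> ordered_pairs S" and 2: "(k, l) \<in> ordered_pairs (S - {i, j})" for i j k l
  proof -
    have ij: "i \<in> S" "j \<in> S" "i \<noteq> j" using 1 by (auto dest: ordered_pairsD)
    have kl: "k \<in> S - {i, j}" "l \<in> S - {i, j}" "k \<noteq> l" using 2 by (auto dest: ordered_pairsD)
    then have kl': "k \<in> S" "l \<in> S" "k \<noteq> l" by auto
    have ij': "i \<in> S - {k, l}" "j \<in> S - {k, l}" "i \<noteq> j" using ij kl by auto
    have dist: "distinct [i, j, k, l]" using ij kl by auto
    let ?Z = "S - {i, j} - {k, l}"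
    have Z1: "?Z = S - {i, j, k, l}" and Z2: "S - {k, l} - {i, j} = ?Z" by auto
    have f: "finite (S - {i, j})" "finite ?Z" "finite (S - {k, l})" using S by auto
    have cZ: "card ?Z = s - 2 - 2"
      using S card_pair[OF S(1) ij] card_pair[OF f(1) kl] by auto
    note p1 = chord_in[OF S(1) ij, of p] and p2 = chord_in[OF f(1) kl, of p]
      and p3 = chord_in[OF S(1) kl', of p] and p4 = chord_in[OF f(3) ij', of p, unfolded Z2]
    note q1 = chord_in[OF S(1) ij, of q] and q2 = chord_in[OF f(1) kl, of q]
      and q3 = chord_in[OF S(1) kl', of q] and q4 = chord_in[OF f(3) ij', of q, unfolded Z2]
    let ?P = "Cmp (ub p) ?Z (S - {k, l}) S (chord p S k l) (chord p (S - {k, l}) i j)"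
    let ?R = "Cmp (ub q) ?Z (S - {k, l}) S (chord q S k l) (chord q (S - {k, l}) i j)"
    have P: "?P \<in> carrier (Hom (ub p) ?Z S)" and R: "?R \<in> carrier (Hom (ub q) ?Z S)"
      by (rule ub_Cmp_in[OF f(2) p4 p3], rule ub_Cmp_in[OF f(2) q4 q3])
    have e1: "?Q i j k l = E (s - 2 - 2) ?Z
        (of_int (twist (snd p) (-1)) \<odot>\<^bsub>Dual ?Z\<^esub> Act N S ?Z ?P \<phi>) (of_int (twist (snd q) (-1)) \<odot>\<^bsub>At M ?Z\<^esub> Act M S ?Z ?R m)"
      unfolding dual_act_comp[OF X f(2) p2 p1] act_comp[OF S(1) f(1) f(2) q1 q2 m]
        chord_commute[OF S(1) ij(1,2) kl'(1,2) dist Z1]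
        linear_maps_smult[OF dual_act_linear2[OF X \<phi>] P] linear_maps_smult[OF act_linear2[OF S(1) f(2) m] R] ..
    have e2: "?Q k l i j = E (s - 2 - 2) ?Z (Act N S ?Z ?P \<phi>) (Act M S ?Z ?R m)"
      unfolding Z2 dual_act_comp[OF X f(2) p4 p3] act_comp[OF S(1) f(3) f(2) q3 q4 m] ..
    have PN: "Act N S ?Z ?P \<phi> \<in> carrier (Dual ?Z)" by (rule N_in[OF P \<phi>])
    have RM: "Act M S ?Z ?R m \<in> carrier (At M ?Z)" by (rule act_in[OF S(1) f(2) R m])
    have "?Q i j k l = fscale (of_int (twist (snd p) (-1) * twist (snd q) (-1))) (E (s - 2 - 2) ?Z (Act N S ?Z ?P \<phi>) (Act M S ?Z ?R m))"
      unfolding e1 lin_on_smult[OF E_lin1[OF f(2) cZ closed_smult[OF M_closed[OF f(2)] RM]] PN]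
        lin_on_smult[OF E_lin2[OF f(2) cZ PN] RM] by simp
    then show ?thesis unfolding e2 opposite_signs by (simp add: poly_mapping_eq_iff fun_eq_iff)
  qed
  let ?A = "Sigma (ordered_pairs S) (\<lambda>(i, j). ordered_pairs (S - {i, j}))"
  let ?f = "\<lambda>((i, j), (k, l)). ?Q i j k l"
  have fin: "finite (ordered_pairs (S - {i, j}))" for i j using S by simp
  have "(\<Sum>(i, j)\<in>ordered_pairs S. \<Sum>(k, l)\<in>ordered_pairs (S - {i, j}). ?Q i j k l) = sum ?f ?A"
    by (subst sum.Sigma[symmetric]) (auto simp: S fin intro!: sum.cong)
  moreover have "sum ?f ?A = (\<Sum>x\<in>?A. - ?f x)"
  proof (rule sum.reindex_bij_witness[where i="\<lambda>(x, y). (y, x)" and j="\<lambda>(x, y). (y, x)"], goal_cases)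
    case (5 a)
    obtain i j k l where a: "a = ((i, j), (k, l))" by (metis surj_pair)
    then have "(i, j) \<in> ordered_pairs S" "(k, l) \<in> ordered_pairs (S - {i, j})" using 5 by auto
    from anti[OF this] show ?case unfolding a by simp
  qed (auto simp: ordered_pairs_def)
  then have "sum ?f ?A = - sum ?f ?A" unfolding sum_negf .
  \<comment> \<open>Twice the sum is zero, and the characteristic is zero.\<close>
  then have "sum ?f ?A = 0" by (simp add: poly_mapping_eq_iff fun_eq_iff)
  ultimately show ?thesis by simp
qed

end

text \<open>A sum of several elements of a quotient is not an operation of its carrier. It is
  expressed by \<open>val\<close>, and additivity of L is recovered by summing
  representatives.\<close>

lemma lin_on_val_sum:
  assumes L: "lin_on (presented S R) L" and y: "y \<in> carrier (presented S R)" and A: "finite A"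
    and x: "\<And>a. a \<in> A \<Longrightarrow> x a \<in> carrier (presented S R)" and v: "val R y = (\<Sum>a\<in>A. val R (x a))"
  shows "L y = (\<Sum>a\<in>A. L (x a))"
proof -
  have "\<forall>a\<in>A. \<exists>p. Poly_Mapping.keys p \<subseteq> S \<and> x a = cls R p" using x by (metis presented_memE)
  then obtain p where p: "\<And>a. a \<in> A \<Longrightarrow> Poly_Mapping.keys (p a) \<subseteq> S \<and> x a = cls R (p a)" by metis
  have k: "Poly_Mapping.keys (sum p A) \<subseteq> S" using p by (intro keys_sum_subset) blast
  have "val R y = val R (cls R (sum p A))" unfolding v val_cls nf_sum by (rule sum.cong) (use p in auto)
  then have "y = cls R (sum p A)" using val_inj[OF y cls_in_presented[OF k]] by blast
  then have "L y = lin_ext (\<lambda>g. L (cls R (gen g))) (sum p A)" using lin_on_cls[OF L k] by simp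
  also have "\<dots> = (\<Sum>a\<in>A. L (x a))" unfolding lin_ext_sum
    by (rule sum.cong[OF refl]) (use p lin_on_cls[OF L] in simp)
  finally show ?thesis .
qed

context brauer
begin

context
  fixes \<Theta> :: "nat set \<Rightarrow> ('k ubmor \<Rightarrow> 'k) \<Rightarrow> 'v \<Rightarrow> ('w \<Rightarrow>\<^sub>0 'k)" and s :: nat
  assumes \<Theta>1: "finite S \<Longrightarrow> card S = s \<Longrightarrow> m \<in> carrier (At M S) \<Longrightarrow> lin_on (Dual S) (\<lambda>\<phi>. \<Theta> S \<phi> m)"
    and \<Theta>2: "finite S \<Longrightarrow> card S = s \<Longrightarrow> \<phi> \<in> carrier (Dual S) \<Longrightarrow> lin_on (At M S) (\<lambda>m. \<Theta> S \<phi> m)"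
    and \<Theta>_balanced: "bij_betw \<sigma> S S' \<Longrightarrow> finite S \<Longrightarrow> card S = s \<Longrightarrow> \<phi> \<in> carrier (Dual S') \<Longrightarrow> m \<in> carrier (At M S) \<Longrightarrow>
      \<Theta> S (Act N S' S (bij_ub p S S' \<sigma>) \<phi>) m = \<Theta> S' \<phi> (Act M S S' (bij_ub q S' S (inv_into S \<sigma>)) m)"
begin

text \<open>
  Balanced families on \<open>S\<close>, \<open>\<phi>\<close>, \<open>m\<close> extend to the triple tensor product, one tensor factor at a time.
\<close>

definition lift1 where
  "lift1 U \<phi> Y m = plift (lin_ext (\<lambda>(S, F, G). \<Theta> S (Act N U S F \<phi>) (Act M Y S G m)))"

lemma lift1_rels:
  assumes U: "finite U" and \<phi>: "\<phi> \<in> carrier (Dual U)" and Y: "finite Y" and m: "m \<in> carrier (At M Y)"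
    and r: "r \<in> Rk s U Y"
  shows "lin_ext (\<lambda>(S, F, G). \<Theta> S (Act N U S F \<phi>) (Act M Y S G m)) r = 0"
proof (rule tensor_lift[OF _ _ _ r[unfolded koszul_rels_def]], goal_cases)
  case (1 S G)
  then have S: "finite S" "card S = s" and G: "G \<in> carrier (Hom (ub q) S Y)" by (simp_all add: FB_simps)
  show ?case unfolding FB_simps prod.case
    by (rule lin_on_comp[OF \<Theta>1[OF S act_in[OF Y S(1) G m]] dual_act_linear2[OF X \<phi>]])
next
  case (2 S F)
  then have S: "finite S" "card S = s" and F: "F \<in> carrier (Hom (ub p) S U)" by (simp_all add: FB_simps)
  show ?case unfolding FB_simps prod.case
    by (rule lin_on_comp[OF \<Theta>2[OF S N_in[OF F \<phi>]] act_linear2[OF Y S(1) m]])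
next
  case (3 S S' a F G)
  then have S: "finite S" "card S = s" and S': "finite S'" "card S' = s" and a: "a \<in> carrier (free_space (Bij S S'))"
    and F: "F \<in> carrier (Hom (ub p) S' U)" and G: "G \<in> carrier (Hom (ub q) S Y)" by (simp_all add: FB_simps)
  note Gm = act_in[OF Y S(1) G m] and F\<phi> = N_in[OF F \<phi>]
  have "\<Theta> S (Act N U S (Cmp (ub p) S S' U F (FB_ub p S S' a)) \<phi>) (Act M Y S G m) =
    \<Theta> S' (Act N U S' F \<phi>) (Act M Y S' (Cmp (ub q) S' S Y G (FB_db q S S' a)) m)"
  proof (rule free_lin_on_eq[OF _ _ _ a])
    show "lin_on (free_space (Bij S S')) (\<lambda>a. \<Theta> S (Act N U S (Cmp (ub p) S S' U F (FB_ub p S S' a)) \<phi>) (Act M Y S G m))"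
      by (rule lin_on_comp[OF lin_on_comp[OF lin_on_comp[OF \<Theta>1[OF S Gm] dual_act_linear2[OF X \<phi>]] ub_Cmp_linear2[OF S(1) F]] FB_ub_linear[OF S(1)]])
    show "lin_on (free_space (Bij S S')) (\<lambda>a. \<Theta> S' (Act N U S' F \<phi>) (Act M Y S' (Cmp (ub q) S' S Y G (FB_db q S S' a)) m))"
      by (rule lin_on_comp[OF lin_on_comp[OF lin_on_comp[OF \<Theta>2[OF S' F\<phi>] act_linear2[OF Y S'(1) m]] ub_Cmp_linear2[OF S'(1) G]] FB_db_linear[OF S'(1)]])
    fix \<sigma> assume s: "\<sigma> \<in> Bij S S'"
    note b = BijD(1)[OF s]
    have p: "bij_ub p S S' \<sigma> \<in> carrier (Hom (ub p) S S')" and q: "bij_ub q S' S (inv_into S \<sigma>) \<in> carrier (Hom (ub q) S' S)"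
      by (intro ub_cls_in bij_D_in_D b bij_betw_inv_into S S')+
    show "\<Theta> S (Act N U S (Cmp (ub p) S S' U F (FB_ub p S S' (gen \<sigma>))) \<phi>) (Act M Y S G m) =
      \<Theta> S' (Act N U S' F \<phi>) (Act M Y S' (Cmp (ub q) S' S Y G (FB_db q S S' (gen \<sigma>))) m)"
      unfolding FB_ub_gen FB_db_gen dual_act_comp[OF X S(1) p F, symmetric] act_comp[OF Y S(1) S'(1) G q m, symmetric]
      by (rule \<Theta>_balanced[OF b S F\<phi> Gm])
  qed
  then show ?case by (simp add: FB_simps)
qed

lemma lift1_lin:
  assumes "finite U" "\<phi> \<in> carrier (Dual U)" "finite Y" "m \<in> carrier (At M Y)"
  shows "lin_on (koszul p q s U Y) (lift1 U \<phi> Y m)"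
  unfolding lift1_def koszul_def tensor_def koszul_rels_def[symmetric]
  by (rule lin_on_plift[OF lift1_rels[OF assms] flin_lin_ext])

lemma lift1_cls:
  assumes "finite U" "\<phi> \<in> carrier (Dual U)" "finite Y" "m \<in> carrier (At M Y)"
  shows "lift1 U \<phi> Y m (cls (Rk s U Y) (gen (S, F, G))) = \<Theta> S (Act N U S F \<phi>) (Act M Y S G m)"
  unfolding lift1_def by (subst plift_cls[OF flin_lin_ext lift1_rels[OF assms]]) simp_all

definition lift2 where "lift2 U \<phi> = plift (lin_ext (\<lambda>(Y, w, m). lift1 U \<phi> Y m w))"

lemma lift2_rels:
  assumes U: "finite U" and \<phi>: "\<phi> \<in> carrier (Dual U)" and r: "r \<in> R2 s U"
  shows "lin_ext (\<lambda>(Y, w, m). lift1 U \<phi> Y m w) r = 0"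
proof (rule tensor_lift[OF _ _ _ r], goal_cases)
  case (1 Y m)
  then show ?case by (simp add: lift1_lin[OF U \<phi>])
next
  case (2 Y w)
  then have Y: "finite Y" and w: "w \<in> carrier (koszul p q s U Y)" by simp_all
  \<comment> \<open>In \<open>lift1\<close> the element m is a parameter of a chosen extension, so
    linearity in m cannot be read off; it is compared on pure tensors, where \<Theta> provides it.
    The same happens with \<phi> in \<open>lift3_rels\<close>.\<close>
  have "lin_on (At M Y) (\<lambda>m. lift1 U \<phi> Y m w)"
  proof (rule lin_onI)
    fix m m' assume m: "m \<in> carrier (At M Y)" and m': "m' \<in> carrier (At M Y)"
    note mm = closed_add[OF M_closed[OF Y] m m']
    show "lift1 U \<phi> Y (m \<oplus>\<^bsub>At M Y\<^esub> m') w = lift1 U \<phi> Y m w + lift1 U \<phi> Y m' w"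
    proof (rule koszul_lin_on_eq[OF lift1_lin[OF U \<phi> Y mm] lin_on_plus[OF lift1_lin[OF U \<phi> Y m] lift1_lin[OF U \<phi> Y m']] _ w])
      fix S and F G :: "'k ubmor"
      assume S: "finite S" "card S = s" and F: "F \<in> carrier (Hom (ub p) S U)" and G: "G \<in> carrier (Hom (ub q) S Y)"
      show "lift1 U \<phi> Y (m \<oplus>\<^bsub>At M Y\<^esub> m') (cls (Rk s U Y) (gen (S, F, G))) =
        lift1 U \<phi> Y m (cls (Rk s U Y) (gen (S, F, G))) + lift1 U \<phi> Y m' (cls (Rk s U Y) (gen (S, F, G)))"
        unfolding lift1_cls[OF U \<phi> Y m] lift1_cls[OF U \<phi> Y m'] lift1_cls[OF U \<phi> Y mm]
        by (rule lin_on_add[OF lin_on_comp[OF \<Theta>2[OF S N_in[OF F \<phi>]] act_linear1[OF Y S(1) G]] m m'])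
    qed
  next
    fix c m assume m: "m \<in> carrier (At M Y)"
    note mm = closed_smult[OF M_closed[OF Y] m]
    show "lift1 U \<phi> Y (c \<odot>\<^bsub>At M Y\<^esub> m) w = fscale c (lift1 U \<phi> Y m w)"
    proof (rule koszul_lin_on_eq[OF lift1_lin[OF U \<phi> Y mm] lin_on_scale[OF lift1_lin[OF U \<phi> Y m]] _ w])
      fix S and F G :: "'k ubmor"
      assume S: "finite S" "card S = s" and F: "F \<in> carrier (Hom (ub p) S U)" and G: "G \<in> carrier (Hom (ub q) S Y)"
      show "lift1 U \<phi> Y (c \<odot>\<^bsub>At M Y\<^esub> m) (cls (Rk s U Y) (gen (S, F, G))) =
        fscale c (lift1 U \<phi> Y m (cls (Rk s U Y) (gen (S, F, G))))"
        unfolding lift1_cls[OF U \<phi> Y m] lift1_cls[OF U \<phi> Y mm]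
        by (rule lin_on_smult[OF lin_on_comp[OF \<Theta>2[OF S N_in[OF F \<phi>]] act_linear1[OF Y S(1) G]] m])
    qed
  qed
  then show ?case by simp
next
  case (3 Y Y' a w m)
  then have Y: "finite Y" "finite Y'" and a: "a \<in> carrier (Hom (ub q) Y' Y)" and w: "w \<in> carrier (koszul p q s U Y')"
    and m: "m \<in> carrier (At M Y)" by simp_all
  note am = act_in[OF Y a m]
  have "lift1 U \<phi> Y m (koszul_ract p q s U Y' Y a w) = lift1 U \<phi> Y' (Act M Y Y' a m) w"
  proof (rule koszul_lin_on_eq[OF lin_on_comp[OF lift1_lin[OF U \<phi> Y(1) m] koszul_ract_linear[OF a]] lift1_lin[OF U \<phi> Y(2) am] _ w])
    fix S and F G :: "'k ubmor"
    assume S: "finite S" "card S = s" and F: "F \<in> carrier (Hom (ub p) S U)" and G: "G \<in> carrier (Hom (ub q) S Y')"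
    show "lift1 U \<phi> Y m (koszul_ract p q s U Y' Y a (cls (Rk s U Y') (gen (S, F, G)))) =
      lift1 U \<phi> Y' (Act M Y Y' a m) (cls (Rk s U Y') (gen (S, F, G)))"
      unfolding koszul_ract_cls[OF a] lift1_cls[OF U \<phi> Y(1) m] lift1_cls[OF U \<phi> Y(2) am] act_comp[OF Y S(1) a G m] ..
  qed
  then show ?case by simp
qed

lemma lift2_lin: "finite U \<Longrightarrow> \<phi> \<in> carrier (Dual U) \<Longrightarrow> lin_on (At (KT s) U) (lift2 U \<phi>)"
  unfolding lift2_def KT_At tensor_def by (rule lin_on_plift[OF lift2_rels flin_lin_ext])

lemma lift2_cls: "finite U \<Longrightarrow> \<phi> \<in> carrier (Dual U) \<Longrightarrow> lift2 U \<phi> (cls (R2 s U) (gen (Y, w, m))) = lift1 U \<phi> Y m w"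
  unfolding lift2_def by (subst plift_cls[OF flin_lin_ext lift2_rels]) simp_all

lemma lift2_eqI:
  assumes L: "lin_on (At (KT s) U) L" and L': "lin_on (At (KT s) U) L'" and z: "z \<in> carrier (At (KT s) U)"
    and eq: "\<And>Y S F G m. finite Y \<Longrightarrow> m \<in> carrier (At M Y) \<Longrightarrow> finite S \<Longrightarrow> card S = s \<Longrightarrow> F \<in> carrier (Hom (ub p) S U) \<Longrightarrow>
      G \<in> carrier (Hom (ub q) S Y) \<Longrightarrow>
      L (cls (R2 s U) (gen (Y, cls (Rk s U Y) (gen (S, F, G)), m))) = L' (cls (R2 s U) (gen (Y, cls (Rk s U Y) (gen (S, F, G)), m)))"
  shows "L z = L' z"
proof (rule tensor_lin_on_eq[OF L[unfolded KT_At] L'[unfolded KT_At] _ z[unfolded KT_At]])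
  fix Y and w :: "'k koszul" and m assume "Y \<in> Ob (db q)" "w \<in> carrier (At (koszul_right p q s U) Y)" and m: "m \<in> carrier (At M Y)"
  then have Y: "finite Y" and w: "w \<in> carrier (koszul p q s U Y)" by simp_all
  note r2 = R2_linear[OF Y m, of s U]
  show "L (cls (R2 s U) (gen (Y, w, m))) = L' (cls (R2 s U) (gen (Y, w, m)))"
    by (rule koszul_lin_on_eq[OF lin_on_comp[OF L r2] lin_on_comp[OF L' r2] _ w]) (rule eq[OF Y m])
qed

lemma lift3_rels:
  assumes r: "r \<in> R3 s"
  shows "lin_ext (\<lambda>(U, \<phi>, z). lift2 U \<phi> z) r = 0"
proof (rule tensor_lift[OF _ _ _ r], goal_cases)
  case (1 U z)
  then have U: "finite U" and z: "z \<in> carrier (At (KT s) U)" by simp_all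
  have cl: "closed_space (Dual U)" by (rule closed_dual[OF ub_closed])
  have "lin_on (Dual U) (\<lambda>\<phi>. lift2 U \<phi> z)"
  proof (rule lin_onI)
    fix \<phi> \<psi> assume \<phi>: "\<phi> \<in> carrier (Dual U)" and \<psi>: "\<psi> \<in> carrier (Dual U)"
    note pp = closed_add[OF cl \<phi> \<psi>]
    show "lift2 U (\<phi> \<oplus>\<^bsub>Dual U\<^esub> \<psi>) z = lift2 U \<phi> z + lift2 U \<psi> z"
    proof (rule lift2_eqI[OF lift2_lin[OF U pp] lin_on_plus[OF lift2_lin[OF U \<phi>] lift2_lin[OF U \<psi>]] z])
      fix Y S and F G :: "'k ubmor" and m
      assume Y: "finite Y" "m \<in> carrier (At M Y)" and S: "finite S" "card S = s" and F: "F \<in> carrier (Hom (ub p) S U)" and G: "G \<in> carrier (Hom (ub q) S Y)"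
      show "lift2 U (\<phi> \<oplus>\<^bsub>Dual U\<^esub> \<psi>) (cls (R2 s U) (gen (Y, cls (Rk s U Y) (gen (S, F, G)), m))) =
        lift2 U \<phi> (cls (R2 s U) (gen (Y, cls (Rk s U Y) (gen (S, F, G)), m))) +
        lift2 U \<psi> (cls (R2 s U) (gen (Y, cls (Rk s U Y) (gen (S, F, G)), m)))"
        unfolding lift2_cls[OF U \<phi>] lift2_cls[OF U \<psi>] lift2_cls[OF U pp] lift1_cls[OF U \<phi> Y] lift1_cls[OF U \<psi> Y] lift1_cls[OF U pp Y]
        by (rule lin_on_add[OF lin_on_comp[OF \<Theta>1[OF S act_in[OF Y(1) S(1) G Y(2)]] dual_act_linear1[OF X F]] \<phi> \<psi>])
    qed
  next
    fix c \<phi> assume \<phi>: "\<phi> \<in> carrier (Dual U)"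
    note pp = closed_smult[OF cl \<phi>]
    show "lift2 U (c \<odot>\<^bsub>Dual U\<^esub> \<phi>) z = fscale c (lift2 U \<phi> z)"
    proof (rule lift2_eqI[OF lift2_lin[OF U pp] lin_on_scale[OF lift2_lin[OF U \<phi>]] z])
      fix Y S and F G :: "'k ubmor" and m
      assume Y: "finite Y" "m \<in> carrier (At M Y)" and S: "finite S" "card S = s" and F: "F \<in> carrier (Hom (ub p) S U)" and G: "G \<in> carrier (Hom (ub q) S Y)"
      show "lift2 U (c \<odot>\<^bsub>Dual U\<^esub> \<phi>) (cls (R2 s U) (gen (Y, cls (Rk s U Y) (gen (S, F, G)), m))) =
        fscale c (lift2 U \<phi> (cls (R2 s U) (gen (Y, cls (Rk s U Y) (gen (S, F, G)), m))))"
        unfolding lift2_cls[OF U \<phi>] lift2_cls[OF U pp] lift1_cls[OF U \<phi> Y] lift1_cls[OF U pp Y]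
        by (rule lin_on_smult[OF lin_on_comp[OF \<Theta>1[OF S act_in[OF Y(1) S(1) G Y(2)]] dual_act_linear1[OF X F]] \<phi>])
    qed
  qed
  then show ?case by (simp add: N_simps)
next
  case (2 U \<phi>)
  then show ?case by (simp add: lift2_lin N_simps)
next
  case (3 U U' a \<phi> z)
  then have U: "finite U" "finite U'" and a: "a \<in> carrier (Hom (ub p) U U')" and \<phi>: "\<phi> \<in> carrier (Dual U')"
    and z: "z \<in> carrier (At (KT s) U)" by (simp_all add: N_simps)
  note a\<phi> = N_in[OF a \<phi>]
  have "lift2 U (Act N U' U a \<phi>) z = lift2 U' \<phi> (Act (KT s) U U' a z)"
  proof (rule lift2_eqI[OF lift2_lin[OF U(1) a\<phi>] lin_on_comp[OF lift2_lin[OF U(2) \<phi>] KT_linear[OF a]] z])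
    fix Y S and F G :: "'k ubmor" and m
    assume Y: "finite Y" "m \<in> carrier (At M Y)" and S: "finite S" "card S = s" and F: "F \<in> carrier (Hom (ub p) S U)" and G: "G \<in> carrier (Hom (ub q) S Y)"
    show "lift2 U (Act N U' U a \<phi>) (cls (R2 s U) (gen (Y, cls (Rk s U Y) (gen (S, F, G)), m))) =
      lift2 U' \<phi> (Act (KT s) U U' a (cls (R2 s U) (gen (Y, cls (Rk s U Y) (gen (S, F, G)), m))))"
      unfolding KT_cls[OF a] koszul_lact_cls[OF a] lift2_cls[OF U(1) a\<phi>] lift2_cls[OF U(2) \<phi>]
        lift1_cls[OF U(1) a\<phi> Y] lift1_cls[OF U(2) \<phi> Y] dual_act_comp[OF X S(1) F a] ..
  qed
  then show ?case by simp
qed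

lemma universal_property:
  obtains \<Lambda> where "lin_on (T s) \<Lambda>"
    "\<And>S \<phi> m. finite S \<Longrightarrow> card S = s \<Longrightarrow> \<phi> \<in> carrier (Dual S) \<Longrightarrow> m \<in> carrier (At M S) \<Longrightarrow> \<Lambda> (ecl s S \<phi> m) = \<Theta> S \<phi> m"
proof (rule that)
  let ?L = "plift (lin_ext (\<lambda>(U, \<phi>, z). lift2 U \<phi> z))"
  show "lin_on (T s) ?L" unfolding T_presented by (rule lin_on_plift[OF lift3_rels flin_lin_ext])
  fix S \<phi> m assume S: "finite S" "card S = s" and \<phi>: "\<phi> \<in> carrier (Dual S)" and m: "m \<in> carrier (At M S)"
  have L: "?L (cls (R3 s) (gen (U, \<psi>, z))) = lift2 U \<psi> z" for U \<psi> z
    by (subst plift_cls[OF flin_lin_ext lift3_rels]) simp_all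
  show "?L (ecl s S \<phi> m) = \<Theta> S \<phi> m"
    unfolding ecl_def elc_def L lift2_cls[OF S(1) \<phi>]
      lift1_cls[OF S(1) \<phi> S(1) m] dual_act_id[OF X S(1) \<phi>] act_id[OF S(1) m] ..
qed

end

lemma T_zero: "val (R3 s) \<zero>\<^bsub>T s\<^esub> = 0" "\<zero>\<^bsub>T s\<^esub> \<in> carrier (T s)"
  by (simp_all add: T_presented presented_zero cls_in_presented)

lemma d_square: "x \<in> carrier (T s) \<Longrightarrow> d (s - 2) (d s x) = \<zero>\<^bsub>T (s - 2 - 2)\<^esub>"
proof -
  assume x: "x \<in> carrier (T s)"
  have dl: "d s \<in> linear_maps (T s) (T (s - 2))" and dl': "d (s - 2) \<in> linear_maps (T (s - 2)) (T (s - 2 - 2))"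
    by (rule d_linear)+
  have L: "lin_on (T (s - 2)) (\<lambda>y. val (R3 (s - 2 - 2)) (d (s - 2) y))"
    by (rule lin_on_comp[OF T_val_lin dl'])
  have "val (R3 (s - 2 - 2)) (d (s - 2) (d s x)) = 0"
  proof (rule T_lin_on_eq[where L'="\<lambda>_. 0", OF lin_on_comp[OF L dl] _ _ x])
    show "lin_on (T s) (\<lambda>_. 0)" by (rule lin_onI) simp_all
    fix S \<phi> m assume S: "finite S" "card S = s" and \<phi>: "\<phi> \<in> carrier (Dual S)" and m: "m \<in> carrier (At M S)"
    let ?e = "\<lambda>(i, j). ecl (s - 2) (S - {i, j}) (Act N S (S - {i, j}) (chord p S i j) \<phi>) (Act M S (S - {i, j}) (chord q S i j) m)"
    have ij: "finite (S - {i, j})" "card (S - {i, j}) = s - 2" "Act N S (S - {i, j}) (chord p S i j) \<phi> \<in> carrier (Dual (S - {i, j}))"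
        "Act M S (S - {i, j}) (chord q S i j) m \<in> carrier (At M (S - {i, j}))" if "(i, j) \<in> ordered_pairs S" for i j
    proof -
      have ij: "i \<in> S" "j \<in> S" "i \<noteq> j" using that by (auto dest: ordered_pairsD)
      show "finite (S - {i, j})" "card (S - {i, j}) = s - 2" using S card_pair[OF S(1) ij] by auto
      show "Act N S (S - {i, j}) (chord p S i j) \<phi> \<in> carrier (Dual (S - {i, j}))" by (intro N_in chord_in S ij \<phi>)
      show "Act M S (S - {i, j}) (chord q S i j) m \<in> carrier (At M (S - {i, j}))" by (intro act_in chord_in S ij m) (simp add: S)
    qed
    have "val (R3 (s - 2 - 2)) (d (s - 2) (d s (ecl s S \<phi> m))) =
      (\<Sum>x\<in>ordered_pairs S. val (R3 (s - 2 - 2)) (d (s - 2) (?e x)))"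
    proof (rule lin_on_val_sum[OF L[unfolded T_presented]])
      show "d s (ecl s S \<phi> m) \<in> carrier (presented (tensor_gens (ub p) N (KT (s - 2))) (R3 (s - 2)))"
        using linear_maps_mem[OF dl ecl_in[OF S \<phi> m]] unfolding T_presented .
      show "?e x \<in> carrier (presented (tensor_gens (ub p) N (KT (s - 2))) (R3 (s - 2)))" if "x \<in> ordered_pairs S" for x
        using that ij ecl_in unfolding T_presented[symmetric] by (cases x) auto
      show "val (R3 (s - 2)) (d s (ecl s S \<phi> m)) = (\<Sum>x\<in>ordered_pairs S. val (R3 (s - 2)) (?e x))"
        unfolding d_ecl[OF S \<phi> m] E_def by (rule sum.cong) auto
    qed (simp add: S)
    also have "\<dots> = (\<Sum>(i, j)\<in>ordered_pairs S. \<Sum>(k, l)\<in>ordered_pairs (S - {i, j}).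
    E (s - 2 - 2) (S - {i, j} - {k, l})
      (Act N (S - {i, j}) (S - {i, j} - {k, l}) (chord p (S - {i, j}) k l) (Act N S (S - {i, j}) (chord p S i j) \<phi>))
      (Act M (S - {i, j}) (S - {i, j} - {k, l}) (chord q (S - {i, j}) k l) (Act M S (S - {i, j}) (chord q S i j) m)))"
    proof (rule sum.cong[OF refl], goal_cases)
      case (1 x)
      obtain i j where xij: "x = (i, j)" by (cases x)
      show ?case unfolding xij prod.case by (rule d_ecl) (use 1 ij xij in auto)
    qed
    also have "\<dots> = 0" by (rule E_d_d[OF S \<phi> m])
    finally show "val (R3 (s - 2 - 2)) (d (s - 2) (d s (ecl s S \<phi> m))) = 0" .
  qed
  then show ?thesis
    using T_val_inj[OF linear_maps_mem[OF dl' linear_maps_mem[OF dl x]] T_zero(2)] by (simp add: T_zero)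
qed

section \<open>Vanishing of homology from a contracting homotopy\<close>

context
  fixes e :: "nat set \<Rightarrow> nat set" and P :: "nat set \<Rightarrow> ('k ubmor \<Rightarrow> 'k) \<Rightarrow> ('k ubmor \<Rightarrow> 'k)" and J :: "nat set \<Rightarrow> 'v \<Rightarrow> 'v"
  assumes e_finite: "finite S \<Longrightarrow> finite (e S)" and e_card: "finite S \<Longrightarrow> card (e S) = card S + 2"
    and P_linear: "finite S \<Longrightarrow> P S \<in> linear_maps (Dual S) (Dual (e S))"
    and J_linear: "finite S \<Longrightarrow> J S \<in> linear_maps (At M S) (At M (e S))"
    and PJ_balanced: "bij_betw \<sigma> S S' \<Longrightarrow> finite S \<Longrightarrow> \<phi> \<in> carrier (Dual S') \<Longrightarrow> m \<in> carrier (At M S) \<Longrightarrow>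
      E (card S + 2) (e S) (P S (Act N S' S (bij_ub p S S' \<sigma>) \<phi>)) (J S m) =
      E (card S + 2) (e S') (P S' \<phi>) (J S' (Act M S S' (bij_ub q S' S (inv_into S \<sigma>)) m))"
    and homotopy: "finite S \<Longrightarrow> \<phi> \<in> carrier (Dual S) \<Longrightarrow> m \<in> carrier (At M S) \<Longrightarrow>
      (\<Sum>(i, j)\<in>ordered_pairs (e S). E (card S) (e S - {i, j}) (Act N (e S) (e S - {i, j}) (chord p (e S) i j) (P S \<phi>))
        (Act M (e S) (e S - {i, j}) (chord q (e S) i j) (J S m))) +
      (\<Sum>(i, j)\<in>ordered_pairs S. E (card S) (e (S - {i, j})) (P (S - {i, j}) (Act N S (S - {i, j}) (chord p S i j) \<phi>))
        (J (S - {i, j}) (Act M S (S - {i, j}) (chord q S i j) m))) = E (card S) S \<phi> m"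
begin

lemma contraction_exists:
  obtains \<Lambda> where "lin_on (T s) \<Lambda>"
    "\<And>S \<phi> m. finite S \<Longrightarrow> card S = s \<Longrightarrow> \<phi> \<in> carrier (Dual S) \<Longrightarrow> m \<in> carrier (At M S) \<Longrightarrow>
      \<Lambda> (ecl s S \<phi> m) = E (s + 2) (e S) (P S \<phi>) (J S m)"
proof (rule universal_property[of s "\<lambda>S \<phi> m. E (s + 2) (e S) (P S \<phi>) (J S m)"])
  fix S m assume "finite S" "card S = s" "m \<in> carrier (At M S)"
  then show "lin_on (Dual S) (\<lambda>\<phi>. E (s + 2) (e S) (P S \<phi>) (J S m))"
    by (intro lin_on_comp[OF E_lin1 P_linear]) (simp_all add: e_finite e_card linear_maps_mem[OF J_linear])
next
  fix S \<phi> assume "finite S" "card S = s" "\<phi> \<in> carrier (Dual S)"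
  then show "lin_on (At M S) (\<lambda>m. E (s + 2) (e S) (P S \<phi>) (J S m))"
    by (intro lin_on_comp[OF E_lin2 J_linear]) (simp_all add: e_finite e_card linear_maps_mem[OF P_linear])
next
  fix \<sigma> S S' \<phi> m
  assume "bij_betw \<sigma> S S'" "finite S" "card S = s" "\<phi> \<in> carrier (Dual S')" "m \<in> carrier (At M S)"
  then show "E (s + 2) (e S) (P S (Act N S' S (bij_ub p S S' \<sigma>) \<phi>)) (J S m) =
      E (s + 2) (e S') (P S' \<phi>) (J S' (Act M S S' (bij_ub q S' S (inv_into S \<sigma>)) m))"
    using PJ_balanced by blast
qed (rule that)

text \<open>The map \<Lambda> comes from the universal property, which only yields values in a free
  space. This brings them back to elements of the complex.\<close>

lemma contraction_in_range:
  assumes \<Lambda>: "lin_on (T s) \<Lambda>"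
    "\<And>S \<phi> m. finite S \<Longrightarrow> card S = s \<Longrightarrow> \<phi> \<in> carrier (Dual S) \<Longrightarrow> m \<in> carrier (At M S) \<Longrightarrow>
      \<Lambda> (ecl s S \<phi> m) = E (s + 2) (e S) (P S \<phi>) (J S m)" and x: "x \<in> carrier (T s)"
  shows "\<exists>y\<in>carrier (T (s + 2)). val (R3 (s + 2)) y = \<Lambda> x"
proof -
  let ?V = "val (R3 (s + 2)) ` carrier (T (s + 2))"
  have cl: "closed_space (T (s + 2))" unfolding T_presented by (rule closed_presented)
  have sub: "v \<in> ?V" if "v \<in> free_vs.span ?V" for v
    using that
  proof (induction rule: free_vs.span_induct_alt)
    case base
    show ?case by (rule image_eqI[OF _ T_zero(2)]) (simp add: T_zero)
  next
    case (step c v w)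
    then obtain a b where ab: "a \<in> carrier (T (s + 2))" "v = val (R3 (s + 2)) a" "b \<in> carrier (T (s + 2))" "w = val (R3 (s + 2)) b"
      by blast
    note ca = closed_smult[OF cl ab(1), of c]
    have "fscale c v + w = val (R3 (s + 2)) ((c \<odot>\<^bsub>T (s + 2)\<^esub> a) \<oplus>\<^bsub>T (s + 2)\<^esub> b)"
      unfolding lin_on_add[OF T_val_lin ca ab(3)] lin_on_smult[OF T_val_lin ab(1)] ab(2,4) ..
    then show ?case using closed_add[OF cl ca ab(3)] by blast
  qed
  \<comment> \<open>The kernel of the linear map \<open>nf ?V\<close> is the span of
    \<open>?V\<close>, which is \<open>?V\<close> itself by \<open>sub\<close>. Membership has
    become a linear equation and can be checked on spanning classes.\<close>
  have "nf ?V (\<Lambda> x) = 0"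
  proof (rule T_lin_on_eq[where L'="\<lambda>_. 0", OF lin_on_flin[OF flin_nf \<Lambda>(1)] _ _ x])
    show "lin_on (T s) (\<lambda>_. 0)" by (rule lin_onI) simp_all
    fix S \<phi> m assume S: "finite S" "card S = s" and \<phi>: "\<phi> \<in> carrier (Dual S)" and m: "m \<in> carrier (At M S)"
    have "ecl (s + 2) (e S) (P S \<phi>) (J S m) \<in> carrier (T (s + 2))"
      by (rule ecl_in) (simp_all add: S e_finite e_card linear_maps_mem[OF P_linear] linear_maps_mem[OF J_linear] \<phi> m)
    then have "\<Lambda> (ecl s S \<phi> m) \<in> ?V" unfolding \<Lambda>(2)[OF S \<phi> m] E_def by (rule imageI)
    then show "nf ?V (\<Lambda> (ecl s S \<phi> m)) = 0" by (rule nf_rel)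
  qed
  then have "\<Lambda> x \<in> ?V" unfolding nf_eq_0_iff by (rule sub)
  then show ?thesis by force
qed

text \<open>Injectivity of \<open>val\<close> makes the preimage \<open>h\<close> of \<Lambda>
  unique and therefore linear. The hypothesis on spanning classes extends to d h + h d = id, so that
  a cycle x is d (h x); the converse inclusion is \<open>d_square\<close>.\<close>

lemma zero_homology_if_contractible: "zero_homology T d"
proof -
  have "\<exists>\<Lambda>. lin_on (T s) \<Lambda> \<and>
    (\<forall>S \<phi> m. finite S \<longrightarrow> card S = s \<longrightarrow> \<phi> \<in> carrier (Dual S) \<longrightarrow> m \<in> carrier (At M S) \<longrightarrow>
      \<Lambda> (ecl s S \<phi> m) = E (s + 2) (e S) (P S \<phi>) (J S m))" for s
    by (rule contraction_exists[of s]) blast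
  then obtain \<Lambda> where \<Lambda>: "\<And>s. lin_on (T s) (\<Lambda> s)"
    "\<And>s S \<phi> m. finite S \<Longrightarrow> card S = s \<Longrightarrow> \<phi> \<in> carrier (Dual S) \<Longrightarrow> m \<in> carrier (At M S) \<Longrightarrow>
      \<Lambda> s (ecl s S \<phi> m) = E (s + 2) (e S) (P S \<phi>) (J S m)" by metis
  define h where "h s x = (SOME y. y \<in> carrier (T (s + 2)) \<and> val (R3 (s + 2)) y = \<Lambda> s x)" for s x
  have h: "h s x \<in> carrier (T (s + 2))" "val (R3 (s + 2)) (h s x) = \<Lambda> s x" if "x \<in> carrier (T s)" for s x
  proof -
    have "\<exists>y. y \<in> carrier (T (s + 2)) \<and> val (R3 (s + 2)) y = \<Lambda> s x"
      using contraction_in_range[OF \<Lambda>(1) \<Lambda>(2) that] by blast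
    from someI_ex[OF this] show "h s x \<in> carrier (T (s + 2))" "val (R3 (s + 2)) (h s x) = \<Lambda> s x"
      unfolding h_def by blast+
  qed
  have cl: "closed_space (T s)" for s unfolding T_presented by (rule closed_presented)
  have h_lin: "h s \<in> linear_maps (T s) (T (s + 2))" for s
  proof (rule linear_mapsI)
    fix x y assume x: "x \<in> carrier (T s)" and y: "y \<in> carrier (T s)"
    have "val (R3 (s + 2)) (h s (x \<oplus>\<^bsub>T s\<^esub> y)) = val (R3 (s + 2)) (h s x \<oplus>\<^bsub>T (s + 2)\<^esub> h s y)"
      unfolding lin_on_add[OF T_val_lin h(1)[OF x] h(1)[OF y]] h(2)[OF x] h(2)[OF y] h(2)[OF closed_add[OF cl x y]]
      by (rule lin_on_add[OF \<Lambda>(1) x y])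
    from this show "h s (x \<oplus>\<^bsub>T s\<^esub> y) = h s x \<oplus>\<^bsub>T (s + 2)\<^esub> h s y"
      unfolding T_val_inj[OF h(1)[OF closed_add[OF cl x y]] closed_add[OF cl h(1)[OF x] h(1)[OF y]]] .
  next
    fix c x assume x: "x \<in> carrier (T s)"
    have "val (R3 (s + 2)) (h s (c \<odot>\<^bsub>T s\<^esub> x)) = val (R3 (s + 2)) (c \<odot>\<^bsub>T (s + 2)\<^esub> h s x)"
      unfolding lin_on_smult[OF T_val_lin h(1)[OF x]] h(2)[OF x] h(2)[OF closed_smult[OF cl x]]
      by (rule lin_on_smult[OF \<Lambda>(1) x])
    then show "h s (c \<odot>\<^bsub>T s\<^esub> x) = c \<odot>\<^bsub>T (s + 2)\<^esub> h s x"
      unfolding T_val_inj[OF h(1)[OF closed_smult[OF cl x]] closed_smult[OF cl h(1)[OF x]]] .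
  qed (rule h(1))
  have dl: "d (s + 2) \<in> linear_maps (T (s + 2)) (T s)" for s using d_linear[of "s + 2"] by simp
  have htpy: "val (R3 s) (d (s + 2) (h s x)) + \<Lambda> (s - 2) (d s x) = val (R3 s) x" if x: "x \<in> carrier (T s)" for s x
  proof (rule T_lin_on_eq[OF _ T_val_lin _ x])
    show "lin_on (T s) (\<lambda>x. val (R3 s) (d (s + 2) (h s x)) + \<Lambda> (s - 2) (d s x))"
      by (rule lin_on_plus[OF lin_on_comp[OF lin_on_comp[OF T_val_lin dl] h_lin] lin_on_comp[OF \<Lambda>(1) d_linear]])
    fix S \<phi> m assume S: "finite S" "card S = s" and \<phi>: "\<phi> \<in> carrier (Dual S)" and m: "m \<in> carrier (At M S)"
    have eS: "finite (e S)" "card (e S) = s + 2" using S e_finite e_card by auto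
    have P: "P S \<phi> \<in> carrier (Dual (e S))" and J: "J S m \<in> carrier (At M (e S))"
      by (rule linear_maps_mem[OF P_linear[OF S(1)] \<phi>], rule linear_maps_mem[OF J_linear[OF S(1)] m])
    have ec: "ecl s S \<phi> m \<in> carrier (T s)" by (rule ecl_in[OF S \<phi> m])
    have "val (R3 (s + 2)) (h s (ecl s S \<phi> m)) = val (R3 (s + 2)) (ecl (s + 2) (e S) (P S \<phi>) (J S m))"
      unfolding h(2)[OF ec] \<Lambda>(2)[OF S \<phi> m] E_def ..
    then have hec: "h s (ecl s S \<phi> m) = ecl (s + 2) (e S) (P S \<phi>) (J S m)"
      using T_val_inj[OF h(1)[OF ec] ecl_in[OF eS P J]] by blast
    let ?e = "\<lambda>(i, j). ecl (s - 2) (S - {i, j}) (Act N S (S - {i, j}) (chord p S i j) \<phi>) (Act M S (S - {i, j}) (chord q S i j) m)"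
    \<comment> \<open>If S has a chord then s is at least 2, and the subtraction in s - 2 is not
      truncated. Otherwise the sums over chords are empty and the index is irrelevant.\<close>
    have ij: "finite (S - {i, j})" "card (S - {i, j}) = s - 2" "Act N S (S - {i, j}) (chord p S i j) \<phi> \<in> carrier (Dual (S - {i, j}))"
        "Act M S (S - {i, j}) (chord q S i j) m \<in> carrier (At M (S - {i, j}))" "s - 2 + 2 = s" if "(i, j) \<in> ordered_pairs S" for i j
    proof -
      have ij: "i \<in> S" "j \<in> S" "i \<noteq> j" using that by (auto dest: ordered_pairsD)
      show "finite (S - {i, j})" "card (S - {i, j}) = s - 2" "s - 2 + 2 = s" using S card_pair[OF S(1) ij] by auto
      show "Act N S (S - {i, j}) (chord p S i j) \<phi> \<in> carrier (Dual (S - {i, j}))" by (intro N_in chord_in S ij \<phi>)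
      show "Act M S (S - {i, j}) (chord q S i j) m \<in> carrier (At M (S - {i, j}))" by (intro act_in chord_in S ij m) (simp add: S)
    qed
    have "\<Lambda> (s - 2) (d s (ecl s S \<phi> m)) = (\<Sum>x\<in>ordered_pairs S. \<Lambda> (s - 2) (?e x))"
    proof (rule lin_on_val_sum[OF \<Lambda>(1)[unfolded T_presented]])
      show "d s (ecl s S \<phi> m) \<in> carrier (presented (tensor_gens (ub p) N (KT (s - 2))) (R3 (s - 2)))"
        using linear_maps_mem[OF d_linear ec] unfolding T_presented .
      show "?e x \<in> carrier (presented (tensor_gens (ub p) N (KT (s - 2))) (R3 (s - 2)))" if "x \<in> ordered_pairs S" for x
        using that ij ecl_in unfolding T_presented[symmetric] by (cases x) auto
      show "val (R3 (s - 2)) (d s (ecl s S \<phi> m)) = (\<Sum>x\<in>ordered_pairs S. val (R3 (s - 2)) (?e x))"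
        unfolding d_ecl[OF S \<phi> m] E_def by (rule sum.cong) auto
    qed (simp add: S)
    also have "\<dots> = (\<Sum>(i, j)\<in>ordered_pairs S. E s (e (S - {i, j})) (P (S - {i, j}) (Act N S (S - {i, j}) (chord p S i j) \<phi>))
        (J (S - {i, j}) (Act M S (S - {i, j}) (chord q S i j) m)))"
    proof (rule sum.cong[OF refl], goal_cases)
      case (1 x)
      obtain i j where xij: "x = (i, j)" by (cases x)
      note ij' = ij[OF 1[unfolded xij]]
      show ?case unfolding xij prod.case \<Lambda>(2)[OF ij'(1-4)] ij'(5) ..
    qed
    finally have 2: "\<Lambda> (s - 2) (d s (ecl s S \<phi> m)) = \<dots>" .
    have 1: "val (R3 s) (d (s + 2) (h s (ecl s S \<phi> m))) =
      (\<Sum>(i, j)\<in>ordered_pairs (e S). E s (e S - {i, j}) (Act N (e S) (e S - {i, j}) (chord p (e S) i j) (P S \<phi>))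
        (Act M (e S) (e S - {i, j}) (chord q (e S) i j) (J S m)))"
      unfolding hec using d_ecl[OF eS P J] by simp
    show "val (R3 s) (d (s + 2) (h s (ecl s S \<phi> m))) + \<Lambda> (s - 2) (d s (ecl s S \<phi> m)) = val (R3 s) (ecl s S \<phi> m)"
      unfolding 1 2 E_def[symmetric] using homotopy[OF S(1) \<phi> m] unfolding S(2) .
  qed
  show ?thesis unfolding zero_homology_def
  proof (intro allI equalityI subsetI)
    fix s x assume "x \<in> {x \<in> carrier (T s). d s x = \<zero>\<^bsub>T (s - 2)\<^esub>}"
    then have x: "x \<in> carrier (T s)" and dx: "d s x = \<zero>\<^bsub>T (s - 2)\<^esub>" by auto
    have "\<Lambda> (s - 2) \<zero>\<^bsub>T (s - 2)\<^esub> = (\<Sum>a\<in>{}. \<Lambda> (s - 2) a)"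
      by (rule lin_on_val_sum[OF \<Lambda>(1)[unfolded T_presented]])
        (use T_zero[of "s - 2"] in \<open>simp_all add: T_presented\<close>)
    then have "\<Lambda> (s - 2) \<zero>\<^bsub>T (s - 2)\<^esub> = 0" by simp
    then have "val (R3 s) (d (s + 2) (h s x)) = val (R3 s) x" using htpy[OF x] dx by simp
    then have "x = d (s + 2) (h s x)" using T_val_inj[OF linear_maps_mem[OF dl h(1)[OF x]] x] by simp
    then show "x \<in> d (s + 2) ` carrier (T (s + 2))" using h(1)[OF x] by blast
  next
    fix s x assume "x \<in> d (s + 2) ` carrier (T (s + 2))"
    then obtain y where y: "y \<in> carrier (T (s + 2))" "x = d (s + 2) y" by blast
    have "d (s + 2 - 2) (d (s + 2) y) = \<zero>\<^bsub>T (s + 2 - 2 - 2)\<^esub>" by (rule d_square[OF y(1)])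
    then show "x \<in> {x \<in> carrier (T s). d s x = \<zero>\<^bsub>T (s - 2)\<^esub>}"
      using y linear_maps_mem[OF dl y(1)] by simp
  qed
qed

end

end

subsection \<open>Signed permutations of lists\<close>

text \<open>\<open>ys\<close> arises from \<open>xs\<close> by a permutation of sign \<open>c\<close> (not determined by the lists when entries repeat).\<close>

definition iperm :: "int \<Rightarrow> 'a list \<Rightarrow> 'a list \<Rightarrow> bool" where
  "iperm c xs ys \<longleftrightarrow> (\<exists>\<pi>. \<pi> permutes {..<length xs} \<and> ys = permute_list \<pi> xs \<and> c = sign \<pi>)"

lemma ipermI: "\<pi> permutes {..<length xs} \<Longrightarrow> iperm (sign \<pi>) xs (permute_list \<pi> xs)"
  unfolding iperm_def by blast

lemma iperm_refl: "iperm 1 xs xs"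
  using ipermI[of id xs] by (simp add: permutes_id)

lemma iperm_length: "iperm c xs ys \<Longrightarrow> length ys = length xs"
  by (auto simp: iperm_def)

lemma iperm_set: "iperm c xs ys \<Longrightarrow> set ys = set xs"
  by (auto simp: iperm_def)

lemma iperm_mset: "iperm c xs ys \<Longrightarrow> mset ys = mset xs"
  by (auto simp: iperm_def)

lemma permutation_lessThan: "\<pi> permutes {..<n::nat} \<Longrightarrow> permutation \<pi>"
  using permutation_permutes finite_lessThan by blast

lemma iperm_trans: "iperm c xs ys \<Longrightarrow> iperm c' ys zs \<Longrightarrow> iperm (c * c') xs zs"
proof -
  assume "iperm c xs ys" "iperm c' ys zs"
  then obtain \<pi> \<rho> where p: "\<pi> permutes {..<length xs}" "ys = permute_list \<pi> xs" "c = sign \<pi>"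
    and r: "\<rho> permutes {..<length ys}" "zs = permute_list \<rho> ys" "c' = sign \<rho>" unfolding iperm_def by blast
  have r': "\<rho> permutes {..<length xs}" using r(1) p(2) by simp
  have "zs = permute_list (\<pi> \<circ> \<rho>) xs" unfolding permute_list_compose[OF r'] r(2) p(2) ..
  moreover have "\<pi> \<circ> \<rho> permutes {..<length xs}" by (rule permutes_compose[OF r' p(1)])
  moreover have "sign (\<pi> \<circ> \<rho>) = c * c'"
    unfolding p(3) r(3) by (rule sign_compose[OF permutation_lessThan[OF p(1)] permutation_lessThan[OF r']])
  ultimately show ?thesis using ipermI[of "\<pi> \<circ> \<rho>" xs] by simp
qed

lemma iperm_sign: "iperm c xs ys \<Longrightarrow> c * c = 1"
  by (auto simp: iperm_def)

lemma iperm_append: "iperm c xs ys \<Longrightarrow> iperm c (xs @ zs) (ys @ zs)"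
proof -
  assume "iperm c xs ys"
  then obtain \<pi> where p: "\<pi> permutes {..<length xs}" "ys = permute_list \<pi> xs" "c = sign \<pi>" unfolding iperm_def by blast
  have p': "\<pi> permutes {..<length (xs @ zs)}" by (rule permutes_subset[OF p(1)]) auto
  have "permute_list \<pi> (xs @ zs) = ys @ zs"
  proof (rule nth_equalityI)
    fix i assume "i < length (permute_list \<pi> (xs @ zs))"
    then have i: "i < length (xs @ zs)" by simp
    show "permute_list \<pi> (xs @ zs) ! i = (ys @ zs) ! i"
    proof (cases "i < length xs")
      case True
      then have "\<pi> i < length xs" using permutes_in_image[OF p(1), of i] by simp
      then show ?thesis using True i p by (simp add: permute_list_nth[OF p'] permute_list_nth[OF p(1)] nth_append)
    next
      case False
      then have "\<pi> i = i" using permutes_not_in[OF p(1), of i] by simp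
      then show ?thesis using False i p by (simp add: permute_list_nth[OF p'] nth_append)
    qed
  qed (simp add: p)
  then show ?thesis using ipermI[OF p'] p(3) by simp
qed

lemma iperm_swap: "iperm (-1) (xs @ x # y # ys) (xs @ y # x # ys)"
proof -
  let ?k = "length xs" and ?l = "xs @ x # y # ys"
  let ?\<pi> = "Transposition.transpose ?k (Suc ?k)"
  have p: "?\<pi> permutes {..<length ?l}" by (rule permutes_swap_id) auto
  have "permute_list ?\<pi> ?l = xs @ y # x # ys"
  proof (rule nth_equalityI)
    fix i assume "i < length (permute_list ?\<pi> ?l)"
    then have i: "i < length ?l" by simp
    show "permute_list ?\<pi> ?l ! i = (xs @ y # x # ys) ! i"
    proof (cases "i < ?k")
      case True
      then have "?\<pi> i = i" by (intro transpose_apply_other) auto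
      then show ?thesis unfolding permute_list_nth[OF p i] using True by (simp add: nth_append)
    next
      case False
      then obtain m where m: "i = ?k + m" using le_Suc_ex[of ?k i] by auto
      consider "m = 0" | "m = 1" | r where "m = Suc (Suc r)" by (metis One_nat_def not0_implies_Suc)
      then show ?thesis
      proof cases
        case 1
        then have e: "?\<pi> i = ?k + 1" using m by simp
        show ?thesis unfolding permute_list_nth[OF p i] e unfolding m 1 nth_append_length_plus by simp
      next
        case 2
        then have e: "?\<pi> i = ?k + 0" using m by simp
        show ?thesis unfolding permute_list_nth[OF p i] e unfolding m 2 nth_append_length_plus by simp
      next
        case 3
        then have e: "?\<pi> i = ?k + Suc (Suc r)" using m by (simp add: transpose_apply_other)
        show ?thesis unfolding permute_list_nth[OF p i] e unfolding m 3 nth_append_length_plus by simp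
      qed
    qed
  qed simp
  then show ?thesis using ipermI[OF p] by (simp add: sign_swap_id)
qed

text \<open>The entry passes those of \<open>ys\<close> by neighbouring transpositions, each
  contributing a factor -1.\<close>

lemma iperm_move: "iperm ((-1) ^ length ys) (xs @ x # ys @ zs) (xs @ ys @ x # zs)"
proof (induction ys arbitrary: xs)
  case Nil
  then show ?case by (simp add: iperm_refl)
next
  case (Cons y ys)
  have "iperm ((-1) * (-1) ^ length ys) (xs @ x # y # ys @ zs) ((xs @ [y]) @ ys @ x # zs)"
    by (rule iperm_trans[OF iperm_swap]) (use Cons[of "xs @ [y]"] in simp)
  then show ?case by simp
qed

lemma iperm_sym: "iperm c xs ys \<Longrightarrow> iperm c ys xs"
proof -
  assume "iperm c xs ys"
  then obtain \<pi> where p: "\<pi> permutes {..<length xs}" "ys = permute_list \<pi> xs" "c = sign \<pi>" unfolding iperm_def by blast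
  have i: "pinv \<pi> permutes {..<length xs}" by (rule permutes_inv[OF p(1)])
  have "permute_list (pinv \<pi>) ys = permute_list (\<pi> \<circ> pinv \<pi>) xs"
    unfolding p(2) by (rule permute_list_compose[OF i, symmetric])
  then have "permute_list (pinv \<pi>) ys = xs" unfolding permutes_inv_o(1)[OF p(1)] by simp
  moreover have "sign (pinv \<pi>) = c" unfolding p(3) by (rule sign_inverse[OF permutation_lessThan[OF p(1)]])
  ultimately show ?thesis using ipermI[of "pinv \<pi>" ys] i p(2) by simp
qed

text \<open>Brings the vertices of interest to the end of a word. The sign may remain unknown: it is
  the same on both sides of the identities where this is applied, or occurs squared.\<close>

lemma iperm_pull:
  "distinct xs \<Longrightarrow> set xs \<subseteq> set ws \<Longrightarrow> \<exists>c rest. iperm c ws (rest @ xs)"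
proof (induction xs)
  case Nil
  then show ?case using iperm_refl[of ws] by auto
next
  case (Cons x xs)
  then obtain c rest where r: "iperm c ws (rest @ xs)" by auto
  have "x \<in> set rest" using Cons.prems iperm_set[OF r] by auto
  then obtain as bs where ab: "rest = as @ x # bs" by (auto simp: in_set_conv_decomp)
  have "iperm (c * (-1) ^ length bs) ws (as @ bs @ x # xs)"
    by (rule iperm_trans[OF r]) (use iperm_move[of bs as x xs] ab in simp)
  then show ?case by (intro exI[of _ "c * (-1) ^ length bs"] exI[of _ "as @ bs"]) simp
qed

lemma permute_list_update:
  assumes p: "\<pi> permutes {..<length xs}" and i: "i < length xs"
  shows "permute_list \<pi> (xs[i := w]) = (permute_list \<pi> xs)[pinv \<pi> i := w]"
proof (rule nth_equalityI)
  fix k assume "k < length (permute_list \<pi> (xs[i := w]))"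
  then have k: "k < length xs" by simp
  then have pk: "\<pi> k < length xs" using permutes_in_image[OF p, of k] by simp
  have p': "\<pi> permutes {..<length (xs[i := w])}" using p by simp
  have e: "i = \<pi> k \<longleftrightarrow> pinv \<pi> i = k" by (metis permutes_inverses p)
  have pi: "pinv \<pi> i < length (permute_list \<pi> xs)" using permutes_in_image[OF permutes_inv[OF p], of i] i by simp
  have "k < length (xs[i := w])" using k by simp
  note n = permute_list_nth[OF p' this]
  show "permute_list \<pi> (xs[i := w]) ! k = (permute_list \<pi> xs)[pinv \<pi> i := w] ! k"
    unfolding n nth_list_update[OF i] nth_list_update[OF pi] permute_list_nth[OF p k] e ..
qed simp

lemma iperm_update:
  assumes "iperm c xs ys" "i < length xs"
  obtains k where "k < length ys" "ys ! k = xs ! i" "\<And>w. iperm c (xs[i := w]) (ys[k := w])"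
proof -
  obtain \<pi> where p: "\<pi> permutes {..<length xs}" "ys = permute_list \<pi> xs" "c = sign \<pi>"
    using assms(1) unfolding iperm_def by blast
  have k: "pinv \<pi> i < length xs" using permutes_in_image[OF permutes_inv[OF p(1)], of i] assms(2) by simp
  show ?thesis
  proof (rule that[of "pinv \<pi> i"])
    show "pinv \<pi> i < length ys" using k p(2) by simp
    show "ys ! pinv \<pi> i = xs ! i" unfolding p(2) permute_list_nth[OF p(1) k] by (simp add: permutes_inverses[OF p(1)])
    fix w
    have "\<pi> permutes {..<length (xs[i := w])}" using p(1) by simp
    from ipermI[OF this] show "iperm c (xs[i := w]) (ys[pinv \<pi> i := w])"
      unfolding permute_list_update[OF p(1) assms(2)] p(2,3) .
  qed
qed

lemma iperm_map: "iperm c xs ys \<Longrightarrow> iperm c (map f xs) (map f ys)"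
proof -
  assume "iperm c xs ys"
  then obtain \<pi> where p: "\<pi> permutes {..<length xs}" "ys = permute_list \<pi> xs" "c = sign \<pi>" unfolding iperm_def by blast
  have "\<pi> permutes {..<length (map f xs)}" using p by simp
  from ipermI[OF this] show ?thesis unfolding permute_list_map[OF p(1)] p .
qed

section \<open>Words with disjoint vertices and their rearrangement\<close>

definition supp :: "(nat set \<times> 'v) list \<Rightarrow> nat set" where
  "supp ws = (\<Union>w\<in>set ws. fst w)"

text \<open>Membership in \<open>words\<close> without the total support. The use of
  \<open>sorted_wrt\<close> makes disjointness split along appended lists, which indices would not
  do.\<close>

definition wf_word :: "('k, 'v) operad_data \<Rightarrow> (nat set \<times> 'v) list \<Rightarrow> bool" where
  "wf_word C ws \<longleftrightarrow> (\<forall>w\<in>set ws. snd w \<in> carrier (Sp C (fst w))) \<and> sorted_wrt (\<lambda>a b. fst a \<inter> fst b = {}) ws"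

lemma supp_simps [simp]: "supp [] = {}" "supp (w # ws) = fst w \<union> supp ws" "supp (ws @ vs) = supp ws \<union> supp vs"
  by (auto simp: supp_def)

lemma sorted_wrt_disjoint:
  "sorted_wrt (\<lambda>a b. fst a \<inter> fst b = {}) ws \<longleftrightarrow>
   (\<forall>i<length ws. \<forall>j<length ws. i \<noteq> j \<longrightarrow> fst (ws ! i) \<inter> fst (ws ! j) = {})"
  unfolding sorted_wrt_iff_nth_less
proof (intro iffI allI impI)
  fix i j
  assume a: "\<forall>i j. i < j \<longrightarrow> j < length ws \<longrightarrow> fst (ws ! i) \<inter> fst (ws ! j) = {}"
    and ij: "i < length ws" "j < length ws" "i \<noteq> j"
  show "fst (ws ! i) \<inter> fst (ws ! j) = {}"
  proof (cases "i < j")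
    case True
    then show ?thesis using a ij by simp
  next
    case False
    then have "fst (ws ! j) \<inter> fst (ws ! i) = {}" using a ij by simp
    then show ?thesis by (simp only: Int_commute)
  qed
qed simp

lemma words_iff: "ws \<in> words C X \<longleftrightarrow> wf_word C ws \<and> supp ws = X"
  unfolding words_def wf_word_def sorted_wrt_disjoint supp_def by (auto simp: case_prod_unfold)

lemma wf_append: "wf_word C (xs @ ys) \<longleftrightarrow> wf_word C xs \<and> wf_word C ys \<and> supp xs \<inter> supp ys = {}"
  by (auto simp: wf_word_def sorted_wrt_append supp_def)

lemma wf_Cons: "wf_word C (w # ws) \<longleftrightarrow> snd w \<in> carrier (Sp C (fst w)) \<and> wf_word C ws \<and> fst w \<inter> supp ws = {}"
  by (auto simp: wf_word_def supp_def)

lemma wf_Nil [simp]: "wf_word C []"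
  by (auto simp: wf_word_def)

lemma supp_mset: "mset xs = mset ys \<Longrightarrow> supp xs = supp ys"
  unfolding supp_def by (metis set_mset_mset)

lemma iperm_supp: "iperm c xs ys \<Longrightarrow> supp ys = supp xs"
  by (rule supp_mset[OF iperm_mset])

lemma wf_nth_disjoint: "wf_word C ws \<Longrightarrow> i < length ws \<Longrightarrow> j < length ws \<Longrightarrow> i \<noteq> j \<Longrightarrow> fst (ws ! i) \<inter> fst (ws ! j) = {}"
  unfolding wf_word_def sorted_wrt_disjoint by simp

lemma wf_nth_unique: "wf_word C ws \<Longrightarrow> i < length ws \<Longrightarrow> j < length ws \<Longrightarrow> u \<in> fst (ws ! i) \<Longrightarrow> u \<in> fst (ws ! j) \<Longrightarrow> i = j"
  using wf_nth_disjoint by blast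

lemma wf_iperm: assumes "iperm c xs ys" "wf_word C xs" shows "wf_word C ys"
proof -
  obtain \<pi> where p: "\<pi> permutes {..<length xs}" "ys = permute_list \<pi> xs"
    using assms(1) unfolding iperm_def by blast
  have "sorted_wrt (\<lambda>a b. fst a \<inter> fst b = {}) ys"
    unfolding sorted_wrt_disjoint
  proof (intro allI impI)
    fix i j assume ij: "i < length ys" "j < length ys" "i \<noteq> j"
    have l: "length ys = length xs" using p by simp
    have "\<pi> i \<noteq> \<pi> j" using ij permutes_inj[OF p(1)] by (simp add: inj_eq)
    moreover have "\<pi> i < length xs" "\<pi> j < length xs"
      using permutes_in_image[OF p(1), of i] permutes_in_image[OF p(1), of j] ij l by auto
    ultimately have "fst (xs ! \<pi> i) \<inter> fst (xs ! \<pi> j) = {}" by (intro wf_nth_disjoint[OF assms(2)])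
    then show "fst (ys ! i) \<inter> fst (ys ! j) = {}" using ij l by (simp add: p(2) permute_list_nth[OF p(1)])
  qed
  then show ?thesis using assms(2) iperm_set[OF assms(1)] by (simp add: wf_word_def)
qed

lemma words_iperm: "iperm c xs ys \<Longrightarrow> xs \<in> words C X \<Longrightarrow> ys \<in> words C X"
  by (simp add: words_iff wf_iperm iperm_supp)

lemma position_eq: "wf_word C ws \<Longrightarrow> i < length ws \<Longrightarrow> u \<in> fst (ws ! i) \<Longrightarrow> position ws u = i"
  unfolding position_def by (rule the_equality) (auto intro: wf_nth_unique)

lemma supp_setE: assumes "u \<in> supp ws" obtains w where "w \<in> set ws" "u \<in> fst w"
  using assms by (auto simp: supp_def)

text \<open>The points u and v each lie in only one vertex, so the comparing permutation fixes the
  last two positions. It is then a permutation of the rest with the same sign. Equality of the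
  entries alone would not do, as an entry may occur twice.\<close>

lemma iperm_cancel:
  assumes ws: "wf_word C ws" and 1: "iperm c ws (rs @ [x, y])" and 2: "iperm c' ws (rs' @ [x', y'])"
    and u: "u \<in> fst x" "u \<in> fst x'" and v: "v \<in> fst y" "v \<in> fst y'"
  shows "x = x' \<and> y = y' \<and> iperm (c * c') rs rs'"
proof -
  let ?l = "rs @ [x, y]" and ?l' = "rs' @ [x', y']"
  have wl: "wf_word C ?l" by (rule wf_iperm[OF 1 ws])
  have len: "length rs' = length rs" using iperm_length[OF 1] iperm_length[OF 2] by simp
  obtain \<pi> where p: "\<pi> permutes {..<length ?l}" "?l' = permute_list \<pi> ?l" "c * c' = sign \<pi>"
    using iperm_trans[OF iperm_sym[OF 1] 2] unfolding iperm_def by blast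
  let ?n = "length rs"
  have n: "?l' ! i = ?l ! \<pi> i" if "i < ?n + 2" for i
    unfolding p(2) by (rule permute_list_nth[OF p(1)]) (use that in simp)
  have lt: "\<pi> i < ?n + 2" if "i < ?n + 2" for i using permutes_in_image[OF p(1), of i] that by simp
  have "x' = ?l ! \<pi> ?n" "y' = ?l ! \<pi> (Suc ?n)" using n[of ?n] n[of "Suc ?n"] len by (simp_all add: nth_append)
  then have "u \<in> fst (?l ! \<pi> ?n)" "v \<in> fst (?l ! \<pi> (Suc ?n))" using u v by auto
  moreover have "u \<in> fst (?l ! ?n)" "v \<in> fst (?l ! Suc ?n)" using u v by (simp_all add: nth_append)
  ultimately have f: "\<pi> ?n = ?n" "\<pi> (Suc ?n) = Suc ?n"
    using wf_nth_unique[OF wl, of "\<pi> ?n" ?n u] wf_nth_unique[OF wl, of "\<pi> (Suc ?n)" "Suc ?n" v] lt[of ?n] lt[of "Suc ?n"]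
    by simp_all
  have xy: "x = x'" "y = y'" using n[of ?n] n[of "Suc ?n"] f len by (simp_all add: nth_append)
  have p': "\<pi> permutes {..<?n}"
  proof (rule permutes_superset[OF p(1)])
    fix i assume "i \<in> {..<length ?l} - {..<?n}"
    then have "i = ?n \<or> i = Suc ?n" by auto
    then show "\<pi> i = i" using f by auto
  qed
  have "rs' = permute_list \<pi> rs"
  proof (rule nth_equalityI)
    fix i assume "i < length rs'"
    then have i: "i < ?n" using len by simp
    then have "\<pi> i < ?n" using permutes_in_image[OF p', of i] by simp
    then show "rs' ! i = permute_list \<pi> rs ! i"
      using n[of i] i len by (simp add: nth_append permute_list_nth[OF p'])
  qed (simp add: len)
  then show ?thesis using ipermI[OF p'] p(3) xy by simp
qed

lemma nths_remove_two:
  assumes "length as = i" "j = Suc (i + length bs)"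
  shows "nths (as @ x # bs @ y # cs) (- {i, j}) = as @ bs @ cs"
proof -
  have 1: "nths as (- {i, j}) = as" by (rule nths_all) (use assms in auto)
  have 2: "{k. Suc k + i \<in> - {i, j}} = - {length bs}" using assms by auto
  have 3: "nths bs (- {length bs}) = bs" by (rule nths_all) auto
  have 4: "nths cs {k. Suc k + length bs \<in> - {length bs}} = cs" by (rule nths_all) auto
  show ?thesis
    using 1 2 3 4 assms by (simp add: nths_append nths_Cons)
qed

text \<open>This accounts for the exponent in \<open>contract\<close>. The entry at j goes to the
  end first, past n - 1 - j others. The one at i follows and stops before it, having passed n - 2 -
  i entries if j was behind it and n - 1 - i otherwise.\<close>

lemma iperm_contract:
  assumes "i < length ws" "j < length ws" "i \<noteq> j"
  shows "iperm ((-1) ^ (if i < j then (length ws - 1 - j) + (length ws - 2 - i) else (length ws - 1 - j) + (length ws - 1 - i)))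
    ws (nths ws (- {i, j}) @ [ws ! i, ws ! j])"
proof (cases "i < j")
  case True
  define as bs cs where "as = take i ws" and "bs = take (j - Suc i) (drop (Suc i) ws)" and "cs = drop (Suc j) ws"
  have d: "drop (Suc i) ws = bs @ ws ! j # cs"
    using id_take_nth_drop[of "j - Suc i" "drop (Suc i) ws"] True assms by (simp add: bs_def cs_def)
  have ws: "ws = as @ ws ! i # bs @ ws ! j # cs"
    unfolding d[symmetric] as_def using assms by (intro id_take_nth_drop)
  have l: "length as = i" "j = Suc (i + length bs)" using True assms by (auto simp: as_def bs_def)
  have l': "length cs = length ws - 1 - j" "length (bs @ cs) = length ws - 2 - i"
    using True assms by (auto simp: cs_def bs_def)
  have "nths ws (- {i, j}) = as @ bs @ cs" by (subst ws) (rule nths_remove_two[OF l])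
  moreover have "iperm ((-1) ^ length cs * (-1) ^ length (bs @ cs)) ws (as @ bs @ cs @ [ws ! i, ws ! j])"
  proof (rule iperm_trans)
    show "iperm ((-1) ^ length cs) ws (as @ ws ! i # bs @ cs @ [ws ! j])"
      using iperm_move[of cs "as @ ws ! i # bs" "ws ! j" "[]"] ws by simp
    show "iperm ((-1) ^ length (bs @ cs)) (as @ ws ! i # bs @ cs @ [ws ! j]) (as @ bs @ cs @ [ws ! i, ws ! j])"
      using iperm_move[of "bs @ cs" as "ws ! i" "[ws ! j]"] by simp
  qed
  ultimately show ?thesis using True unfolding l' by (simp add: power_add)
next
  case False
  then have ji: "j < i" using assms by simp
  define as bs cs where "as = take j ws" and "bs = take (i - Suc j) (drop (Suc j) ws)" and "cs = drop (Suc i) ws"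
  have d: "drop (Suc j) ws = bs @ ws ! i # cs"
    using id_take_nth_drop[of "i - Suc j" "drop (Suc j) ws"] ji assms by (simp add: bs_def cs_def)
  have ws: "ws = as @ ws ! j # bs @ ws ! i # cs"
    unfolding d[symmetric] as_def using assms by (intro id_take_nth_drop)
  have l: "length as = j" "i = Suc (j + length bs)" using ji assms by (auto simp: as_def bs_def)
  have l': "length cs = length ws - 1 - i" "length (bs @ ws ! i # cs) = length ws - 1 - j"
    using ji assms by (auto simp: cs_def bs_def)
  have "{i, j} = {j, i}" by auto
  then have "nths ws (- {i, j}) = as @ bs @ cs" by (subst ws) (simp only: nths_remove_two[OF l])
  moreover have "iperm ((-1) ^ length (bs @ ws ! i # cs) * (-1) ^ length cs) ws (as @ bs @ cs @ [ws ! i, ws ! j])"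
  proof (rule iperm_trans)
    show "iperm ((-1) ^ length (bs @ ws ! i # cs)) ws (as @ bs @ ws ! i # cs @ [ws ! j])"
      using iperm_move[of "bs @ ws ! i # cs" as "ws ! j" "[]"] ws by simp
    show "iperm ((-1) ^ length cs) (as @ bs @ ws ! i # cs @ [ws ! j]) (as @ bs @ cs @ [ws ! i, ws ! j])"
      using iperm_move[of cs "as @ bs" "ws ! i" "[ws ! j]"] by simp
  qed
  ultimately show ?thesis using False unfolding l' by (simp add: power_add)
qed

section \<open>Relations between words and linear maps respecting them\<close>

definition sg :: "polarity \<Rightarrow> int \<Rightarrow> 'k::field" where "sg e c = of_int (twist e c)"

lemma sg_mult: "sg e (a * b) = sg e a * sg e b" by (simp add: sg_def twist_mult)

lemma sg_one [simp]: "sg e 1 = 1" by (simp add: sg_def)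

lemma sg_square: "c * c = 1 \<Longrightarrow> sg e c * sg e c = (1 :: 'k::field)"
  by (simp flip: sg_mult)

lemma odot_rel_perm:
  assumes "ws \<in> words C X" "iperm c ws ws'"
  shows "nf (odot_rels e C X) (gen ws') = fscale (sg e c) (nf (odot_rels e C X) (gen ws))"
proof -
  obtain \<pi> where p: "\<pi> permutes {..<length ws}" "ws' = permute_list \<pi> ws" "c = sign \<pi>"
    using assms(2) unfolding iperm_def by blast
  have "gen (permute_list \<pi> ws) - fscale (of_int (twist e (sign \<pi>))) (gen ws) \<in> odot_rels e C X"
    unfolding odot_rels_def by (rule UnI2, rule CollectI, rule exI[of _ ws], rule exI[of _ \<pi>]) (use assms p in simp)
  from nf_rel_eq[OF this] show ?thesis unfolding p sg_def nf_scale .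
qed

lemma odot_rel_add:
  assumes "xs @ (U, a) # ys \<in> words C X" "a \<in> carrier (Sp C U)" "b \<in> carrier (Sp C U)"
  shows "nf (odot_rels e C X) (gen (xs @ (U, a \<oplus>\<^bsub>Sp C U\<^esub> b) # ys)) =
    nf (odot_rels e C X) (gen (xs @ (U, a) # ys)) + nf (odot_rels e C X) (gen (xs @ (U, b) # ys))"
proof -
  let ?ws = "xs @ (U, a) # ys"
  have "gen (?ws[length xs := (U, a \<oplus>\<^bsub>Sp C U\<^esub> b)]) - gen (?ws[length xs := (U, a)]) - gen (?ws[length xs := (U, b)]) \<in> odot_rels e C X"
    unfolding odot_rels_def
    by (rule UnI1, rule UnI1, rule CollectI, rule exI[of _ ?ws], rule exI[of _ "length xs"], rule exI[of _ U], rule exI[of _ a], rule exI[of _ b])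
      (use assms in simp)
  from nf_rel[OF this] show ?thesis by (simp only: nf_diff list_update_length) (simp add: algebra_simps)
qed

lemma odot_rel_smult:
  assumes "xs @ (U, a) # ys \<in> words C X" "a \<in> carrier (Sp C U)"
  shows "nf (odot_rels e C X) (gen (xs @ (U, c \<odot>\<^bsub>Sp C U\<^esub> a) # ys)) =
    fscale c (nf (odot_rels e C X) (gen (xs @ (U, a) # ys)))"
proof -
  let ?ws = "xs @ (U, a) # ys"
  have "gen (?ws[length xs := (U, c \<odot>\<^bsub>Sp C U\<^esub> a)]) - fscale c (gen (?ws[length xs := (U, a)])) \<in> odot_rels e C X"
    unfolding odot_rels_def
    by (rule UnI1, rule UnI2, rule CollectI, rule exI[of _ ?ws], rule exI[of _ "length xs"], rule exI[of _ U], rule exI[of _ c], rule exI[of _ a])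
      (use assms in simp)
  from nf_rel[OF this] show ?thesis by (simp add: nf_diff nf_scale)
qed

lemma list_split_at: "i < length ws \<Longrightarrow> ws[i := w] = take i ws @ w # drop (Suc i) ws"
  by (simp add: upd_conv_take_nth_drop)

lemma words_replace: "xs @ (U, a) # ys \<in> words C X \<Longrightarrow> b \<in> carrier (Sp C U) \<Longrightarrow> xs @ (U, b) # ys \<in> words C X"
  by (simp add: words_iff wf_append wf_Cons)

lemma odot_relsE:
  assumes r: "r \<in> odot_rels e C X"
  obtains (add) xs U a b ys where "xs @ (U, a) # ys \<in> words C X" "a \<in> carrier (Sp C U)" "b \<in> carrier (Sp C U)"
      "r = gen (xs @ (U, a \<oplus>\<^bsub>Sp C U\<^esub> b) # ys) - gen (xs @ (U, a) # ys) - gen (xs @ (U, b) # ys)"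
    | (smult) xs U a c ys where "xs @ (U, a) # ys \<in> words C X" "a \<in> carrier (Sp C U)"
      "r = gen (xs @ (U, c \<odot>\<^bsub>Sp C U\<^esub> a) # ys) - fscale c (gen (xs @ (U, a) # ys))"
    | (perm) ws ws' c where "ws \<in> words C X" "iperm c ws ws'" "r = gen ws' - fscale (sg e c) (gen ws)"
proof -
  have w: "take i ws @ (U, a) # drop (Suc i) ws \<in> words C X"
    if "ws \<in> words C X" "i < length ws" "U = fst (ws ! i)" "a \<in> carrier (Sp C U)" for ws i U a
  proof -
    have "take i ws @ (U, snd (ws ! i)) # drop (Suc i) ws = ws"
      unfolding that(3) using id_take_nth_drop[OF that(2)] by simp
    then have "take i ws @ (U, snd (ws ! i)) # drop (Suc i) ws \<in> words C X" using that(1) by simp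
    then show ?thesis by (rule words_replace[OF _ that(4)])
  qed
  consider (1) ws i U a b where "r = gen (ws[i := (U, a \<oplus>\<^bsub>Sp C U\<^esub> b)]) - gen (ws[i := (U, a)]) - gen (ws[i := (U, b)])"
        "ws \<in> words C X" "i < length ws" "U = fst (ws ! i)" "a \<in> carrier (Sp C U)" "b \<in> carrier (Sp C U)"
    | (2) ws i U c a where "r = gen (ws[i := (U, c \<odot>\<^bsub>Sp C U\<^esub> a)]) - fscale c (gen (ws[i := (U, a)]))"
        "ws \<in> words C X" "i < length ws" "U = fst (ws ! i)" "a \<in> carrier (Sp C U)"
    | (3) ws \<pi> where "r = gen (permute_list \<pi> ws) - fscale (of_int (twist e (sign \<pi>))) (gen ws)"
        "ws \<in> words C X" "\<pi> permutes {..<length ws}"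
    using r unfolding odot_rels_def by blast
  then show ?thesis
  proof cases
    case 1
    show ?thesis by (rule add[OF w[OF 1(2-5)] 1(5,6) 1(1)[unfolded list_split_at[OF 1(3)]]])
  next
    case 2
    show ?thesis by (rule smult[OF w[OF 2(2-5)] 2(5) 2(1)[unfolded list_split_at[OF 2(3)]]])
  next
    case 3
    show ?thesis by (rule perm[OF 3(2) ipermI[OF 3(3)] 3(1)[folded sg_def]])
  qed
qed

lemma odot_lift:
  fixes h :: "(nat set \<times> 'v) list \<Rightarrow> ('h \<Rightarrow>\<^sub>0 'k::field)"
  assumes add: "\<And>xs ys U a b. xs @ (U, a) # ys \<in> words C X \<Longrightarrow> a \<in> carrier (Sp C U) \<Longrightarrow> b \<in> carrier (Sp C U) \<Longrightarrow>
      h (xs @ (U, a \<oplus>\<^bsub>Sp C U\<^esub> b) # ys) = h (xs @ (U, a) # ys) + h (xs @ (U, b) # ys)"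
    and smult: "\<And>xs ys U a c. xs @ (U, a) # ys \<in> words C X \<Longrightarrow> a \<in> carrier (Sp C U) \<Longrightarrow>
      h (xs @ (U, c \<odot>\<^bsub>Sp C U\<^esub> a) # ys) = fscale c (h (xs @ (U, a) # ys))"
    and perm: "\<And>ws ws' c. ws \<in> words C X \<Longrightarrow> iperm c ws ws' \<Longrightarrow> h ws' = fscale (sg e c) (h ws)"
    and r: "r \<in> odot_rels e C X"
  shows "lin_ext h r = 0"
  using r
proof (cases rule: odot_relsE)
  case (add xs U a b ys)
  show ?thesis unfolding add(4) lin_ext_diff lin_ext_gen assms(1)[OF add(1-3)] by simp
next
  case (smult xs U a c ys)
  show ?thesis unfolding smult(3) lin_ext_diff lin_ext_gen lin_ext_scale assms(2)[OF smult(1,2)] by simp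
next
  case (perm ws ws' c)
  show ?thesis unfolding perm(3) lin_ext_diff lin_ext_gen lin_ext_scale assms(3)[OF perm(1,2)] by simp
qed

abbreviation con :: "polarity \<Rightarrow> ('k::field, 'v) operad_data \<Rightarrow> nat \<Rightarrow> nat \<Rightarrow> ((nat set \<times> 'v) list \<Rightarrow>\<^sub>0 'k) \<Rightarrow> ((nat set \<times> 'v) list \<Rightarrow>\<^sub>0 'k)" where
  "con e C u v \<equiv> lin_ext (contract e C u v)"

definition join :: "('k, 'v) operad_data \<Rightarrow> nat \<Rightarrow> nat \<Rightarrow> nat set \<times> 'v \<Rightarrow> nat set \<times> 'v \<Rightarrow> nat set \<times> 'v" where
  "join C u v x y = ((fst x - {u}) \<union> (fst y - {v}), Circ C (fst x) (fst y) u v (snd x) (snd y))"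

text \<open>A linear map on words that induces one from \<open>odot e C X\<close> to
  \<open>odot e C Y\<close>. Keeping the map on words allows contractions and relabellings to be
  composed before passing to cosets.\<close>

definition odot_hom :: "polarity \<Rightarrow> ('k::field, 'v) operad_data \<Rightarrow> nat set \<Rightarrow> nat set
    \<Rightarrow> (((nat set \<times> 'v) list \<Rightarrow>\<^sub>0 'k) \<Rightarrow> ((nat set \<times> 'v) list \<Rightarrow>\<^sub>0 'k)) \<Rightarrow> bool" where
  "odot_hom e C X Y L \<longleftrightarrow> flin L \<and> (\<forall>p. Poly_Mapping.keys p \<subseteq> words C X \<longrightarrow> Poly_Mapping.keys (L p) \<subseteq> words C Y) \<and>
     (\<forall>r\<in>odot_rels e C X. nf (odot_rels e C Y) (L r) = 0)"

lemma odot_hom_flin: "odot_hom e C X Y L \<Longrightarrow> flin L" by (simp add: odot_hom_def)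

lemma odot_hom_keys: "odot_hom e C X Y L \<Longrightarrow> Poly_Mapping.keys p \<subseteq> words C X \<Longrightarrow> Poly_Mapping.keys (L p) \<subseteq> words C Y"
  by (simp add: odot_hom_def)

lemma odot_hom_rel: "odot_hom e C X Y L \<Longrightarrow> r \<in> odot_rels e C X \<Longrightarrow> nf (odot_rels e C Y) (L r) = 0"
  by (simp add: odot_hom_def)

lemma odot_hom_nf:
  assumes "odot_hom e C X Y L" "nf (odot_rels e C X) x = nf (odot_rels e C X) y"
  shows "nf (odot_rels e C Y) (L x) = nf (odot_rels e C Y) (L y)"
  by (rule flin_nf_eq[of "\<lambda>x. nf (odot_rels e C Y) (L x)", OF flin_compose[OF flin_nf odot_hom_flin[OF assms(1)]] odot_hom_rel[OF assms(1)] assms(2)])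

lemma odot_hom_id: "odot_hom e C X X (\<lambda>x. x)"
  by (simp add: odot_hom_def flin_def nf_rel)

lemma odot_hom_comp: "odot_hom e C X Y L \<Longrightarrow> odot_hom e C Y Z L' \<Longrightarrow> odot_hom e C X Z (\<lambda>x. L' (L x))"
  unfolding odot_hom_def[of e C X Z]
proof (intro conjI ballI allI impI)
  assume 1: "odot_hom e C X Y L" and 2: "odot_hom e C Y Z L'"
  show "flin (\<lambda>x. L' (L x))" by (rule flin_compose[OF odot_hom_flin[OF 2] odot_hom_flin[OF 1]])
  show "Poly_Mapping.keys (L' (L p)) \<subseteq> words C Z" if "Poly_Mapping.keys p \<subseteq> words C X" for p
    by (rule odot_hom_keys[OF 2 odot_hom_keys[OF 1 that]])
  fix r assume "r \<in> odot_rels e C X"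
  then have "nf (odot_rels e C Y) (L r) = nf (odot_rels e C Y) 0" using odot_hom_rel[OF 1] by simp
  from odot_hom_nf[OF 2 this] show "nf (odot_rels e C Z) (L' (L r)) = 0"
    by (simp add: flin_zero[OF odot_hom_flin[OF 2]])
qed

lemma flin_ident: "flin (\<lambda>x. x)" by (simp add: flin_def)

lemmas flin_intros = flin_compose[OF flin_nf] flin_compose[OF flin_fscale] flin_compose[OF flin_lin_ext] flin_ident

lemma flin_agree:
  assumes "flin L" "flin L'" "Poly_Mapping.keys p \<subseteq> S" "\<And>g. g \<in> S \<Longrightarrow> L (gen g) = L' (gen g)"
  shows "L p = L' p"
  unfolding flin_eq_lin_ext[OF assms(1), of p] flin_eq_lin_ext[OF assms(2), of p]
  by (rule lin_ext_cong) (use assms in blast)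

lemma contract_gen:
  assumes "wf_word C ws" "i < length ws" "j < length ws" "i \<noteq> j" "u \<in> fst (ws ! i)" "v \<in> fst (ws ! j)"
  shows "contract e C u v ws = fscale (sg e ((-1) ^ (if i < j then (length ws - 1 - j) + (length ws - 2 - i) else (length ws - 1 - j) + (length ws - 1 - i))))
    (gen (nths ws (- {i, j}) @ [join C u v (ws ! i) (ws ! j)]))"
  unfolding contract_def Let_def position_eq[OF assms(1,2,5)] position_eq[OF assms(1,3,6)] sg_def join_def
  using assms(4) by simp

lemma contract_same:
  assumes "wf_word C ws" "x \<in> set ws" "u \<in> fst x" "v \<in> fst x"
  shows "contract e C u v ws = 0"
proof -
  obtain i where i: "i < length ws" "x = ws ! i" using assms(2) by (auto simp: in_set_conv_nth)
  show ?thesis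
    unfolding contract_def Let_def using position_eq[OF assms(1) i(1)] assms(3,4) i(2) by simp
qed

lemma sg_cancel: "n * n = 1 \<Longrightarrow> sg e n * sg e (c * n) = (sg e c :: 'k::field)"
proof -
  assume "n * n = 1"
  then have "sg e n * sg e n = (1 :: 'k)" by (rule sg_square)
  then show ?thesis unfolding sg_mult by (simp add: mult.left_commute)
qed

definition rl :: "('k::field, 'v) operad_data \<Rightarrow> (nat \<Rightarrow> nat) \<Rightarrow> nat set \<times> 'v \<Rightarrow> nat set \<times> 'v" where
  "rl C \<tau> w = (\<tau> ` fst w, Tr C (fst w) (\<tau> ` fst w) (restrict \<tau> (fst w)) (snd w))"

lemma relabel_map: "relabel C \<tau> = map (rl C \<tau>)"
  by (rule ext) (simp add: relabel_def rl_def case_prod_unfold)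

abbreviation rel :: "('k::field, 'v) operad_data \<Rightarrow> (nat \<Rightarrow> nat) \<Rightarrow> ((nat set \<times> 'v) list \<Rightarrow>\<^sub>0 'k) \<Rightarrow> ((nat set \<times> 'v) list \<Rightarrow>\<^sub>0 'k)" where
  "rel C \<tau> \<equiv> lin_ext (\<lambda>ws. gen (relabel C \<tau> ws))"

lemma supp_relabel: "supp (relabel C \<tau> ws) = \<tau> ` supp ws"
  by (auto simp: relabel_map supp_def rl_def)

section \<open>Contraction of words modulo the relations\<close>

context cyclic_operad
begin

lemma closed_Sp: "finite U \<Longrightarrow> closed_space (Sp C U)"
proof -
  assume "finite U"
  then interpret module scalars "Sp C U" by (rule space)
  show ?thesis by (auto simp: closed_space_def intro: smult_closed)
qed

lemma keys_odot_rels: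
  assumes X: "finite X" and r: "r \<in> odot_rels e C X"
  shows "Poly_Mapping.keys r \<subseteq> words C X"
  using r
proof (cases rule: odot_relsE)
  case (add xs U a b ys)
  have U: "finite U" using add(1) X by (auto simp: words_iff)
  have "xs @ (U, a \<oplus>\<^bsub>Sp C U\<^esub> b) # ys \<in> words C X" "xs @ (U, b) # ys \<in> words C X"
    by (rule words_replace[OF add(1)], rule closed_add[OF closed_Sp[OF U] add(2,3)], rule words_replace[OF add(1) add(3)])
  then show ?thesis unfolding add(4) by (intro keys_minus) (use add(1) in simp_all)
next
  case (smult xs U a c ys)
  have U: "finite U" using smult(1) X by (auto simp: words_iff)
  have "xs @ (U, c \<odot>\<^bsub>Sp C U\<^esub> a) # ys \<in> words C X"
    by (rule words_replace[OF smult(1)], rule closed_smult[OF closed_Sp[OF U] smult(2)])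
  then show ?thesis unfolding smult(3) by (intro keys_minus keys_scale) (use smult(1) in simp_all)
next
  case (perm ws ws' c)
  then show ?thesis unfolding perm(3) by (intro keys_minus keys_scale) (use perm words_iperm in simp_all)
qed

lemma join_in:
  assumes "finite (fst x)" "finite (fst y)" "fst x \<inter> fst y = {}" "u \<in> fst x" "v \<in> fst y"
    "snd x \<in> carrier (Sp C (fst x))" "snd y \<in> carrier (Sp C (fst y))"
  shows "snd (join C u v x y) \<in> carrier (Sp C (fst (join C u v x y)))"
  unfolding join_def fst_conv snd_conv
  by (rule linear_maps_mem[OF circ_linear_left[OF assms(1-5,7)] assms(6)])

lemma words_finite: "ws \<in> words C X \<Longrightarrow> finite X \<Longrightarrow> w \<in> set ws \<Longrightarrow> finite (fst w)"
  by (auto simp: words_iff supp_def intro: finite_subset)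

lemma join_word:
  assumes X: "finite X" and w: "rs @ [x, y] \<in> words C X" and u: "u \<in> fst x" and v: "v \<in> fst y"
  shows "rs @ [join C u v x y] \<in> words C (X - {u, v})"
proof -
  have f: "finite (fst x)" "finite (fst y)" using words_finite[OF w X] by auto
  have xy: "fst x \<inter> fst y = {}" "snd x \<in> carrier (Sp C (fst x))" "snd y \<in> carrier (Sp C (fst y))"
    "wf_word C rs" "supp rs \<inter> (fst x \<union> fst y) = {}" "supp rs \<union> (fst x \<union> fst y) = X"
    using w by (auto simp: words_iff wf_append wf_Cons)
  have s: "fst (join C u v x y) = (fst x - {u}) \<union> (fst y - {v})" by (simp add: join_def)
  have "u \<notin> fst y" "v \<notin> fst x" using u v xy by auto
  then show ?thesis
    using join_in[OF f xy(1) u v xy(2,3)] xy(4-6) u v by (auto simp: words_iff wf_append wf_Cons s)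
qed

text \<open>Modulo the relations, any signed rearrangement with the two vertices at the end computes
  the contraction. From here on the positions and the exponent in the definition are out of
  sight.\<close>

lemma contract_char:
  assumes X: "finite X" and ws: "ws \<in> words C X" and p: "iperm c ws (rs @ [x, y])" and u: "u \<in> fst x" and v: "v \<in> fst y"
  shows "nf (odot_rels e C (X - {u, v})) (contract e C u v ws) =
    fscale (sg e c) (nf (odot_rels e C (X - {u, v})) (gen (rs @ [join C u v x y])))"
proof -
  have wf: "wf_word C ws" using ws by (simp add: words_iff)
  have xs: "x \<in> set ws" "y \<in> set ws" using iperm_set[OF p] by auto
  obtain i where i: "i < length ws" "x = ws ! i" using xs by (auto simp: in_set_conv_nth)
  obtain j where j: "j < length ws" "y = ws ! j" using xs by (auto simp: in_set_conv_nth)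
  have "fst x \<inter> fst y = {}" using words_iperm[OF p ws] by (auto simp: words_iff wf_append wf_Cons)
  then have "i \<noteq> j" using i j u by auto
  let ?N = "(-1) ^ (if i < j then (length ws - 1 - j) + (length ws - 2 - i) else (length ws - 1 - j) + (length ws - 1 - i)) :: int"
  note q = iperm_contract[OF i(1) j(1) \<open>i \<noteq> j\<close>]
  have ij: "u \<in> fst (ws ! i)" "v \<in> fst (ws ! j)" using u v i j by auto
  have r: "iperm (c * ?N) (rs @ [join C u v x y]) (nths ws (- {i, j}) @ [join C u v x y])"
    using iperm_cancel[OF wf p q u ij(1) v ij(2)] by (intro iperm_append) simp
  note w = join_word[OF X words_iperm[OF p ws] u v]
  have "nf (odot_rels e C (X - {u, v})) (contract e C u v ws) =
    fscale (sg e ?N) (nf (odot_rels e C (X - {u, v})) (gen (nths ws (- {i, j}) @ [join C u v x y])))"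
    unfolding contract_gen[OF wf i(1) j(1) \<open>i \<noteq> j\<close> ij] nf_scale i(2) j(2) ..
  also have "\<dots> = fscale (sg e ?N * sg e (c * ?N)) (nf (odot_rels e C (X - {u, v})) (gen (rs @ [join C u v x y])))"
    unfolding odot_rel_perm[OF w r] by simp
  also have "sg e ?N * sg e (c * ?N) = (sg e c :: 'k)"
    by (rule sg_cancel[OF iperm_sign[OF q]])
  finally show ?thesis .
qed

lemma vertex_cases:
  assumes ws: "ws \<in> words C X" and u: "u \<in> X" and v: "v \<in> X"
  obtains (same) x where "x \<in> set ws" "u \<in> fst x" "v \<in> fst x"
  | (two) x y where "x \<in> set ws" "y \<in> set ws" "x \<noteq> y" "u \<in> fst x" "v \<in> fst y"
proof -
  obtain x where x: "x \<in> set ws" "u \<in> fst x" using u ws by (auto simp: words_iff elim: supp_setE)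
  obtain y where y: "y \<in> set ws" "v \<in> fst y" using v ws by (auto simp: words_iff elim: supp_setE)
  show ?thesis using that x y by (cases "x = y") auto
qed

lemma keys_contract:
  assumes X: "finite X" and ws: "ws \<in> words C X" and u: "u \<in> X" and v: "v \<in> X"
  shows "Poly_Mapping.keys (contract e C u v ws) \<subseteq> words C (X - {u, v})"
using ws u v
proof (cases rule: vertex_cases)
  case (same x)
  then show ?thesis using contract_same[of C ws x u v e] ws by (simp add: words_iff)
next
  case (two x y)
  have wf: "wf_word C ws" using ws by (simp add: words_iff)
  obtain i where i: "i < length ws" "x = ws ! i" using two by (auto simp: in_set_conv_nth)
  obtain j where j: "j < length ws" "y = ws ! j" using two by (auto simp: in_set_conv_nth)
  have n: "i \<noteq> j" using two i j by auto
  have "nths ws (- {i, j}) @ [join C u v x y] \<in> words C (X - {u, v})"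
    using join_word[OF X words_iperm[OF iperm_contract[OF i(1) j(1) n] ws]] two i j by simp
  then have g: "Poly_Mapping.keys (gen (nths ws (- {i, j}) @ [join C u v x y])) \<subseteq> words C (X - {u, v})" by simp
  show ?thesis
    unfolding contract_gen[OF wf i(1) j(1) n two(4,5)[unfolded i(2) j(2)]] using keys_scale[OF g] unfolding i(2) j(2) .
qed

text \<open>Isolates the dependence on one entry t. If u and v share a vertex the contraction
  vanishes for every t. Otherwise t sits in a spectator vertex and survives unchanged, or it enters
  the operadic composition as its left or its right argument; each is linear in t.\<close>

lemma contract_linear_form:
  assumes X: "finite X" and ws: "xs @ (U, a) # ys \<in> words C X" and u: "u \<in> X" and v: "v \<in> X"
  obtains (zero) "\<And>t. t \<in> carrier (Sp C U) \<Longrightarrow> contract e C u v (xs @ (U, t) # ys) = 0"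
  | (form) c as V g bs where "g \<in> linear_maps (Sp C U) (Sp C V)"
     "\<And>t. t \<in> carrier (Sp C U) \<Longrightarrow> as @ (V, g t) # bs \<in> words C (X - {u, v})"
     "\<And>t. t \<in> carrier (Sp C U) \<Longrightarrow> nf (odot_rels e C (X - {u, v})) (contract e C u v (xs @ (U, t) # ys)) =
       fscale c (nf (odot_rels e C (X - {u, v})) (gen (as @ (V, g t) # bs)))"
using ws u v
proof (cases rule: vertex_cases)
  case (same x)
  show ?thesis
  proof (rule zero)
    fix t assume "t \<in> carrier (Sp C U)"
    then have w: "wf_word C (xs @ (U, t) # ys)" using words_replace[OF ws] by (simp add: words_iff)
    have "\<exists>x'. x' \<in> set (xs @ (U, t) # ys) \<and> fst x' = fst x"
    proof (cases "x = (U, a)")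
      case True
      then show ?thesis by (intro exI[of _ "(U, t)"]) simp
    next
      case False
      then show ?thesis using same(1) by (intro exI[of _ x]) auto
    qed
    then show "contract e C u v (xs @ (U, t) # ys) = 0" using contract_same[OF w] same(2,3) by metis
  qed
next
  case (two x y)
  let ?ws = "xs @ (U, a) # ys"
  obtain c rs where p: "iperm c ?ws (rs @ [x, y])" using iperm_pull[of "[x, y]" ?ws] two by auto
  have l: "length xs < length ?ws" by simp
  \<comment> \<open>The entry under study is followed to its position \<open>k\<close> in the
    rearranged word. The rearrangement does not depend on its value, so the sign \<open>c\<close> is
    the same for all t.\<close>
  obtain k where k: "k < length (rs @ [x, y])" "(rs @ [x, y]) ! k = ?ws ! length xs"
    "\<And>w. iperm c (?ws[length xs := w]) ((rs @ [x, y])[k := w])" by (rule iperm_update[OF p l]) blast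
  have kU: "(rs @ [x, y]) ! k = (U, a)" using k(2) by simp
  have p': "iperm c (xs @ (U, t) # ys) ((rs @ [x, y])[k := (U, t)])" for t using k(3)[of "(U, t)"] by simp
  have wt: "xs @ (U, t) # ys \<in> words C X" if "t \<in> carrier (Sp C U)" for t by (rule words_replace[OF ws that])
  have w0: "rs @ [x, y] \<in> words C X" by (rule words_iperm[OF p ws])
  have fx: "finite (fst x)" "finite (fst y)" "fst x \<inter> fst y = {}" "snd x \<in> carrier (Sp C (fst x))" "snd y \<in> carrier (Sp C (fst y))"
    using words_finite[OF w0 X] w0 by (auto simp: words_iff wf_append wf_Cons)
  have fU: "finite U" using words_finite[OF ws X, of "(U, a)"] by simp
  consider (1) "k < length rs" | (2) "k = length rs" | (3) "k = Suc (length rs)" using k(1) by force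
  then show ?thesis
  proof cases
    case 1
    have e: "(rs @ [x, y])[k := (U, t)] = rs[k := (U, t)] @ [x, y]" for t using 1 by (simp add: list_update_append)
    show ?thesis
    proof (rule form[of "\<lambda>t. t" U "take k rs" "drop (Suc k) rs @ [join C u v x y]" "sg e c"])
      show "(\<lambda>t. t) \<in> linear_maps (Sp C U) (Sp C U)" by (rule linear_maps_ident[OF closed_Sp[OF fU]])
      fix t assume t: "t \<in> carrier (Sp C U)"
      have s: "take k rs @ (U, t) # drop (Suc k) rs @ [join C u v x y] = rs[k := (U, t)] @ [join C u v x y]"
        using list_split_at[OF 1] by simp
      show "take k rs @ (U, t) # drop (Suc k) rs @ [join C u v x y] \<in> words C (X - {u, v})"
        unfolding s by (rule join_word[OF X _ two(4,5)], fold e) (rule words_iperm[OF p' wt[OF t]])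
      show "nf (odot_rels e C (X - {u, v})) (contract e C u v (xs @ (U, t) # ys)) =
        fscale (sg e c) (nf (odot_rels e C (X - {u, v})) (gen (take k rs @ (U, t) # drop (Suc k) rs @ [join C u v x y])))"
        unfolding s by (rule contract_char[OF X wt[OF t] p'[of t, unfolded e] two(4,5)])
    qed
  next
    case 2
    then have x: "x = (U, a)" using kU by (simp add: nth_append)
    have e: "(rs @ [x, y])[k := (U, t)] = rs @ [(U, t), y]" for t using 2 by (simp add: list_update_append)
    let ?V = "(U - {u}) \<union> (fst y - {v})"
    have j: "join C u v (U, t) y = (?V, Circ C U (fst y) u v t (snd y))" for t by (simp add: join_def)
    show ?thesis
    proof (rule form[of "\<lambda>t. Circ C U (fst y) u v t (snd y)" ?V rs "[]" "sg e c"])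
      show "(\<lambda>t. Circ C U (fst y) u v t (snd y)) \<in> linear_maps (Sp C U) (Sp C ?V)"
        using fx two(4,5) by (intro circ_linear_left) (simp_all add: x)
      fix t assume t: "t \<in> carrier (Sp C U)"
      have ut: "u \<in> fst (U, t)" using two(4) x by simp
      show "rs @ [(?V, Circ C U (fst y) u v t (snd y))] \<in> words C (X - {u, v})"
        unfolding j[symmetric] by (rule join_word[OF X _ ut two(5)], fold e) (rule words_iperm[OF p' wt[OF t]])
      show "nf (odot_rels e C (X - {u, v})) (contract e C u v (xs @ (U, t) # ys)) =
        fscale (sg e c) (nf (odot_rels e C (X - {u, v})) (gen (rs @ [(?V, Circ C U (fst y) u v t (snd y))])))"
        unfolding j[symmetric] by (rule contract_char[OF X wt[OF t] p'[of t, unfolded e] ut two(5)])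
    qed
  next
    case 3
    then have y: "y = (U, a)" using kU by (simp add: nth_append)
    have e: "(rs @ [x, y])[k := (U, t)] = rs @ [x, (U, t)]" for t using 3 by (simp add: list_update_append)
    let ?V = "(fst x - {u}) \<union> (U - {v})"
    have j: "join C u v x (U, t) = (?V, Circ C (fst x) U u v (snd x) t)" for t by (simp add: join_def)
    show ?thesis
    proof (rule form[of "\<lambda>t. Circ C (fst x) U u v (snd x) t" ?V rs "[]" "sg e c"])
      show "(\<lambda>t. Circ C (fst x) U u v (snd x) t) \<in> linear_maps (Sp C U) (Sp C ?V)"
        using fx two(4,5) by (intro circ_linear_right) (simp_all add: y)
      fix t assume t: "t \<in> carrier (Sp C U)"
      have ut: "v \<in> fst (U, t)" using two(5) y by simp
      show "rs @ [(?V, Circ C (fst x) U u v (snd x) t)] \<in> words C (X - {u, v})"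
        unfolding j[symmetric] by (rule join_word[OF X _ two(4) ut], fold e) (rule words_iperm[OF p' wt[OF t]])
      show "nf (odot_rels e C (X - {u, v})) (contract e C u v (xs @ (U, t) # ys)) =
        fscale (sg e c) (nf (odot_rels e C (X - {u, v})) (gen (rs @ [(?V, Circ C (fst x) U u v (snd x) t)])))"
        unfolding j[symmetric] by (rule contract_char[OF X wt[OF t] p'[of t, unfolded e] two(4) ut])
    qed
  qed
qed

lemma odot_hom_con:
  assumes X: "finite X" and u: "u \<in> X" and v: "v \<in> X"
  shows "odot_hom e C X (X - {u, v}) (con e C u v)"
  unfolding odot_hom_def
proof (intro conjI ballI allI impI)
  show "flin (con e C u v)" by (rule flin_lin_ext)
  show "Poly_Mapping.keys (con e C u v p) \<subseteq> words C (X - {u, v})" if "Poly_Mapping.keys p \<subseteq> words C X" for p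
    by (rule keys_lin_ext) (use that keys_contract[OF X _ u v] in blast)
  fix r :: "(nat set \<times> 'v) list \<Rightarrow>\<^sub>0 'k" assume r: "r \<in> odot_rels e C X"
  show "nf (odot_rels e C (X - {u, v})) (con e C u v r) = 0"
    unfolding nf_lin_ext
  proof (rule odot_lift[OF _ _ _ r])
    fix xs ys U a b assume ws: "xs @ (U, a) # ys \<in> words C X" and a: "a \<in> carrier (Sp C U)" and b: "b \<in> carrier (Sp C U)"
    have U: "finite U" using words_finite[OF ws X, of "(U, a)"] by simp
    note ab = closed_add[OF closed_Sp[OF U] a b]
    show "nf (odot_rels e C (X - {u, v})) (contract e C u v (xs @ (U, a \<oplus>\<^bsub>Sp C U\<^esub> b) # ys)) =
      nf (odot_rels e C (X - {u, v})) (contract e C u v (xs @ (U, a) # ys)) + nf (odot_rels e C (X - {u, v})) (contract e C u v (xs @ (U, b) # ys))"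
      using X ws u v
    proof (cases rule: contract_linear_form[where e=e])
      case zero
      then show ?thesis using a b ab by simp
    next
      case (form c as V g bs)
      show ?thesis
        unfolding form(3)[OF a] form(3)[OF b] form(3)[OF ab] linear_maps_add[OF form(1) a b]
          odot_rel_add[OF form(2)[OF a] linear_maps_mem[OF form(1) a] linear_maps_mem[OF form(1) b]]
        by (rule free_vs.scale_right_distrib)
    qed
  next
    fix xs ys U a c assume ws: "xs @ (U, a) # ys \<in> words C X" and a: "a \<in> carrier (Sp C U)"
    have U: "finite U" using words_finite[OF ws X, of "(U, a)"] by simp
    note ab = closed_smult[OF closed_Sp[OF U] a, of c]
    show "nf (odot_rels e C (X - {u, v})) (contract e C u v (xs @ (U, c \<odot>\<^bsub>Sp C U\<^esub> a) # ys)) =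
      fscale c (nf (odot_rels e C (X - {u, v})) (contract e C u v (xs @ (U, a) # ys)))"
      using X ws u v
    proof (cases rule: contract_linear_form[where e=e])
      case zero
      then show ?thesis using a ab by simp
    next
      case (form d as V g bs)
      show ?thesis
        unfolding form(3)[OF a] form(3)[OF ab] linear_maps_smult[OF form(1) a]
          odot_rel_smult[OF form(2)[OF a] linear_maps_mem[OF form(1) a]] free_vs.scale_scale
        by (simp only: mult.commute)
    qed
  next
    fix ws ws' c assume ws: "ws \<in> words C X" and p: "iperm c ws ws'"
    have ws': "ws' \<in> words C X" by (rule words_iperm[OF p ws])
    show "nf (odot_rels e C (X - {u, v})) (contract e C u v ws') = fscale (sg e c) (nf (odot_rels e C (X - {u, v})) (contract e C u v ws))"
    using ws u v
    proof (cases rule: vertex_cases)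
      case (same x)
      then show ?thesis using contract_same[of C ws x u v e] contract_same[of C ws' x u v e] ws ws' iperm_set[OF p]
        by (simp add: words_iff)
    next
      case (two x y)
      obtain d rs where d: "iperm d ws' (rs @ [x, y])" using iperm_pull[of "[x, y]" ws'] two iperm_set[OF p] by auto
      have s: "sg e c * sg e c = (1 :: 'k)" by (rule sg_square[OF iperm_sign[OF p]])
      show ?thesis
        unfolding contract_char[OF X ws' d two(4,5)] contract_char[OF X ws iperm_trans[OF p d] two(4,5)]
          free_vs.scale_scale sg_mult mult.assoc[symmetric] s by simp
    qed
  qed
qed

lemma con_char:
  assumes "finite X" "ws \<in> words C X" "iperm c ws (rs @ [x, y])" "u \<in> fst x" "v \<in> fst y"
  shows "nf (odot_rels e C (X - {u, v})) (con e C u v (gen ws)) =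
    nf (odot_rels e C (X - {u, v})) (fscale (sg e c) (gen (rs @ [join C u v x y])))"
  unfolding lin_ext_gen nf_scale by (rule contract_char[OF assms])

lemma con_same: "ws \<in> words C X \<Longrightarrow> x \<in> set ws \<Longrightarrow> u \<in> fst x \<Longrightarrow> v \<in> fst x \<Longrightarrow> con e C u v (gen ws) = 0"
  using contract_same[of C ws x u v e] by (simp add: words_iff)

lemma Diff_pair_commute: "A - {u, v} = A - {v, u}" by auto

text \<open>Symmetry of the operadic composition identifies the two joined vertices. The sign is
  that of exchanging the two vertices before they are joined.\<close>

lemma con_flip_gen:
  assumes X: "finite X" and ws: "ws \<in> words C X" and u: "u \<in> X" and v: "v \<in> X"
  shows "nf (odot_rels e C (X - {u, v})) (con e C v u (gen ws)) = fscale (sg e (-1)) (nf (odot_rels e C (X - {u, v})) (con e C u v (gen ws)))"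
using ws u v
proof (cases rule: vertex_cases)
  case (same x)
  then show ?thesis by (simp add: con_same[OF ws] del: lin_ext_gen)
next
  case (two x y)
  obtain c rs where p: "iperm c ws (rs @ [x, y])" using iperm_pull[of "[x, y]" ws] two by auto
  have p': "iperm (c * -1) ws (rs @ [y, x])" by (rule iperm_trans[OF p iperm_swap])
  have w: "rs @ [x, y] \<in> words C X" by (rule words_iperm[OF p ws])
  have "join C v u y x = join C u v x y"
    using words_finite[OF w X] w two(4,5) circ_sym[of "fst x" "fst y" u v "snd x" "snd y"]
    by (auto simp: join_def words_iff wf_append wf_Cons)
  then have "nf (odot_rels e C (X - {u, v})) (con e C v u (gen ws)) =
    nf (odot_rels e C (X - {u, v})) (fscale (sg e (c * -1)) (gen (rs @ [join C u v x y])))"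
    using con_char[OF X ws p' two(5,4), of e] unfolding Diff_pair_commute[of X v u] by simp
  then show ?thesis unfolding con_char[OF X ws p two(4,5)] nf_scale sg_mult by (simp add: mult.commute)
qed

lemma con_flip:
  assumes X: "finite X" and u: "u \<in> X" and v: "v \<in> X" and k: "Poly_Mapping.keys x \<subseteq> words C X"
  shows "nf (odot_rels e C (X - {u, v})) (con e C v u x) = fscale (sg e (-1)) (nf (odot_rels e C (X - {u, v})) (con e C u v x))"
  by (rule flin_agree[where S="words C X" and L="\<lambda>x. nf (odot_rels e C (X - {u, v})) (con e C v u x)"
        and L'="\<lambda>x. fscale (sg e (-1)) (nf (odot_rels e C (X - {u, v})) (con e C u v x))"])
    (intro flin_intros k con_flip_gen[OF X _ u v])+

lemma con_con_char:
  assumes X: "finite X" and ws: "ws \<in> words C X" and p: "iperm c ws (rs @ [x, y])" and u: "u \<in> fst x" and v: "v \<in> fst y"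
    and w: "w \<in> X - {u, v}" and z: "z \<in> X - {u, v}"
  shows "nf (odot_rels e C (X - {u, v} - {w, z})) (con e C w z (con e C u v (gen ws))) =
    fscale (sg e c) (nf (odot_rels e C (X - {u, v} - {w, z})) (con e C w z (gen (rs @ [join C u v x y]))))"
proof -
  have f: "finite (X - {u, v})" using X by simp
  show ?thesis
    unfolding odot_hom_nf[OF odot_hom_con[OF f w z] con_char[OF X ws p u v]] lin_ext_scale nf_scale ..
qed

definition con_commute where
  "con_commute e X ws u v w z \<longleftrightarrow>
    nf (odot_rels e C (X - {u, v, w, z})) (con e C w z (con e C u v (gen ws))) =
    fscale (sg e (-1)) (nf (odot_rels e C (X - {u, v, w, z})) (con e C u v (con e C w z (gen ws))))"

lemma con_commute_sym: "con_commute e X ws w z u v \<Longrightarrow> con_commute e X ws u v w z"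
proof -
  assume a: "con_commute e X ws w z u v"
  have s: "sg e (-1) * sg e (-1) = (1 :: 'k)" by (rule sg_square) simp
  have X: "X - {w, z, u, v} = X - {u, v, w, z}" by auto
  show ?thesis using a unfolding con_commute_def X by (simp add: s)
qed

lemma con_commute_flip:
  assumes X: "finite X" and ws: "ws \<in> words C X" and i: "u \<in> X" "v \<in> X" "w \<in> X" "z \<in> X" and d: "distinct [u, v, w, z]"
    and a: "con_commute e X ws u v z w"
  shows "con_commute e X ws u v w z"
proof -
  have s: "sg e (-1) * sg e (-1) = (1 :: 'k)" by (rule sg_square) simp
  have Z: "X - {u, v, z, w} = X - {u, v, w, z}" "X - {u, v} - {w, z} = X - {u, v, w, z}" "X - {w, z} - {u, v} = X - {u, v, w, z}" by auto
  have f: "finite (X - {u, v})" "finite (X - {w, z})" using X by auto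
  have wz: "w \<in> X - {u, v}" "z \<in> X - {u, v}" and uv: "u \<in> X - {w, z}" "v \<in> X - {w, z}" using i d by auto
  have k: "Poly_Mapping.keys (con e C u v (gen ws)) \<subseteq> words C (X - {u, v})"
    by (rule odot_hom_keys[OF odot_hom_con[OF X i(1,2)]]) (simp add: ws)
  note 1 = con_flip[OF f(1) wz k, unfolded Z]
  have "nf (odot_rels e C (X - {w, z})) (con e C z w (gen ws)) = nf (odot_rels e C (X - {w, z})) (fscale (sg e (-1)) (con e C w z (gen ws)))"
    unfolding nf_scale by (rule con_flip_gen[OF X ws i(3,4)])
  note 2 = odot_hom_nf[OF odot_hom_con[OF f(2) uv] this, unfolded Z lin_ext_scale nf_scale]
  have "fscale (sg e (-1)) (fscale (sg e (-1)) (nf (odot_rels e C (X - {u, v, w, z})) (con e C w z (con e C u v (gen ws))))) =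
     fscale (sg e (-1)) (fscale (sg e (-1)) (fscale (sg e (-1)) (nf (odot_rels e C (X - {u, v, w, z})) (con e C u v (con e C w z (gen ws))))))"
    using a unfolding con_commute_def Z(1) 1 2 by simp
  then show ?thesis unfolding con_commute_def free_vs.scale_scale s by simp
qed

text \<open>A chord inside one vertex gives zero in either order: contracting the other chord first
  can only enlarge the vertex that contains both u and v.\<close>

lemma con_commute_zero:
  assumes X: "finite X" and ws: "ws \<in> words C X" and i: "u \<in> X" "v \<in> X" "w \<in> X" "z \<in> X" and d: "distinct [u, v, w, z]"
    and x: "x \<in> set ws" "u \<in> fst x" "v \<in> fst x"
  shows "con_commute e X ws u v w z"
proof -
  have Z: "X - {w, z} - {u, v} = X - {u, v, w, z}" by auto
  have uv: "u \<in> X - {w, z}" "v \<in> X - {w, z}" using i d by auto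
  have "nf (odot_rels e C (X - {w, z} - {u, v})) (con e C u v (con e C w z (gen ws))) = 0"
  using ws i(3) i(4)
  proof (cases rule: vertex_cases)
    case (same y)
    then show ?thesis by (simp add: con_same[OF ws same(1)] del: lin_ext_gen)
  next
    case (two y y')
    obtain c rs where p: "iperm c ws (rs @ [y, y'])" using iperm_pull[of "[y, y']" ws] two by auto
    note j = join_word[OF X words_iperm[OF p ws] two(4,5)]
    have "con e C u v (gen (rs @ [join C w z y y'])) = 0"
    proof (cases "x = y \<or> x = y'")
      case True
      have "u \<in> fst (join C w z y y')" "v \<in> fst (join C w z y y')"
        using True x d two(4,5) words_iperm[OF p ws] by (auto simp: join_def)
      then show ?thesis by (intro con_same[OF j, of "join C w z y y'"]) auto
    next
      case False
      then have "x \<in> set rs" using x(1) iperm_set[OF p] by auto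
      then show ?thesis by (intro con_same[OF j, of x]) (use x in auto)
    qed
    then show ?thesis unfolding con_con_char[OF X ws p two(4,5) uv] by simp
  qed
  then show ?thesis unfolding con_commute_def Z con_same[OF ws x] by simp
qed

text \<open>With two chords between the same two vertices, the first contraction turns the other
  chord into one inside a single vertex. Both orders give zero.\<close>

lemma con_commute_double:
  assumes X: "finite X" and ws: "ws \<in> words C X" and i: "u \<in> X" "v \<in> X" "w \<in> X" "z \<in> X" and d: "distinct [u, v, w, z]"
    and x: "x \<in> set ws" "y \<in> set ws" "x \<noteq> y" "u \<in> fst x" "v \<in> fst y" "w \<in> fst x" "z \<in> fst y"
  shows "con_commute e X ws u v w z"
proof -
  have Z: "X - {w, z} - {u, v} = X - {u, v, w, z}" "X - {u, v} - {w, z} = X - {u, v, w, z}" by auto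
  have wz: "w \<in> X - {u, v}" "z \<in> X - {u, v}" and uv: "u \<in> X - {w, z}" "v \<in> X - {w, z}" using i d by auto
  obtain c rs where p: "iperm c ws (rs @ [x, y])" using iperm_pull[of "[x, y]" ws] x by auto
  have 1: "con e C w z (gen (rs @ [join C u v x y])) = 0"
    by (rule con_same[OF join_word[OF X words_iperm[OF p ws] x(4,5)], of "join C u v x y"]) (use x d in \<open>auto simp: join_def\<close>)
  have 2: "con e C u v (gen (rs @ [join C w z x y])) = 0"
    by (rule con_same[OF join_word[OF X words_iperm[OF p ws] x(6,7)], of "join C w z x y"]) (use x d in \<open>auto simp: join_def\<close>)
  show ?thesis
    unfolding con_commute_def
    using con_con_char[OF X ws p x(4,5) wz, of e] con_con_char[OF X ws p x(6,7) uv, of e] unfolding Z 1 2 by simp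
qed

lemma join_assoc:
  assumes "finite (fst x)" "finite (fst y)" "finite (fst t)" "fst x \<inter> fst y = {}" "fst x \<inter> fst t = {}" "fst y \<inter> fst t = {}"
    "u \<in> fst x" "v \<in> fst y" "w \<in> fst y" "v \<noteq> w" "z \<in> fst t"
    "snd x \<in> carrier (Sp C (fst x))" "snd y \<in> carrier (Sp C (fst y))" "snd t \<in> carrier (Sp C (fst t))"
  shows "join C w z (join C u v x y) t = join C u v x (join C w z y t)"
proof -
  have "w \<notin> fst x" "v \<notin> fst t" using assms by auto
  then have "((fst x - {u}) \<union> (fst y - {v})) - {w} \<union> (fst t - {z}) = (fst x - {u}) \<union> (((fst y - {w}) \<union> (fst t - {z})) - {v})"
    by auto
  then show ?thesis unfolding join_def fst_conv snd_conv circ_assoc[OF assms] by simp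
qed

text \<open>Associativity identifies the two resulting vertices. If x and y are joined first, their
  join lands behind t and has to be exchanged with it, which is the only sign; joining y and t first
  leaves x in the right place.\<close>

lemma con_commute_chain:
  assumes X: "finite X" and ws: "ws \<in> words C X" and i: "u \<in> X" "v \<in> X" "w \<in> X" "z \<in> X" and d: "distinct [u, v, w, z]"
    and x: "x \<in> set ws" "y \<in> set ws" "t \<in> set ws" "distinct [x, y, t]" "u \<in> fst x" "v \<in> fst y" "w \<in> fst y" "z \<in> fst t"
  shows "con_commute e X ws u v w z"
proof -
  have Z: "X - {w, z} - {u, v} = X - {u, v, w, z}" "X - {u, v} - {w, z} = X - {u, v, w, z}" by auto
  have wz: "w \<in> X - {u, v}" "z \<in> X - {u, v}" and uv: "u \<in> X - {w, z}" "v \<in> X - {w, z}" using i d by auto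
  have f: "finite (X - {u, v})" "finite (X - {w, z})" using X by auto
  obtain c rs where p: "iperm c ws (rs @ [x, y, t])" using iperm_pull[of "[x, y, t]" ws] x by auto
  have w3: "rs @ [x, y, t] \<in> words C X" by (rule words_iperm[OF p ws])
  have ja: "join C w z (join C u v x y) t = join C u v x (join C w z y t)"
    by (rule join_assoc) (use words_finite[OF w3 X] w3 x d in \<open>auto simp: words_iff wf_append wf_Cons\<close>)
  have p1: "iperm (c * 1) ws ((rs @ [t]) @ [x, y])"
    by (rule iperm_trans[OF p]) (use iperm_sym[OF iperm_move[of "[x, y]" rs t "[]"]] in simp)
  have p2: "iperm c ws ((rs @ [x]) @ [y, t])" using p by simp
  let ?j1 = "join C u v x y" and ?j2 = "join C w z y t"
  have j1: "(rs @ [t]) @ [?j1] \<in> words C (X - {u, v})" by (rule join_word[OF X words_iperm[OF p1 ws] x(5,6)])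
  have j2: "(rs @ [x]) @ [?j2] \<in> words C (X - {w, z})" by (rule join_word[OF X words_iperm[OF p2 ws] x(7,8)])
  have q1: "iperm (-1) ((rs @ [t]) @ [?j1]) (rs @ [?j1, t])" using iperm_swap[of rs t ?j1 "[]"] by simp
  have q2: "iperm 1 ((rs @ [x]) @ [?j2]) (rs @ [x, ?j2])" using iperm_refl[of "rs @ [x, ?j2]"] by simp
  have m1: "w \<in> fst ?j1" "v \<in> fst ?j2" using x d by (auto simp: join_def)
  note A = con_con_char[OF X ws p1 x(5,6) wz, of e, unfolded Z con_char[OF f(1) j1 q1 m1(1) x(8), unfolded Z] nf_scale]
  note B = con_con_char[OF X ws p2 x(7,8) uv, of e, unfolded Z con_char[OF f(2) j2 q2 x(5) m1(2), unfolded Z] nf_scale]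
  show ?thesis unfolding con_commute_def A B ja by (simp add: mult.commute)
qed

text \<open>Every vertex that gets out of the way passes two others, without a sign. The two joined
  vertices end up in opposite orders, and their exchange is the sign.\<close>

lemma con_commute_disjoint:
  assumes X: "finite X" and ws: "ws \<in> words C X" and i: "u \<in> X" "v \<in> X" "w \<in> X" "z \<in> X" and d: "distinct [u, v, w, z]"
    and x: "x \<in> set ws" "y \<in> set ws" "s \<in> set ws" "t \<in> set ws" "distinct [x, y, s, t]" "u \<in> fst x" "v \<in> fst y" "w \<in> fst s" "z \<in> fst t"
  shows "con_commute e X ws u v w z"
proof -
  have Z: "X - {w, z} - {u, v} = X - {u, v, w, z}" "X - {u, v} - {w, z} = X - {u, v, w, z}" by auto
  have wz: "w \<in> X - {u, v}" "z \<in> X - {u, v}" and uv: "u \<in> X - {w, z}" "v \<in> X - {w, z}" using i d by auto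
  have f: "finite (X - {u, v})" "finite (X - {w, z})" using X by auto
  obtain c rs where p: "iperm c ws (rs @ [x, y, s, t])" using iperm_pull[of "[x, y, s, t]" ws] x by auto
  have "iperm (1 * 1) (rs @ [x, y, s, t]) (rs @ [s, t, x, y])"
    by (rule iperm_trans[of 1 _ "rs @ [s, x, y, t]"])
      (use iperm_sym[OF iperm_move[of "[x, y]" rs s "[t]"]] iperm_sym[OF iperm_move[of "[x, y]" "rs @ [s]" t "[]"]] in simp_all)
  then have p1: "iperm (c * 1) ws ((rs @ [s, t]) @ [x, y])"
    using iperm_trans[OF p, of 1 "rs @ [s, t, x, y]"] by simp
  have p2: "iperm c ws ((rs @ [x, y]) @ [s, t])" using p by simp
  let ?j1 = "join C u v x y" and ?j2 = "join C w z s t"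
  have j1: "(rs @ [s, t]) @ [?j1] \<in> words C (X - {u, v})" by (rule join_word[OF X words_iperm[OF p1 ws] x(6,7)])
  have j2: "(rs @ [x, y]) @ [?j2] \<in> words C (X - {w, z})" by (rule join_word[OF X words_iperm[OF p2 ws] x(8,9)])
  have q1: "iperm 1 ((rs @ [s, t]) @ [?j1]) ((rs @ [?j1]) @ [s, t])"
    using iperm_sym[OF iperm_move[of "[s, t]" rs ?j1 "[]"]] by simp
  have q2: "iperm 1 ((rs @ [x, y]) @ [?j2]) ((rs @ [?j2]) @ [x, y])"
    using iperm_sym[OF iperm_move[of "[x, y]" rs ?j2 "[]"]] by simp
  have j12: "(rs @ [?j1]) @ [?j2] \<in> words C (X - {u, v, w, z})"
    using join_word[OF f(1) words_iperm[OF q1 j1] x(8,9)] unfolding Z .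
  have sw: "nf (odot_rels e C (X - {u, v, w, z})) (gen ((rs @ [?j2]) @ [?j1])) =
    fscale (sg e (-1)) (nf (odot_rels e C (X - {u, v, w, z})) (gen ((rs @ [?j1]) @ [?j2])))"
    by (rule odot_rel_perm[OF j12]) (use iperm_swap[of rs ?j1 ?j2 "[]"] in simp)
  have ss: "sg e (-1) * sg e (-1) = (1 :: 'k)" by (rule sg_square) simp
  note A = con_con_char[OF X ws p1 x(6,7) wz, of e, unfolded Z con_char[OF f(1) j1 q1 x(8,9), unfolded Z] nf_scale]
  note B = con_con_char[OF X ws p2 x(8,9) uv, of e, unfolded Z con_char[OF f(2) j2 q2 x(6,7), unfolded Z] nf_scale sw]
  have "sg e (-1) * (sg e c * sg e (-1)) = (sg e c :: 'k)" using ss by (simp add: mult.commute mult.left_commute)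
  then show ?thesis unfolding con_commute_def A B by simp
qed

text \<open>Up to reversing a chord and exchanging the two chords there are four configurations: a
  chord inside a vertex, a double chord, a chain of three vertices, and two chords on four vertices.
  The nine cases list their variants.\<close>

lemma con_commute_all:
  assumes X: "finite X" and ws: "ws \<in> words C X" and i: "u \<in> X" "v \<in> X" "w \<in> X" "z \<in> X" and d: "distinct [u, v, w, z]"
  shows "con_commute e X ws u v w z"
proof -
  have ex: "\<exists>x\<in>set ws. u \<in> fst x" if "u \<in> X" for u using that ws by (auto simp: words_iff elim: supp_setE)
  obtain a b s t where x: "a \<in> set ws" "u \<in> fst a" "b \<in> set ws" "v \<in> fst b" "s \<in> set ws" "w \<in> fst s" "t \<in> set ws" "z \<in> fst t"
    using ex[OF i(1)] ex[OF i(2)] ex[OF i(3)] ex[OF i(4)] by metis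
  have d': "distinct [u, v, z, w]" "distinct [w, z, u, v]" "distinct [w, z, v, u]" "distinct [v, u, w, z]" "distinct [v, u, z, w]"
    using d by auto
  have flip1: "con_commute e X ws u v w z" if "con_commute e X ws v u w z"
    by (rule con_commute_sym, rule con_commute_flip[OF X ws i(3,4,1,2) d'(2)], rule con_commute_sym, rule that)
  note flip2 = con_commute_flip[OF X ws i d]
  consider (1) "a = b" | (2) "s = t" | (3) "a \<noteq> b" "s = a" "t = b" | (4) "a \<noteq> b" "s = b" "t = a"
    | (5) "a \<noteq> b" "s \<noteq> t" "b = s" "a \<noteq> t" | (6) "a \<noteq> b" "s \<noteq> t" "b = t" "a \<noteq> s"
    | (7) "a \<noteq> b" "s \<noteq> t" "a = s" "b \<noteq> t" | (8) "a \<noteq> b" "s \<noteq> t" "a = t" "b \<noteq> s"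
    | (9) "distinct [a, b, s, t]" by auto
  then show ?thesis
  proof cases
    case 1
    show ?thesis by (rule con_commute_zero[OF X ws i d x(1,2)]) (use 1 x in simp)
  next
    case 2
    show ?thesis by (rule con_commute_sym, rule con_commute_zero[OF X ws i(3,4,1,2) d'(2) x(5,6)]) (use 2 x in simp)
  next
    case 3
    show ?thesis by (rule con_commute_double[OF X ws i d x(1,3) 3(1) x(2,4)]) (use 3 x in simp_all)
  next
    case 4
    show ?thesis by (rule flip2, rule con_commute_double[OF X ws i(1,2,4,3) d'(1) x(1,3) 4(1) x(2,4)]) (use 4 x in simp_all)
  next
    case 5
    show ?thesis by (rule con_commute_chain[OF X ws i d x(1,3,7)]) (use 5 x in auto)
  next
    case 6
    show ?thesis by (rule flip2, rule con_commute_chain[OF X ws i(1,2,4,3) d'(1) x(1,3,5)]) (use 6 x in auto)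
  next
    case 7
    show ?thesis by (rule flip1, rule con_commute_chain[OF X ws i(2,1,3,4) d'(4) x(3,1,7)]) (use 7 x in auto)
  next
    case 8
    show ?thesis
      by (rule flip1, rule con_commute_flip[OF X ws i(2,1,3,4) d'(4)], rule con_commute_chain[OF X ws i(2,1,4,3) d'(5) x(3,1,5)])
        (use 8 x in auto)
  next
    case 9
    show ?thesis by (rule con_commute_disjoint[OF X ws i d x(1,3,5,7) 9 x(2,4,6,8)])
  qed
qed

lemma con_commutes:
  assumes X: "finite X" and i: "u \<in> X" "v \<in> X" "w \<in> X" "z \<in> X" and d: "distinct [u, v, w, z]" and k: "Poly_Mapping.keys x \<subseteq> words C X"
  shows "nf (odot_rels e C (X - {u, v, w, z})) (con e C w z (con e C u v x)) =
    fscale (sg e (-1)) (nf (odot_rels e C (X - {u, v, w, z})) (con e C u v (con e C w z x)))"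
  by (rule flin_agree[where S="words C X" and L="\<lambda>x. nf (odot_rels e C (X - {u, v, w, z})) (con e C w z (con e C u v x))"
        and L'="\<lambda>x. fscale (sg e (-1)) (nf (odot_rels e C (X - {u, v, w, z})) (con e C u v (con e C w z x)))"])
    (intro flin_intros k con_commute_all[OF X _ i d, unfolded con_commute_def])+

section \<open>Relabelling of words and its compatibility with contraction\<close>

lemma Tr_rl:
  assumes "finite U" "inj_on \<tau> U"
  shows "Tr C U (\<tau> ` U) (restrict \<tau> U) \<in> linear_maps (Sp C U) (Sp C (\<tau> ` U))"
  by (rule tr_linear[OF assms(1)]) (use assms in \<open>simp add: Bij_def inj_on_imp_bij_betw\<close>)

lemma wf_relabel:
  assumes X: "finite X" and t: "inj_on \<tau> X" and ws: "wf_word C ws" "supp ws \<subseteq> X"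
  shows "wf_word C (relabel C \<tau> ws)"
  using ws
proof (induction ws)
  case (Cons w ws)
  have 1: "finite (fst w)" "inj_on \<tau> (fst w)" using Cons.prems X t by (auto intro: finite_subset inj_on_subset)
  have "\<tau> ` fst w \<inter> \<tau> ` supp ws = {}"
    using Cons.prems inj_on_image_Int[OF t, of "fst w" "supp ws"] by (simp add: wf_Cons)
  then show ?case
    using Cons linear_maps_mem[OF Tr_rl[OF 1]] supp_relabel[of C \<tau> ws] by (simp add: relabel_map wf_Cons rl_def)
qed (simp add: relabel_map)

lemma relabel_words:
  assumes "finite X" "inj_on \<tau> X" "ws \<in> words C X" shows "relabel C \<tau> ws \<in> words C (\<tau> ` X)"
  using assms wf_relabel[OF assms(1,2)] by (simp add: words_iff supp_relabel)

lemma odot_hom_relabel: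
  assumes X: "finite X" and t: "inj_on \<tau> X"
  shows "odot_hom e C X (\<tau> ` X) (rel C \<tau>)"
  unfolding odot_hom_def
proof (intro conjI ballI allI impI)
  show "flin (rel C \<tau>)" by (rule flin_lin_ext)
  show "Poly_Mapping.keys (rel C \<tau> p) \<subseteq> words C (\<tau> ` X)" if "Poly_Mapping.keys p \<subseteq> words C X" for p
  proof (rule keys_lin_ext)
    fix g assume "g \<in> Poly_Mapping.keys p"
    then show "Poly_Mapping.keys (gen (relabel C \<tau> g)) \<subseteq> words C (\<tau> ` X)" using that relabel_words[OF X t] by auto
  qed
  fix r :: "(nat set \<times> 'v) list \<Rightarrow>\<^sub>0 'k" assume r: "r \<in> odot_rels e C X"
  show "nf (odot_rels e C (\<tau> ` X)) (rel C \<tau> r) = 0"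
    unfolding nf_lin_ext
  proof (rule odot_lift[OF _ _ _ r])
    fix xs ys U a b assume ws: "xs @ (U, a) # ys \<in> words C X" and a: "a \<in> carrier (Sp C U)" and b: "b \<in> carrier (Sp C U)"
    have U: "finite U" "inj_on \<tau> U" using ws X t by (auto simp: words_iff intro: finite_subset inj_on_subset)
    note T = Tr_rl[OF U]
    have s: "relabel C \<tau> (xs @ (U, t) # ys) = relabel C \<tau> xs @ (\<tau> ` U, Tr C U (\<tau> ` U) (restrict \<tau> U) t) # relabel C \<tau> ys" for t
      by (simp add: relabel_map rl_def)
    note w = relabel_words[OF X t ws, unfolded s]
    show "nf (odot_rels e C (\<tau> ` X)) (gen (relabel C \<tau> (xs @ (U, a \<oplus>\<^bsub>Sp C U\<^esub> b) # ys))) =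
      nf (odot_rels e C (\<tau> ` X)) (gen (relabel C \<tau> (xs @ (U, a) # ys))) + nf (odot_rels e C (\<tau> ` X)) (gen (relabel C \<tau> (xs @ (U, b) # ys)))"
      unfolding s linear_maps_add[OF T a b] by (rule odot_rel_add[OF w linear_maps_mem[OF T a] linear_maps_mem[OF T b]])
  next
    fix xs ys U a c assume ws: "xs @ (U, a) # ys \<in> words C X" and a: "a \<in> carrier (Sp C U)"
    have U: "finite U" "inj_on \<tau> U" using ws X t by (auto simp: words_iff intro: finite_subset inj_on_subset)
    note T = Tr_rl[OF U]
    have s: "relabel C \<tau> (xs @ (U, t) # ys) = relabel C \<tau> xs @ (\<tau> ` U, Tr C U (\<tau> ` U) (restrict \<tau> U) t) # relabel C \<tau> ys" for t
      by (simp add: relabel_map rl_def)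
    note w = relabel_words[OF X t ws, unfolded s]
    show "nf (odot_rels e C (\<tau> ` X)) (gen (relabel C \<tau> (xs @ (U, c \<odot>\<^bsub>Sp C U\<^esub> a) # ys))) =
      fscale c (nf (odot_rels e C (\<tau> ` X)) (gen (relabel C \<tau> (xs @ (U, a) # ys))))"
      unfolding s linear_maps_smult[OF T a] by (rule odot_rel_smult[OF w linear_maps_mem[OF T a]])
  next
    fix ws ws' c assume ws: "ws \<in> words C X" and p: "iperm c ws ws'"
    show "nf (odot_rels e C (\<tau> ` X)) (gen (relabel C \<tau> ws')) = fscale (sg e c) (nf (odot_rels e C (\<tau> ` X)) (gen (relabel C \<tau> ws)))"
      by (rule odot_rel_perm[OF relabel_words[OF X t ws]]) (unfold relabel_map, rule iperm_map[OF p])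
  qed
qed

lemma join_rl:
  assumes f: "finite (fst x)" "finite (fst y)" and xy: "fst x \<inter> fst y = {}" and t: "inj_on \<tau> (fst x \<union> fst y)"
    and u: "u \<in> fst x" and v: "v \<in> fst y"
    and c: "snd x \<in> carrier (Sp C (fst x))" "snd y \<in> carrier (Sp C (fst y))"
  shows "join C (\<tau> u) (\<tau> v) (rl C \<tau> x) (rl C \<tau> y) = rl C \<tau> (join C u v x y)"
proof -
  let ?U = "fst x" and ?V = "fst y"
  have b: "restrict \<tau> ?U \<in> Bij ?U (\<tau> ` ?U)" "restrict \<tau> ?V \<in> Bij ?V (\<tau> ` ?V)"
    using inj_on_subset[OF t, of ?U] inj_on_subset[OF t, of ?V] by (simp_all add: Bij_def inj_on_imp_bij_betw)
  have d: "\<tau> ` ?U \<inter> \<tau> ` ?V = {}" using inj_on_image_Int[OF t, of ?U ?V] xy by simp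
  have i: "\<tau> ` ?U - {\<tau> u} = \<tau> ` (?U - {u})" "\<tau> ` ?V - {\<tau> v} = \<tau> ` (?V - {v})"
    using inj_on_image_set_diff[OF t, of ?U "{u}"] inj_on_image_set_diff[OF t, of ?V "{v}"] u v by auto
  have r: "(\<lambda>z\<in>(?U - {u}) \<union> (?V - {v}). if z \<in> ?U then restrict \<tau> ?U z else restrict \<tau> ?V z) = restrict \<tau> ((?U - {u}) \<union> (?V - {v}))"
    by (rule restrict_ext) auto
  have n: "Circ C (\<tau> ` ?U) (\<tau> ` ?V) (\<tau> u) (\<tau> v) (Tr C ?U (\<tau> ` ?U) (restrict \<tau> ?U) (snd x)) (Tr C ?V (\<tau> ` ?V) (restrict \<tau> ?V) (snd y)) =
    Tr C ((?U - {u}) \<union> (?V - {v})) (\<tau> ` ((?U - {u}) \<union> (?V - {v}))) (restrict \<tau> ((?U - {u}) \<union> (?V - {v})))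
      (Circ C ?U ?V u v (snd x) (snd y))"
    using circ_natural[OF f xy u v b d c] u v unfolding r by (simp add: i image_Un)
  show ?thesis unfolding join_def rl_def fst_conv snd_conv n i image_Un[symmetric] ..
qed

lemma con_relabel_gen:
  assumes X: "finite X" and t: "inj_on \<tau> X" and ws: "ws \<in> words C X" and u: "u \<in> X" and v: "v \<in> X"
  shows "nf (odot_rels e C (\<tau> ` (X - {u, v}))) (con e C (\<tau> u) (\<tau> v) (rel C \<tau> (gen ws))) =
    nf (odot_rels e C (\<tau> ` (X - {u, v}))) (rel C \<tau> (con e C u v (gen ws)))"
proof -
  have i: "\<tau> ` (X - {u, v}) = \<tau> ` X - {\<tau> u, \<tau> v}" using inj_on_image_set_diff[OF t, of X "{u, v}"] u v by auto
  have ws': "relabel C \<tau> ws \<in> words C (\<tau> ` X)" by (rule relabel_words[OF X t ws])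
  have X': "finite (\<tau> ` X)" using X by simp
  show ?thesis
  using ws u v
  proof (cases rule: vertex_cases)
    case (same x)
    have "con e C (\<tau> u) (\<tau> v) (gen (relabel C \<tau> ws)) = 0"
      by (rule con_same[OF ws', of "rl C \<tau> x"]) (use same in \<open>auto simp: relabel_map rl_def\<close>)
    then show ?thesis unfolding con_same[OF ws same] lin_ext_gen[of "\<lambda>ws. gen (relabel C \<tau> ws)"] by simp
  next
    case (two x y)
    obtain c rs where p: "iperm c ws (rs @ [x, y])" using iperm_pull[of "[x, y]" ws] two by auto
    have w2: "rs @ [x, y] \<in> words C X" by (rule words_iperm[OF p ws])
    have p': "iperm c (relabel C \<tau> ws) (relabel C \<tau> rs @ [rl C \<tau> x, rl C \<tau> y])"
      using iperm_map[OF p, of "rl C \<tau>"] by (simp add: relabel_map)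
    have uv: "\<tau> u \<in> fst (rl C \<tau> x)" "\<tau> v \<in> fst (rl C \<tau> y)" using two by (auto simp: rl_def)
    have j: "join C (\<tau> u) (\<tau> v) (rl C \<tau> x) (rl C \<tau> y) = rl C \<tau> (join C u v x y)"
      by (rule join_rl) (use words_finite[OF w2 X] w2 two t in \<open>auto simp: words_iff wf_append wf_Cons intro: inj_on_subset\<close>)
    have f: "finite (X - {u, v})" "inj_on \<tau> (X - {u, v})" using X t by (auto intro: inj_on_subset)
    have "nf (odot_rels e C (\<tau> ` (X - {u, v}))) (rel C \<tau> (con e C u v (gen ws))) =
      nf (odot_rels e C (\<tau> ` (X - {u, v}))) (rel C \<tau> (fscale (sg e c) (gen (rs @ [join C u v x y]))))"
      by (rule odot_hom_nf[OF odot_hom_relabel[OF f] con_char[OF X ws p two(4,5)]])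
    moreover have "nf (odot_rels e C (\<tau> ` (X - {u, v}))) (con e C (\<tau> u) (\<tau> v) (gen (relabel C \<tau> ws))) =
      nf (odot_rels e C (\<tau> ` (X - {u, v}))) (fscale (sg e c) (gen (relabel C \<tau> rs @ [rl C \<tau> (join C u v x y)])))"
      using con_char[OF X' ws' p' uv, of e] unfolding j i .
    ultimately show ?thesis
      by (simp only: lin_ext_scale lin_ext_gen[of "\<lambda>ws. gen (relabel C \<tau> ws)"]) (simp add: relabel_map)
  qed
qed

lemma con_relabel:
  assumes X: "finite X" and t: "inj_on \<tau> X" and u: "u \<in> X" and v: "v \<in> X" and k: "Poly_Mapping.keys x \<subseteq> words C X"
  shows "nf (odot_rels e C (\<tau> ` (X - {u, v}))) (con e C (\<tau> u) (\<tau> v) (rel C \<tau> x)) =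
    nf (odot_rels e C (\<tau> ` (X - {u, v}))) (rel C \<tau> (con e C u v x))"
  by (rule flin_agree[where S="words C X" and L="\<lambda>x. nf (odot_rels e C (\<tau> ` (X - {u, v}))) (con e C (\<tau> u) (\<tau> v) (rel C \<tau> x))"
        and L'="\<lambda>x. nf (odot_rels e C (\<tau> ` (X - {u, v}))) (rel C \<tau> (con e C u v x))"])
    (intro flin_intros k con_relabel_gen[OF X t _ u v])+

text \<open>\<rho> is only compared with the composite on X, because the maps
  \<open>inv_into\<close> to which this is applied have no meaningful values elsewhere.\<close>

lemma relabel_comp:
  assumes X: "finite X" and t: "inj_on \<tau> X" and s: "inj_on \<sigma> (\<tau> ` X)" and ws: "ws \<in> words C X"
    and r: "\<And>x. x \<in> X \<Longrightarrow> \<rho> x = \<sigma> (\<tau> x)"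
  shows "relabel C \<sigma> (relabel C \<tau> ws) = relabel C \<rho> ws"
  unfolding relabel_map map_map
proof (rule map_cong[OF refl])
  fix w assume w: "w \<in> set ws"
  have c: "snd w \<in> carrier (Sp C (fst w))" and sub: "fst w \<subseteq> X" using ws w by (auto simp: words_iff wf_word_def supp_def)
  have f: "finite (fst w)" using sub X by (rule finite_subset)
  have b: "restrict \<tau> (fst w) \<in> Bij (fst w) (\<tau> ` fst w)"
    using inj_on_subset[OF t sub] by (simp add: Bij_def inj_on_imp_bij_betw)
  have b': "restrict \<sigma> (\<tau> ` fst w) \<in> Bij (\<tau> ` fst w) (\<sigma> ` \<tau> ` fst w)"
    using inj_on_subset[OF s, of "\<tau> ` fst w"] sub by (simp add: Bij_def inj_on_imp_bij_betw image_mono)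
  have e1: "\<rho> ` fst w = \<sigma> ` \<tau> ` fst w" using sub r by (auto simp: image_image intro!: image_cong)
  have e2: "restrict \<rho> (fst w) = compose (fst w) (restrict \<sigma> (\<tau> ` fst w)) (restrict \<tau> (fst w))"
    using sub r by (auto simp: compose_def fun_eq_iff restrict_def)
  show "(rl C \<sigma> \<circ> rl C \<tau>) w = rl C \<rho> w"
    unfolding comp_apply rl_def fst_conv snd_conv e1 e2 tr_comp[OF f b b' c] ..
qed

lemma relabel_id:
  assumes X: "finite X" and ws: "ws \<in> words C X" and r: "\<And>x. x \<in> X \<Longrightarrow> \<rho> x = x"
  shows "relabel C \<rho> ws = ws"
  unfolding relabel_map
proof (rule map_idI)
  fix w assume w: "w \<in> set ws"
  have c: "snd w \<in> carrier (Sp C (fst w))" and sub: "fst w \<subseteq> X" using ws w by (auto simp: words_iff wf_word_def supp_def)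
  have f: "finite (fst w)" using sub X by (rule finite_subset)
  have "\<rho> ` fst w = (\<lambda>x. x) ` fst w" by (rule image_cong) (use sub r in auto)
  then have e1: "\<rho> ` fst w = fst w" by simp
  have e2: "restrict \<rho> (fst w) = restrict id (fst w)" by (rule restrict_ext) (use sub r in auto)
  show "rl C \<rho> w = w" unfolding rl_def e1 e2 tr_id[OF f c] by simp
qed

end

subsection \<open>The action of diagrams on words\<close>

abbreviation "cp \<equiv> contract_pairs"

definition pairset :: "(nat + nat \<Rightarrow> nat) \<Rightarrow> nat \<Rightarrow> nat set" where
  "pairset f t = (\<lambda>i. f (Inr i)) ` {1..2 * t}"

text \<open>An induction over the contracted pairs leaves the set \<open>D Y X\<close> after one
  step. This condition on the first \<open>t\<close> pairs survives it, with X losing two points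
  each time.\<close>

definition okp :: "nat set \<Rightarrow> (nat + nat \<Rightarrow> nat) \<Rightarrow> nat \<Rightarrow> bool" where
  "okp X f t \<longleftrightarrow> inj_on (\<lambda>i. f (Inr i)) {1..2 * t} \<and> pairset f t \<subseteq> X"

lemma atLeastAtMost_double_Suc: "{1..2 * Suc t} = insert (2 * t + 1) (insert (2 * t + 2) {1..2 * t})"
  by auto

lemma pairset_0 [simp]: "pairset f 0 = {}"
  by (simp add: pairset_def)

lemma pairset_Suc: "pairset f (Suc t) = {f (Inr (2 * t + 1)), f (Inr (2 * t + 2))} \<union> pairset f t"
  unfolding pairset_def atLeastAtMost_double_Suc by auto

lemma Diff_pairset_Suc: "X - {f (Inr (2 * t + 1)), f (Inr (2 * t + 2))} - pairset f t = X - pairset f (Suc t)"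
  unfolding pairset_Suc by auto

lemma okp_Suc:
  assumes "okp X f (Suc t)"
  shows "f (Inr (2 * t + 1)) \<in> X" "f (Inr (2 * t + 2)) \<in> X" "f (Inr (2 * t + 1)) \<noteq> f (Inr (2 * t + 2))"
    "okp (X - {f (Inr (2 * t + 1)), f (Inr (2 * t + 2))}) f t"
proof -
  have i: "inj_on (\<lambda>i. f (Inr i)) (insert (2 * t + 1) (insert (2 * t + 2) {1..2 * t}))" and s: "pairset f (Suc t) \<subseteq> X"
    using assms unfolding okp_def atLeastAtMost_double_Suc by auto
  show "f (Inr (2 * t + 1)) \<in> X" "f (Inr (2 * t + 2)) \<in> X" using s unfolding pairset_Suc by auto
  have "inj_on (\<lambda>i. f (Inr i)) {1..2 * t}" by (rule inj_on_subset[OF i]) auto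
  moreover have "f (Inr (2 * t + 1)) \<notin> pairset f t" "f (Inr (2 * t + 2)) \<notin> pairset f t"
    "f (Inr (2 * t + 1)) \<noteq> f (Inr (2 * t + 2))"
    using i unfolding pairset_def inj_on_insert by (auto split: if_splits)
  ultimately show "f (Inr (2 * t + 1)) \<noteq> f (Inr (2 * t + 2))"
    "okp (X - {f (Inr (2 * t + 1)), f (Inr (2 * t + 2))}) f t"
    using s unfolding okp_def pairset_Suc by auto
qed

lemma cp_cong: "(\<And>i. 1 \<le> i \<Longrightarrow> i \<le> 2 * t \<Longrightarrow> f (Inr i) = g (Inr i)) \<Longrightarrow> cp e C f t x = cp e C g t x"
  by (induction t arbitrary: x) simp_all

lemma flin_cp: "flin (cp e C f t)"
proof (induction t)
  case 0
  show ?case using flin_ident by simp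
next
  case (Suc t)
  show ?case using flin_compose[OF Suc flin_lin_ext] by simp
qed

context cyclic_operad
begin

lemma odot_hom_cp: "finite X \<Longrightarrow> okp X f t \<Longrightarrow> odot_hom e C X (X - pairset f t) (cp e C f t)"
proof (induction t arbitrary: X)
  case 0
  then show ?case using odot_hom_id by simp
next
  case (Suc t)
  let ?u = "f (Inr (2 * t + 1))" and ?v = "f (Inr (2 * t + 2))"
  have "odot_hom e C X (X - {?u, ?v}) (con e C ?u ?v)"
    by (rule odot_hom_con[OF Suc.prems(1) okp_Suc(1,2)[OF Suc.prems(2)]])
  moreover have "odot_hom e C (X - {?u, ?v}) (X - {?u, ?v} - pairset f t) (cp e C f t)"
    by (rule Suc.IH) (use Suc.prems okp_Suc(4)[OF Suc.prems(2)] in simp_all)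
  ultimately show ?case using odot_hom_comp unfolding Diff_pairset_Suc by fastforce
qed

text \<open>Contraction begins with the last pair. If that is the flipped one,
  \<open>con_flip\<close> gives the sign at once and the remaining pairs carry it along; if not, the
  same first contraction is split off and the induction goes on.\<close>

lemma cp_flip:
  assumes "finite X" "okp X f t" "1 \<le> k" "k \<le> t" "Poly_Mapping.keys x \<subseteq> words C X"
  shows "nf (odot_rels e C (X - pairset f t)) (cp e C (f \<circ> map_sum id (flip k)) t x) =
    fscale (sg e (-1)) (nf (odot_rels e C (X - pairset f t)) (cp e C f t x))"
  using assms
proof (induction t arbitrary: X x)
  case (Suc t)
  let ?u = "f (Inr (2 * t + 1))" and ?v = "f (Inr (2 * t + 2))" and ?f = "f \<circ> map_sum id (flip k)"
  note ok = okp_Suc[OF Suc.prems(2)]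
  have X': "finite (X - {?u, ?v})" using Suc.prems by simp
  note h = odot_hom_cp[OF X' ok(4), of e, unfolded Diff_pairset_Suc]
  show ?case
  proof (cases "k = Suc t")
    case True
    have a: "flip k (2 * t + 1) = 2 * t + 2" "flip k (2 * t + 2) = 2 * t + 1"
      using Suc.prems(3) True by (simp_all add: flip_apply)
    have b: "cp e C ?f t y = cp e C f t y" for y
      by (rule cp_cong) (use Suc.prems(3) True in \<open>simp add: flip_apply\<close>)
    have 1: "cp e C ?f (Suc t) x = cp e C f t (con e C ?v ?u x)"
      unfolding contract_pairs.simps b comp_apply map_sum.simps a ..
    have "nf (odot_rels e C (X - {?u, ?v})) (con e C ?v ?u x) = nf (odot_rels e C (X - {?u, ?v})) (fscale (sg e (-1)) (con e C ?u ?v x))"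
      unfolding nf_scale by (rule con_flip[OF Suc.prems(1) ok(1,2) Suc.prems(5)])
    from odot_hom_nf[OF h this] show ?thesis
      unfolding 1 contract_pairs.simps(2)[of e C f] flin_scale[OF flin_cp] nf_scale .
  next
    case False
    then have k: "k \<le> t" using Suc.prems by simp
    have a: "flip k (2 * t + 1) = 2 * t + 1" "flip k (2 * t + 2) = 2 * t + 2"
      using Suc.prems(3) k by (simp_all add: flip_apply)
    have 1: "cp e C ?f (Suc t) x = cp e C ?f t (con e C ?u ?v x)"
      unfolding contract_pairs.simps comp_apply map_sum.simps a ..
    show ?thesis
      unfolding 1 contract_pairs.simps(2)[of e C f] Diff_pairset_Suc[symmetric]
      by (rule Suc.IH[OF X' ok(4) Suc.prems(3) k odot_hom_keys[OF odot_hom_con[OF Suc.prems(1) ok(1,2)] Suc.prems(5)]])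
  qed
qed simp

text \<open>As for flips, but the exchange becomes visible when it concerns the last two pairs:
  their contractions then happen in the opposite order, and \<open>con_commutes\<close> supplies the
  sign.\<close>

lemma cp_pswap:
  assumes "finite X" "okp X f t" "1 \<le> k" "k < t" "Poly_Mapping.keys x \<subseteq> words C X"
  shows "nf (odot_rels e C (X - pairset f t)) (cp e C (f \<circ> map_sum id (pswap k)) t x) =
    fscale (sg e (-1)) (nf (odot_rels e C (X - pairset f t)) (cp e C f t x))"
  using assms
proof (induction t arbitrary: X x)
  case (Suc t)
  let ?u = "f (Inr (2 * t + 1))" and ?v = "f (Inr (2 * t + 2))" and ?f = "f \<circ> map_sum id (pswap k)"
  note ok = okp_Suc[OF Suc.prems(2)]
  have X': "finite (X - {?u, ?v})" using Suc.prems by simp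
  show ?case
  proof (cases "k = t")
    case True
    then obtain r where t: "t = Suc r" using Suc.prems(3) by (cases t) auto
    let ?w = "f (Inr (2 * r + 1))" and ?z = "f (Inr (2 * r + 2))"
    have "okp (X - {?u, ?v}) f (Suc r)" using ok(4) unfolding t .
    note ok2 = okp_Suc[OF this]
    have u: "?u = f (Inr (2 * r + 3))" "?v = f (Inr (2 * r + 4))" by (simp_all add: t numeral_eq_Suc)
    have a: "pswap k (2 * r + 1) = 2 * r + 3" "pswap k (2 * r + 2) = 2 * r + 4" "pswap k (2 * t + 1) = 2 * r + 1" "pswap k (2 * t + 2) = 2 * r + 2"
      using True t by (simp_all add: pswap_apply pr_def)
    have b: "cp e C ?f r y = cp e C f r y" for y
      by (rule cp_cong) (use True t in \<open>auto simp: pswap_apply pr_def\<close>)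
    have 1: "cp e C ?f (Suc t) x = cp e C f r (con e C ?u ?v (con e C ?w ?z x))"
      unfolding t contract_pairs.simps b comp_apply map_sum.simps a[unfolded t] u[unfolded t] ..
    have 2: "cp e C f (Suc t) x = cp e C f r (con e C ?w ?z (con e C ?u ?v x))"
      unfolding t contract_pairs.simps ..
    have wz: "?w \<in> X" "?z \<in> X" "distinct [?w, ?z, ?u, ?v]" using ok ok2 by (auto simp: t)
    have Z: "X - {?u, ?v} - {?w, ?z} = X - {?w, ?z, ?u, ?v}" by auto
    have "X - {?u, ?v} - {?w, ?z} - pairset f r = X - {?u, ?v} - pairset f t"
      using Diff_pairset_Suc[of "X - {?u, ?v}" f r] unfolding t .
    then have P: "X - {?u, ?v} - {?w, ?z} - pairset f r = X - pairset f (Suc t)"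
      unfolding Diff_pairset_Suc[of X f t] .
    have "finite (X - {?u, ?v} - {?w, ?z})" using Suc.prems(1) by simp
    note h = odot_hom_cp[OF this ok2(4), unfolded P, unfolded Z]
    have "nf (odot_rels e C (X - {?w, ?z, ?u, ?v})) (con e C ?u ?v (con e C ?w ?z x)) =
      nf (odot_rels e C (X - {?w, ?z, ?u, ?v})) (fscale (sg e (-1)) (con e C ?w ?z (con e C ?u ?v x)))"
      unfolding nf_scale by (rule con_commutes[OF Suc.prems(1) wz(1,2) ok(1,2) wz(3) Suc.prems(5)])
    from odot_hom_nf[OF h this] show ?thesis unfolding 1 2 flin_scale[OF flin_cp] nf_scale .
  next
    case False
    then have k: "k < t" using Suc.prems by simp
    have a: "pswap k (2 * t + 1) = 2 * t + 1" "pswap k (2 * t + 2) = 2 * t + 2"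
      using Suc.prems(3) k by (simp_all add: pswap_apply pr_def)
    have 1: "cp e C ?f (Suc t) x = cp e C ?f t (con e C ?u ?v x)"
      unfolding contract_pairs.simps comp_apply map_sum.simps a ..
    show ?thesis
      unfolding 1 contract_pairs.simps(2)[of e C f] Diff_pairset_Suc[symmetric]
      by (rule Suc.IH[OF X' ok(4) Suc.prems(3) k odot_hom_keys[OF odot_hom_con[OF Suc.prems(1) ok(1,2)] Suc.prems(5)]])
  qed
qed simp

text \<open>Contraction commutes with relabelling if the pairs are relabelled too. Two diagrams
  occur because those of \<open>g\<close> live in the target of \<tau> and those of \<open>h\<close>
  in its source.\<close>

lemma cp_relabel:
  assumes "finite X" "inj_on \<tau> X" "okp X h s" "\<And>i. 1 \<le> i \<Longrightarrow> i \<le> 2 * s \<Longrightarrow> g (Inr i) = \<tau> (h (Inr i))"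
    "Poly_Mapping.keys x \<subseteq> words C X"
  shows "nf (odot_rels e C (\<tau> ` (X - pairset h s))) (cp e C g s (rel C \<tau> x)) =
    nf (odot_rels e C (\<tau> ` (X - pairset h s))) (rel C \<tau> (cp e C h s x))"
  using assms
proof (induction s arbitrary: X x)
  case (Suc s)
  let ?u = "h (Inr (2 * s + 1))" and ?v = "h (Inr (2 * s + 2))"
  let ?X = "X - {?u, ?v}"
  note ok = okp_Suc[OF Suc.prems(3)]
  have X': "finite ?X" "inj_on \<tau> ?X" using Suc.prems by (auto intro: inj_on_subset)
  have g: "g (Inr (2 * s + 1)) = \<tau> ?u" "g (Inr (2 * s + 2)) = \<tau> ?v" using Suc.prems(4) by simp_all
  have gs: "g (Inr i) = \<tau> (h (Inr i))" if "1 \<le> i" "i \<le> 2 * s" for i using Suc.prems(4) that by simp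
  have pg: "pairset g s = \<tau> ` pairset h s"
    unfolding pairset_def image_image by (rule image_cong) (use gs in auto)
  have sub: "pairset h s \<subseteq> ?X" using ok(4) unfolding okp_def by blast
  have okg: "okp (\<tau> ` ?X) g s"
    unfolding okp_def
  proof
    have i1: "inj_on (\<lambda>i. h (Inr i)) {1..2 * s}" using ok(4) unfolding okp_def by blast
    have "inj_on (\<tau> \<circ> (\<lambda>i. h (Inr i))) {1..2 * s}"
      by (rule comp_inj_on[OF i1]) (use inj_on_subset[OF X'(2) sub] in \<open>simp add: pairset_def\<close>)
    then show "inj_on (\<lambda>i. g (Inr i)) {1..2 * s}"
      using inj_on_cong[of "{1..2 * s}" "\<lambda>i. g (Inr i)" "\<tau> \<circ> (\<lambda>i. h (Inr i))"] gs by simp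
    show "pairset g s \<subseteq> \<tau> ` ?X" unfolding pg using sub by (rule image_mono)
  qed
  have im: "\<tau> ` ?X - pairset g s = \<tau> ` (?X - pairset h s)"
    unfolding pg by (rule inj_on_image_set_diff[OF X'(2) _ sub, symmetric]) simp
  have h: "odot_hom e C (\<tau> ` ?X) (\<tau> ` (?X - pairset h s)) (cp e C g s)"
    using odot_hom_cp[OF _ okg, of e] X' unfolding im by simp
  have "nf (odot_rels e C (\<tau> ` ?X)) (con e C (\<tau> ?u) (\<tau> ?v) (rel C \<tau> x)) = nf (odot_rels e C (\<tau> ` ?X)) (rel C \<tau> (con e C ?u ?v x))"
    by (rule con_relabel[OF Suc.prems(1,2) ok(1,2) Suc.prems(5)])
  note 1 = odot_hom_nf[OF h this]
  show ?case
    unfolding Diff_pairset_Suc[symmetric] contract_pairs.simps g 1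
    by (rule Suc.IH[OF X' ok(4) _ odot_hom_keys[OF odot_hom_con[OF Suc.prems(1) ok(1,2)] Suc.prems(5)]]) (rule gs)
qed simp

lemma D_okp: "f \<in> D Y X \<Longrightarrow> okp X f (pairs_of Y X)"
  unfolding okp_def pairset_def
proof
  assume f: "f \<in> D Y X"
  show "inj_on (\<lambda>i. f (Inr i)) {1..2 * pairs_of Y X}" by (rule inj_onI) (simp add: D_Inr_inj[OF f])
  show "(\<lambda>i. f (Inr i)) ` {1..2 * pairs_of Y X} \<subseteq> X" using D_Inr[OF f] by auto
qed

lemma D_Diff_pairset: "f \<in> D Y X \<Longrightarrow> X - pairset f (pairs_of Y X) = (\<lambda>y. f (Inl y)) ` Y"
proof -
  assume f: "f \<in> D Y X"
  show ?thesis
  proof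
    show "X - pairset f (pairs_of Y X) \<subseteq> (\<lambda>y. f (Inl y)) ` Y"
    proof
      fix x assume x: "x \<in> X - pairset f (pairs_of Y X)"
      then have "x \<in> X" by blast
      with f show "x \<in> (\<lambda>y. f (Inl y)) ` Y"
        by (rule D_surjE) (use x in \<open>auto simp: pairset_def\<close>)
    qed
    show "(\<lambda>y. f (Inl y)) ` Y \<subseteq> X - pairset f (pairs_of Y X)"
      using D_Inl[OF f] D_Inl_Inr[OF f] by (auto simp: pairset_def)
  qed
qed

definition dact :: "polarity \<Rightarrow> nat set \<Rightarrow> nat set \<Rightarrow> (nat + nat \<Rightarrow> nat) \<Rightarrow> ((nat set \<times> 'v) list \<Rightarrow>\<^sub>0 'k) \<Rightarrow> ((nat set \<times> 'v) list \<Rightarrow>\<^sub>0 'k)" where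
  "dact e X Y f x = rel C (inv_into Y (\<lambda>y. f (Inl y))) (cp e C f (pairs_of Y X) x)"

lemma flin_dact: "flin (dact e X Y f)"
  unfolding dact_def[abs_def] by (rule flin_compose[OF flin_lin_ext flin_cp])

lemma lin_ext_D_action: "lin_ext (D_action e C X Y f) = dact e X Y f"
proof
  fix x
  show "lin_ext (D_action e C X Y f) x = dact e X Y f x"
    unfolding flin_eq_lin_ext[OF flin_dact, of e X Y f x] by (rule lin_ext_cong) (simp add: D_action_def dact_def)
qed

lemma D_action_eq: "D_action e C X Y f ws = dact e X Y f (gen ws)"
  by (simp add: D_action_def dact_def)

lemma D_inj_Inl: "f \<in> D Y X \<Longrightarrow> inj_on (\<lambda>y. f (Inl y)) Y"
  by (rule inj_onI) (simp add: D_Inl_inj)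

lemma odot_hom_relabel_inv:
  assumes f: "f \<in> D Y X" and Y: "finite Y"
  shows "odot_hom e C (X - pairset f (pairs_of Y X)) Y (rel C (inv_into Y (\<lambda>y. f (Inl y))))"
proof -
  have i: "inj_on (\<lambda>y. f (Inl y)) Y" by (rule D_inj_Inl[OF f])
  have "odot_hom e C ((\<lambda>y. f (Inl y)) ` Y) (inv_into Y (\<lambda>y. f (Inl y)) ` (\<lambda>y. f (Inl y)) ` Y) (rel C (inv_into Y (\<lambda>y. f (Inl y))))"
    by (rule odot_hom_relabel) (use Y in \<open>auto intro: inj_on_inv_into\<close>)
  moreover have "inv_into Y (\<lambda>y. f (Inl y)) ` (\<lambda>y. f (Inl y)) ` Y = Y" using i by (rule inv_into_image_cancel) simp
  ultimately show ?thesis unfolding D_Diff_pairset[OF f] by simp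
qed

lemma odot_hom_dact:
  assumes f: "f \<in> D Y X" and Y: "finite Y"
  shows "odot_hom e C X Y (dact e X Y f)"
  unfolding dact_def[abs_def]
  by (rule odot_hom_comp[OF odot_hom_cp[OF D_finite[OF f Y] D_okp[OF f]] odot_hom_relabel_inv[OF f Y]])

lemma dact_act:
  assumes f: "f \<in> D Y X" and Y: "finite Y"
    and c: "nf (odot_rels e C (X - pairset f (pairs_of Y X))) (cp e C (f \<circ> map_sum id \<sigma>) (pairs_of Y X) x) =
      fscale c (nf (odot_rels e C (X - pairset f (pairs_of Y X))) (cp e C f (pairs_of Y X) x))"
  shows "nf (odot_rels e C Y) (dact e X Y (f \<circ> map_sum id \<sigma>) x) = fscale c (nf (odot_rels e C Y) (dact e X Y f x))"
proof -
  note h = odot_hom_relabel_inv[OF f Y, of e]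
  have i: "(\<lambda>y. (f \<circ> map_sum id \<sigma>) (Inl y)) = (\<lambda>y. f (Inl y))" by (simp add: fun_eq_iff)
  show ?thesis unfolding dact_def i
    using odot_hom_nf[OF h c[folded nf_scale]] unfolding lin_ext_scale nf_scale .
qed

text \<open>The relabelling belonging to \<open>f\<close> stands between the two contractions. It is
  moved outwards by \<open>cp_relabel\<close>, at the cost of transporting the pairs of
  \<open>g\<close> into X; the contractions then merge into those of the composite, and so do the
  relabellings.\<close>

lemma dact_comp:
  assumes g: "g \<in> D Z Y" and f: "f \<in> D Y X" and Z: "finite Z" and k: "Poly_Mapping.keys x \<subseteq> words C X"
  shows "nf (odot_rels e C Z) (dact e Y Z g (dact e X Y f x)) = nf (odot_rels e C Z) (dact e X Z (D_comp Z Y X f g) x)"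
proof -
  have Y: "finite Y" by (rule D_finite[OF g Z])
  have X: "finite X" by (rule D_finite[OF f Y])
  let ?s = "pairs_of Z Y" and ?t = "pairs_of Y X" and ?c = "D_comp Z Y X f g"
  let ?F = "\<lambda>y. f (Inl y)" and ?G = "\<lambda>z. g (Inl z)"
  \<comment> \<open>The diagram \<open>g\<close> with its values transported along \<open>f\<close>,
    so that its pairs are points of X.\<close>
  let ?h = "\<lambda>z. f (Inl (g z))"
  let ?X1 = "?F ` Y"
  have c: "?c \<in> D Z X" by (rule D_comp_in_D[OF g f Z])
  note p = pairs_of_add[OF g f Z]
  have iF: "inj_on ?F Y" and iG: "inj_on ?G Z" by (rule D_inj_Inl[OF f], rule D_inj_Inl[OF g])
  have X1: "finite ?X1" using Y by simp
  have y: "Poly_Mapping.keys (cp e C f ?t x) \<subseteq> words C ?X1"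
    using odot_hom_keys[OF odot_hom_cp[OF X D_okp[OF f]] k] unfolding D_Diff_pairset[OF f] .
  have ph: "pairset ?h ?s = ?F ` pairset g ?s" by (auto simp: pairset_def image_image)
  have subg: "pairset g ?s \<subseteq> Y" using D_okp[OF g] unfolding okp_def by blast
  have okh: "okp ?X1 ?h ?s"
    unfolding okp_def
  proof
    have i1: "inj_on (\<lambda>i. g (Inr i)) {1..2 * ?s}" using D_okp[OF g] unfolding okp_def by blast
    have "inj_on (?F \<circ> (\<lambda>i. g (Inr i))) {1..2 * ?s}"
      by (rule comp_inj_on[OF i1]) (use inj_on_subset[OF iF subg] in \<open>simp add: pairset_def\<close>)
    then show "inj_on (\<lambda>i. ?h (Inr i)) {1..2 * ?s}" by (simp add: o_def)
    show "pairset ?h ?s \<subseteq> ?X1" unfolding ph using subg by (rule image_mono)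
  qed
  have X2: "?X1 - pairset ?h ?s = ?F ` ?G ` Z"
    unfolding ph D_Diff_pairset[OF g, symmetric] by (rule inj_on_image_set_diff[OF iF _ subg, symmetric]) simp
  let ?if = "inv_into Y ?F" and ?ig = "inv_into Z ?G" and ?ic = "inv_into Z (\<lambda>z. ?c (Inl z))"
  have invF: "?if (?F y) = y" if "y \<in> Y" for y using iF that by (rule inv_into_f_f)
  have invG: "?ig (?G z) = z" if "z \<in> Z" for z using iG that by (rule inv_into_f_f)
  have Yim: "?if ` ?F ` A = A" if "A \<subseteq> Y" for A using iF that by (rule inv_into_image_cancel)
  have GY: "?G ` Z \<subseteq> Y" using D_Inl[OF g] by auto
  have gi: "g (Inr i) = ?if (?h (Inr i))" if "1 \<le> i" "i \<le> 2 * ?s" for i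
    using invF[OF D_Inr[OF g that]] by simp
  have injif: "inj_on ?if ?X1" by (rule inj_on_inv_into) simp
  have 1: "nf (odot_rels e C (?G ` Z)) (cp e C g ?s (rel C ?if (cp e C f ?t x))) =
    nf (odot_rels e C (?G ` Z)) (rel C ?if (cp e C ?h ?s (cp e C f ?t x)))"
    using cp_relabel[OF X1 injif okh gi y, of e] unfolding X2 Yim[OF GY] by simp
  have h: "odot_hom e C (?G ` Z) Z (rel C ?ig)" using odot_hom_relabel_inv[OF g Z] unfolding D_Diff_pairset[OF g] .
  have y2: "Poly_Mapping.keys (cp e C ?h ?s (cp e C f ?t x)) \<subseteq> words C (?F ` ?G ` Z)"
    using odot_hom_keys[OF odot_hom_cp[OF X1 okh] y] unfolding X2 .
  have 2: "rel C ?ig (rel C ?if w) = rel C ?ic w" if "Poly_Mapping.keys w \<subseteq> words C (?F ` ?G ` Z)" for w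
  proof (rule flin_agree[where S="words C (?F ` ?G ` Z)" and L="\<lambda>w. rel C ?ig (rel C ?if w)" and L'="rel C ?ic"])
    fix ws assume ws: "ws \<in> words C (?F ` ?G ` Z)"
    have ic: "?ic (?F (?G z)) = z" if "z \<in> Z" for z
      using inv_into_f_f[OF D_inj_Inl[OF c] that] D_comp_Inl[OF that, of Y X f g] by simp
    have "relabel C ?ig (relabel C ?if ws) = relabel C ?ic ws"
    proof (rule relabel_comp[OF _ _ _ ws])
      show "finite (?F ` ?G ` Z)" using Z by simp
      show "inj_on ?if (?F ` ?G ` Z)" by (rule inj_on_subset[OF injif]) (use GY in auto)
      show "inj_on ?ig (?if ` ?F ` ?G ` Z)" unfolding Yim[OF GY] by (rule inj_on_inv_into) simp
      fix w assume "w \<in> ?F ` ?G ` Z"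
      then obtain z where z: "z \<in> Z" "w = ?F (?G z)" by blast
      have "?G z \<in> Y" using GY z by blast
      show "?ic w = ?ig (?if w)" unfolding z(2) ic[OF z(1)] invF[OF \<open>?G z \<in> Y\<close>] invG[OF z(1)] ..
    qed
    then show "rel C ?ig (rel C ?if (gen ws)) = rel C ?ic (gen ws)" by simp
  qed (intro flin_intros flin_lin_ext that)+
  \<comment> \<open>A composite diagram lists the pairs of the inner \<open>g\<close> first and
    those of \<open>f\<close> last, and contraction proceeds from the last pair. So the pairs of
    \<open>f\<close> are contracted before those of \<open>g\<close>.\<close>
  have 3: "cp e C ?c (?s + r) w = cp e C ?h ?s (cp e C f r w)" if "r \<le> ?t" for r w
    using that
  proof (induction r arbitrary: w)
    case 0
    have "cp e C ?c ?s w = cp e C ?h ?s w" by (rule cp_cong) (simp add: D_comp_Inr1)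
    then show ?case by simp
  next
    case (Suc r)
    have "?c (Inr (2 * (?s + r) + 1)) = f (Inr (2 * r + 1))" "?c (Inr (2 * (?s + r) + 2)) = f (Inr (2 * r + 2))"
      using Suc.prems by (simp_all add: D_comp_Inr2)
    then show ?case using Suc by simp
  qed
  have "nf (odot_rels e C Z) (dact e Y Z g (dact e X Y f x)) =
    nf (odot_rels e C Z) (rel C ?ig (rel C ?if (cp e C ?h ?s (cp e C f ?t x))))"
    unfolding dact_def by (rule odot_hom_nf[OF h 1])
  also have "\<dots> = nf (odot_rels e C Z) (dact e X Z ?c x)"
    unfolding dact_def p 3[OF order_refl] 2[OF y2] ..
  finally show ?thesis .
qed

lemma dact_id:
  assumes Y: "finite Y" and ws: "ws \<in> words C Y"
  shows "dact e Y Y (bij_D Y id) (gen ws) = gen ws"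
proof -
  have p: "pairs_of Y Y = 0" by (rule pairs_of_same) simp
  have "inv_into Y (\<lambda>y. bij_D Y id (Inl y)) x = x" if "x \<in> Y" for x
    by (rule inv_into_f_eq) (use that in \<open>auto simp: bij_D_Inl inj_on_def\<close>)
  then have "relabel C (inv_into Y (\<lambda>y. bij_D Y id (Inl y))) ws = ws" by (rule relabel_id[OF Y ws])
  then show ?thesis unfolding dact_def p by simp
qed

text \<open>Both polarities are \<open>e\<close>: reversing a chord exchanges the two vertices to be
  joined, and reordering two chords also costs one exchange of vertices.\<close>

lemma odot_bilinear:
  assumes Y: "finite Y" and Z: "finite Z"
  shows "bilinear_induced (D Z Y) (ub_rels (e, e) Z Y) (words C Y) (odot_rels e C Y) (words C Z) (odot_rels e C Z) (D_action e C Y Z)"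
proof
  fix r :: "(nat + nat \<Rightarrow> nat) \<Rightarrow>\<^sub>0 'k" and ws assume r: "r \<in> ub_rels (e, e) Z Y" and ws: "ws \<in> words C Y"
  have k: "Poly_Mapping.keys (gen ws) \<subseteq> words C Y" using ws by simp
  show "nf (odot_rels e C Z) (lin_ext (\<lambda>f. D_action e C Y Z f ws) r) = 0"
    unfolding nf_lin_ext
  proof (rule ub_lift[OF _ _ r])
    fix f i assume f: "f \<in> D Z Y" and i: "1 \<le> i" "i \<le> pairs_of Z Y"
    show "nf (odot_rels e C Z) (D_action e C Y Z (f \<circ> map_sum id (flip i)) ws) =
      fscale (of_int (twist (fst (e, e)) (-1))) (nf (odot_rels e C Z) (D_action e C Y Z f ws))"
      unfolding D_action_eq fst_conv sg_def[symmetric]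
      by (rule dact_act[OF f Z cp_flip[OF Y D_okp[OF f] i k]])
  next
    fix f i assume f: "f \<in> D Z Y" and i: "1 \<le> i" "i < pairs_of Z Y"
    show "nf (odot_rels e C Z) (D_action e C Y Z (f \<circ> map_sum id (pswap i)) ws) =
      fscale (of_int (twist (snd (e, e)) (-1))) (nf (odot_rels e C Z) (D_action e C Y Z f ws))"
      unfolding D_action_eq snd_conv sg_def[symmetric]
      by (rule dact_act[OF f Z cp_pswap[OF Y D_okp[OF f] i k]])
  qed
next
  fix r a assume r: "r \<in> odot_rels e C Y" and a: "a \<in> D Z Y"
  show "nf (odot_rels e C Z) (lin_ext (D_action e C Y Z a) r) = 0"
    unfolding lin_ext_D_action by (rule odot_hom_rel[OF odot_hom_dact[OF a Z] r])
next
  fix a ws assume a: "a \<in> D Z Y" and ws: "ws \<in> words C Y"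
  show "Poly_Mapping.keys (D_action e C Y Z a ws) \<subseteq> words C Z"
    unfolding D_action_eq by (rule odot_hom_keys[OF odot_hom_dact[OF a Z]]) (simp add: ws)
qed (rule keys_ub_rels, assumption, rule keys_odot_rels[OF Y])

lemma odot_Act: "Act (odot_module e C) Y Z = induced2 (odot_rels e C Z) (D_action e C Y Z)"
  by (simp add: odot_module_def)

lemma odot_At: "At (odot_module e C) Y = presented (words C Y) (odot_rels e C Y)"
  by (simp add: odot_module_def odot_def)

lemma odot_Act_cls:
  assumes Y: "finite Y" and Z: "finite Z" and f: "f \<in> D Z Y" and k: "Poly_Mapping.keys x \<subseteq> words C Y"
  shows "Act (odot_module e C) Y Z (ub_cls (e, e) Z Y f) (cls (odot_rels e C Y) x) = cls (odot_rels e C Z) (dact e Y Z f x)"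
proof -
  have "Poly_Mapping.keys (gen f) \<subseteq> D Z Y" using f by simp
  from bilinear_induced.induced2_cls[OF odot_bilinear[OF Y Z] this k, of e] show ?thesis
    unfolding odot_Act ub_cls_def by (simp add: bilin_ext_def lin_ext_D_action)
qed

lemma odot_db_module: "db_module (e, e) (odot_module e C)"
proof
  fix Y :: "nat set" assume Y: "finite Y"
  show "closed_space (At (odot_module e C) Y)" unfolding odot_At by (rule closed_presented)
next
  fix Y Z :: "nat set" and a :: "'k ubmor" assume Y: "finite Y" and Z: "finite Z" and a: "a \<in> carrier (Hom (ub (e, e)) Z Y)"
  show "Act (odot_module e C) Y Z a \<in> linear_maps (At (odot_module e C) Y) (At (odot_module e C) Z)"
    unfolding odot_At odot_Act by (rule bilinear_induced.induced2_linear2[OF odot_bilinear[OF Y Z] a[unfolded ub_Hom]])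
next
  fix Y Z :: "nat set" and m assume Y: "finite Y" and Z: "finite Z" and m: "m \<in> carrier (At (odot_module e C) Y)"
  show "(\<lambda>a. Act (odot_module e C) Y Z a m) \<in> linear_maps (Hom (ub (e, e)) Z Y) (At (odot_module e C) Z)"
    unfolding odot_At odot_Act ub_Hom by (rule bilinear_induced.induced2_linear1[OF odot_bilinear[OF Y Z] m[unfolded odot_At]])
next
  fix Y :: "nat set" and m assume Y: "finite Y" and m: "m \<in> carrier (At (odot_module e C) Y)"
  show "Act (odot_module e C) Y Y (idm (e, e) Y) m = m"
  proof (rule linear_maps_eq[where f="Act (odot_module e C) Y Y (idm (e, e) Y)" and g="\<lambda>m. m", OF _ linear_maps_ident[OF closed_presented] _ m[unfolded odot_At]])
    show "Act (odot_module e C) Y Y (idm (e, e) Y) \<in> linear_maps (presented (words C Y) (odot_rels e C Y)) (presented (words C Y) (odot_rels e C Y))"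
      unfolding odot_Act by (rule bilinear_induced.induced2_linear2[OF odot_bilinear[OF Y Y] idm_in[OF Y, unfolded ub_Hom]])
    fix ws assume ws: "ws \<in> words C Y"
    have k: "Poly_Mapping.keys (gen ws) \<subseteq> words C Y" using ws by simp
    show "Act (odot_module e C) Y Y (idm (e, e) Y) (cls (odot_rels e C Y) (gen ws)) = cls (odot_rels e C Y) (gen ws)"
      unfolding odot_Act_cls[OF Y Y bij_D_in_D[OF bij_betw_id Y] k] dact_id[OF Y ws] ..
  qed
next
  fix Y Z W :: "nat set" and a b :: "'k ubmor" and m
  assume Y: "finite Y" and Z: "finite Z" and W: "finite W" and a: "a \<in> carrier (Hom (ub (e, e)) Z Y)"
    and b: "b \<in> carrier (Hom (ub (e, e)) W Z)" and m: "m \<in> carrier (At (odot_module e C) Y)"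
  let ?q = "(e, e)" and ?M = "odot_module e C"
  let ?v = "val (odot_rels e C W)"
  have lin1: "Act ?M Y Z a \<in> linear_maps (At ?M Y) (At ?M Z)" if "finite Y" "finite Z" "a \<in> carrier (Hom (ub ?q) Z Y)" for Y Z a
    unfolding odot_At odot_Act by (rule bilinear_induced.induced2_linear2[OF odot_bilinear[OF that(1,2)] that(3)[unfolded ub_Hom]])
  have lin2: "(\<lambda>a. Act ?M Y Z a m) \<in> linear_maps (Hom (ub ?q) Z Y) (At ?M Z)" if "finite Y" "finite Z" "m \<in> carrier (At ?M Y)" for Y Z m
    unfolding odot_At odot_Act ub_Hom by (rule bilinear_induced.induced2_linear1[OF odot_bilinear[OF that(1,2)] that(3)[unfolded odot_At]])
  have V: "lin_on (At ?M W) ?v" unfolding odot_At by (rule lin_on_val)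
  have "?v (Act ?M Z W b (Act ?M Y Z a m)) = ?v (Act ?M Y W (Cmp (ub ?q) W Z Y a b) m)"
  proof (rule ub_lin_on_eq[where a=b, OF _ _ _ b])
    show "lin_on (Hom (ub ?q) W Z) (\<lambda>b. ?v (Act ?M Z W b (Act ?M Y Z a m)))"
      by (rule lin_on_comp[OF V lin2[OF Z W linear_maps_mem[OF lin1[OF Y Z a] m]]])
    show "lin_on (Hom (ub ?q) W Z) (\<lambda>b. ?v (Act ?M Y W (Cmp (ub ?q) W Z Y a b) m))"
      by (rule lin_on_comp[OF lin_on_comp[OF V lin2[OF Y W m]] ub_Cmp_linear2[OF W a]])
    fix g assume g: "g \<in> D W Z"
    note g' = ub_cls_in[OF g, of ?q]
    show "?v (Act ?M Z W (ub_cls ?q W Z g) (Act ?M Y Z a m)) = ?v (Act ?M Y W (Cmp (ub ?q) W Z Y a (ub_cls ?q W Z g)) m)"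
    proof (rule ub_lin_on_eq[where a=a, OF _ _ _ a])
      show "lin_on (Hom (ub ?q) Z Y) (\<lambda>a. ?v (Act ?M Z W (ub_cls ?q W Z g) (Act ?M Y Z a m)))"
        by (rule lin_on_comp[OF lin_on_comp[OF V lin1[OF Z W g']] lin2[OF Y Z m]])
      show "lin_on (Hom (ub ?q) Z Y) (\<lambda>a. ?v (Act ?M Y W (Cmp (ub ?q) W Z Y a (ub_cls ?q W Z g)) m))"
        by (rule lin_on_comp[OF lin_on_comp[OF V lin2[OF Y W m]] ub_Cmp_linear1[OF W g']])
      fix f assume f: "f \<in> D Z Y"
      note f' = ub_cls_in[OF f, of ?q]
      have fg: "D_comp W Z Y f g \<in> D W Y" by (rule D_comp_in_D[OF g f W])
      obtain x where x: "Poly_Mapping.keys x \<subseteq> words C Y" "m = cls (odot_rels e C Y) x"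
        using m unfolding odot_At by (rule presented_memE)
      show "?v (Act ?M Z W (ub_cls ?q W Z g) (Act ?M Y Z (ub_cls ?q Z Y f) m)) =
        ?v (Act ?M Y W (Cmp (ub ?q) W Z Y (ub_cls ?q Z Y f) (ub_cls ?q W Z g)) m)"
        unfolding x(2) ub_Cmp_cls[OF W g f] odot_Act_cls[OF Y Z f x(1)] odot_Act_cls[OF Y W fg x(1)]
          odot_Act_cls[OF Z W g odot_hom_keys[OF odot_hom_dact[OF f Z] x(1)]] val_cls
        by (rule dact_comp[OF g f W x(1)])
    qed
  qed
  then show "Act ?M Z W b (Act ?M Y Z a m) = Act ?M Y W (Cmp (ub ?q) W Z Y a b) m"
    using val_inj[of "Act ?M Z W b (Act ?M Y Z a m)" "words C W" "odot_rels e C W" "Act ?M Y W (Cmp (ub ?q) W Z Y a b) m"]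
      linear_maps_mem[OF lin1[OF Z W b] linear_maps_mem[OF lin1[OF Y Z a] m]]
      linear_maps_mem[OF lin1[OF Y W ub_Cmp_in[OF W b a]] m]
    unfolding odot_At by blast
qed

end

subsection \<open>Extending functionals by a new pair\<close>

text \<open>
  Redirects \<open>x0\<close> to \<open>a\<close> and adds, as the last pair, the old image of \<open>x0\<close> together with \<open>b\<close>.
\<close>

definition extend_chord :: "nat \<Rightarrow> nat \<Rightarrow> nat \<Rightarrow> nat set \<Rightarrow> nat set \<Rightarrow> (nat + nat \<Rightarrow> nat) \<Rightarrow> (nat + nat \<Rightarrow> nat)" where
  "extend_chord x0 a b X S g = restrict (\<lambda>z. case z of
      Inl x \<Rightarrow> if x = x0 then a else g (Inl x)
    | Inr i \<Rightarrow> if i = 2 * pairs_of X S + 1 then g (Inl x0) else if i = 2 * pairs_of X S + 2 then b else g (Inr i))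
    (X <+> {1..2 * Suc (pairs_of X S)})"

locale plus_construction =
  fixes X S :: "nat set" and x0 a b :: nat
  assumes X: "finite X" and x0: "x0 \<in> X" and S: "finite S" and a: "a \<notin> S" and b: "b \<notin> S" and ab: "a \<noteq> b"
begin

abbreviation "ins \<equiv> extend_chord x0 a b X S"
abbreviation "S' \<equiv> insert a (insert b S)"
abbreviation "t \<equiv> pairs_of X S"

lemma card_S': "card S' = card S + 2"
  using S a b ab by simp

lemma ins_Inl: "x \<in> X \<Longrightarrow> ins g (Inl x) = (if x = x0 then a else g (Inl x))"
  by (simp add: extend_chord_def)

lemma ins_Inr: "1 \<le> i \<Longrightarrow> i \<le> 2 * t \<Longrightarrow> ins g (Inr i) = g (Inr i)"
  by (simp add: extend_chord_def)

lemma ins_last: "ins g (Inr (Suc (2 * t))) = g (Inl x0)" "ins g (Inr (Suc (Suc (2 * t)))) = b"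
  by (simp_all add: extend_chord_def)

lemma pairs_S': "g \<in> D X S \<Longrightarrow> pairs_of X S' = Suc t"
  by (rule pairs_of_eq) (use D_card[of g X S] X card_S' in simp)

lemma Inr_cases: "1 \<le> i \<Longrightarrow> i \<le> 2 * Suc k \<Longrightarrow> i \<le> 2 * k \<or> i = Suc (2 * k) \<or> i = Suc (Suc (2 * k))" for i k :: nat
  by auto

lemma ins_in_D:
  assumes g: "g \<in> D X S"
  shows "ins g \<in> D X S'"
proof (rule DI[OF X])
  show "card S' = card X + 2 * Suc t" using D_card[OF g X] card_S' by simp
  show "ins g \<in> extensional (X <+> {1..2 * Suc t})" unfolding extend_chord_def by (rule restrict_extensional)
  show "finite S'" using S by simp
  have img: "ins g ` (X <+> {1..2 * Suc t}) = S'"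
  proof (rule antisym)
    show "ins g ` (X <+> {1..2 * Suc t}) \<subseteq> S'"
    proof (intro subsetI, elim imageE)
      fix y z assume y: "y = ins g z" and z: "z \<in> X <+> {1..2 * Suc t}"
      show "y \<in> S'"
      proof (cases z)
        case (Inl x)
        then show ?thesis using z D_Inl[OF g, of x] by (simp add: y ins_Inl)
      next
        case (Inr i)
        then have "i \<le> 2 * t \<or> i = Suc (2 * t) \<or> i = Suc (Suc (2 * t))" using z Inr_cases[of i t] by simp
        then show ?thesis using z D_Inr[OF g, of i] D_Inl[OF g x0] by (auto simp: y Inr ins_Inr ins_last)
      qed
    qed
    have m: "ins g z \<in> ins g ` (X <+> {1..2 * Suc t})" if "z \<in> X <+> {1..2 * Suc t}" for z using that by (rule imageI)
    show "S' \<subseteq> ins g ` (X <+> {1..2 * Suc t})"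
    proof
      fix y assume "y \<in> S'"
      then consider "y = a" | "y = b" | "y \<in> S" by auto
      then show "y \<in> ins g ` (X <+> {1..2 * Suc t})"
      proof cases
        case 1 then show ?thesis using m[of "Inl x0"] x0 by (simp add: ins_Inl)
      next
        case 2 then show ?thesis using m[of "Inr (Suc (Suc (2 * t)))"] by (simp add: ins_last)
      next
        case 3
        from g this show ?thesis
        proof (cases rule: D_surjE)
          case (Inl x)
          then show ?thesis using m[of "Inl x"] m[of "Inr (Suc (2 * t))"] by (cases "x = x0") (simp_all add: ins_Inl ins_last)
        next
          case (Inr i)
          then show ?thesis using m[of "Inr i"] by (simp add: ins_Inr)
        qed
      qed
    qed
  qed
  show "ins g ` (X <+> {1..2 * Suc t}) \<subseteq> S'" using img by simp
  show "inj_on (ins g) (X <+> {1..2 * Suc t})"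
    by (rule eq_card_imp_inj_on) (use X D_card[OF g X] card_S' in \<open>simp_all only: img finite_Plus finite_atLeastAtMost card_Plus card_atLeastAtMost\<close>, simp)
qed

text \<open>Undoes the extension: x0 goes back to the partner of b, which is the first entry of the
  last pair, and that pair is dropped.\<close>

lemma ins_surj:
  assumes f: "f \<in> D X S'" and fa: "f (Inl x0) = a" and t': "pairs_of X S' = Suc k" and fb: "f (Inr (2 * Suc k)) = b"
  obtains g where "g \<in> D X S" "f = ins g"
proof -
  have k: "t = k" by (rule pairs_of_eq) (use D_card[OF f X] card_S' t' in simp)
  define g where "g = restrict (\<lambda>z. case z of Inl x \<Rightarrow> if x = x0 then f (Inr (Suc (2 * k))) else f (Inl x) | Inr i \<Rightarrow> f (Inr i)) (X <+> {1..2 * k})"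
  have gl: "g (Inl x) = (if x = x0 then f (Inr (Suc (2 * k))) else f (Inl x))" if "x \<in> X" for x using that by (simp add: g_def)
  have gr: "g (Inr i) = f (Inr i)" if "1 \<le> i" "i \<le> 2 * k" for i using that by (simp add: g_def)
  note inj = D_Inl_inj[OF f] D_Inr_inj[OF f, unfolded t'] D_Inl_Inr[OF f, unfolded t']
  have rng: "f (Inl x) \<in> S" if "x \<in> X" "x \<noteq> x0" for x
    using D_Inl[OF f that(1)] inj(1)[OF that(1) x0] inj(3)[OF that(1), of "2 * Suc k"] that(2) fa fb by auto
  have rng': "f (Inr i) \<in> S" if "1 \<le> i" "i < 2 * Suc k" for i
    using D_Inr[OF f that(1)] inj(3)[OF x0 that(1)] inj(2)[OF that(1), of "2 * Suc k"] that(2) fa fb t' by auto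
  have g: "g \<in> D X S"
  proof (rule DI[OF X])
    show "card S = card X + 2 * k" using D_card[OF f X] card_S' t' by simp
    show "g \<in> extensional (X <+> {1..2 * k})" unfolding g_def by (rule restrict_extensional)
    show "finite S" by (rule S)
    show "g ` (X <+> {1..2 * k}) \<subseteq> S" by (auto simp: gl gr intro!: rng rng')
    show "inj_on g (X <+> {1..2 * k})"
    proof (rule inj_onI)
      fix z w assume z: "z \<in> X <+> {1..2 * k}" and w: "w \<in> X <+> {1..2 * k}" and e: "g z = g w"
      \<comment> \<open>Sends x0 to the slot from which \<open>g\<close> takes its value there. With
        it \<open>g\<close> is a restriction of f after \<open>up\<close>, and injectivity of both
        maps gives that of \<open>g\<close>.\<close>
      define up :: "nat + nat \<Rightarrow> nat + nat" where "up z = (if z = Inl x0 then Inr (Suc (2 * k)) else z)" for z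
      have g_up: "g z = f (up z)" if "z \<in> X <+> {1..2 * k}" for z
        using that by (cases z) (simp_all add: up_def gl gr)
      have up_in: "up z \<in> X <+> {1..2 * pairs_of X S'}" if "z \<in> X <+> {1..2 * k}" for z
        using that t' by (cases z) (simp_all add: up_def)
      have "up z = up w"
        using inj_onD[OF D_inj[OF f]] g_up[OF z] g_up[OF w] e up_in[OF z] up_in[OF w] by simp
      then show "z = w" using z w by (auto simp: up_def split: if_splits)
    qed
  qed
  have "f = ins g"
  proof (rule D_eqI[OF f ins_in_D[OF g]])
    show "f (Inl x) = ins g (Inl x)" if "x \<in> X" for x using that fa by (simp add: ins_Inl gl)
    show "f (Inr i) = ins g (Inr i)" if "1 \<le> i" "i \<le> 2 * pairs_of X S'" for i
    proof -
      from that(2) have "i \<le> 2 * Suc k" unfolding t' .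
      from Inr_cases[OF that(1) this] show ?thesis
        using that(1) fb x0 gl[OF x0] gr ins_last[of g, unfolded k] ins_Inr[of i g, unfolded k] by auto
    qed
  qed
  with g show thesis by (rule that)
qed

text \<open>The diagrams on which \<open>\<phi>\<^sup>+\<close> vanishes; all others are extensions of smaller ones up to the wreath product.\<close>

definition dead :: "(nat + nat \<Rightarrow> nat) \<Rightarrow> bool" where
  "dead f \<longleftrightarrow> f (Inl x0) \<noteq> a \<or> (\<exists>x\<in>X. f (Inl x) = b)"

text \<open>If f is not dead, b occupies some slot of a pair. The wreath product is transitive on
  slots, so b can be moved to the very last one, where \<open>ins_surj\<close> applies.\<close>

lemma plus_cases:
  assumes f: "f \<in> D X S'"
  obtains (dead) "dead f"
  | (ins) g \<sigma> where "g \<in> D X S" "\<sigma> \<in> wreath (pairs_of X S')" "f = ins g \<circ> map_sum id \<sigma>"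
proof (cases "dead f")
  case False
  then have fa: "f (Inl x0) = a" and nb: "\<forall>x\<in>X. f (Inl x) \<noteq> b" by (auto simp: dead_def)
  have "b \<in> S'" by simp
  with f obtain i where i: "1 \<le> i" "i \<le> 2 * pairs_of X S'" "b = f (Inr i)"
    using nb by (cases rule: D_surjE) auto
  obtain \<sigma> where s: "\<sigma> \<in> wreath (pairs_of X S')" "\<sigma> (2 * pairs_of X S') = i"
    using wgen_transitive[OF i(1,2)] wgen_wreath by blast
  obtain k where k: "pairs_of X S' = Suc k" using i by (cases "pairs_of X S'") auto
  let ?f = "f \<circ> map_sum id \<sigma>"
  have 1: "?f (Inl x0) = a" using fa by simp
  have 2: "?f (Inr (2 * Suc k)) = b" using i(3) s(2) unfolding k by simp
  obtain g where g: "g \<in> D X S" "?f = ins g" by (rule ins_surj[OF D_act_wreath[OF f s(1)] 1 k 2])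
  have "f = ins g \<circ> map_sum id (pinv \<sigma>)"
    unfolding g(2)[symmetric] map_sum_id_comp[symmetric] permutes_inv_o(1)[OF wreath_permutes[OF s(1)]] map_sum_id_id ..
  from that(2)[OF g(1) wreath_inv[OF s(1)] this] show ?thesis .
qed (rule that(1))

lemma not_dead_ins:
  assumes g: "g \<in> D X S" and s: "\<sigma> \<in> wreath (pairs_of X S')"
  shows "\<not> dead (ins g \<circ> map_sum id \<sigma>)"
proof -
  have "ins g (Inl x) \<noteq> ins g (Inr (Suc (Suc (2 * t))))" if "x \<in> X" for x
    by (rule D_Inl_Inr[OF ins_in_D[OF g] that]) (simp_all add: pairs_S'[OF g])
  then show ?thesis using x0 by (simp add: dead_def ins_Inl ins_last(2))
qed

text \<open>Both extensions have b in the last slot, so \<rho> fixes this slot and hence the last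
  pair. It acts on the old pairs only, and the slots can be compared one by one.\<close>

lemma ins_unique:
  assumes g: "g \<in> D X S" "g' \<in> D X S" and r: "\<rho> \<in> wreath (pairs_of X S')" and e: "ins g' = ins g \<circ> map_sum id \<rho>"
  shows "\<rho> \<in> wreath t" "g' = g \<circ> map_sum id \<rho>"
proof -
  have e': "ins g' (Inr i) = ins g (Inr (\<rho> i))" for i unfolding e by simp
  have r': "\<rho> \<in> wreath (Suc t)" using r unfolding pairs_S'[OF g(1)] .
  have "\<rho> (2 * Suc t) \<in> {1..2 * Suc t}" using permutes_in_image[OF wreath_permutes[OF r'], of "2 * Suc t"] by simp
  moreover have "ins g (Inr (\<rho> (2 * Suc t))) = ins g (Inr (2 * Suc t))"
    unfolding e'[symmetric] using ins_last(2)[of g] ins_last(2)[of g'] by simp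
  ultimately have "\<rho> (2 * Suc t) = 2 * Suc t"
    using D_Inr_inj[OF ins_in_D[OF g(1)], of "\<rho> (2 * Suc t)" "2 * Suc t"] pairs_S'[OF g(1)] by simp
  from wreath_fix_last[OF r' this] show rt: "\<rho> \<in> wreath t" .
  note rp = wreath_permutes[OF rt]
  show "g' = g \<circ> map_sum id \<rho>"
  proof (rule D_eqI[OF g(2) D_act_wreath[OF g(1) rt]])
    show "g' (Inl x) = (g \<circ> map_sum id \<rho>) (Inl x)" if x: "x \<in> X" for x
    proof (cases "x = x0")
      case True
      have "\<rho> (Suc (2 * t)) = Suc (2 * t)" by (rule permutes_not_in[OF rp]) simp
      then show ?thesis using e'[of "Suc (2 * t)"] True by (simp add: ins_last)
    next
      case False
      have "ins g' (Inl x) = ins g (Inl x)" unfolding e by simp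
      then show ?thesis using x False by (simp add: ins_Inl)
    qed
    show "g' (Inr i) = (g \<circ> map_sum id \<rho>) (Inr i)" if i: "1 \<le> i" "i \<le> 2 * t" for i
      using e'[of i] i permutes_in_image[OF rp, of i] by (simp add: ins_Inr)
  qed
qed

text \<open>A value is chosen among all ways to present f as a translate of an extension. They agree
  by \<open>ins_unique\<close>: two presentations differ by an element acting on the old pairs,
  under which \<phi> is equivariant.\<close>

definition plus_fun :: "polarities \<Rightarrow> ('k::field ubmor \<Rightarrow> 'k) \<Rightarrow> (nat + nat \<Rightarrow> nat) \<Rightarrow> 'k" where
  "plus_fun p \<phi> f = (if dead f then 0 else SOME c. \<exists>g \<sigma>. g \<in> D X S \<and> \<sigma> \<in> wreath (pairs_of X S') \<and>
     f = ins g \<circ> map_sum id \<sigma> \<and> c = of_int (character p \<sigma>) * \<phi> (ub_cls p X S g))"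

context
  fixes p :: polarities and \<phi> :: "'k::field ubmor \<Rightarrow> 'k"
  assumes phi: "\<phi> \<in> carrier (dual (Hom (ub p) X S))"
begin

lemma plus_fun_ins:
  assumes g: "g \<in> D X S" and s: "\<sigma> \<in> wreath (pairs_of X S')"
  shows "plus_fun p \<phi> (ins g \<circ> map_sum id \<sigma>) = of_int (character p \<sigma>) * \<phi> (ub_cls p X S g)"
proof -
  have "c = of_int (character p \<sigma>) * \<phi> (ub_cls p X S g)"
    if c: "g' \<in> D X S" "\<sigma>' \<in> wreath (pairs_of X S')" "ins g \<circ> map_sum id \<sigma> = ins g' \<circ> map_sum id \<sigma>'"
      "c = of_int (character p \<sigma>') * \<phi> (ub_cls p X S g')" for c g' \<sigma>'
  proof -
    let ?r = "\<sigma> \<circ> pinv \<sigma>'"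
    have r: "?r \<in> wreath (pairs_of X S')" by (rule wreath_comp[OF s wreath_inv[OF c(2)]])
    have "ins g' = ins g' \<circ> map_sum id \<sigma>' \<circ> map_sum id (pinv \<sigma>')"
      unfolding map_sum_id_comp[symmetric] permutes_inv_o(1)[OF wreath_permutes[OF c(2)]] map_sum_id_id ..
    also have "\<dots> = ins g \<circ> map_sum id ?r" unfolding c(3)[symmetric] map_sum_id_comp[symmetric] ..
    finally have e: "ins g' = ins g \<circ> map_sum id ?r" .
    note u = ins_unique[OF g c(1) r e]
    have ch: "character p ?r = character p \<sigma> * character p \<sigma>'"
      unfolding character_comp[OF s wreath_inv[OF c(2)]] character_inv[OF c(2)] ..
    have sq: "(of_int (character p \<sigma>') :: 'k) * of_int (character p \<sigma>') = 1"
      unfolding of_int_mult[symmetric] character_square by simp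
    have "c = (of_int (character p \<sigma>') * of_int (character p \<sigma>')) * (of_int (character p \<sigma>) * \<phi> (ub_cls p X S g))"
      unfolding c(4) u(2) dual_equivariant[OF phi g u(1)] ch of_int_mult by (simp add: mult_ac)
    then show ?thesis unfolding sq by simp
  qed
  then have "(SOME c. \<exists>g' \<sigma>'. g' \<in> D X S \<and> \<sigma>' \<in> wreath (pairs_of X S') \<and>
     ins g \<circ> map_sum id \<sigma> = ins g' \<circ> map_sum id \<sigma>' \<and> c = of_int (character p \<sigma>') * \<phi> (ub_cls p X S g')) =
     of_int (character p \<sigma>) * \<phi> (ub_cls p X S g)"
    by (intro some_equality) (use g s in blast)+
  then show ?thesis using not_dead_ins[OF g s] unfolding plus_fun_def by simp
qed

lemma dead_act: "dead (f \<circ> map_sum id \<sigma>) = dead f"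
  by (simp add: dead_def)

lemma plus_fun_equivariant:
  assumes f: "f \<in> D X S'" and s: "\<sigma> \<in> wreath (pairs_of X S')"
  shows "plus_fun p \<phi> (f \<circ> map_sum id \<sigma>) = of_int (character p \<sigma>) * plus_fun p \<phi> f"
  using f
proof (cases rule: plus_cases)
  case dead
  then show ?thesis unfolding plus_fun_def dead_act by simp
next
  case (ins g \<tau>)
  show ?thesis
    unfolding ins(3) map_sum_id_comp[symmetric] plus_fun_ins[OF ins(1) wreath_comp[OF ins(2) s]] plus_fun_ins[OF ins(1,2)]
      character_comp[OF ins(2) s] of_int_mult by (simp add: mult_ac)
qed

definition plus :: "'k ubmor \<Rightarrow> 'k" where
  "plus = dual_fun p X S' (plus_fun p \<phi>)"

lemma plus_in: "plus \<in> carrier (dual (Hom (ub p) X S'))"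
  unfolding plus_def by (rule dual_fun_in[OF plus_fun_equivariant])

lemma plus_cls: "f \<in> D X S' \<Longrightarrow> plus (ub_cls p X S' f) = plus_fun p \<phi> f"
  unfolding plus_def by (rule dual_fun_cls[OF plus_fun_equivariant])

lemma plus_dead: "f \<in> D X S' \<Longrightarrow> dead f \<Longrightarrow> plus (ub_cls p X S' f) = 0"
  unfolding plus_cls by (simp add: plus_fun_def)

lemma plus_ins: "g \<in> D X S \<Longrightarrow> plus (ub_cls p X S' (ins g)) = \<phi> (ub_cls p X S g)"
  unfolding plus_cls[OF ins_in_D] using plus_fun_ins[OF _ wreath_id] by (simp add: map_sum_id_id)

end

lemma plus_eqI:
  fixes \<psi> \<psi>' :: "'k::field ubmor \<Rightarrow> 'k"
  assumes p: "\<psi> \<in> carrier (dual (Hom (ub p) X S'))" "\<psi>' \<in> carrier (dual (Hom (ub p) X S'))"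
    and d: "\<And>f. f \<in> D X S' \<Longrightarrow> dead f \<Longrightarrow> \<psi> (ub_cls p X S' f) = \<psi>' (ub_cls p X S' f)"
    and i: "\<And>g. g \<in> D X S \<Longrightarrow> \<psi> (ub_cls p X S' (ins g)) = \<psi>' (ub_cls p X S' (ins g))"
  shows "\<psi> = \<psi>'"
proof (rule dual_eqI[OF p])
  fix f assume "f \<in> D X S'"
  then show "\<psi> (ub_cls p X S' f) = \<psi>' (ub_cls p X S' f)"
  proof (cases rule: plus_cases)
    case dead
    with \<open>f \<in> D X S'\<close> show ?thesis by (rule d)
  next
    case (ins g \<sigma>)
    show ?thesis unfolding ins(3) dual_equivariant[OF p(1) ins_in_D[OF ins(1)] ins(2)] dual_equivariant[OF p(2) ins_in_D[OF ins(1)] ins(2)] i[OF ins(1)] ..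
  qed
qed

lemma plus_linear:
  "plus p \<in> linear_maps (dual (Hom (ub p) X S)) (dual (Hom (ub p) X S'))" for p
proof (rule linear_mapsI)
  fix \<phi> :: "'k::field ubmor \<Rightarrow> 'k" assume phi: "\<phi> \<in> carrier (dual (Hom (ub p) X S))"
  then show "plus p \<phi> \<in> carrier (dual (Hom (ub p) X S'))" by (rule plus_in)
  note cd = closed_dual[OF ub_closed]
  note ci = ub_cls_in[OF ins_in_D] ub_cls_in
  { fix \<psi> :: "'k ubmor \<Rightarrow> 'k" assume psi: "\<psi> \<in> carrier (dual (Hom (ub p) X S))"
    show "plus p (\<phi> \<oplus>\<^bsub>dual (Hom (ub p) X S)\<^esub> \<psi>) = plus p \<phi> \<oplus>\<^bsub>dual (Hom (ub p) X S')\<^esub> plus p \<psi>"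
      unfolding dual_add
      by (rule plus_eqI[where p = p])
        (simp_all add: plus_in closed_add[OF cd, unfolded dual_add] phi psi plus_dead plus_ins ci) }
  fix c :: 'k
  show "plus p (c \<odot>\<^bsub>dual (Hom (ub p) X S)\<^esub> \<phi>) = c \<odot>\<^bsub>dual (Hom (ub p) X S')\<^esub> plus p \<phi>"
    unfolding dual_smult
    by (rule plus_eqI[where p = p])
      (simp_all add: plus_in closed_smult[OF cd, unfolded dual_smult] phi plus_dead plus_ins ci)
qed

end

lemma extend_chord_bij:
  assumes A: "plus_construction X S x0 a b" and B: "plus_construction X S' x0 a' b'"
    and s: "bij_betw \<sigma> S S'" and t: "bij_betw \<tau> (insert a (insert b S)) (insert a' (insert b' S'))"
    and st: "\<And>x. x \<in> S \<Longrightarrow> \<tau> x = \<sigma> x" "\<tau> a = a'" "\<tau> b = b'" and g: "g \<in> D X S"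
  shows "D_comp X (insert a (insert b S)) (insert a' (insert b' S')) (bij_D (insert a (insert b S)) \<tau>) (extend_chord x0 a b X S g) =
    extend_chord x0 a' b' X S' (D_comp X S S' (bij_D S \<sigma>) g)"
proof -
  interpret A: plus_construction X S x0 a b by (rule A)
  interpret B: plus_construction X S' x0 a' b' by (rule B)
  note bs = bij_D_in_D[OF s A.S] and bt = bij_D_in_D[OF t]
  have bt: "bij_D A.S' \<tau> \<in> D A.S' B.S'" by (rule bij_D_in_D[OF t]) (simp add: A.S)
  have p0: "pairs_of S S' = 0" "pairs_of A.S' B.S' = 0" using bij_D_pairs s t by blast+
  have gs: "D_comp X S S' (bij_D S \<sigma>) g \<in> D X S'" by (rule D_comp_in_D[OF g bs A.X])
  have tt: "B.t = A.t" using pairs_of_add[OF g bs A.X] p0 by simp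
  note pS = A.pairs_S'[OF g]
  show ?thesis
  proof (rule D_eqI[OF D_comp_in_D[OF A.ins_in_D[OF g] bt A.X] B.ins_in_D[OF gs]])
    fix x assume x: "x \<in> X"
    show "D_comp X A.S' B.S' (bij_D A.S' \<tau>) (A.ins g) (Inl x) = B.ins (D_comp X S S' (bij_D S \<sigma>) g) (Inl x)"
      using D_Inl[OF g x] by (simp add: D_comp_Inl x A.ins_Inl B.ins_Inl bij_D_Inl st)
  next
    fix i assume i: "1 \<le> i" "i \<le> 2 * pairs_of X B.S'"
    have i': "i \<le> 2 * Suc A.t" using i(2) unfolding B.pairs_S'[OF gs] tt .
    have l: "D_comp X A.S' B.S' (bij_D A.S' \<tau>) (A.ins g) (Inr i) = bij_D A.S' \<tau> (Inl (A.ins g (Inr i)))"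
      by (rule D_comp_Inr1) (use i i' pS in simp_all)
    show "D_comp X A.S' B.S' (bij_D A.S' \<tau>) (A.ins g) (Inr i) = B.ins (D_comp X S S' (bij_D S \<sigma>) g) (Inr i)"
      unfolding l
      using A.Inr_cases[OF i(1) i']
    proof (elim disjE)
      assume k: "i \<le> 2 * A.t"
      show "bij_D A.S' \<tau> (Inl (A.ins g (Inr i))) = B.ins (D_comp X S S' (bij_D S \<sigma>) g) (Inr i)"
        using D_Inr[OF g i(1) k] i(1) k by (simp add: A.ins_Inr B.ins_Inr tt bij_D_Inl st D_comp_Inr1)
    next
      assume k: "i = Suc (2 * A.t)"
      show "bij_D A.S' \<tau> (Inl (A.ins g (Inr i))) = B.ins (D_comp X S S' (bij_D S \<sigma>) g) (Inr i)"
        using D_Inl[OF g A.x0] B.ins_last(1)[of "D_comp X S S' (bij_D S \<sigma>) g", unfolded tt]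
        by (simp add: k A.ins_last bij_D_Inl st D_comp_Inl A.x0)
    next
      assume k: "i = Suc (Suc (2 * A.t))"
      show "bij_D A.S' \<tau> (Inl (A.ins g (Inr i))) = B.ins (D_comp X S S' (bij_D S \<sigma>) g) (Inr i)"
        using B.ins_last(2)[of "D_comp X S S' (bij_D S \<sigma>) g", unfolded tt]
        by (simp add: k A.ins_last bij_D_Inl st)
    qed
  qed
qed

lemma dual_act_cls:
  assumes "finite X" "f \<in> D X Y" "g \<in> D Y Z"
  shows "Act (dual_right (ub p) X) Z Y (ub_cls p Y Z g) \<phi> (ub_cls p X Y f) = \<phi> (ub_cls p X Z (D_comp X Y Z g f))"
  unfolding dual_right_simps using assms by (simp add: ub_cls_in ub_Cmp_cls)

lemma plus_bij:
  fixes \<phi> :: "'k::field ubmor \<Rightarrow> 'k"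
  assumes A: "plus_construction X S x0 a b" and B: "plus_construction X S' x0 a' b'"
    and s: "bij_betw \<sigma> S S'" and t: "bij_betw \<tau> (insert a (insert b S)) (insert a' (insert b' S'))"
    and st: "\<And>x. x \<in> S \<Longrightarrow> \<tau> x = \<sigma> x" "\<tau> a = a'" "\<tau> b = b'" and phi: "\<phi> \<in> carrier (dual (Hom (ub p) X S'))"
  shows "plus_construction.plus X S x0 a b p (Act (dual_right (ub p) X) S' S (ub_cls p S S' (bij_D S \<sigma>)) \<phi>) =
    Act (dual_right (ub p) X) (insert a' (insert b' S')) (insert a (insert b S))
      (ub_cls p (insert a (insert b S)) (insert a' (insert b' S')) (bij_D (insert a (insert b S)) \<tau>))
      (plus_construction.plus X S' x0 a' b' p \<phi>)"
proof -
  interpret A: plus_construction X S x0 a b by (rule A)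
  interpret B: plus_construction X S' x0 a' b' by (rule B)
  have bs: "bij_D S \<sigma> \<in> D S S'" by (rule bij_D_in_D[OF s A.S])
  have bt: "bij_D A.S' \<tau> \<in> D A.S' B.S'" by (rule bij_D_in_D[OF t]) (simp add: A.S)
  note in1 = dual_act_in[OF A.X ub_cls_in[OF bs] phi] and in2 = dual_act_in[OF A.X ub_cls_in[OF bt] B.plus_in[OF phi]]
  show ?thesis
  proof (rule A.plus_eqI[OF A.plus_in[OF in1] in2])
    fix f assume f: "f \<in> D X A.S'" and d: "A.dead f"
    note h = D_comp_in_D[OF f bt A.X]
    have inj: "inj_on \<tau> A.S'" using t by (simp add: bij_betw_def)
    have "B.dead (D_comp X A.S' B.S' (bij_D A.S' \<tau>) f)"
    proof -
      have e: "D_comp X A.S' B.S' (bij_D A.S' \<tau>) f (Inl x) = \<tau> (f (Inl x))" if "x \<in> X" for x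
        using D_Inl[OF f that] that by (simp add: D_comp_Inl bij_D_Inl)
      have "\<tau> (f (Inl x0)) \<noteq> a'" if "f (Inl x0) \<noteq> a"
        using inj_onD[OF inj, of "f (Inl x0)" a] D_Inl[OF f A.x0] that st(2) by auto
      then show ?thesis using d st(3) A.x0 by (auto simp: A.dead_def B.dead_def e)
    qed
    then show "A.plus p (Act (dual_right (ub p) X) S' S (ub_cls p S S' (bij_D S \<sigma>)) \<phi>) (ub_cls p X A.S' f) =
      Act (dual_right (ub p) X) B.S' A.S' (ub_cls p A.S' B.S' (bij_D A.S' \<tau>)) (B.plus p \<phi>) (ub_cls p X A.S' f)"
      unfolding A.plus_dead[OF in1 f d] dual_act_cls[OF A.X f bt] by (simp only: B.plus_dead[OF phi h])
  next
    fix g assume g: "g \<in> D X S"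
    show "A.plus p (Act (dual_right (ub p) X) S' S (ub_cls p S S' (bij_D S \<sigma>)) \<phi>) (ub_cls p X A.S' (A.ins g)) =
      Act (dual_right (ub p) X) B.S' A.S' (ub_cls p A.S' B.S' (bij_D A.S' \<tau>)) (B.plus p \<phi>) (ub_cls p X A.S' (A.ins g))"
    proof -
      have e: "D_comp X A.S' B.S' (bij_D A.S' \<tau>) (A.ins g) = B.ins (D_comp X S S' (bij_D S \<sigma>) g)"
        by (rule extend_chord_bij[OF A B s t]) (simp_all add: st g)
      show ?thesis
        unfolding A.plus_ins[OF in1 g] dual_act_cls[OF A.X A.ins_in_D[OF g] bt] dual_act_cls[OF A.X g bs]
          e B.plus_ins[OF phi D_comp_in_D[OF g bs A.X]] ..
    qed
  qed
qed

text \<open>The chord \<open>(i, j)\<close> and the new pair compete for the last position, hence the exchange of pairs and its sign.\<close>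

lemma extend_chord_chord:
  assumes A: "plus_construction X (S - {i, j}) x0 a b" and B: "plus_construction X S x0 a b"
    and ij: "i \<in> S" "j \<in> S" "i \<noteq> j" and g: "g \<in> D X (S - {i, j})"
  shows "D_comp X (insert a (insert b (S - {i, j}))) (insert a (insert b S)) (chordD (insert a (insert b S)) i j) (extend_chord x0 a b X (S - {i, j}) g) =
    extend_chord x0 a b X S (D_comp X (S - {i, j}) S (chordD S i j) g) \<circ> map_sum id (pswap (pairs_of X S))"
proof -
  interpret A: plus_construction X "S - {i, j}" x0 a b by (rule A)
  interpret B: plus_construction X S x0 a b by (rule B)
  have ne: "a \<noteq> i" "a \<noteq> j" "b \<noteq> i" "b \<noteq> j" using ij B.a B.b by auto
  have eA: "B.S' - {i, j} = A.S'" using ne B.a B.b by auto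
  have fin: "finite B.S'" using B.S by simp
  have c1: "chordD S i j \<in> D (S - {i, j}) S" by (rule chordD_in_D[OF B.S ij])
  have c2: "chordD B.S' i j \<in> D A.S' B.S'" using chordD_in_D[OF fin, of i j] ij unfolding eA by simp
  have p1: "pairs_of (S - {i, j}) S = 1" by (rule pairs_of_pair[OF B.S ij])
  have p2: "pairs_of A.S' B.S' = 1" using pairs_of_pair[OF fin, of i j] ij unfolding eA by simp
  let ?k = "A.t" and ?h = "D_comp X (S - {i, j}) S (chordD S i j) g"
  have h: "?h \<in> D X S" by (rule D_comp_in_D[OF g c1 B.X])
  have tt: "B.t = Suc ?k" using pairs_of_add[OF g c1 B.X] p1 by simp
  note pA = A.pairs_S'[OF g] and pB = B.pairs_S'[OF h, unfolded tt]
  have sw: "pswap (Suc ?k) \<in> wreath (pairs_of X B.S')" unfolding pB by (rule pswap_wreath) simp_all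
  have hl: "?h (Inl x) = g (Inl x)" if "x \<in> X" for x
    using D_Inl[OF g that] that by (simp add: D_comp_Inl chordD_Inl)
  have hr: "?h (Inr i) = g (Inr i)" if "1 \<le> i" "i \<le> 2 * ?k" for i
    using D_Inr[OF g that] that by (simp add: D_comp_Inr1 chordD_Inl)
  have hc: "?h (Inr (Suc (2 * ?k))) = i" "?h (Inr (Suc (Suc (2 * ?k)))) = j"
    by (subst D_comp_Inr2; simp add: p1 chordD_Inr numeral_2_eq_2[symmetric])+
  show ?thesis unfolding tt
  proof (rule D_eqI[OF D_comp_in_D[OF A.ins_in_D[OF g] c2 A.X] D_act_wreath[OF B.ins_in_D[OF h] sw]])
    fix x assume x: "x \<in> X"
    have "g (Inl x) \<in> S" "g (Inl x) \<noteq> i" "g (Inl x) \<noteq> j" using D_Inl[OF g x] by auto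
    then show "D_comp X A.S' B.S' (chordD B.S' i j) (A.ins g) (Inl x) = (B.ins ?h \<circ> map_sum id (pswap (Suc ?k))) (Inl x)"
      using x ne by (simp add: D_comp_Inl A.ins_Inl B.ins_Inl chordD_Inl hl)
  next
    fix l assume l: "1 \<le> l" "l \<le> 2 * pairs_of X B.S'"
    have l': "l \<le> 2 * Suc (Suc ?k)" using l(2) unfolding pB .
    have ps: "pswap (Suc ?k) m = (if m \<le> 2 * ?k then m else if m \<le> 2 * Suc ?k then m + 2 else m - 2)"
      if "1 \<le> m" "m \<le> 2 * Suc (Suc ?k)" for m
      using that by (auto simp: pswap_apply pr_def)
    have low: "D_comp X A.S' B.S' (chordD B.S' i j) (A.ins g) (Inr l) = A.ins g (Inr l)" if "l \<le> 2 * Suc ?k"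
    proof -
      have m: "l \<le> 2 * pairs_of X A.S'" using that unfolding pA .
      have "A.ins g (Inr l) \<in> A.S'" by (rule D_Inr[OF A.ins_in_D[OF g] l(1) m])
      then have "A.ins g (Inr l) \<in> B.S'" "A.ins g (Inr l) \<noteq> i" "A.ins g (Inr l) \<noteq> j" using ne by auto
      then show ?thesis unfolding D_comp_Inr1[OF l(1) m] by (rule chordD_Inl)
    qed
    have high: "D_comp X A.S' B.S' (chordD B.S' i j) (A.ins g) (Inr l) = chordD B.S' i j (Inr (l - 2 * Suc ?k))" if "2 * Suc ?k < l"
      using D_comp_Inr2[of X A.S' l B.S'] that l' unfolding pA p2 by simp
    consider "l \<le> 2 * ?k" | "l = Suc (2 * ?k)" | "l = Suc (Suc (2 * ?k))" | "l = Suc (Suc (Suc (2 * ?k)))" | "l = Suc (Suc (Suc (Suc (2 * ?k))))"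
      using l' by fastforce
    then show "D_comp X A.S' B.S' (chordD B.S' i j) (A.ins g) (Inr l) = (B.ins ?h \<circ> map_sum id (pswap (Suc ?k))) (Inr l)"
    proof cases
      case 1
      then show ?thesis using l(1) low by (simp add: ps A.ins_Inr B.ins_Inr[unfolded tt] hr)
    next
      case 2
      then show ?thesis using low B.ins_last(1)[of ?h, unfolded tt] by (simp add: ps A.ins_last hl A.x0)
    next
      case 3
      then show ?thesis using low B.ins_last(2)[of ?h, unfolded tt] by (simp add: ps A.ins_last)
    next
      case 4
      then show ?thesis using high by (simp add: ps B.ins_Inr[unfolded tt] hc chordD_Inr)
    next
      case 5
      then show ?thesis using high by (simp add: ps B.ins_Inr[unfolded tt] hc chordD_Inr numeral_2_eq_2[symmetric])
    qed
  qed
qed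

lemma plus_chord:
  fixes \<phi> :: "'k::field ubmor \<Rightarrow> 'k"
  assumes A: "plus_construction X (S - {i, j}) x0 a b" and B: "plus_construction X S x0 a b"
    and ij: "i \<in> S" "j \<in> S" "i \<noteq> j" and phi: "\<phi> \<in> carrier (dual (Hom (ub p) X S))"
  shows "Act (dual_right (ub p) X) (insert a (insert b S)) (insert a (insert b (S - {i, j}))) (chord p (insert a (insert b S)) i j)
      (plus_construction.plus X S x0 a b p \<phi>) =
    of_int (twist (snd p) (-1)) \<odot>\<^bsub>dual (Hom (ub p) X (insert a (insert b (S - {i, j}))))\<^esub>
    plus_construction.plus X (S - {i, j}) x0 a b p (Act (dual_right (ub p) X) S (S - {i, j}) (chord p S i j) \<phi>)"
proof -
  interpret A: plus_construction X "S - {i, j}" x0 a b by (rule A)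
  interpret B: plus_construction X S x0 a b by (rule B)
  have ne: "a \<noteq> i" "a \<noteq> j" "b \<noteq> i" "b \<noteq> j" using ij B.a B.b by auto
  have eA: "B.S' - {i, j} = A.S'" using ne B.a B.b by auto
  have fin: "finite B.S'" using B.S by simp
  have c1: "chordD S i j \<in> D (S - {i, j}) S" by (rule chordD_in_D[OF B.S ij])
  have c2: "chordD B.S' i j \<in> D A.S' B.S'" using chordD_in_D[OF fin, of i j] ij unfolding eA by simp
  have p1: "pairs_of (S - {i, j}) S = 1" by (rule pairs_of_pair[OF B.S ij])
  have ch: "chord p B.S' i j = (ub_cls p A.S' B.S' (chordD B.S' i j) :: 'k ubmor)" unfolding chord_eq eA ..
  have ch': "chord p S i j = (ub_cls p (S - {i, j}) S (chordD S i j) :: 'k ubmor)" unfolding chord_eq ..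
  note in1 = dual_act_in[OF A.X ub_cls_in[OF c1] phi] and in2 = dual_act_in[OF A.X ub_cls_in[OF c2] B.plus_in[OF phi]]
  have in3: "of_int (twist (snd p) (-1)) \<odot>\<^bsub>dual (Hom (ub p) X A.S')\<^esub> A.plus p (Act (dual_right (ub p) X) S (S - {i, j}) (ub_cls p (S - {i, j}) S (chordD S i j)) \<phi>)
    \<in> carrier (dual (Hom (ub p) X A.S'))"
    by (rule closed_smult[OF closed_dual[OF ub_closed] A.plus_in[OF in1]])
  show ?thesis unfolding ch ch'
  proof (rule A.plus_eqI[OF in2 in3])
    fix f assume f: "f \<in> D X A.S'" and d: "A.dead f"
    note h = D_comp_in_D[OF f c2 A.X]
    have "B.dead (D_comp X A.S' B.S' (chordD B.S' i j) f)"
    proof -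
      have e: "D_comp X A.S' B.S' (chordD B.S' i j) f (Inl x) = f (Inl x)" if "x \<in> X" for x
        using D_Inl[OF f that] that ne by (subst D_comp_Inl) (auto intro!: chordD_Inl)
      show ?thesis using d A.x0 by (auto simp: A.dead_def B.dead_def e)
    qed
    from B.plus_dead[OF phi h this]
    show "Act (dual_right (ub p) X) B.S' A.S' (ub_cls p A.S' B.S' (chordD B.S' i j)) (B.plus p \<phi>) (ub_cls p X A.S' f) =
      (of_int (twist (snd p) (-1)) \<odot>\<^bsub>dual (Hom (ub p) X A.S')\<^esub> A.plus p (Act (dual_right (ub p) X) S (S - {i, j}) (ub_cls p (S - {i, j}) S (chordD S i j)) \<phi>)) (ub_cls p X A.S' f)"
      unfolding dual_act_cls[OF A.X f c2] dual_smult by (simp add: A.plus_dead[OF in1 f d] ub_cls_in[OF f])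
  next
    fix g assume g: "g \<in> D X (S - {i, j})"
    have h: "D_comp X (S - {i, j}) S (chordD S i j) g \<in> D X S" by (rule D_comp_in_D[OF g c1 B.X])
    have tt: "B.t = Suc A.t" using pairs_of_add[OF g c1 B.X] p1 by simp
    have sw: "pswap B.t \<in> wreath (pairs_of X B.S')" unfolding B.pairs_S'[OF h] tt by (rule pswap_wreath) simp_all
    have cs: "character p (pswap B.t) = twist (snd p) (-1)" by (rule character_pswap) (simp add: tt)
    show "Act (dual_right (ub p) X) B.S' A.S' (ub_cls p A.S' B.S' (chordD B.S' i j)) (B.plus p \<phi>) (ub_cls p X A.S' (A.ins g)) =
      (of_int (twist (snd p) (-1)) \<odot>\<^bsub>dual (Hom (ub p) X A.S')\<^esub> A.plus p (Act (dual_right (ub p) X) S (S - {i, j}) (ub_cls p (S - {i, j}) S (chordD S i j)) \<phi>)) (ub_cls p X A.S' (A.ins g))"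
      unfolding dual_act_cls[OF A.X A.ins_in_D[OF g] c2] extend_chord_chord[OF A B ij g]
        dual_equivariant[OF B.plus_in[OF phi] B.ins_in_D[OF h] sw] cs B.plus_ins[OF phi h] dual_smult
      by (simp add: A.plus_ins[OF in1 g] dual_act_cls[OF A.X g c1] ub_cls_in[OF A.ins_in_D[OF g]])
  qed
qed

section \<open>Splitting a functional by the image of the base point\<close>

lemma dual_zero: "\<zero>\<^bsub>dual V\<^esub> = (\<lambda>x\<in>carrier V. 0)"
  by (simp add: dual_def)

lemma dual_zero_in: "\<zero>\<^bsub>dual (Hom (ub p) X Y)\<^esub> \<in> carrier (dual (Hom (ub p) X Y :: ('k::field, 'k ubmor) module))"
  unfolding dual_zero by (rule dual_restrict[OF ub_closed]) (simp add: linear_maps_def)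

text \<open>The cut-off is compatible with the character because the wreath product does not move
  the image of x0. A set A is allowed so that the parts can be summed by induction, up to A =
  S.\<close>

definition part :: "polarities \<Rightarrow> nat set \<Rightarrow> nat set \<Rightarrow> nat \<Rightarrow> nat set \<Rightarrow> ('k::field ubmor \<Rightarrow> 'k) \<Rightarrow> 'k ubmor \<Rightarrow> 'k" where
  "part p X S x0 A \<phi> = dual_fun p X S (\<lambda>g. if g (Inl x0) \<in> A then \<phi> (ub_cls p X S g) else 0)"

context
  fixes p X S and \<phi> :: "'k::field ubmor \<Rightarrow> 'k"
  assumes phi: "\<phi> \<in> carrier (dual (Hom (ub p) X S))"
begin

lemma part_equivariant:
  "f \<in> D X S \<Longrightarrow> \<sigma> \<in> wreath (pairs_of X S) \<Longrightarrow>
   (if (f \<circ> map_sum id \<sigma>) (Inl x0) \<in> A then \<phi> (ub_cls p X S (f \<circ> map_sum id \<sigma>)) else 0) =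
   of_int (character p \<sigma>) * (if f (Inl x0) \<in> A then \<phi> (ub_cls p X S f) else 0)"
  using dual_equivariant[OF phi, of f \<sigma>] by simp

lemma part_in: "part p X S x0 A \<phi> \<in> carrier (dual (Hom (ub p) X S))"
  unfolding part_def by (rule dual_fun_in[OF part_equivariant])

lemma part_cls: "f \<in> D X S \<Longrightarrow> part p X S x0 A \<phi> (ub_cls p X S f) = (if f (Inl x0) \<in> A then \<phi> (ub_cls p X S f) else 0)"
  unfolding part_def by (rule dual_fun_cls[OF part_equivariant])

lemma part_empty: "part p X S x0 {} \<phi> = \<zero>\<^bsub>dual (Hom (ub p) X S)\<^esub>"
  by (rule dual_eqI[OF part_in dual_zero_in]) (simp add: part_cls dual_zero ub_cls_in)

lemma part_insert: "y \<notin> A \<Longrightarrow> part p X S x0 (insert y A) \<phi> = part p X S x0 {y} \<phi> \<oplus>\<^bsub>dual (Hom (ub p) X S)\<^esub> part p X S x0 A \<phi>"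
  by (rule dual_eqI[OF part_in closed_add[OF closed_dual[OF ub_closed] part_in part_in]])
    (auto simp add: part_cls dual_add ub_cls_in)

lemma part_all: "x0 \<in> X \<Longrightarrow> part p X S x0 S \<phi> = \<phi>"
  by (rule dual_eqI[OF part_in phi]) (simp add: part_cls D_Inl)

lemma lin_on_parts:
  assumes L: "lin_on (dual (Hom (ub p) X S)) L" and S: "finite S" and x0: "x0 \<in> X"
  shows "(\<Sum>y\<in>S. L (part p X S x0 {y} \<phi>)) = L \<phi>"
proof -
  have "(\<Sum>y\<in>A. L (part p X S x0 {y} \<phi>)) = L (part p X S x0 A \<phi>)" if "finite A" for A
    using that
  proof (induction A)
    case empty
    have "L \<zero>\<^bsub>dual (Hom (ub p) X S)\<^esub> = L (0 \<odot>\<^bsub>dual (Hom (ub p) X S)\<^esub> \<phi>)"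
      unfolding dual_smult dual_zero by simp
    also have "\<dots> = 0" unfolding lin_on_smult[OF L phi] by (rule poly_mapping_eqI) simp
    finally show ?case unfolding part_empty by simp
  next
    case (insert y A)
    then show ?case unfolding part_insert[OF insert(2)] lin_on_add[OF L part_in part_in] by simp
  qed
  from this[OF S] show ?thesis unfolding part_all[OF x0] .
qed

end

context plus_construction
begin

context
  fixes p :: polarities and \<phi> :: "'k::field ubmor \<Rightarrow> 'k" and u v :: nat
  assumes phi: "\<phi> \<in> carrier (dual (Hom (ub p) X S))" and uv: "u \<in> S'" "v \<in> S'" "u \<noteq> v"
begin

lemma plus_chord_cls:
  assumes "f \<in> D X (S' - {u, v})"
  shows "Act (dual_right (ub p) X) S' (S' - {u, v}) (chord p S' u v) (plus p \<phi>) (ub_cls p X (S' - {u, v}) f) =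
    plus p \<phi> (ub_cls p X S' (D_comp X (S' - {u, v}) S' (chordD S' u v) f))"
  unfolding chord_eq by (rule dual_act_cls[OF X assms chordD_in_D]) (use S uv in simp_all)

lemma plus_chord_in:
  "Act (dual_right (ub p) X) S' (S' - {u, v}) (chord p S' u v) (plus p \<phi>) \<in> carrier (dual (Hom (ub p) X (S' - {u, v})))"
  by (rule dual_act_in[OF X chord_in plus_in[OF phi]]) (use S uv in simp_all)

lemma plus_chord_dead:
  assumes f: "f \<in> D X (S' - {u, v})" and d: "f (Inl x0) \<noteq> a"
  shows "plus p \<phi> (ub_cls p X S' (D_comp X (S' - {u, v}) S' (chordD S' u v) f)) = 0"
proof (rule plus_dead[OF phi D_comp_in_D[OF f chordD_in_D X]])
  have "f (Inl x0) \<in> S'" "f (Inl x0) \<noteq> u" "f (Inl x0) \<noteq> v" using D_Inl[OF f x0] by auto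
  then show "dead (D_comp X (S' - {u, v}) S' (chordD S' u v) f)"
    using d unfolding dead_def D_comp_Inl[OF x0] by (simp add: chordD_Inl)
qed (use S uv in simp_all)

text \<open>A diagram that factors through a chord at a has a in the chord's pair. It cannot send x0
  to a, hence is dead.\<close>

lemma plus_chord_zero:
  assumes "a = u \<or> a = v"
  shows "Act (dual_right (ub p) X) S' (S' - {u, v}) (chord p S' u v) (plus p \<phi>) = \<zero>\<^bsub>dual (Hom (ub p) X (S' - {u, v}))\<^esub>"
proof (rule dual_eqI[OF plus_chord_in dual_zero_in])
  fix f assume f: "f \<in> D X (S' - {u, v})"
  have d: "f (Inl x0) \<noteq> a" using D_Inl[OF f x0] assms by auto
  show "Act (dual_right (ub p) X) S' (S' - {u, v}) (chord p S' u v) (plus p \<phi>) (ub_cls p X (S' - {u, v}) f) =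
      \<zero>\<^bsub>dual (Hom (ub p) X (S' - {u, v}))\<^esub> (ub_cls p X (S' - {u, v}) f)"
    unfolding plus_chord_cls[OF f] plus_chord_dead[OF f d] dual_zero by (simp add: ub_cls_in[OF f])
qed

end

text \<open>Suppose f sends x0 to a. Composed with the chord (y, b), it has (y, b) as its last pair,
  so it extends the diagram that \<tau> makes of f by renaming a to y, which sends x0 to y. For
  other f the left side is dead, and the renamed diagram avoids y at x0.\<close>

lemma plus_chord_end:
  fixes \<phi> :: "'k::field ubmor \<Rightarrow> 'k"
  assumes phi: "\<phi> \<in> carrier (dual (Hom (ub p) X S))" and y: "y \<in> S" and t: "bij_betw \<tau> (S' - {y, b}) S"
    and ta: "\<tau> a = y" and tz: "\<And>z. z \<in> S - {y} \<Longrightarrow> \<tau> z = z"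
  shows "Act (dual_right (ub p) X) S' (S' - {y, b}) (chord p S' y b) (plus p \<phi>) =
    Act (dual_right (ub p) X) S (S' - {y, b}) (ub_cls p (S' - {y, b}) S (bij_D (S' - {y, b}) \<tau>)) (part p X S x0 {y} \<phi>)"
proof -
  let ?Y = "S' - {y, b}"
  have yb: "y \<in> S'" "b \<in> S'" "y \<noteq> b" using y b by auto
  have fin: "finite ?Y" "finite S'" using S by simp_all
  have ct: "bij_D ?Y \<tau> \<in> D ?Y S" by (rule bij_D_in_D[OF t fin(1)])
  have cc: "chordD S' y b \<in> D ?Y S'" by (rule chordD_in_D[OF fin(2) yb])
  show ?thesis
  proof (rule dual_eqI[OF plus_chord_in[OF phi yb] dual_act_in[OF X ub_cls_in[OF ct] part_in[OF phi]]])
    fix f assume f: "f \<in> D X ?Y"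
    let ?g = "D_comp X ?Y S (bij_D ?Y \<tau>) f"
    have g: "?g \<in> D X S" by (rule D_comp_in_D[OF f ct X])
    have gl: "?g (Inl x) = \<tau> (f (Inl x))" if "x \<in> X" for x
      unfolding D_comp_Inl[OF that] by (rule bij_D_Inl[OF D_Inl[OF f that]])
    have p0: "pairs_of ?Y S = 0" by (rule bij_D_pairs[OF t])
    have tt: "t = pairs_of X ?Y" using pairs_of_add[OF f ct X] p0 by simp
    have gr: "?g (Inr i) = \<tau> (f (Inr i))" if "1 \<le> i" "i \<le> 2 * t" for i
      unfolding D_comp_Inr1[OF that[unfolded tt]] by (rule bij_D_Inl[OF D_Inr[OF f that[unfolded tt]]])
    have id: "\<tau> z = z" if "z \<in> ?Y" "z \<noteq> a" for z using that by (intro tz) auto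
    have "plus p \<phi> (ub_cls p X S' (D_comp X ?Y S' (chordD S' y b) f)) = (if ?g (Inl x0) = y then \<phi> (ub_cls p X S ?g) else 0)"
    proof (cases "f (Inl x0) = a")
      case True
      have p1: "pairs_of ?Y S' = 1" by (rule pairs_of_pair[OF fin(2) yb])
      have "D_comp X ?Y S' (chordD S' y b) f = ins ?g"
      proof (rule D_eqI[OF D_comp_in_D[OF f cc X] ins_in_D[OF g]])
        fix x assume x: "x \<in> X"
        have fx: "f (Inl x) \<in> ?Y" by (rule D_Inl[OF f x])
        have c: "chordD S' y b (Inl (f (Inl x))) = f (Inl x)" by (rule chordD_Inl) (use fx in blast)+
        show "D_comp X ?Y S' (chordD S' y b) f (Inl x) = ins ?g (Inl x)"
        proof (cases "x = x0")
          case False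
          then have "f (Inl x) \<noteq> a" using True D_Inl_inj[OF f x x0] by simp
          from id[OF fx this] False show ?thesis unfolding ins_Inl[OF x] gl[OF x] unfolding D_comp_Inl[OF x] c by simp
        next
          case x_x0: True
          show ?thesis unfolding ins_Inl[OF x] D_comp_Inl[OF x] c using True x_x0 by simp
        qed
      next
        fix i assume i: "1 \<le> i" "i \<le> 2 * pairs_of X S'"
        have "i \<le> 2 * Suc t" using i(2) unfolding pairs_S'[OF g] .
        from Inr_cases[OF i(1) this] show "D_comp X ?Y S' (chordD S' y b) f (Inr i) = ins ?g (Inr i)"
        proof (elim disjE)
          assume k: "i \<le> 2 * t"
          have fi: "f (Inr i) \<in> ?Y" by (rule D_Inr[OF f i(1) k[unfolded tt]])
          have "f (Inr i) \<noteq> a" using D_Inl_Inr[OF f x0 i(1) k[unfolded tt]] True by simp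
          from id[OF fi this] have "?g (Inr i) = f (Inr i)" unfolding gr[OF i(1) k] .
          moreover have "chordD S' y b (Inl (f (Inr i))) = f (Inr i)" by (rule chordD_Inl) (use fi in blast)+
          ultimately show ?thesis
            unfolding ins_Inr[OF i(1) k] by (simp only: D_comp_Inr1[OF i(1) k[unfolded tt], of S' "chordD S' y b"])
        next
          assume k: "i = Suc (2 * t)"
          show ?thesis unfolding k ins_last gl[OF x0] True ta
            using D_comp_Inr2[of X ?Y i S' "chordD S' y b" f] by (simp add: k tt p1 chordD_Inr)
        next
          assume k: "i = Suc (Suc (2 * t))"
          show ?thesis unfolding k ins_last
            using D_comp_Inr2[of X ?Y i S' "chordD S' y b" f] by (simp add: k tt p1 chordD_Inr numeral_2_eq_2[symmetric])
        qed
      qed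
      then show ?thesis by (simp only: plus_ins[OF phi g] gl[OF x0] True ta simp_thms if_True)
    next
      case False
      have "f (Inl x0) \<in> ?Y" by (rule D_Inl[OF f x0])
      with id[OF this False] have "?g (Inl x0) \<noteq> y" unfolding gl[OF x0] by auto
      then show ?thesis using plus_chord_dead[OF phi yb f False] by simp
    qed
    then show "Act (dual_right (ub p) X) S' ?Y (chord p S' y b) (plus p \<phi>) (ub_cls p X ?Y f) =
      Act (dual_right (ub p) X) S ?Y (ub_cls p ?Y S (bij_D ?Y \<tau>)) (part p X S x0 {y} \<phi>) (ub_cls p X ?Y f)"
      unfolding plus_chord_cls[OF phi yb f] dual_act_cls[OF X f ct] part_cls[OF phi g] by simp
  qed
qed

end

subsection \<open>Appending the unit\<close>

abbreviation app :: "nat set \<times> 'v \<Rightarrow> ((nat set \<times> 'v) list \<Rightarrow>\<^sub>0 'k::field) \<Rightarrow> ((nat set \<times> 'v) list \<Rightarrow>\<^sub>0 'k)" where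
  "app w \<equiv> lin_ext (\<lambda>ws. gen (ws @ [w]))"

lemma rl_cong: "(\<And>z. z \<in> fst w \<Longrightarrow> \<tau> z = \<rho> z) \<Longrightarrow> rl C \<tau> w = rl C \<rho> w"
  by (simp add: rl_def cong: image_cong restrict_cong)

lemma relabel_cong: "(\<And>z. z \<in> supp ws \<Longrightarrow> \<tau> z = \<rho> z) \<Longrightarrow> relabel C \<tau> ws = relabel C \<rho> ws"
  unfolding relabel_map by (intro map_cong rl_cong refl) (auto simp: supp_def)

lemma words_snoc:
  "ws \<in> words C S \<Longrightarrow> snd w \<in> carrier (Sp C (fst w)) \<Longrightarrow> fst w \<inter> S = {} \<Longrightarrow> ws @ [w] \<in> words C (S \<union> fst w)"
  unfolding words_iff wf_append wf_Cons by auto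

context cyclic_operad
begin

context
  fixes S :: "nat set" and w :: "nat set \<times> 'v"
  assumes S: "finite S" and wc: "snd w \<in> carrier (Sp C (fst w))" and wS: "fst w \<inter> S = {}"
begin

text \<open>At the end of a word the new vertex is fixed when the word is permuted, so signs are
  unchanged and the relations are respected.\<close>

lemma odot_hom_app: "odot_hom e C S (S \<union> fst w) (app w)"
  unfolding odot_hom_def
proof (intro conjI allI impI ballI)
  show "flin (app w)" by (rule flin_lin_ext)
  show "Poly_Mapping.keys (app w p) \<subseteq> words C (S \<union> fst w)" if "Poly_Mapping.keys p \<subseteq> words C S" for p
    by (rule keys_lin_ext) (use words_snoc[OF _ wc wS] that in auto)
  fix r assume r: "r \<in> odot_rels e C S"
  let ?R = "odot_rels e C (S \<union> fst w)"
  note sn = words_snoc[OF _ wc wS]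
  have sn': "xs @ (U, c) # ys @ [w] \<in> words C (S \<union> fst w)" if "xs @ (U, c) # ys \<in> words C S" for xs U c ys
    using sn[OF that] by simp
  show "nf ?R (app w r) = 0"
    unfolding nf_lin_ext
    by (rule odot_lift[OF _ _ _ r])
      (simp_all add: odot_rel_add[OF sn'] odot_rel_smult[OF sn'] odot_rel_perm[OF sn iperm_append])
qed

text \<open>Before the contraction the new vertex is passed by two vertices, which costs nothing;
  after it, by their join alone. This single exchange is the sign.\<close>

lemma con_app:
  assumes u: "u \<in> S" and v: "v \<in> S" and w: "finite (fst w)" and k: "Poly_Mapping.keys x \<subseteq> words C S"
  shows "nf (odot_rels e C (S - {u, v} \<union> fst w)) (con e C u v (app w x)) =
    fscale (sg e (-1)) (nf (odot_rels e C (S - {u, v} \<union> fst w)) (app w (con e C u v x)))"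
proof (rule flin_agree[OF _ _ k])
  have eq: "S \<union> fst w - {u, v} = S - {u, v} \<union> fst w" using u v wS by auto
  have fin: "finite (S \<union> fst w)" using S w by simp
  let ?R = "odot_rels e C (S - {u, v} \<union> fst w)"
  show "flin (\<lambda>x. nf ?R (con e C u v (app w x)))" "flin (\<lambda>x. fscale (sg e (-1)) (nf ?R (app w (con e C u v x))))"
    by (rule flin_intros)+
  fix ws assume ws: "ws \<in> words C S"
  note ws' = words_snoc[OF ws wc wS]
  show "nf ?R (con e C u v (app w (gen ws))) = fscale (sg e (-1)) (nf ?R (app w (con e C u v (gen ws))))"
    using ws u v
  proof (cases rule: vertex_cases)
    case (same y)
    have "con e C u v (gen (ws @ [w])) = 0" by (rule con_same[OF ws' _ same(2,3)]) (simp add: same)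
    then show ?thesis using con_same[OF ws same] by (simp add: flin_zero[OF flin_fscale])
  next
    case (two y z)
    obtain c rs where p: "iperm c ws (rs @ [y, z])" using iperm_pull[of "[y, z]" ws] two by auto
    note rw = words_iperm[OF p ws]
    have "iperm c (ws @ [w]) (rs @ [y, z] @ [w])" using iperm_append[OF p, of "[w]"] by simp
    moreover have "iperm 1 (rs @ [y, z] @ [w]) (rs @ w # [y, z])" using iperm_sym[OF iperm_move[of "[y, z]" rs w "[]"]] by simp
    ultimately have p': "iperm c (ws @ [w]) ((rs @ [w]) @ [y, z])" using iperm_trans by fastforce
    have jw: "rs @ [join C u v y z] \<in> words C (S - {u, v})" by (rule join_word[OF S rw two(4,5)])
    have wS': "fst w \<inter> (S - {u, v}) = {}" using wS by auto
    have l: "nf ?R (con e C u v (gen (ws @ [w]))) = fscale (sg e c) (nf ?R (gen ((rs @ [w]) @ [join C u v y z])))"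
      using con_char[OF fin ws' p' two(4,5), of e] unfolding eq nf_scale .
    have sw: "nf ?R (gen (rs @ w # [join C u v y z])) = fscale (sg e (-1)) (nf ?R (gen (rs @ join C u v y z # [w])))"
      by (rule odot_rel_perm[OF _ iperm_swap]) (use words_snoc[OF jw wc wS'] in simp)
    have "nf (odot_rels e C (S - {u, v})) (con e C u v (gen ws)) = nf (odot_rels e C (S - {u, v})) (fscale (sg e c) (gen (rs @ [join C u v y z])))"
      by (rule con_char[OF S ws p two(4,5)])
    then have "nf ?R (app w (con e C u v (gen ws))) = nf ?R (app w (fscale (sg e c) (gen (rs @ [join C u v y z]))))"
    proof (rule odot_hom_nf[rotated])
      have "finite (S - {u, v})" using S by simp
      from cyclic_operad.odot_hom_app[OF cyclic_operad_axioms this wc wS'] show "odot_hom e C (S - {u, v}) (S - {u, v} \<union> fst w) (app w)" .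
    qed
    then show ?thesis
      using l sw by (simp add: lin_ext_scale nf_scale mult.commute)
  qed
qed

end

lemma odot_chord:
  assumes X: "finite X" and uv: "u \<in> X" "v \<in> X" "u \<noteq> v" and k: "Poly_Mapping.keys x \<subseteq> words C X"
  shows "Act (odot_module e C) X (X - {u, v}) (chord (e, e) X u v) (cls (odot_rels e C X) x) =
    cls (odot_rels e C (X - {u, v})) (con e C u v x)"
proof -
  let ?Y = "X - {u, v}" and ?f = "chordD X u v"
  have Y: "finite ?Y" using X by simp
  have "dact e X ?Y ?f x = rel C (inv_into ?Y (\<lambda>y. ?f (Inl y))) (con e C u v x)"
    using chordD_Inr[of X u v] unfolding dact_def pairs_of_pair[OF X uv] One_nat_def contract_pairs.simps
    by (simp add: numeral_2_eq_2[symmetric])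
  also have "\<dots> = con e C u v x"
  proof -
    have kc: "Poly_Mapping.keys (con e C u v x) \<subseteq> words C ?Y" by (rule odot_hom_keys[OF odot_hom_con[OF X uv(1,2)] k])
    have inv: "inv_into ?Y (\<lambda>y. ?f (Inl y)) z = z" if "z \<in> ?Y" for z
      by (rule inv_into_f_eq) (use that in \<open>auto simp: chordD_Inl inj_on_def\<close>)
    have "relabel C (inv_into ?Y (\<lambda>y. ?f (Inl y))) ws = ws" if "ws \<in> words C ?Y" for ws by (rule relabel_id[OF Y that inv])
    then show ?thesis by (intro flin_agree[OF flin_lin_ext flin_ident kc]) (simp only: lin_ext_gen)
  qed
  finally show ?thesis unfolding chord_eq odot_Act_cls[OF X Y chordD_in_D[OF X uv] k] by simp
qed

lemma odot_bij:
  assumes X: "finite X" and Y: "finite Y" and t: "bij_betw \<tau> Y X" and k: "Poly_Mapping.keys x \<subseteq> words C X"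
  shows "Act (odot_module e C) X Y (ub_cls (e, e) Y X (bij_D Y \<tau>)) (cls (odot_rels e C X) x) =
    cls (odot_rels e C Y) (rel C (inv_into Y \<tau>) x)"
proof -
  have "inv_into Y (\<lambda>y. bij_D Y \<tau> (Inl y)) = inv_into Y \<tau>"
    by (simp add: inv_into_def bij_D_Inl cong: conj_cong)
  then have "dact e X Y (bij_D Y \<tau>) x = rel C (inv_into Y \<tau>) x"
    unfolding dact_def bij_D_pairs[OF t] by simp
  then show ?thesis unfolding odot_Act_cls[OF X Y bij_D_in_D[OF t Y] k] by simp
qed

end

locale unital_cyclic_operad = cyclic_operad C for C :: "('k::field_char_0, 'v) operad_data" +
  fixes e0 :: 'v
  assumes e0: "e0 \<in> carrier (Sp C {1, 2})"
    and unit: "finite U \<Longrightarrow> u \<in> U \<Longrightarrow> x \<notin> U \<Longrightarrow> y \<notin> U \<Longrightarrow> x \<noteq> y \<Longrightarrow> c \<in> carrier (Sp C U) \<Longrightarrow>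
        Circ C U {x, y} u x c (Tr C {1, 2} {x, y} (\<lambda>i\<in>{1, 2}. if i = 1 then x else y) e0) =
        Tr C U ((U - {u}) \<union> {y}) (\<lambda>z\<in>U. if z = u then y else z) c"
begin

text \<open>The leaves are numbered with b first, since the unit law contracts the first leaf and
  the chord (y, b) is to be contracted at b, leaving a.\<close>

definition unit_vertex :: "nat \<Rightarrow> nat \<Rightarrow> nat set \<times> 'v" where
  "unit_vertex a b = ({b, a}, Tr C {1, 2} {b, a} (\<lambda>i\<in>{1, 2}. if i = 1 then b else a) e0)"

lemma Bij_pair: "a \<noteq> b \<Longrightarrow> (\<lambda>i\<in>{1, 2}. if i = 1 then b else a) \<in> Bij {1, 2} {b, a}" for a b :: nat
  by (auto simp: Bij_def bij_betw_def inj_on_def)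

lemma fst_unit_vertex: "fst (unit_vertex a b) = {a, b}"
  by (simp add: unit_vertex_def insert_commute)

lemma unit_vertex_in: "a \<noteq> b \<Longrightarrow> snd (unit_vertex a b) \<in> carrier (Sp C (fst (unit_vertex a b)))"
  unfolding unit_vertex_def fst_conv snd_conv by (rule linear_maps_mem[OF tr_linear[OF _ Bij_pair] e0]) simp_all

lemma rl_unit_vertex:
  assumes "a \<noteq> b" "\<tau> a \<noteq> \<tau> b"
  shows "rl C \<tau> (unit_vertex a b) = unit_vertex (\<tau> a) (\<tau> b)"
proof -
  have B: "restrict \<tau> {b, a} \<in> Bij {b, a} {\<tau> b, \<tau> a}"
    using assms by (auto simp: Bij_def bij_betw_def inj_on_def)
  have c: "compose {1, 2} (restrict \<tau> {b, a}) (\<lambda>i\<in>{1, 2}. if i = 1 then b else a) = (\<lambda>i\<in>{1, 2}. if i = 1 then \<tau> b else \<tau> a)"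
    by (auto simp: compose_def restrict_def)
  show ?thesis
    using tr_comp[OF _ Bij_pair[OF assms(1)] B e0] unfolding c by (simp add: rl_def unit_vertex_def)
qed

lemma app_unit_bij:
  assumes X: "ws \<in> words C S" and ab: "a \<noteq> b" "\<tau> a \<noteq> \<tau> b" and t: "\<And>z. z \<in> S \<Longrightarrow> \<tau> z = \<sigma> z"
  shows "relabel C \<tau> (ws @ [unit_vertex a b]) = relabel C \<sigma> ws @ [unit_vertex (\<tau> a) (\<tau> b)]"
proof -
  have "relabel C \<tau> ws = relabel C \<sigma> ws" by (rule relabel_cong) (use X t in \<open>simp add: words_iff\<close>)
  then show ?thesis using rl_unit_vertex[of a b \<tau>, OF ab] by (simp add: relabel_map)
qed

text \<open>With the vertex of y moved next to the unit, the unit law replaces the join by that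
  vertex with y renamed to a. Moving it back costs the same sign \<open>c\<close> again, and
  \<open>c\<close> squares to 1.\<close>

lemma con_unit:
  assumes S: "finite S" and y: "y \<in> S" and a: "a \<notin> S" and b: "b \<notin> S" and ab: "a \<noteq> b" and ws: "ws \<in> words C S"
    and r: "\<rho> y = a" "\<And>z. z \<in> S \<Longrightarrow> z \<noteq> y \<Longrightarrow> \<rho> z = z"
  shows "nf (odot_rels e C (insert a (S - {y}))) (con e C y b (gen (ws @ [unit_vertex a b]))) =
    nf (odot_rels e C (insert a (S - {y}))) (gen (relabel C \<rho> ws))"
proof -
  let ?w = "unit_vertex a b" and ?R = "odot_rels e C (insert a (S - {y}))"
  note w = unit_vertex_in[OF ab]
  have fin: "finite (S \<union> fst ?w)" using S by (simp add: fst_unit_vertex)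
  have ws': "ws @ [?w] \<in> words C (S \<union> fst ?w)" by (rule words_snoc[OF ws w]) (use a b in \<open>simp add: fst_unit_vertex\<close>)
  have eq: "S \<union> fst ?w - {y, b} = insert a (S - {y})" using y a b ab by (auto simp: fst_unit_vertex)
  have inj: "inj_on \<rho> S" using a y by (auto intro!: inj_onI simp: r) (metis r)+
  have img: "\<rho> ` S = insert a (S - {y})" using y r by (auto simp: image_iff) (metis r)+
  have "y \<in> supp ws" using ws y by (simp add: words_iff)
  then obtain x where x: "x \<in> set ws" "y \<in> fst x" by (rule supp_setE)
  obtain c rs where p: "iperm c ws (rs @ [x])" using iperm_pull[of "[x]" ws] x by auto
  note rw = words_iperm[OF p ws]
  have xf: "finite (fst x)" "fst x \<subseteq> S" "snd x \<in> carrier (Sp C (fst x))" "y \<notin> supp rs" "supp rs \<subseteq> S"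
    using rw S x(2) words_finite[OF ws S x(1)] unfolding words_iff wf_append wf_Cons by auto
  have p': "iperm c (ws @ [?w]) (rs @ [x, ?w])" using iperm_append[OF p, of "[?w]"] by simp
  have l: "nf ?R (con e C y b (gen (ws @ [?w]))) = fscale (sg e c) (nf ?R (gen (rs @ [join C y b x ?w])))"
    using con_char[OF fin ws' p' x(2), of b e] unfolding eq nf_scale by (simp add: fst_unit_vertex)
  have j: "join C y b x ?w = rl C \<rho> x"
  proof -
    have i: "\<rho> ` fst x = (fst x - {y}) \<union> {a}" using x(2) xf(2) r by (auto simp: image_iff) (metis r subsetD)+
    have re: "restrict \<rho> (fst x) = (\<lambda>z\<in>fst x. if z = y then a else z)"
      by (rule restrict_ext) (use r xf(2) in auto)
    have "Circ C (fst x) {b, a} y b (snd x) (Tr C {1, 2} {b, a} (\<lambda>i\<in>{1, 2}. if i = 1 then b else a) e0) =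
      Tr C (fst x) ((fst x - {y}) \<union> {a}) (\<lambda>z\<in>fst x. if z = y then a else z) (snd x)"
      by (rule unit) (use xf x a b ab in auto)
    moreover have "{b, a} - {b} = {a}" using ab by auto
    ultimately show ?thesis unfolding join_def rl_def unit_vertex_def i re by simp
  qed
  have rr: "relabel C \<rho> rs = rs"
  proof -
    have "finite (supp rs)" using xf(5) S by (rule finite_subset)
    moreover have "rs \<in> words C (supp rs)" using rw by (simp add: words_iff wf_append)
    ultimately show ?thesis by (rule relabel_id) (use r xf(4,5) in auto)
  qed
  have "rs @ [rl C \<rho> x] = relabel C \<rho> (rs @ [x])" using rr by (simp add: relabel_map)
  moreover have "nf ?R (gen (relabel C \<rho> (rs @ [x]))) = fscale (sg e c) (nf ?R (gen (relabel C \<rho> ws)))"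
    by (rule odot_rel_perm[OF relabel_words[OF S inj ws, unfolded img] iperm_map[OF p, of "rl C \<rho>", folded relabel_map]])
  ultimately have "nf ?R (con e C y b (gen (ws @ [?w]))) = fscale (sg e c * sg e c) (nf ?R (gen (relabel C \<rho> ws)))"
    unfolding l j by simp
  then show ?thesis unfolding sg_square[OF iperm_sign[OF p]] by simp
qed

definition add_unit :: "polarity \<Rightarrow> nat set \<Rightarrow> nat \<Rightarrow> nat \<Rightarrow> ((nat set \<times> 'v) list \<Rightarrow>\<^sub>0 'k) set \<Rightarrow> ((nat set \<times> 'v) list \<Rightarrow>\<^sub>0 'k) set" where
  "add_unit e S a b = induced (odot_rels e C (insert a (insert b S))) (\<lambda>ws. gen (ws @ [unit_vertex a b]))"

context
  fixes S :: "nat set" and a b :: nat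
  assumes S: "finite S" and a: "a \<notin> S" and b: "b \<notin> S" and ab: "a \<noteq> b"
begin

lemma un_fst: "S \<union> fst (unit_vertex a b) = insert a (insert b S)" by (auto simp: fst_unit_vertex)

lemma fst_disjoint: "fst (unit_vertex a b) \<inter> S = {}" using a b by (simp add: fst_unit_vertex)

lemmas app_hom = odot_hom_app[OF S unit_vertex_in[OF ab] fst_disjoint, unfolded un_fst]

lemma add_unit_cls: "add_unit e S a b (cls (odot_rels e C S) x) = cls (odot_rels e C (insert a (insert b S))) (app (unit_vertex a b) x)"
  unfolding add_unit_def by (rule induced_cls) (rule odot_hom_rel[OF app_hom])

lemma add_unit_linear: "add_unit e S a b \<in> linear_maps (At (odot_module e C) S) (At (odot_module e C) (insert a (insert b S)))"
  unfolding odot_At by (rule linear_maps_presentedI[OF flin_lin_ext add_unit_cls odot_hom_keys[OF app_hom]])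

lemma add_unit_chord:
  assumes ij: "i \<in> S" "j \<in> S" "i \<noteq> j" and m: "m \<in> carrier (At (odot_module e C) S)"
  shows "Act (odot_module e C) (insert a (insert b S)) (insert a (insert b (S - {i, j}))) (chord (e, e) (insert a (insert b S)) i j) (add_unit e S a b m) =
    sg e (-1) \<odot>\<^bsub>At (odot_module e C) (insert a (insert b (S - {i, j})))\<^esub>
    add_unit e (S - {i, j}) a b (Act (odot_module e C) S (S - {i, j}) (chord (e, e) S i j) m)"
proof -
  let ?S' = "insert a (insert b S)" and ?Y = "insert a (insert b (S - {i, j}))" and ?w = "unit_vertex a b"
  from m obtain x where x: "Poly_Mapping.keys x \<subseteq> words C S" "m = cls (odot_rels e C S) x"
    unfolding odot_At by (rule presented_memE)
  have fin: "finite ?S'" "finite (fst ?w)" using S by (simp_all add: fst_unit_vertex)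
  have eq: "?S' - {i, j} = ?Y" using ij a b by auto
  have eq': "S - {i, j} \<union> fst ?w = ?Y" by (auto simp: fst_unit_vertex)
  have ij': "i \<in> ?S'" "j \<in> ?S'" using ij by simp_all
  have S2: "finite (S - {i, j})" "a \<notin> S - {i, j}" "b \<notin> S - {i, j}" using S a b by simp_all
  have "nf (odot_rels e C ?Y) (con e C i j (app ?w x)) = nf (odot_rels e C ?Y) (fscale (sg e (-1)) (app ?w (con e C i j x)))"
    using con_app[OF S unit_vertex_in[OF ab] fst_disjoint ij(1,2) fin(2) x(1), of e] unfolding eq' nf_scale .
  then show ?thesis
    unfolding x(2) add_unit_cls odot_chord[OF S ij x(1)]
      odot_chord[OF fin(1) ij' ij(3) odot_hom_keys[OF app_hom x(1)], of e, unfolded eq]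
      unital_cyclic_operad.add_unit_cls[OF unital_cyclic_operad_axioms S2 ab] odot_At presented_smult cls_eq_iff .
qed

text \<open>An instance of \<open>con_unit\<close> with \<rho> the inverse of \<tau>, which sends y
  to a and fixes the other leaves in S.\<close>

lemma add_unit_end:
  assumes y: "y \<in> S" and t: "bij_betw \<tau> (insert a (insert b S) - {y, b}) S" and ta: "\<tau> a = y" and tz: "\<And>z. z \<in> S - {y} \<Longrightarrow> \<tau> z = z"
    and m: "m \<in> carrier (At (odot_module e C) S)"
  shows "Act (odot_module e C) (insert a (insert b S)) (insert a (insert b S) - {y, b}) (chord (e, e) (insert a (insert b S)) y b) (add_unit e S a b m) =
    Act (odot_module e C) S (insert a (insert b S) - {y, b}) (ub_cls (e, e) (insert a (insert b S) - {y, b}) S (bij_D (insert a (insert b S) - {y, b}) \<tau>)) m"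
proof -
  let ?S' = "insert a (insert b S)"
  let ?Y = "?S' - {y, b}" and ?w = "unit_vertex a b"
  from m obtain x where x: "Poly_Mapping.keys x \<subseteq> words C S" "m = cls (odot_rels e C S) x"
    unfolding odot_At by (rule presented_memE)
  have fin: "finite ?S'" "finite ?Y" using S by simp_all
  have yb: "y \<in> ?S'" "b \<in> ?S'" "y \<noteq> b" using y b by auto
  have eq: "?Y = insert a (S - {y})" using y a b ab by auto
  have inj: "inj_on \<tau> ?Y" using t by (simp add: bij_betw_def)
  have i1: "inv_into ?Y \<tau> y = a" by (rule inv_into_f_eq[OF inj _ ta]) (use a y ab in auto)
  have i2: "inv_into ?Y \<tau> z = z" if "z \<in> S" "z \<noteq> y" for z by (rule inv_into_f_eq[OF inj _ tz]) (use that b in auto)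
  have "nf (odot_rels e C ?Y) (con e C y b (app ?w x)) = nf (odot_rels e C ?Y) (rel C (inv_into ?Y \<tau>) x)"
  proof (rule flin_agree[OF _ _ x(1)])
    show "flin (\<lambda>x. nf (odot_rels e C ?Y) (con e C y b (app ?w x)))" "flin (\<lambda>x. nf (odot_rels e C ?Y) (rel C (inv_into ?Y \<tau>) x))"
      by (rule flin_intros)+
    show "nf (odot_rels e C ?Y) (con e C y b (app ?w (gen ws))) = nf (odot_rels e C ?Y) (rel C (inv_into ?Y \<tau>) (gen ws))" if "ws \<in> words C S" for ws
      using con_unit[OF S y a b ab that, of "inv_into ?Y \<tau>" e] i1 i2 unfolding eq by simp
  qed
  then show ?thesis
    unfolding x(2) add_unit_cls odot_chord[OF fin(1) yb odot_hom_keys[OF app_hom x(1)]] odot_bij[OF S fin(2) t x(1)] cls_eq_iff .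
qed

lemma add_unit_bij:
  assumes T: "finite T" "c \<notin> T" "d \<notin> T" "c \<noteq> d" and s: "bij_betw \<sigma> T S"
    and t: "bij_betw \<tau> (insert c (insert d T)) (insert a (insert b S))" and tcd: "\<tau> c = a" "\<tau> d = b" and ts: "\<And>z. z \<in> T \<Longrightarrow> \<tau> z = \<sigma> z"
    and m: "m \<in> carrier (At (odot_module e C) S)"
  shows "add_unit e T c d (Act (odot_module e C) S T (ub_cls (e, e) T S (bij_D T \<sigma>)) m) =
    Act (odot_module e C) (insert a (insert b S)) (insert c (insert d T))
      (ub_cls (e, e) (insert c (insert d T)) (insert a (insert b S)) (bij_D (insert c (insert d T)) \<tau>)) (add_unit e S a b m)"
proof -
  let ?S' = "insert a (insert b S)" and ?T' = "insert c (insert d T)"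
  from m obtain x where x: "Poly_Mapping.keys x \<subseteq> words C S" "m = cls (odot_rels e C S) x"
    unfolding odot_At by (rule presented_memE)
  have fin: "finite ?S'" "finite ?T'" using S T by simp_all
  have inj: "inj_on \<tau> ?T'" using t by (simp add: bij_betw_def)
  have inv: "inv_into ?T' \<tau> a = c" "inv_into ?T' \<tau> b = d" by (rule inv_into_f_eq[OF inj]; simp add: tcd)+
  have invs: "inv_into ?T' \<tau> z = inv_into T \<sigma> z" if "z \<in> S" for z
  proof (rule inv_into_f_eq[OF inj])
    have *: "inv_into T \<sigma> z \<in> T" using bij_betwE[OF bij_betw_inv_into[OF s]] that by blast
    then show "inv_into T \<sigma> z \<in> ?T'" by simp
    show "\<tau> (inv_into T \<sigma> z) = z" using ts[OF *] bij_betw_inv_into_right[OF s that] by simp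
  qed
  have "app (unit_vertex c d) (rel C (inv_into T \<sigma>) x) = rel C (inv_into ?T' \<tau>) (app (unit_vertex a b) x)"
  proof (rule flin_agree[OF _ _ x(1)])
    show "flin (\<lambda>x. app (unit_vertex c d) (rel C (inv_into T \<sigma>) x))" "flin (\<lambda>x. rel C (inv_into ?T' \<tau>) (app (unit_vertex a b) x))"
      by (rule flin_compose[OF flin_lin_ext flin_lin_ext])+
    show "app (unit_vertex c d) (rel C (inv_into T \<sigma>) (gen ws)) = rel C (inv_into ?T' \<tau>) (app (unit_vertex a b) (gen ws))" if "ws \<in> words C S" for ws
      unfolding lin_ext_gen using app_unit_bij[OF that ab _ invs] inv T(4) by simp
  qed
  then show ?thesis
    unfolding x(2) odot_bij[OF S T(1) s x(1)] add_unit_cls odot_bij[OF fin t odot_hom_keys[OF app_hom x(1)]]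
      unital_cyclic_operad.add_unit_cls[OF unital_cyclic_operad_axioms T] by simp
qed

end

end

subsection \<open>The contracting homotopy\<close>

lemma bij_betw_insert_two:
  assumes s: "bij_betw \<sigma> S S'" and a: "a \<notin> S" "b \<notin> S" "a \<noteq> b" "a' \<notin> S'" "b' \<notin> S'" "a' \<noteq> b'"
  shows "bij_betw (\<lambda>z. if z = a then a' else if z = b then b' else \<sigma> z) (insert a (insert b S)) (insert a' (insert b' S'))"
proof -
  let ?t = "\<lambda>z. if z = a then a' else if z = b then b' else \<sigma> z"
  have "bij_betw ?t S S'" using s by (rule bij_betw_cong[THEN iffD1, rotated]) (use a in auto)
  then have "bij_betw ?t (insert b S) (insert b' S')" using notIn_Un_bij_betw[of b S ?t S'] a by simp
  then show ?thesis using notIn_Un_bij_betw[of a "insert b S" ?t "insert b' S'"] a by simp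
qed

text \<open>With both new leaves above S, every new chord is listed with its larger new leaf second.
  The groups are those treated differently later: chords inside S, chords containing a, and the
  chords (y, b).\<close>

lemma sum_ordered_pairs_insert_two:
  fixes F :: "nat \<times> nat \<Rightarrow> 'a::comm_monoid_add"
  assumes S: "finite S" and a: "\<And>z. z \<in> S \<Longrightarrow> z < a" and ab: "a < b"
  shows "(\<Sum>z\<in>ordered_pairs (insert a (insert b S)). F z) =
    (\<Sum>z\<in>ordered_pairs S. F z) + (\<Sum>z\<in>insert (a, b) ((\<lambda>y. (y, a)) ` S). F z) + (\<Sum>y\<in>S. F (y, b))"
proof -
  let ?A = "insert (a, b) ((\<lambda>y. (y, a)) ` S)" and ?B = "(\<lambda>y. (y, b)) ` S"
  have b: "z < b" if "z \<in> S" for z using a[OF that] ab by simp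
  have "ordered_pairs (insert a (insert b S)) = (ordered_pairs S \<union> ?A) \<union> ?B"
    using a b ab by (auto simp: ordered_pairs_def dest: less_asym)
  moreover have "(\<Sum>z\<in>(ordered_pairs S \<union> ?A) \<union> ?B. F z) = (\<Sum>z\<in>ordered_pairs S \<union> ?A. F z) + (\<Sum>z\<in>?B. F z)"
    by (rule sum.union_disjoint) (use S a b ab in \<open>auto dest: ordered_pairsD\<close>)
  moreover have "(\<Sum>z\<in>ordered_pairs S \<union> ?A. F z) = (\<Sum>z\<in>ordered_pairs S. F z) + (\<Sum>z\<in>?A. F z)"
    by (rule sum.union_disjoint) (use S a b ab in \<open>auto dest: ordered_pairsD\<close>)
  moreover have "(\<Sum>z\<in>?B. F z) = (\<Sum>y\<in>S. F (y, b))" by (subst sum.reindex) (auto simp: inj_on_def)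
  ultimately show ?thesis by simp
qed

context unital_cyclic_operad
begin

context
  fixes e :: polarity and p :: polarities and X :: "nat set" and x0 :: nat
  assumes X: "finite X" and x0: "x0 \<in> X" and pe: "fst p = e" and signs: "twist (snd p) (-1) * twist e (-1) = -1"
begin

interpretation odot: brauer "(e, e)" "odot_module e C" p X
proof (rule brauer.intro[OF odot_db_module])
  show "brauer_axioms (e, e) p X" by unfold_locales (use X pe signs in simp_all)
qed

text \<open>The homotopy, for an arbitrary choice of the two new leaves.\<close>

definition fill where
  "fill a b S \<phi> m = odot.E (card S + 2) (insert a (insert b S)) (plus_construction.plus X S x0 a b p \<phi>) (add_unit e S a b m)"

lemma act_mem:
  assumes "f \<in> D T S" "finite T" "finite S" "m \<in> carrier (At (odot_module e C) S)"
  shows "Act (odot_module e C) S T (ub_cls (e, e) T S f) m \<in> carrier (At (odot_module e C) T)"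
  using odot.act_in assms by (simp add: ub_cls_in)

lemma plusI: "finite S \<Longrightarrow> a \<notin> S \<Longrightarrow> b \<notin> S \<Longrightarrow> a \<noteq> b \<Longrightarrow> plus_construction X S x0 a b"
  using X x0 by unfold_locales

text \<open>
  With \<open>\<sigma> = id\<close> this also shows that the new leaves may be chosen freely.
\<close>

lemma fill_bij:
  assumes S: "finite S" "a \<notin> S" "b \<notin> S" "a \<noteq> b" and S': "a' \<notin> S'" "b' \<notin> S'" "a' \<noteq> b'"
    and s: "bij_betw \<sigma> S S'" and phi: "\<phi> \<in> carrier (odot.Dual S')" and m: "m \<in> carrier (At (odot_module e C) S)"
  shows "fill a b S (Act odot.N S' S (odot.bij_ub p S S' \<sigma>) \<phi>) m =
    fill a' b' S' \<phi> (Act (odot_module e C) S S' (odot.bij_ub (e, e) S' S (inv_into S \<sigma>)) m)"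
proof -
  let ?T = "insert a (insert b S)" and ?T' = "insert a' (insert b' S')"
  define \<tau> where "\<tau> z = (if z = a then a' else if z = b then b' else \<sigma> z)" for z
  have t: "bij_betw \<tau> ?T ?T'" unfolding \<tau>_def by (rule bij_betw_insert_two[OF s S(2-4) S'])
  have ts: "\<tau> a = a'" "\<tau> b = b'" "\<And>z. z \<in> S \<Longrightarrow> \<tau> z = \<sigma> z" using S by (auto simp: \<tau>_def)
  have fin: "finite S'" and card: "card S' = card S" using bij_betw_finite[OF s] bij_betw_same_card[OF s] S by simp_all
  have finT: "finite ?T" "card ?T = card S + 2" using S by simp_all
  note A = plusI[OF S] and B = plusI[OF fin S']
  have inj: "inj_on \<tau> ?T" using t by (simp add: bij_betw_def)
  have inv: "inv_into ?T \<tau> a' = a" "inv_into ?T \<tau> b' = b" by (rule inv_into_f_eq[OF inj]; simp add: ts)+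
  have invs: "inv_into ?T \<tau> z = inv_into S \<sigma> z" if "z \<in> S'" for z
  proof (rule inv_into_f_eq[OF inj])
    have *: "inv_into S \<sigma> z \<in> S" using bij_betwE[OF bij_betw_inv_into[OF s]] that by blast
    then show "inv_into S \<sigma> z \<in> ?T" by simp
    show "\<tau> (inv_into S \<sigma> z) = z" using ts(3)[OF *] bij_betw_inv_into_right[OF s that] by simp
  qed
  have "plus_construction.plus X S x0 a b p (Act odot.N S' S (odot.bij_ub p S S' \<sigma>) \<phi>) =
    Act odot.N ?T' ?T (odot.bij_ub p ?T ?T' \<tau>) (plus_construction.plus X S' x0 a' b' p \<phi>)"
    by (rule plus_bij[OF A B s t ts(3,1,2) phi])
  moreover have "add_unit e S' a' b' (Act (odot_module e C) S S' (odot.bij_ub (e, e) S' S (inv_into S \<sigma>)) m) =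
    Act (odot_module e C) ?T ?T' (odot.bij_ub (e, e) ?T' ?T (inv_into ?T \<tau>)) (add_unit e S a b m)"
    by (rule add_unit_bij[OF S fin S' bij_betw_inv_into[OF s] bij_betw_inv_into[OF t] inv invs m])
  moreover have "add_unit e S a b m \<in> carrier (At (odot_module e C) ?T)"
    by (rule linear_maps_mem[OF add_unit_linear[OF S] m])
  ultimately show ?thesis
    unfolding fill_def card
    by (simp only: odot.E_balanced[OF t finT plus_construction.plus_in[OF B phi]])
qed

lemma fill_fresh:
  assumes S: "finite S" "a \<notin> S" "b \<notin> S" "a \<noteq> b" and S': "a' \<notin> S" "b' \<notin> S" "a' \<noteq> b'"
    and phi: "\<phi> \<in> carrier (odot.Dual S)" and m: "m \<in> carrier (At (odot_module e C) S)"
  shows "fill a b S \<phi> m = fill a' b' S \<phi> m"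
proof -
  have "bij_D S (inv_into S id) = bij_D S id" by (rule bij_D_cong) (simp add: inv_into_f_eq)
  then show ?thesis
    using fill_bij[OF S S' bij_betw_id phi m] unfolding dual_act_id[OF X S(1) phi] by (simp add: odot.act_id[OF S(1) m])
qed

text \<open>\<open>plus_chord\<close> contributes the sign of the second polarity of
  \<open>p\<close> and \<open>add_unit_chord\<close> that of \<open>e\<close>. Their product is -1
  by the assumption on signs.\<close>

lemma fill_chord:
  assumes S: "finite S" "a \<notin> S" "b \<notin> S" "a \<noteq> b" and ij: "i \<in> S" "j \<in> S" "i \<noteq> j"
    and phi: "\<phi> \<in> carrier (odot.Dual S)" and m: "m \<in> carrier (At (odot_module e C) S)"
  shows "odot.E (card S) (insert a (insert b S) - {i, j})
      (Act odot.N (insert a (insert b S)) (insert a (insert b S) - {i, j}) (chord p (insert a (insert b S)) i j) (plus_construction.plus X S x0 a b p \<phi>))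
      (Act (odot_module e C) (insert a (insert b S)) (insert a (insert b S) - {i, j}) (chord (e, e) (insert a (insert b S)) i j) (add_unit e S a b m)) =
    - fill a b (S - {i, j}) (Act odot.N S (S - {i, j}) (chord p S i j) \<phi>) (Act (odot_module e C) S (S - {i, j}) (chord (e, e) S i j) m)"
proof -
  let ?S2 = "S - {i, j}"
  let ?T = "insert a (insert b ?S2)"
  have S2: "finite ?S2" "a \<notin> ?S2" "b \<notin> ?S2" using S by simp_all
  have eq: "insert a (insert b S) - {i, j} = ?T" using ij S by auto
  have card: "card ?S2 + 2 = card S" using card_pair[OF S(1) ij] by simp
  have finT: "finite ?T" "card ?T = card S" using S2 S card by simp_all
  let ?phi = "Act odot.N S ?S2 (chord p S i j) \<phi>" and ?m = "Act (odot_module e C) S ?S2 (chord (e, e) S i j) m"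
  have phi2: "?phi \<in> carrier (odot.Dual ?S2)" by (rule dual_act_in[OF X chord_in[OF S(1) ij] phi])
  have m2: "?m \<in> carrier (At (odot_module e C) ?S2)"
    unfolding chord_eq by (rule act_mem[OF chordD_in_D[OF S(1) ij] S2(1) S(1) m])
  note A = plusI[OF S2 S(4)] and B = plusI[OF S]
  note pin = plus_construction.plus_in[OF A phi2] and min = linear_maps_mem[OF add_unit_linear[OF S2 S(4)] m2]
  have sg: "of_int (twist (snd p) (-1)) * sg e (-1) = (-1 :: 'k)"
    unfolding sg_def of_int_mult[symmetric] signs by simp
  have neg: "fscale (-1) x = - x" for x :: "'g \<Rightarrow>\<^sub>0 'k" by (rule poly_mapping_eqI) simp
  have cm: "sg e (-1) \<odot>\<^bsub>At (odot_module e C) ?T\<^esub> add_unit e ?S2 a b ?m \<in> carrier (At (odot_module e C) ?T)"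
    by (rule closed_smult[OF _ min]) (simp add: odot_At closed_presented)
  have sq: "fscale c (fscale d x) = fscale (c * d) x" for c d and x :: "'g \<Rightarrow>\<^sub>0 'k" by (rule poly_mapping_eqI) simp
  show ?thesis
    unfolding eq plus_chord[OF A B ij phi] add_unit_chord[OF S ij m]
      lin_on_smult[OF odot.E_lin1[OF finT cm] pin] lin_on_smult[OF odot.E_lin2[OF finT pin] min] sq sg neg fill_def card ..
qed

text \<open>The chord removes y and b, so the tensor lives on the set where a has taken the place of
  y. The renaming \<tau> acts on the functional and in the inverse direction on the word, and
  \<open>E_balanced\<close> carries both back to S.\<close>

lemma fill_end:
  assumes S: "finite S" "a \<notin> S" "b \<notin> S" "a \<noteq> b" and y: "y \<in> S"
    and phi: "\<phi> \<in> carrier (odot.Dual S)" and m: "m \<in> carrier (At (odot_module e C) S)"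
  shows "odot.E (card S) (insert a (insert b S) - {y, b})
      (Act odot.N (insert a (insert b S)) (insert a (insert b S) - {y, b}) (chord p (insert a (insert b S)) y b) (plus_construction.plus X S x0 a b p \<phi>))
      (Act (odot_module e C) (insert a (insert b S)) (insert a (insert b S) - {y, b}) (chord (e, e) (insert a (insert b S)) y b) (add_unit e S a b m)) =
    odot.E (card S) S (part p X S x0 {y} \<phi>) m"
proof -
  let ?Y = "insert a (insert b S) - {y, b}"
  define \<tau> where "\<tau> z = (if z = a then y else z)" for z
  have t: "bij_betw \<tau> ?Y S"
    by (rule bij_betw_byWitness[where f' = "\<lambda>z. if z = y then a else z"]) (use S y in \<open>auto simp: \<tau>_def\<close>)
  have ts: "\<tau> a = y" "\<And>z. z \<in> S - {y} \<Longrightarrow> \<tau> z = z" using S by (auto simp: \<tau>_def)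
  have finY: "finite ?Y" "card ?Y = card S" using S bij_betw_same_card[OF t] by simp_all
  note A = plusI[OF S]
  have dt: "bij_D ?Y \<tau> \<in> D ?Y S" by (rule bij_D_in_D[OF t finY(1)])
  have ti: "bij_betw (inv_into ?Y \<tau>) S ?Y" by (rule bij_betw_inv_into[OF t])
  let ?m = "Act (odot_module e C) S ?Y (odot.bij_ub (e, e) ?Y S \<tau>) m"
  have m2: "?m \<in> carrier (At (odot_module e C) ?Y)" by (rule act_mem[OF dt finY(1) S(1) m])
  have "Act (odot_module e C) ?Y S (odot.bij_ub (e, e) S ?Y (inv_into ?Y \<tau>)) ?m = m"
  proof -
    note di = bij_D_in_D[OF ti S(1)]
    have "Cmp (ub (e, e)) S ?Y S (odot.bij_ub (e, e) ?Y S \<tau>) (odot.bij_ub (e, e) S ?Y (inv_into ?Y \<tau>)) = (idm (e, e) S :: 'k ubmor)"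
      unfolding ub_Cmp_cls[OF S(1) di dt] D_comp_bij[OF ti t S(1)]
      by (rule arg_cong[where f = "ub_cls (e, e) S S"], rule bij_D_cong) (simp add: bij_betw_inv_into_right[OF t])
    then show ?thesis
      using odot.act_comp[OF S(1) finY(1) S(1) ub_cls_in[OF dt] ub_cls_in[OF di] m] odot.act_id[OF S(1) m] by simp
  qed
  then have "odot.E (card S) ?Y (Act odot.N S ?Y (odot.bij_ub p ?Y S \<tau>) (part p X S x0 {y} \<phi>)) ?m = odot.E (card S) S (part p X S x0 {y} \<phi>) m"
    using odot.E_balanced[OF t finY part_in[OF phi, of x0 "{y}"] m2] by simp
  moreover have "Act odot.N (insert a (insert b S)) ?Y (chord p (insert a (insert b S)) y b) (plus_construction.plus X S x0 a b p \<phi>) =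
    Act odot.N S ?Y (odot.bij_ub p ?Y S \<tau>) (part p X S x0 {y} \<phi>)"
    by (rule plus_construction.plus_chord_end[OF A phi y t ts(1)]) (rule ts(2))
  moreover have "Act (odot_module e C) (insert a (insert b S)) ?Y (chord (e, e) (insert a (insert b S)) y b) (add_unit e S a b m) = ?m"
    by (rule add_unit_end[OF S y t ts(1) _ m]) (rule ts(2))
  ultimately show ?thesis by simp
qed

lemma E_zero:
  assumes "finite S" "m \<in> carrier (At (odot_module e C) S)"
  shows "odot.E (card S) S \<zero>\<^bsub>odot.Dual S\<^esub> m = 0"
proof -
  have z: "\<zero>\<^bsub>odot.Dual S\<^esub> \<in> carrier (odot.Dual S)" by (rule dual_zero_in)
  have "\<zero>\<^bsub>odot.Dual S\<^esub> = 0 \<odot>\<^bsub>odot.Dual S\<^esub> \<zero>\<^bsub>odot.Dual S\<^esub>" unfolding dual_smult dual_zero by simp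
  then have "odot.E (card S) S \<zero>\<^bsub>odot.Dual S\<^esub> m = fscale 0 (odot.E (card S) S \<zero>\<^bsub>odot.Dual S\<^esub> m)"
    using lin_on_smult[OF odot.E_lin1[OF assms(1) refl assms(2)] z, of 0] by simp
  then show ?thesis by (metis free_vs.scale_zero_left)
qed

lemma fill_dead:
  assumes S: "finite S" "a \<notin> S" "b \<notin> S" "a \<noteq> b" and uv: "u \<in> insert a (insert b S)" "v \<in> insert a (insert b S)" "u \<noteq> v" "a = u \<or> a = v"
    and phi: "\<phi> \<in> carrier (odot.Dual S)" and m: "m \<in> carrier (At (odot_module e C) S)"
  shows "odot.E (card S) (insert a (insert b S) - {u, v})
      (Act odot.N (insert a (insert b S)) (insert a (insert b S) - {u, v}) (chord p (insert a (insert b S)) u v) (plus_construction.plus X S x0 a b p \<phi>))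
      (Act (odot_module e C) (insert a (insert b S)) (insert a (insert b S) - {u, v}) (chord (e, e) (insert a (insert b S)) u v) (add_unit e S a b m)) = 0"
proof -
  let ?T = "insert a (insert b S)"
  have fin: "finite ?T" "finite (?T - {u, v})" using S by simp_all
  have card: "card S = card (?T - {u, v})" using card_pair[OF fin(1) uv(1-3)] S by simp
  have "Act (odot_module e C) ?T (?T - {u, v}) (chord (e, e) ?T u v) (add_unit e S a b m) \<in> carrier (At (odot_module e C) (?T - {u, v}))"
    unfolding chord_eq by (rule act_mem[OF chordD_in_D[OF fin(1) uv(1-3)] fin(2,1) linear_maps_mem[OF add_unit_linear[OF S] m]])
  from E_zero[OF fin(2) this] show ?thesis
    unfolding plus_construction.plus_chord_zero[OF plusI[OF S] phi uv] card .
qed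

text \<open>A leaf larger than all of S, as required for splitting the sum over ordered pairs;
  inserting 0 keeps \<open>Max\<close> meaningful for the empty set.\<close>

definition top1 :: "nat set \<Rightarrow> nat" where "top1 S = Suc (Max (insert 0 S))"

lemma top1: "finite S \<Longrightarrow> z \<in> S \<Longrightarrow> z < top1 S"
  unfolding top1_def by (simp add: less_Suc_eq_le)

lemma top1_notin: "finite S \<Longrightarrow> top1 S \<notin> S" "finite S \<Longrightarrow> Suc (top1 S) \<notin> S"
  using top1 by fastforce+

lemma add_cancel_middle: "u + v = 0 \<Longrightarrow> u + 0 + w + v = w" for u v w :: "'a::comm_monoid_add"
  by (metis add.assoc add.commute add.right_neutral)

lemma zero_homology_odot: "zero_homology odot.T odot.d"
proof (rule odot.zero_homology_if_contractible
    [where e = "\<lambda>S. insert (top1 S) (insert (Suc (top1 S)) S)"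
      and P = "\<lambda>S. plus_construction.plus X S x0 (top1 S) (Suc (top1 S)) p"
      and J = "\<lambda>S. add_unit e S (top1 S) (Suc (top1 S))"])
  have fr: "finite S \<Longrightarrow> top1 S \<notin> S" "finite S \<Longrightarrow> Suc (top1 S) \<notin> S" "top1 S \<noteq> Suc (top1 S)" for S
    by (simp_all add: top1_notin)
  fix S :: "nat set" and \<phi> :: "'k ubmor \<Rightarrow> 'k" and m assume S: "finite S"
  let ?a = "top1 S" and ?b = "Suc (top1 S)"
  let ?e = "insert ?a (insert ?b S)" and ?P = "plus_construction.plus X S x0 ?a ?b p" and ?J = "add_unit e S ?a ?b"
  note F = S fr(1,2)[OF S] fr(3)[of S]
  show "finite ?e" "card ?e = card S + 2" using S F by simp_all
  show "?P \<in> linear_maps (odot.Dual S) (odot.Dual ?e)" by (rule plus_construction.plus_linear[OF plusI[OF F]])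
  show "?J \<in> linear_maps (At (odot_module e C) S) (At (odot_module e C) ?e)" by (rule add_unit_linear[OF F])
  { fix \<sigma> S' assume s: "bij_betw \<sigma> S S'" and phi: "\<phi> \<in> carrier (odot.Dual S')" and m: "m \<in> carrier (At (odot_module e C) S)"
    have S': "finite S'" "card S' = card S" using bij_betw_finite[OF s] bij_betw_same_card[OF s] S by simp_all
    show "odot.E (card S + 2) ?e (?P (Act odot.N S' S (odot.bij_ub p S S' \<sigma>) \<phi>)) (?J m) =
      odot.E (card S + 2) (insert (top1 S') (insert (Suc (top1 S')) S')) (plus_construction.plus X S' x0 (top1 S') (Suc (top1 S')) p \<phi>)
        (add_unit e S' (top1 S') (Suc (top1 S')) (Act (odot_module e C) S S' (odot.bij_ub (e, e) S' S (inv_into S \<sigma>)) m))"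
      using fill_bij[OF F fr(1,2)[OF S'(1)] fr(3) s phi m] unfolding fill_def S'(2) . }
  assume phi: "\<phi> \<in> carrier (odot.Dual S)" and m: "m \<in> carrier (At (odot_module e C) S)"
  let ?F = "\<lambda>(i, j). odot.E (card S) (?e - {i, j}) (Act odot.N ?e (?e - {i, j}) (chord p ?e i j) (?P \<phi>))
        (Act (odot_module e C) ?e (?e - {i, j}) (chord (e, e) ?e i j) (?J m))"
  let ?G = "\<lambda>(i, j). odot.E (card S) (insert (top1 (S - {i, j})) (insert (Suc (top1 (S - {i, j}))) (S - {i, j})))
    (plus_construction.plus X (S - {i, j}) x0 (top1 (S - {i, j})) (Suc (top1 (S - {i, j}))) p (Act odot.N S (S - {i, j}) (chord p S i j) \<phi>))
        (add_unit e (S - {i, j}) (top1 (S - {i, j})) (Suc (top1 (S - {i, j}))) (Act (odot_module e C) S (S - {i, j}) (chord (e, e) S i j) m))"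
  have 1: "(\<Sum>z\<in>ordered_pairs S. ?F z) + (\<Sum>z\<in>ordered_pairs S. ?G z) = 0"
    unfolding sum.distrib[symmetric]
  proof (rule sum.neutral, rule ballI)
    fix z assume "z \<in> ordered_pairs S"
    then obtain i j where z: "z = (i, j)" and ij: "i \<in> S" "j \<in> S" "i \<noteq> j" by (cases z) (auto dest: ordered_pairsD)
    let ?S2 = "S - {i, j}"
    have S2: "finite ?S2" "?a \<notin> ?S2" "?b \<notin> ?S2" using F by simp_all
    have card: "card ?S2 + 2 = card S" using card_pair[OF S ij] by simp
    have phi2: "Act odot.N S ?S2 (chord p S i j) \<phi> \<in> carrier (odot.Dual ?S2)" by (rule dual_act_in[OF X chord_in[OF S ij] phi])
    have m2: "Act (odot_module e C) S ?S2 (chord (e, e) S i j) m \<in> carrier (At (odot_module e C) ?S2)"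
      unfolding chord_eq by (rule act_mem[OF chordD_in_D[OF S ij] S2(1) S m])
    have "?F (i, j) + ?G (i, j) = - fill ?a ?b ?S2 (Act odot.N S ?S2 (chord p S i j) \<phi>) (Act (odot_module e C) S ?S2 (chord (e, e) S i j) m) +
      fill (top1 ?S2) (Suc (top1 ?S2)) ?S2 (Act odot.N S ?S2 (chord p S i j) \<phi>) (Act (odot_module e C) S ?S2 (chord (e, e) S i j) m)"
      unfolding prod.case fill_chord[OF F ij phi m] fill_def card ..
    \<comment> \<open>The left summand uses the new leaves of S, the right one those chosen for S
      without i and j. They can be different, and \<open>fill_fresh\<close> makes the terms
      comparable.\<close>
    also have "\<dots> = 0"
      unfolding fill_fresh[OF S2 F(4) fr(1,2)[OF S2(1)] fr(3) phi2 m2] by simp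
    finally show "?F z + ?G z = 0" unfolding z .
  qed
  have 2: "(\<Sum>z\<in>insert (?a, ?b) ((\<lambda>y. (y, ?a)) ` S). ?F z) = 0"
  proof (rule sum.neutral, rule ballI)
    fix z assume "z \<in> insert (?a, ?b) ((\<lambda>y. (y, ?a)) ` S)"
    then obtain u v where z: "z = (u, v)" "u \<in> ?e" "v \<in> ?e" "u \<noteq> v" "?a = u \<or> ?a = v" using F by auto
    show "?F z = 0" unfolding z(1) prod.case by (rule fill_dead[OF F z(2-5) phi m])
  qed
  have 3: "(\<Sum>y\<in>S. ?F (y, ?b)) = odot.E (card S) S \<phi> m"
    unfolding lin_on_parts[OF phi odot.E_lin1[OF S refl m] S x0, symmetric]
    by (rule sum.cong[OF refl]) (simp only: prod.case fill_end[OF F _ phi m])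
  have split: "(\<Sum>z\<in>ordered_pairs ?e. ?F z) = (\<Sum>z\<in>ordered_pairs S. ?F z) + (\<Sum>z\<in>insert (?a, ?b) ((\<lambda>y. (y, ?a)) ` S). ?F z) + (\<Sum>y\<in>S. ?F (y, ?b))"
    by (rule sum_ordered_pairs_insert_two[OF S top1[OF S]]) simp_all
  show "(\<Sum>z\<in>ordered_pairs ?e. ?F z) + (\<Sum>z\<in>ordered_pairs S. ?G z) = odot.E (card S) S \<phi> m"
    unfolding split 2 3
    by (rule add_cancel_middle[OF 1])
qed

end

end

theorem theorem10p1:
  fixes C :: "('k::field_char_0, 'v) operad_data"
    and S :: "nat set"
  assumes "cyclic_operad C"
    and "has_unit C"
    and "carrier (Sp C {}) = {\<zero>\<^bsub>Sp C {}\<^esub>}"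
    and "finite S"
    and "S \<noteq> {}"
  shows "zero_homology
           (brauer_complex (Minus, Plus) (Minus, Minus) (Lambda_odot C) S)
           (brauer_complex_d (Minus, Plus) (Minus, Minus) (Lambda_odot C) S) \<and>
         zero_homology
           (brauer_complex (Plus, Minus) (Plus, Plus) (S_odot C) S)
           (brauer_complex_d (Plus, Minus) (Plus, Plus) (S_odot C) S)"
proof -
  from assms(2) obtain e0 where e0: "e0 \<in> carrier (Sp C {1, 2})"
    "\<And>U u x y c. finite U \<and> u \<in> U \<and> x \<notin> U \<and> y \<notin> U \<and> x \<noteq> y \<and> c \<in> carrier (Sp C U) \<Longrightarrow>
        Circ C U {x, y} u x c (Tr C {1, 2} {x, y} (\<lambda>i\<in>{1, 2}. if i = 1 then x else y) e0) =
        Tr C U ((U - {u}) \<union> {y}) (\<lambda>z\<in>U. if z = u then y else z) c"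
    unfolding has_unit_def by blast
  have "unital_cyclic_operad C e0"
    by (rule unital_cyclic_operad.intro[OF assms(1)]) (unfold_locales, use e0 in blast)+
  then interpret unital_cyclic_operad C e0 .
  from assms(5) obtain x0 where "x0 \<in> S" by blast
  note z = zero_homology_odot[OF assms(4) this]
  \<comment> \<open>For \<Lambda> the words carry the sign -1 and the exchange of pairs in
    \<open>ub\<close> carries none; for S it is the other way round. In both cases the product of
    the two signs is -1.\<close>
  show ?thesis using z[of "(Minus, Plus)" Minus] z[of "(Plus, Minus)" Plus] by simp
qed

end
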